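(* Let $d\ge1$ and $k\in\mathbb N$, $k\ge1$, and consider the Cauchy problem $$(\star)\qquad i\partial_t u-Hu=(K*|u|^{2k})u,\qquad u(0,\cdot)=u_0,\qquad H=-\Delta+|x|^2.$$ (1) If $K\in\mathcal FL^q(\mathbb R^d)$ with $1<q<\infty$ and $u_0\in M^{1,1}(\mathbb R^d)$, then there exists $T^*=T^*(\|u_0\|_{M^{1,1}})>0$ such that $(\star)$ has a unique solution $u\in C([0,T^* ),M^{1,1}(\mathbb R^d))$. (2) If $k=1$, $K\in\mathcal FL^q(\mathbb R^d)$ with $1<q<2$, and $u_0\in M^{\frac{2r}{2r-1},\frac{2r}{2r-1}}(\mathbb R^d)$ with $q<r<\infty$, then there exists $T^*=T^*\big(\|u_0\|_{M^{\frac{2r}{2r-1},\frac{2r}{2r-1}}}\big)>0$ such that $(\star)$ has a unique solution $u\in C\big([0,T^* ),M^{\frac{2r}{2r-1},\frac{2r}{2r-1}}(\mathbb R^d)\big)$. (3) If $K\in M^{1,\infty}(\mathbb R^d)$ and $u_0\in M^{1,1}(\mathbb R^d)$, then there exists $T^*=T^*(\|u_0\|_{M^{1,1}})>0$ such that $(\star)$ has a unique solution $u\in C([0,T^* ),M^{1,1}(\mathbb R^d))$.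
   Context: Fourier transform: $\hat f(\xi)=\mathcal Ff(\xi)=(2\pi)^{-d/2}\int f(x)e^{-ix\cdot\xi}\,dx$, extended to $\mathcal S'(\mathbb R^d)$. $\mathcal FL^q(\mathbb R^d)=\{f\in\mathcal S'(\mathbb R^d):\hat f\in L^q(\mathbb R^d)\}$ with norm $\|\hat f\|_{L^q}$. Convolution with the tempered distribution $K$ is understood as $K*h=(2\pi)^{d/2}\mathcal F^{-1}(\hat K\,\hat h)$ (in case (3), $\hat K\in L^\infty$). Modulation spaces: for a fixed nonzero $g\in\mathcal S(\mathbb R^d)$ and $f\in\mathcal S'(\mathbb R^d)$, the short-time Fourier transform is $V_gf(x,y)=(2\pi)^{-d/2}\langle f,M_yT_xg\rangle$, i.e. $V_gf(x,y)=(2\pi)^{-d/2}\int f(t)\overline{g(t-x)}e^{-iy\cdot t}\,dt$, where $T_xg(t)=g(t-x)$, $M_yg(t)=e^{iy\cdot t}g(t)$. For $1\le p,q\le\infty$, $M^{p,q}(\mathbb R^d)$ is the Banach space of $f\in\mathcal S'(\mathbb R^d)$ with $$\|f\|_{M^{p,q}}=\Big(\int_{\mathbb R^d}\Big(\int_{\mathbb R^d}|V_gf(x,y)|^p\,dx\Big)^{q/p}dy\Big)^{1/q}<\infty$$ (essential suprema if $p$ or $q$ is $\infty$); different choices of $g$ give equivalent norms. For $1\le p\le 2$, $M^{p,p}(\mathbb R^d)\subset L^2(\mathbb R^d)$. The Hermite operator $H$ has the orthonormal basis of eigenfunctions of $L^2(\mathbb R^d)$ given by the normalized Hermite functions $\Phi_\alpha$,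 $\alpha\in\mathbb N^d$ ($0\in\mathbb N$ for multi-indices), with $H\Phi_\alpha=(2|\alpha|+d)\Phi_\alpha$, and $e^{-itH}f=\sum_\alpha e^{-it(2|\alpha|+d)}\langle f,\Phi_\alpha\rangle\Phi_\alpha$ for $f\in L^2(\mathbb R^d)$. A solution of $i\partial_tu-Hu=F(u)$, $u(0)=u_0$, on $[0,T)$ is understood in the sense of Duhamel's formula: $u(t)=e^{-itH}u_0-i\int_0^te^{-i(t-\tau)H}F(u(\tau))\,d\tau$ for all $t\in[0,T)$. The notation $T^*=T^*(\|u_0\|_X)$ means that, for the given $K,k,d$ (and $q,r$), $T^*$ can be chosen depending on $u_0$ only through $\|u_0\|_X$. *)

theory Defs
  imports "HOL-Analysis.Analysis" "HOL-Probability.Essential_Supremum"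
begin

section \<open>Lebesgue norms\<close>

text \<open>Real powers on \<^typ>\<open>ennreal\<close>; only used with exponent \<open>r > 0\<close>.\<close>

definition ennpowr :: "ennreal \<Rightarrow> real \<Rightarrow> ennreal" where
  "ennpowr x r = (if x = \<infinity> then \<infinity> else ennreal (enn2real x powr r))"

definition Lnorm :: "ennreal \<Rightarrow> 'a measure \<Rightarrow> ('a \<Rightarrow> ennreal) \<Rightarrow> ennreal" where
  "Lnorm p M f =
     (if p = \<infinity> then esssup M f
      else ennpowr (\<integral>\<^sup>+ x. ennpowr (f x) (enn2real p) \<partial>M) (1 / enn2real p))"

definition Lspace :: "ennreal \<Rightarrow> ('a::euclidean_space \<Rightarrow> complex) set" where
  "Lspace p = {f \<in> borel_measurable lborel. Lnorm p lborel (\<lambda>x. ennreal (norm (f x))) < \<infinity>}"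

section \<open>Schwartz functions and tempered distributions\<close>

definition partial_deriv :: "'n \<Rightarrow> (real^'n \<Rightarrow> complex) \<Rightarrow> (real^'n \<Rightarrow> complex)" where
  "partial_deriv i f = (\<lambda>x. vector_derivative (\<lambda>t. f (x + t *\<^sub>R axis i 1)) (at 0))"

definition partial_derivs :: "'n list \<Rightarrow> (real^'n \<Rightarrow> complex) \<Rightarrow> (real^'n \<Rightarrow> complex)" where
  "partial_derivs js f = foldr partial_deriv js f"

definition schwartz_space :: "(real^'n \<Rightarrow> complex) set" where
  "schwartz_space = {f. \<forall>js.
     (\<forall>x. partial_derivs js f differentiable (at x)) \<and>
     (\<forall>N. bounded (range (\<lambda>x. (1 + norm x) ^ N *\<^sub>R partial_derivs js f x)))}"

definition schwartz_seminorm :: "nat \<Rightarrow> 'n list \<Rightarrow> (real^'n \<Rightarrow> complex) \<Rightarrow> real" where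
  "schwartz_seminorm N js f = (SUP x. (1 + norm x) ^ N * norm (partial_derivs js f x))"

text \<open>
  A tempered distribution is a linear functional on the Schwartz space that is (sequentially)
  continuous for the seminorms above.  It is encoded as a total function which is \<open>0\<close> off the
  Schwartz space, so that two distributions are equal iff they agree on Schwartz functions.
  Distributions act bilinearly: a function \<open>f\<close> acts by \<open>\<phi> \<mapsto> \<integral> f \<phi>\<close>.
\<close>

type_synonym 'n dist = "(real^'n \<Rightarrow> complex) \<Rightarrow> complex"

definition tempered :: "('n::finite) dist set" where
  "tempered = {T.
     (\<forall>\<phi>. \<phi> \<notin> schwartz_space \<longrightarrow> T \<phi> = 0) \<and>
     (\<forall>\<phi>\<in>schwartz_space. \<forall>\<psi>\<in>schwartz_space. T (\<lambda>x. \<phi> x + \<psi> x) = T \<phi> + T \<psi>) \<and>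
     (\<forall>c. \<forall>\<phi>\<in>schwartz_space. T (\<lambda>x. c * \<phi> x) = c * T \<phi>) \<and>
     (\<forall>\<Phi>::nat \<Rightarrow> real^'n \<Rightarrow> complex.
        (\<forall>n. \<Phi> n \<in> schwartz_space) \<and>
        (\<forall>N js. (\<lambda>n. schwartz_seminorm N js (\<Phi> n)) \<longlonglongrightarrow> 0)
        \<longrightarrow> (\<lambda>n. T (\<Phi> n)) \<longlonglongrightarrow> 0)}"

text \<open>The sesquilinear bracket \<open>\<langle>T, \<phi>\<rangle>\<close>, which extends the inner product of \<open>L\<^sup>2\<close>.\<close>

definition bracket :: "('n::finite) dist \<Rightarrow> (real^'n \<Rightarrow> complex) \<Rightarrow> complex" where
  "bracket T \<phi> = T (\<lambda>x. cnj (\<phi> x))"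

definition dist_of_fun :: "(real^'n \<Rightarrow> complex) \<Rightarrow> ('n::finite) dist" where
  "dist_of_fun f = (\<lambda>\<phi>. if \<phi> \<in> schwartz_space then \<integral>x. f x * \<phi> x \<partial>lborel else 0)"

text \<open>
  The function, unique almost everywhere, that a distribution is given by.  If the distribution is
  not a function, the value is arbitrary.
\<close>

definition fun_of_dist :: "('n::finite) dist \<Rightarrow> real^'n \<Rightarrow> complex" where
  "fun_of_dist T = (SOME f. f \<in> borel_measurable lborel \<and>
     (\<forall>\<phi>\<in>schwartz_space. integrable lborel (\<lambda>x. f x * \<phi> x)) \<and> dist_of_fun f = T)"

definition dist_mult :: "('n::finite) dist \<Rightarrow> 'n dist \<Rightarrow> 'n dist" where
  "dist_mult S T = dist_of_fun (\<lambda>x. fun_of_dist S x * fun_of_dist T x)"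

definition dist_abs_power :: "('n::finite) dist \<Rightarrow> nat \<Rightarrow> 'n dist" where
  "dist_abs_power T m = dist_of_fun (\<lambda>x. complex_of_real (norm (fun_of_dist T x) ^ m))"

section \<open>Fourier transform and convolution\<close>

definition fourier :: "(real^'n \<Rightarrow> complex) \<Rightarrow> (real^'n \<Rightarrow> complex)" where
  "fourier f = (\<lambda>\<xi>. complex_of_real ((2 * pi) powr (- real CARD('n) / 2)) *
     (\<integral>x. f x * cis (- (x \<bullet> \<xi>)) \<partial>lborel))"

definition inv_fourier :: "(real^'n \<Rightarrow> complex) \<Rightarrow> (real^'n \<Rightarrow> complex)" where
  "inv_fourier f = (\<lambda>x. complex_of_real ((2 * pi) powr (- real CARD('n) / 2)) *
     (\<integral>\<xi>. f \<xi> * cis (x \<bullet> \<xi>) \<partial>lborel))"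

definition dist_fourier :: "('n::finite) dist \<Rightarrow> 'n dist" where
  "dist_fourier T = (\<lambda>\<phi>. if \<phi> \<in> schwartz_space then T (fourier \<phi>) else 0)"

definition dist_inv_fourier :: "('n::finite) dist \<Rightarrow> 'n dist" where
  "dist_inv_fourier T = (\<lambda>\<phi>. if \<phi> \<in> schwartz_space then T (inv_fourier \<phi>) else 0)"

definition fourier_Lspace :: "ennreal \<Rightarrow> ('n::finite) dist set" where
  "fourier_Lspace q = {T \<in> tempered. \<exists>h\<in>Lspace q. dist_fourier T = dist_of_fun h}"

definition dist_convolution :: "('n::finite) dist \<Rightarrow> 'n dist \<Rightarrow> 'n dist" where
  "dist_convolution K h = (\<lambda>\<phi>. complex_of_real ((2 * pi) powr (real CARD('n) / 2)) *
     dist_inv_fourier (dist_mult (dist_fourier K) (dist_fourier h)) \<phi>)"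

section \<open>Modulation spaces\<close>

definition stft :: "(real^'n \<Rightarrow> complex) \<Rightarrow> ('n::finite) dist \<Rightarrow> real^'n \<Rightarrow> real^'n \<Rightarrow> complex" where
  "stft g T x y = complex_of_real ((2 * pi) powr (- real CARD('n) / 2)) *
     bracket T (\<lambda>t. cis (y \<bullet> t) * g (t - x))"

definition mod_norm :: "(real^'n \<Rightarrow> complex) \<Rightarrow> ennreal \<Rightarrow> ennreal \<Rightarrow> ('n::finite) dist \<Rightarrow> ennreal" where
  "mod_norm g p q T =
     Lnorm q lborel (\<lambda>y. Lnorm p lborel (\<lambda>x. ennreal (norm (stft g T x y))))"

definition mod_space :: "(real^'n \<Rightarrow> complex) \<Rightarrow> ennreal \<Rightarrow> ennreal \<Rightarrow> ('n::finite) dist set" where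
  "mod_space g p q = {T \<in> tempered. mod_norm g p q T < \<infinity>}"

text \<open>The space \<open>C([0,T), M\<^sup>p\<^sup>,\<^sup>p)\<close>; its elements are extensional functions on \<open>[0,T)\<close>.\<close>

definition mod_curves ::
  "(real^'n \<Rightarrow> complex) \<Rightarrow> ennreal \<Rightarrow> real \<Rightarrow> (real \<Rightarrow> ('n::finite) dist) set" where
  "mod_curves g p T = {u \<in> {0..<T} \<rightarrow>\<^sub>E mod_space g p p.
     \<forall>t\<in>{0..<T}. ((\<lambda>s. mod_norm g p p (\<lambda>\<phi>. u s \<phi> - u t \<phi>)) \<longlongrightarrow> 0) (at t within {0..<T})}"

text \<open>
  The Riemann integral of a curve with values in the Banach space \<open>M\<^sup>p\<^sup>,\<^sup>p\<close>: the Riemann sums over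
  tagged divisions of \<open>[a,b]\<close> converge in norm to \<open>J\<close> as the mesh tends to \<open>0\<close>.  For continuous
  curves this is the Bochner integral.
\<close>

definition has_mod_integral ::
  "(real^'n \<Rightarrow> complex) \<Rightarrow> ennreal \<Rightarrow> (real \<Rightarrow> ('n::finite) dist) \<Rightarrow> real \<Rightarrow> real \<Rightarrow> 'n dist \<Rightarrow> bool" where
  "has_mod_integral g p G a b J \<longleftrightarrow>
     (\<forall>\<tau>\<in>{a..b}. G \<tau> \<in> mod_space g p p) \<and> J \<in> mod_space g p p \<and>
     (\<forall>\<epsilon>>0. \<exists>\<delta>>0. \<forall>D. D tagged_division_of {a..b} \<and> (\<lambda>\<tau>. ball \<tau> \<delta>) fine D \<longrightarrow>
        mod_norm g p p (\<lambda>\<phi>. (\<Sum>(\<tau>, I)\<in>D. complex_of_real (measure lborel I) * G \<tau> \<phi>) - J \<phi>) < ennreal \<epsilon>)"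

section \<open>The propagator of the Hermite operator\<close>

definition hermite_fun :: "nat \<Rightarrow> real \<Rightarrow> real" where
  "hermite_fun n x =
     (- 1) ^ n / sqrt (sqrt pi * 2 ^ n * fact n) * exp (x\<^sup>2 / 2) * (deriv ^^ n) (\<lambda>y. exp (- y\<^sup>2)) x"

definition hermite :: "('n \<Rightarrow> nat) \<Rightarrow> real^('n::finite) \<Rightarrow> complex" where
  "hermite \<alpha> x = complex_of_real (\<Prod>i\<in>UNIV. hermite_fun (\<alpha> i) (x $ i))"

text \<open>
  \<open>e\<^sup>-\<^sup>i\<^sup>t\<^sup>H T = \<Sum>\<^sub>\<alpha> e\<^sup>-\<^sup>i\<^sup>t\<^sup>(\<^sup>2\<^sup>|\<^sup>\<alpha>\<^sup>|\<^sup>+\<^sup>d\<^sup>) \<langle>T, \<Phi>\<^sub>\<alpha>\<rangle> \<Phi>\<^sub>\<alpha>\<close>, where the series converges unconditionally in \<open>L\<^sup>2\<close>;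
  meaningful for distributions \<open>T\<close> given by \<open>L\<^sup>2\<close> functions.
\<close>

definition hermite_propagator :: "real \<Rightarrow> ('n::finite) dist \<Rightarrow> 'n dist" where
  "hermite_propagator t T = (THE S. \<exists>h\<in>Lspace 2. S = dist_of_fun h \<and>
     ((\<lambda>A. Lnorm 2 lborel (\<lambda>x. ennreal (norm
          ((\<Sum>\<alpha>\<in>A. cis (- t * (2 * real (\<Sum>i\<in>UNIV. \<alpha> i) + real CARD('n))) *
              bracket T (hermite \<alpha>) * hermite \<alpha> x) - h x)))) \<longlongrightarrow> 0)
       (finite_subsets_at_top UNIV))"

section \<open>The Cauchy problem\<close>

definition hartree :: "('n::finite) dist \<Rightarrow> nat \<Rightarrow> 'n dist \<Rightarrow> 'n dist" where
  "hartree K k v = dist_mult (dist_convolution K (dist_abs_power v (2 * k))) v"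

text \<open>
  Duhamel's formula on \<open>[0,T)\<close> with the time integral taken in \<open>M\<^sup>p\<^sup>,\<^sup>p\<close>; the case \<open>t = 0\<close> is the
  initial condition \<open>u(0) = u\<^sub>0\<close>.
\<close>

definition duhamel ::
  "(real^'n \<Rightarrow> complex) \<Rightarrow> ennreal \<Rightarrow> ('n::finite) dist \<Rightarrow> nat \<Rightarrow> 'n dist \<Rightarrow> real
     \<Rightarrow> (real \<Rightarrow> 'n dist) \<Rightarrow> bool" where
  "duhamel g p K k u0 T u \<longleftrightarrow>
     (\<forall>t\<in>{0..<T}. \<exists>J.
        has_mod_integral g p (\<lambda>\<tau>. hermite_propagator (t - \<tau>) (hartree K k (u \<tau>))) 0 t J \<and>
        u t = (\<lambda>\<phi>. hermite_propagator t u0 \<phi> - \<i> * J \<phi>))"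

end

theory Submission
  imports Defs "HOL-Probability.Probability" "HOL-Probability.Discrete_Topology" "HOL-Computational_Algebra.Polynomial"
begin

text \<open>
  A distribution is recovered from its short-time Fourier transform by integrating against the
  coefficients of the test function; this gives the equivalence of windows, completeness, and, for
  \<open>p \<le> 2\<close>, the embedding into \<open>L\<^sup>2\<close>.  With a Gaussian window the Hermite propagator rotates phase space,
  so \<open>e\<^sup>-\<^sup>i\<^sup>t\<^sup>H\<close> is uniformly bounded and strongly continuous.  The Fourier transform of \<open>u \<cdot> cnj v\<close> at
  \<open>\<xi>\<close> is an integral of the transforms of \<open>u\<close> and \<open>v\<close> shifted by \<open>\<xi>\<close> in frequency; weighted AM-GM makes
  it integrable against a bounded or \<open>L\<^sup>q\<close> multiplier, and the inverse Fourier transforms of \<open>L\<^sup>1\<close>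
  functions multiply the modulation space.  The nonlinearity is thus locally Lipschitz, and the
  contraction principle and a Gronwall argument apply.
\<close>

text \<open>The rotation has an elementary source: the Hermite coefficients of a Gaussian atom at
  (x, y) are, up to a phase and a radial factor, powers of x - iy, so multiplying the coefficient of
  index alpha by e^{-2it|alpha|} amounts to turning (x, y) by the angle 2t. Completeness of the
  Hermite system enters only through these atoms, where Parseval's identity is an exponential
  series. The critical exponent 2q/(2q-1) is forced by the AM-GM weights 1/(2q), 1/(2q), 1 - 1/q;
  M^{p,p} with smaller p embeds in the critical space, so every r > q is covered and p = 1 serves
  every q. Higher powers are built as |u|^{2j}u inside M^{1,1}, where the constant multiplier 1 is
  admissible; the nonlinearity is then a trilinear form at (|u|^{2k-2}u, u, u). The encoding adds
  two obstacles: the modulation space is a set of functionals and not a type, hence the isometric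
  copy in a Banach space; and the nonlinearity is written through chosen representatives of
  distributions, hence the many almost-everywhere identities.\<close>

abbreviation (input) Schw :: "(real^'n => complex) set" where "Schw == schwartz_space"
abbreviation (input) BM :: "('a::topological_space => 'b::topological_space) set" where "BM == borel_measurable borel"
abbreviation (input) LM :: "('a::euclidean_space => 'b::topological_space) set" where "LM == borel_measurable lborel"
abbreviation (input) L1 :: "('a::euclidean_space => 'b::{banach, second_countable_topology}) => bool" where "L1 == integrable lborel"
abbreviation (input) cx :: "real => complex" where "cx == complex_of_real"
abbreviation (input) en :: "'a::real_normed_vector => ennreal" where "en x == ennreal (norm x)"
abbreviation (input) nn_int :: "('a::euclidean_space => ennreal) => ennreal" (binder "LNINT " [60] 60) where "nn_int f == nn_integral lborel f"
abbreviation (input) seq_tends (infix "---->" 60) where "f ----> l == tendsto f l sequentially"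
abbreviation (input) tends (infixr "~~>" 55) where "f ~~> l == tendsto f l"
abbreviation (input) scale :: "real => 'a::real_vector => 'a" (infixr "*r" 75) where "a *r x == scaleR a x"
lemmas integrable_bound = Bochner_Integration.integrable_bound
lemmas int_cong = Bochner_Integration.integral_cong
lemmas integral_ge_0_AE = Bochner_Integration.integral_nonneg_AE
lemmas int_cnj = Bochner_Integration.integral_cnj
lemmas borel_cont = borel_measurable_continuous_onI

section \<open>Integration\<close>

text \<open>The p-th root is left off so that Tonelli, Fatou and constant factors act directly on an
  \<open>ennreal\<close> integral; \<open>Lnorm_ennreal\<close> recovers the norm.\<close>

definition Lpow :: "real => 'a measure => ('a => complex) => ennreal" where
 "Lpow p M f = (\<integral>\<^sup>+ x. ennreal (norm (f x) powr p) \<partial>M)"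

lemma has_vector_derivative_quotient:
 fixes f :: "real => 'a::real_normed_vector"
 shows "(f has_vector_derivative d) (at x) \<longleftrightarrow> ((%h. (f (x + h) - f x) /\<^sub>R h) ~~> d) (at 0)"
proof -
 have "norm (f (x + h) - f x - h *r d) / norm h = norm ((f (x + h) - f x) /\<^sub>R h - d)" if "h ~= 0" for h
 proof -
 have "(f (x + h) - f x) /\<^sub>R h - d = (f (x + h) - f x - h *r d) /\<^sub>R h"
 using that by (simp add: scaleR_diff_right)
 thus ?thesis by (simp add: divide_inverse mult.commute)
 qed
 hence "((%h. norm (f (x + h) - f x - h *r d) / norm h) ~~> 0) (at 0) \<longleftrightarrow>
 ((%h. norm ((f (x + h) - f x) /\<^sub>R h - d)) ~~> 0) (at 0)"
 by (intro tendsto_cong) (auto simp: eventually_at_filter)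
 thus ?thesis
 unfolding has_vector_derivative_def has_derivative_at
 by (simp add: bounded_linear_scaleR_left tendsto_norm_zero_iff LIM_zero_iff)
qed

text \<open>Differentiation under the integral sign: the mean value bound \<open>lip\<close>
  dominates every difference quotient by \<open>w\<close>. The base point is 0 because
  \<open>partial_deriv\<close> is a derivative at 0 along a coordinate line.\<close>

lemma has_vector_derivative_integral:
 fixes f :: "real => 'a => complex"
 assumes int: "!!s. integrable M (f s)"
 and der: "!!s x. ((%s. f s x) has_vector_derivative f' s x) (at s)"
 and bnd: "!!s x. norm (f' s x) <= w x" and w: "integrable M w"
 shows "((%s. \<integral>x. f s x \<partial>M) has_vector_derivative (\<integral>x. f' 0 x \<partial>M)) (at 0)"
proof -
 have lip: "norm (f s x - f 0 x) <= w x * \<bar>s\<bar>" for s x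
 proof -
 have "norm (f s x - f 0 x) <= w x * norm (s - 0)"
 proof (rule differentiable_bound[where S=UNIV and f'="%s h. h *r f' s x"])
 show "onorm (%h. h *r f' s x) <= w x" for s
 using bnd[of s x] by (intro onorm_bound) (auto intro: order_trans[OF norm_ge_zero] simp: mult.commute mult_left_mono)
 qed (use der in \<open>auto simp: has_vector_derivative_def\<close>)
 thus ?thesis by simp
 qed
 have "((%s. ((\<integral>x. f s x \<partial>M) - (\<integral>x. f 0 x \<partial>M)) /\<^sub>R s) ~~> (\<integral>x. f' 0 x \<partial>M)) (at 0)"
 unfolding tendsto_at_iff_sequentially
 proof (intro allI impI)
 fix X :: "nat => real" assume X0: "ALL i. X i : UNIV - {0}" and X: "X ----> 0"
 have lim: "(%i. (f (X i) x - f 0 x) /\<^sub>R X i) ----> f' 0 x" for x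
 using der[of x 0] X0 X unfolding has_vector_derivative_quotient tendsto_at_iff_sequentially comp_def
 by simp
 have m: "(%x. (f (X i) x - f 0 x) /\<^sub>R X i) : borel_measurable M" for i
 using int by (intro borel_measurable_scaleR borel_measurable_diff borel_measurable_const) auto
 have "(%i. \<integral>x. (f (X i) x - f 0 x) /\<^sub>R X i \<partial>M) ----> (\<integral>x. f' 0 x \<partial>M)"
 proof (rule integral_dominated_convergence[where w=w])
 show "f' 0 : borel_measurable M"
 by (rule borel_measurable_LIMSEQ_metric[OF m lim])
 show "AE x in M. norm ((f (X i) x - f 0 x) /\<^sub>R X i) <= w x" for i
 proof (rule AE_I2)
 fix x
 have "X i ~= 0" using X0 by auto
 thus "norm ((f (X i) x - f 0 x) /\<^sub>R X i) <= w x"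
 using lip[of "X i" x] by (simp add: pos_divide_le_eq divide_inverse_commute[symmetric])
 qed
 qed (use m w lim in auto)
 thus "((%s. ((\<integral>x. f s x \<partial>M) - (\<integral>x. f 0 x \<partial>M)) /\<^sub>R s) \<circ> X) ----> (\<integral>x. f' 0 x \<partial>M)"
 using int by (simp add: comp_def)
 qed
 thus ?thesis
 by (simp add: has_vector_derivative_quotient)
qed

text \<open>No hypothesis on \<open>f\<close>: if \<open>f\<close> is not measurable, neither is its
  translate, and both integrals have the default value 0.\<close>

lemma lborel_integral_translate:
 fixes f :: "'a::euclidean_space => 'b::{banach, second_countable_topology}"
 shows "(LBINT x. f (x + a)) = (LBINT x. f x)"
proof -
 have "(LBINT x. f x) = (\<integral>x. f x \<partial>(distr lborel borel ((+) a)))"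
 by (simp add: lborel_distr_plus)
 show ?thesis
 proof (cases "f : BM")
 case True
 have "(\<integral>x. f x \<partial>(distr lborel borel ((+) a))) = (LBINT x. f (a + x))"
 by (rule integral_distr) (use True in auto)
 thus ?thesis by (simp add: lborel_distr_plus add.commute)
 next
 case False
 have "(%x. f (x + a)) \<notin> borel_measurable borel"
 proof
 assume "(%x. f (x + a)) : BM"
 hence "(%x. f ((x - a) + a)) : BM"
 by (rule measurable_compose[rotated]) measurable
 thus False using False by simp
 qed
 hence "\<not> L1 (%x. f (x + a))" "\<not> L1 f"
 using False borel_measurable_integrable by fastforce+
 thus ?thesis
 by (simp add: not_integrable_integral_eq)
 qed
qed

lemma nn_translate:
 fixes f :: "'a::euclidean_space => ennreal"
 assumes [measurable]: "f : BM"
 shows "(LNINT x. f (x + a)) = (LNINT x. f x)"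
proof -
 have "(\<integral>\<^sup>+x. f x \<partial>(distr lborel borel ((+) a))) = (LNINT x. f (a + x))"
 by (rule nn_integral_distr) auto
 thus ?thesis by (simp add: lborel_distr_plus add.commute)
qed

lemma lborel_integrable_translate:
 fixes f :: "'a::euclidean_space => 'b::{banach, second_countable_topology}"
 assumes "L1 f"
 shows "L1 (%x. f (x + a))"
proof -
 have "integrable (distr lborel borel ((+) a)) f"
 using assms by (simp add: lborel_distr_plus)
 hence "L1 (%x. f (a + x))"
 by (rule integrable_distr[rotated]) auto
 thus ?thesis by (simp add: add.commute)
qed

lemma lborel_affine_scale:
 fixes f :: "'a::euclidean_space => 'b::{banach, second_countable_topology}"
 assumes [measurable]: "f : BM" and c: "c ~= 0"
 shows "(LBINT x. f x) = \<bar>c\<bar> ^ DIM('a) *r (LBINT x. f (t + c *r x))"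
 by (subst lborel_affine[OF c, of t])
 (simp add: integral_density integral_distr)

lemma lborel_nn_affine_scale:
 fixes f :: "'a::euclidean_space => ennreal"
 assumes [measurable]: "f : BM" and c: "c ~= 0"
 shows "(LNINT x. f x) = ennreal (\<bar>c\<bar> ^ DIM('a)) * (LNINT x. f (t + c *r x))"
 by (subst lborel_affine[OF c, of t])
 (simp add: nn_integral_density nn_integral_distr nn_integral_cmult)

lemma lborel_nn_integral_reflect:
 fixes f :: "'a::euclidean_space => ennreal"
 assumes "f : BM"
 shows "(LNINT x. f (a - x)) = (LNINT x. f x)"
 using lborel_nn_affine_scale[OF assms, of "-1" a] by simp

text \<open>Integrate \<open>F (x + v) - F x = \<integral>\<^sub>0\<^sup>1 F' (x + s v) ds\<close> over \<open>x\<close>: both sides are translation invariant.\<close>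

lemma integral_directional_derivative:
 fixes F F' :: "'a::euclidean_space => complex"
 assumes F: "L1 F" and F': "L1 F'"
 and der: "!!x s. ((%s. F (x + s *r v)) has_vector_derivative F' (x + s *r v)) (at s)"
 and cont: "continuous_on UNIV F'"
 shows "(LBINT x. F' x) = 0"
proof -
 have [measurable]: "F' : BM"
 using cont by (rule borel_cont)
 let ?h = "%(s::real, x). indicator {0..1} s *r F' (x + s *r v)"
 have int: "integrable (lborel \<Otimes>\<^sub>M lborel) ?h"
 proof (rule lborel_pair.Fubini_integrable)
 show "?h : borel_measurable (lborel \<Otimes>\<^sub>M lborel)" by measurable
 have "(%s::real. LBINT x. norm (?h (s, x))) = (%s. indicator {0..1} s * (LBINT x. norm (F' x)))"
 by (auto simp: fun_eq_iff lborel_integral_translate[of "%x. norm (F' x)"] indicator_def)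
 thus "L1 (%s::real. LBINT x. norm (?h (s, x)))"
 by simp
 show "AE s in lborel. L1 (%x. ?h (s, x))"
 using lborel_integrable_translate[OF F'] by auto
 qed
 have 1: "(LBINT s. (LBINT x. ?h (s, x))) = (LBINT x. (LBINT s. ?h (s, x)))"
 using lborel_pair.Fubini_integral[of "%s x. ?h (s, x)"] int by (simp add: split_def)
 have 2: "(LBINT x. ?h (s, x)) = indicator {0..1} s *r (LBINT x. F' x)" for s
 by (simp add: lborel_integral_translate[of F'])
 have 3: "(LBINT s. ?h (s, x)) = F (x + v) - F x" for x
 proof -
 have "continuous_on {0..1} (%s::real. F' (x + s *r v))"
 by (intro continuous_intros continuous_on_compose2[OF cont]) auto
 hence "(LBINT s. indicator {0..1} s *r F' (x + s *r v)) = F (x + 1 *r v) - F (x + 0 *r v)"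
 by (intro integral_FTC_Icc) (auto intro: has_vector_derivative_at_within der)
 thus ?thesis by simp
 qed
 have 4: "(LBINT x. F (x + v) - F x) = 0"
 using F lborel_integrable_translate[OF F] by (simp add: lborel_integral_translate)
 show ?thesis using 1 unfolding 2 3 4 by simp
qed

text \<open>The exponent gives each coordinate one factor \<open>(1 + norm x)^2\<close>, which
  dominates \<open>1 + (x \<bullet> b)^2\<close>; what remains is a product of integrals of
  \<open>1 / (1 + t^2)\<close> on the line.\<close>

lemma integrable_weight:
 "L1 (%x::'a::euclidean_space. 1 / (1 + norm x) ^ (2 * DIM('a)))"
proof -
 have i1: "(LNINT x. ennreal (1 / (1 + x\<^sup>2))) < \<infinity>"
 proof -
 have "set_integrable lborel (einterval (-\<infinity>) \<infinity>) (%x. inverse (1 + x\<^sup>2))"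
 using integrable_inverse_1_plus_square by simp
 hence "L1 (%x::real. inverse (1 + x\<^sup>2))"
 by (simp add: set_integrable_def)
 thus ?thesis
 by (simp add: integrable_iff_bounded inverse_eq_divide)
 qed
 have le: "1 / (1 + norm x) ^ (2 * DIM('a)) <= (\<Prod>b\<in>Basis. 1 / (1 + (x \<bullet> b)^2))" for x :: 'a
 proof -
 have "(\<Prod>b\<in>Basis. 1 + (x \<bullet> b)^2) <= (\<Prod>b\<in>(Basis::'a set). (1 + norm x)^2)"
 proof (rule prod_mono, safe)
 fix b :: 'a assume b: "b : Basis"
 have "(x \<bullet> b)^2 <= (norm x)^2"
 using Basis_le_norm[OF b, of x] by (simp add: abs_le_square_iff[symmetric])
 thus "1 + (x \<bullet> b)^2 <= (1 + norm x)^2"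
 by (simp add: power2_sum add_increasing2)
 qed auto
 also have "... = (1 + norm x) ^ (2 * DIM('a))"
 by (simp add: power_mult)
 finally have "1 / (1 + norm x) ^ (2 * DIM('a)) <= 1 / (\<Prod>b\<in>Basis. 1 + (x \<bullet> b)^2)"
 by (intro divide_left_mono mult_pos_pos prod_pos zero_less_power) (auto intro: add_pos_nonneg)
 thus ?thesis by (simp add: prod_dividef)
 qed
 have "(LNINT x. ennreal (1 / (1 + norm (x::'a)) ^ (2 * DIM('a))))
 <= (LNINT x. (\<Prod>b\<in>Basis. ennreal (1 / (1 + ((x::'a) \<bullet> b)^2))))"
 using le by (intro nn_integral_mono) (simp add: prod_ennreal ennreal_leI)
 also have "... = (\<Prod>b\<in>(Basis::'a set). (LNINT x. ennreal (1 / (1 + x\<^sup>2))))"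
 by (subst nn_integral_lborel_prod) auto
 also have "... < \<infinity>"
 using i1 by (simp add: power_less_top_ennreal)
 finally show ?thesis
 by (intro integrableI_bounded) auto
qed

lemma integrable_weight_bound:
 fixes f :: "'a::euclidean_space => 'b::{banach, second_countable_topology}"
 assumes [measurable]: "f : BM"
 and "!!x. norm (f x) * (1 + norm x) ^ (2 * DIM('a)) <= C"
 shows "L1 f"
proof (rule integrable_bound)
 show "L1 (%x::'a. C * (1 / (1 + norm x) ^ (2 * DIM('a))))"
 by (intro integrable_mult_right integrable_weight)
 have le: "norm (f x) <= C * (1 / (1 + norm x) ^ (2 * DIM('a)))" for x
 using assms(2)[of x] by (simp add: pos_le_divide_eq add_pos_nonneg)
 show "AE x in lborel. norm (f x) <= norm (C * (1 / (1 + norm x) ^ (2 * DIM('a))))"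
 by (intro AE_I2) (use le in \<open>metis abs_ge_self order_trans real_norm_def\<close>)
qed simp

section \<open>Product integrals and the Gaussian\<close>

lemma lborel_integral_prod:
 fixes f :: "'a::euclidean_space => real => complex"
 assumes "!!b. b : Basis ==> L1 (f b)"
 shows "(LBINT x. (\<Prod>b\<in>Basis. f b (x \<bullet> b))) = (\<Prod>b\<in>Basis. LBINT x. f b x)"
proof -
 interpret finite_product_sigma_finite "%_. lborel :: real measure" "Basis :: 'a set"
 by standard simp
 have [measurable]: "b : Basis ==> f b : BM" for b
 using borel_measurable_integrable[OF assms] by simp
 have "(LBINT x. (\<Prod>b\<in>Basis. f b (x \<bullet> b)))
 = (\<integral>x. (\<Prod>b\<in>Basis. f b ((\<Sum>b\<in>Basis. x b *r b) \<bullet> b)) \<partial>Pi\<^sub>M Basis (%_. lborel))"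
 by (subst lborel_eq, subst integral_distr) auto
 also have "... = (\<integral>x. (\<Prod>b\<in>Basis. f b (x b)) \<partial>Pi\<^sub>M Basis (%_. lborel))"
 by (intro int_cong prod.cong refl) simp
 also have "... = (\<Prod>b\<in>Basis. LBINT x. f b x)"
 by (rule product_integral_prod) (use assms in auto)
 finally show ?thesis .
qed

lemma gauss_fourier1:
 "L1 (%x::real. cx (exp (- x\<^sup>2 / 2)) * cis (x * s))"
 "(LBINT x. cx (exp (- x\<^sup>2 / 2)) * cis (x * s)) = cx (sqrt (2 * pi) * exp (- s\<^sup>2 / 2))"
proof -
 have e: "exp (- x\<^sup>2 / 2) = sqrt (2 * pi) * std_normal_density x" for x
 by (simp add: std_normal_density_def)
 have i: "L1 (%x::real. exp (- x\<^sup>2 / 2))"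
 unfolding e by simp
 show "L1 (%x::real. cx (exp (- x\<^sup>2 / 2)) * cis (x * s))"
 proof (rule integrable_bound[OF i])
 have [measurable]: "cis : BM"
 by (intro borel_cont continuous_intros)
 show "(%x::real. cx (exp (- x\<^sup>2 / 2)) * cis (x * s)) : LM"
 by measurable
 qed (auto simp: norm_mult)
 have "char std_normal_distribution s = (LBINT x. std_normal_density x *r iexp (s * x))"
 unfolding char_def by (subst integral_density) auto
 hence "(LBINT x. std_normal_density x *r iexp (s * x)) = cx (exp (- s\<^sup>2 / 2))"
 by (simp add: char_std_normal_distribution)
 hence "cx (sqrt (2 * pi)) * (LBINT x. std_normal_density x *r iexp (s * x))
 = cx (sqrt (2 * pi) * exp (- s\<^sup>2 / 2))" by simp
 thus "(LBINT x. cx (exp (- x\<^sup>2 / 2)) * cis (x * s)) = cx (sqrt (2 * pi) * exp (- s\<^sup>2 / 2))"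
 by (simp only: e integral_mult_right_zero[symmetric])
 (simp add: cis_conv_exp scaleR_conv_of_real mult_ac)
qed

definition gauss :: "real^'n => complex" where
 "gauss x = cx (exp (- (norm x)\<^sup>2 / 2))"

lemma gauss_prod: "gauss (x::real^'n) = (\<Prod>i\<in>UNIV. cx (exp (- (x $ i)\<^sup>2 / 2)))"
proof -
 have "(norm x)^2 = (\<Sum>i\<in>UNIV. (x $ i)^2)"
 by (simp add: norm_vec_def L2_set_def real_norm_def sum_nonneg)
 hence "- (norm x)\<^sup>2 / 2 = (\<Sum>i\<in>UNIV. - (x $ i)\<^sup>2 / 2)"
 by (simp add: sum_negf sum_divide_distrib)
 thus ?thesis by (simp add: gauss_def exp_sum)
qed

lemma prod_Basis_cart:
 fixes F :: "(real^'n) => real => 'b::comm_monoid_mult"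
 shows "(\<Prod>b\<in>Basis. F b (x \<bullet> b)) = (\<Prod>i\<in>UNIV. F (axis i 1) (x $ i))"
proof -
 have "Basis = range (%i::'n. axis i (1::real))"
 by (auto simp: Basis_vec_def)
 hence "(\<Prod>b\<in>Basis. F b (x \<bullet> b)) = (\<Prod>b\<in>range (%i::'n. axis i 1). F b (x \<bullet> b))"
 by simp
 also have "... = (\<Prod>i\<in>UNIV. F (axis i 1) (x $ i))"
 by (subst prod.reindex) (auto simp: inj_def axis_eq_axis cart_eq_inner_axis)
 finally show ?thesis .
qed

lemma lborel_integral_prod_cart:
 fixes f :: "'n::finite => real => complex"
 assumes "!!i. L1 (f i)"
 shows "(LBINT x. (\<Prod>i\<in>UNIV. f i ((x::real^'n) $ i))) = (\<Prod>i\<in>UNIV. LBINT x. f i x)"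
proof -
 define F :: "real^'n => real => complex" where "F b = f (THE i. b = axis i 1)" for b
 have F: "F (axis i 1) = f i" for i
 by (simp add: F_def axis_eq_axis)
 have "(LBINT x. (\<Prod>b\<in>Basis. F b ((x::real^'n) \<bullet> b))) = (\<Prod>b\<in>(Basis::(real^'n) set). LBINT x. F b x)"
 by (rule lborel_integral_prod) (auto simp: F_def assms)
 thus ?thesis
 unfolding prod_Basis_cart F
 using prod_Basis_cart[of "%b _. LBINT x. F b x"] by (simp add: F)
qed

lemma cis_sum: "finite A ==> cis (sum f A) = (\<Prod>i\<in>A. cis (f i))"
 by (induction rule: finite_induct) (auto simp: cis_mult[symmetric])

lemma gauss_fourier:
 "(LBINT x. gauss x * cis (x \<bullet> s)) = cx ((2 * pi) powr (real CARD('n) / 2)) * gauss (s::real^'n)"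
proof -
 have "(LBINT x. gauss x * cis (x \<bullet> s)) =
 (LBINT x. (\<Prod>i\<in>UNIV. cx (exp (- (x $ i)\<^sup>2 / 2)) * cis ((x $ i) * (s $ i))))"
 by (simp add: gauss_prod inner_vec_def cis_sum prod.distrib)
 also have "... = (\<Prod>i\<in>UNIV. cx (sqrt (2 * pi) * exp (- (s $ i)\<^sup>2 / 2)))"
 by (subst lborel_integral_prod_cart, rule gauss_fourier1(1), simp only: gauss_fourier1(2))
 also have "... = cx (sqrt (2 * pi) ^ CARD('n)) * gauss s"
 by (simp add: gauss_prod prod.distrib)
 also have "sqrt (2 * pi) ^ CARD('n) = (2 * pi) powr (real CARD('n) / 2)"
 by (simp add: powr_half_sqrt[symmetric] powr_realpow[symmetric] powr_powr)
 finally show ?thesis .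
qed


section \<open>Inequalities and limit theorems for \<open>Lpow\<close>\<close>

lemma Lpow_cmult:
 assumes [measurable]: "f : borel_measurable M"
 shows "Lpow p M (%x. c * f x) = ennreal (norm c powr p) * Lpow p M f"
 unfolding Lpow_def
 by (subst nn_integral_cmult[symmetric]) (auto simp: norm_mult powr_mult ennreal_mult)

lemma powr_add_le:
 fixes a b :: real
 assumes "0 <= a" "0 <= b" "1 <= p"
 shows "(a + b) powr p <= 2 powr p * (a powr p + b powr p)"
proof -
 have "(a + b) powr p <= (2 * max a b) powr p"
 using assms by (intro powr_mono2) auto
 also have "... = 2 powr p * max a b powr p"
 using assms by (simp add: powr_mult)
 also have "max a b powr p <= a powr p + b powr p"
 by (auto simp: max_def)
 finally show ?thesis by simp
qed

text \<open>The crude constant is enough for closure under sums; the sharp triangle inequality for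
  \<open>Mnorm\<close> comes later from \<open>norm_emb\<close>.\<close>

lemma Lpow_add:
 assumes [measurable]: "f : borel_measurable M" "g : borel_measurable M" and p: "1 <= p"
 shows "Lpow p M (%x. f x + g x) <= ennreal (2 powr p) * (Lpow p M f + Lpow p M g)"
proof -
 have "ennreal (norm (f x + g x) powr p) <= ennreal (2 powr p) * (ennreal (norm (f x) powr p) + ennreal (norm (g x) powr p))" for x
 proof -
 have "norm (f x + g x) powr p <= (norm (f x) + norm (g x)) powr p"
 using p by (intro powr_mono2) (auto intro: norm_triangle_ineq)
 also have "... <= 2 powr p * (norm (f x) powr p + norm (g x) powr p)"
 by (intro powr_add_le p) auto
 finally show ?thesis
 by (simp add: ennreal_leI flip: ennreal_plus ennreal_mult)
 qed
 hence "Lpow p M (%x. f x + g x) <= (\<integral>\<^sup>+x. ennreal (2 powr p) * (ennreal (norm (f x) powr p) + ennreal (norm (g x) powr p)) \<partial>M)"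
 unfolding Lpow_def by (intro nn_integral_mono)
 also have "... = ennreal (2 powr p) * (Lpow p M f + Lpow p M g)"
 unfolding Lpow_def by (subst nn_integral_cmult) (auto simp: nn_integral_add)
 finally show ?thesis .
qed

lemma Lpow_minus_commute: "Lpow p M (%x. f x - g x) = Lpow p M (%x. g x - f x)"
 by (simp add: Lpow_def norm_minus_commute)

text \<open>The weak form of Jensen's inequality comes from \<open>a \<le> \<lambda> + a\<^sup>p \<lambda>\<^sup>1\<^sup>-\<^sup>p\<close>, optimised over \<open>\<lambda>\<close>.\<close>

lemma kernel_power:
 fixes W k :: "'a => real"
 assumes p: "1 <= p" and K: "0 < K" and h: "0 <= h"
 and [measurable]: "W : borel_measurable M" "k : borel_measurable M"
 and nn: "!!z. 0 <= W z" "!!z. 0 <= k z"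
 and kK: "(\<integral>\<^sup>+z. ennreal (k z) \<partial>M) <= ennreal K"
 and hle: "ennreal h <= (\<integral>\<^sup>+z. ennreal (W z * k z) \<partial>M)"
 shows "ennreal (h powr p) <= ennreal (2 powr p * K powr (p - 1)) * (\<integral>\<^sup>+z. ennreal (W z powr p * k z) \<partial>M)"
proof (cases "(\<integral>\<^sup>+z. ennreal (W z powr p * k z) \<partial>M)")
 case top
 thus ?thesis using K by (simp add: ennreal_mult_top)
next
 case (real j)
 have key: "h <= l * K + l powr (1 - p) * j" if l: "l > 0" for l
 proof -
 have pt: "W z <= l + l powr (1 - p) * W z powr p" for z
 proof (cases "W z <= l")
 case False
 hence "W z > 0" using l by simp
 have "W z powr (1 - p) <= l powr (1 - p)"
 using False l p by (intro powr_mono2') auto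
 hence "W z powr (1 - p) * W z powr p <= l powr (1 - p) * W z powr p"
 by (intro mult_right_mono) auto
 moreover have "W z powr (1 - p) * W z powr p = W z"
 using \<open>W z > 0\<close> by (simp add: powr_add[symmetric])
 ultimately show ?thesis using l by simp
 qed (auto intro: add_increasing2)
 have "ennreal h <= (\<integral>\<^sup>+z. ennreal l * ennreal (k z) + ennreal (l powr (1 - p)) * ennreal (W z powr p * k z) \<partial>M)"
 proof (rule order_trans[OF hle], rule nn_integral_mono)
 fix z
 have "W z * k z <= (l + l powr (1 - p) * W z powr p) * k z"
 by (intro mult_right_mono pt nn)
 hence "ennreal (W z * k z) <= ennreal (l * k z + l powr (1 - p) * (W z powr p * k z))"
 by (intro ennreal_leI) (simp add: algebra_simps)
 thus "ennreal (W z * k z) <= ennreal l * ennreal (k z) + ennreal (l powr (1 - p)) * ennreal (W z powr p * k z)"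
 using l nn by (simp add: ennreal_mult)
 qed
 also have "... = ennreal l * (\<integral>\<^sup>+z. ennreal (k z) \<partial>M) + ennreal (l powr (1 - p)) * ennreal j"
 by (subst nn_integral_add) (auto simp: nn_integral_cmult real)
 also have "... <= ennreal l * ennreal K + ennreal (l powr (1 - p)) * ennreal j"
 by (intro add_mono mult_left_mono kK) auto
 also have "... = ennreal (l * K + l powr (1 - p) * j)"
 using l K real by (simp add: ennreal_mult)
 finally show ?thesis using l K real by (subst (asm) ennreal_le_iff) auto
 qed
 have "h powr p <= 2 powr p * K powr (p - 1) * j"
 proof (cases "j = 0")
 case True
 have "h <= 0"
 proof (rule field_le_epsilon)
 fix e :: real assume "e > 0"
 thus "h <= 0 + e" using key[of "e / K"] K True by simp
 qed
 thus ?thesis using h True by simp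
 next
 case False
 hence j: "j > 0" using real by simp
 let ?l = "(j / K) powr (1 / p)"
 have "?l > 0" using j K by simp
 have 1: "?l * K = j powr (1/p) * K powr (1 - 1/p)"
 using j K by (simp add: powr_divide powr_diff)
 have 2: "?l powr (1 - p) * j = j powr (1/p) * K powr (1 - 1/p)"
 proof -
 have "?l powr (1 - p) = (j / K) powr (1/p - 1)"
 using p by (simp add: powr_powr diff_divide_distrib)
 thus ?thesis using j K by (simp add: powr_divide powr_diff)
 qed
 have "h <= 2 * (j powr (1/p) * K powr (1 - 1/p))"
 using key[OF \<open>?l > 0\<close>] unfolding 1 2 by simp
 hence "h powr p <= (2 * (j powr (1/p) * K powr (1 - 1/p))) powr p"
 using h p by (intro powr_mono2) auto
 also have "... = 2 powr p * K powr (p - 1) * j"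
 using j K p by (simp add: powr_mult powr_powr right_diff_distrib left_diff_distrib)
 finally show ?thesis .
 qed
 thus ?thesis
 using real K by (simp add: ennreal_leI flip: ennreal_mult)
qed

lemma Lpow_fatou:
 assumes [measurable]: "!!n. f n : borel_measurable M"
 and lim: "AE x in M. (%n. f n x) ----> g x"
 and bnd: "eventually (%n. Lpow p M (f n) <= c) sequentially" and p: "1 <= p"
 shows "Lpow p M g <= c"
proof -
 have "AE x in M. ennreal (norm (g x) powr p) = liminf (%n. ennreal (norm (f n x) powr p))"
 using lim
 proof eventually_elim
 case (elim x)
 have "(%n. ennreal (norm (f n x) powr p)) ----> ennreal (norm (g x) powr p)"
 using p by (intro tendsto_ennrealI tendsto_powr' tendsto_norm elim) auto
 thus ?case using lim_imp_Liminf[OF sequentially_bot] by force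
 qed
 hence "Lpow p M g = (\<integral>\<^sup>+x. liminf (%n. ennreal (norm (f n x) powr p)) \<partial>M)"
 unfolding Lpow_def by (rule nn_integral_cong_AE)
 also have "... <= liminf (%n. Lpow p M (f n))"
 unfolding Lpow_def by (rule nn_integral_liminf) measurable
 also have "... <= c"
 using Liminf_le[OF _ bnd] by (simp)
 finally show ?thesis .
qed

lemma ennreal_tendsto_0I:
 fixes f :: "'a => ennreal"
 assumes "!!e::real. e > 0 ==> eventually (%n. f n <= ennreal e) F"
 shows "(f ~~> 0) F"
proof (rule order_tendstoI)
 fix a :: ennreal assume "0 < a"
 then obtain e :: real where e: "e > 0" "ennreal e < a"
 by (metis ennreal_0 ennreal_less_zero_iff ennreal_rat_dense of_rat_less_0_iff dense ennreal_cases less_irrefl not_less_iff_gr_or_eq order_le_less_trans order.strict_trans top_neq_ennreal less_top)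
 thus "\<forall>\<^sub>F n in F. f n < a"
 using assms[OF e(1)] by (auto elim: eventually_mono)
qed auto

text \<open>Along a subsequence with squared distances below \<open>(1/4)^k\<close>, the sum of
  \<open>2^k\<close> times the squared increments has finite integral. Hence almost everywhere the
  increments decay geometrically and the subsequence converges; Fatou turns the pointwise limit into
  a limit in mean.\<close>

lemma L2_complete:
 fixes f :: "nat => 'a => complex"
 assumes [measurable]: "!!n. f n : borel_measurable M"
 and cauchy: "!!e. e > 0 ==> EX N. \<forall>m\<ge>N. \<forall>n\<ge>N. Lpow 2 M (%x. f m x - f n x) <= ennreal e"
 shows "EX g:borel_measurable M. (%n. Lpow 2 M (%x. f n x - g x)) ----> 0"
proof -
 have "EX N. ALL k. \<forall>m\<ge>N k. \<forall>n\<ge>N k. Lpow 2 M (%x. f m x - f n x) <= ennreal ((1/4) ^ k)"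
 using cauchy[of "(1/4) ^ k" for k] by (intro choice) auto
 then obtain N where N: "!!k m n. m >= N k ==> n >= N k ==> Lpow 2 M (%x. f m x - f n x) <= ennreal ((1/4) ^ k)"
 by blast
 \<comment> \<open>Partial sums make both \<open>r k\<close> and \<open>r (Suc k)\<close> at least
   \<open>N k\<close>; the added \<open>k\<close> makes \<open>r\<close> tend to infinity.\<close>
 define r where "r k = (\<Sum>i\<le>k. N i) + k" for k
 have rN: "r k >= N k" for k
 unfolding r_def by (intro trans_le_add1 member_le_sum) auto
 have rS: "r (Suc k) >= N k" for k
 unfolding r_def by (intro trans_le_add1 member_le_sum) auto
 have rk: "r k >= k" for k by (simp add: r_def)
 let ?D = "%k x. f (r (Suc k)) x - f (r k) x"
 have "(\<integral>\<^sup>+x. (\<Sum>k. ennreal (2 ^ k * norm (?D k x) ^ 2)) \<partial>M) = (\<Sum>k. \<integral>\<^sup>+x. ennreal (2 ^ k * norm (?D k x) ^ 2) \<partial>M)"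
 by (rule nn_integral_suminf) measurable
 also have "... <= (\<Sum>k. ennreal ((1/2) ^ k))"
 proof (intro suminf_le allI)
 fix k
 have "(\<integral>\<^sup>+x. ennreal (2 ^ k * norm (?D k x) ^ 2) \<partial>M) = ennreal (2 ^ k) * Lpow 2 M (?D k)"
 unfolding Lpow_def by (subst nn_integral_cmult[symmetric]) (auto simp: ennreal_mult)
 also have "... <= ennreal (2 ^ k) * ennreal ((1/4) ^ k)"
 by (intro mult_left_mono N rN rS) auto
 also have "... = ennreal ((1/2) ^ k)"
 by (simp flip: ennreal_mult power_mult_distrib)
 finally show "(\<integral>\<^sup>+x. ennreal (2 ^ k * norm (?D k x) ^ 2) \<partial>M) <= ennreal ((1/2) ^ k)" .
 qed auto
 also have "... = ennreal (\<Sum>k. (1/2) ^ k)"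
 by (rule suminf_ennreal2) auto
 also have "... < \<infinity>" by simp
 finally have fin: "AE x in M. (\<Sum>k. ennreal (2 ^ k * norm (?D k x) ^ 2)) ~= \<infinity>"
 by (intro nn_integral_PInf_AE) auto
 have conv: "AE x in M. convergent (%k. f (r k) x)"
 using fin
 proof eventually_elim
 fix x
 define S where "S = (\<Sum>k. ennreal (2 ^ k * norm (?D k x) ^ 2))"
 assume "(\<Sum>k. ennreal (2 ^ k * norm (?D k x) ^ 2)) ~= \<infinity>"
 hence "S ~= \<infinity>" by (simp only: S_def not_False_eq_True)
 then obtain G where "S = ennreal G" "G >= 0"
 by (cases S) auto
 hence G: "(\<Sum>k. ennreal (2 ^ k * norm (?D k x) ^ 2)) = ennreal G" "G >= 0"
 by (simp_all only: S_def)
 have le: "norm (?D k x) <= sqrt G * (sqrt (1/2)) ^ k" for k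
 proof -
 have "ennreal (2 ^ k * norm (?D k x) ^ 2) <= ennreal G"
 using sum_le_suminf[of "%k. ennreal (2 ^ k * norm (?D k x) ^ 2)" "{k}"] G by simp
 hence "2 ^ k * norm (?D k x) ^ 2 <= G" using G by simp
 hence "norm (?D k x) ^ 2 <= G * (1/2) ^ k"
 by (simp add: field_simps power_divide)
 hence "sqrt (norm (?D k x) ^ 2) <= sqrt (G * (1/2) ^ k)"
 by (rule real_sqrt_le_mono)
 thus ?thesis by (simp add: real_sqrt_mult real_sqrt_power)
 qed
 have "summable (%k. sqrt G * (sqrt (1/2)) ^ k)"
 by (intro summable_mult summable_geometric) simp
 hence "summable (%k. ?D k x)"
 by (rule summable_comparison_test'[of _ 0]) (use le in auto)
 hence "convergent (%n. \<Sum>k<n. ?D k x)"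
 by (simp add: summable_iff_convergent)
 hence "convergent (%n. f (r 0) x + (f (r n) x - f (r 0) x))"
 unfolding sum_lessThan_telescope[of "%k. f (r k) x"] by (intro convergent_add convergent_const)
 thus "convergent (%k. f (r k) x)" by simp
 qed
 define g where "g x = lim (%k. f (r k) x)" for x
 have gm[measurable]: "g : borel_measurable M"
 unfolding g_def by measurable
 have lim: "AE x in M. (%k. f (r k) x) ----> g x"
 using conv by eventually_elim (simp add: g_def convergent_LIMSEQ_iff)
 have "(%n. Lpow 2 M (%x. f n x - g x)) ----> 0"
 proof (rule ennreal_tendsto_0I)
 fix e :: real assume "e > 0"
 then obtain N where N: "!!m n. m >= N ==> n >= N ==> Lpow 2 M (%x. f m x - f n x) <= ennreal e"
 using cauchy by blast
 have "Lpow 2 M (%x. f n x - g x) <= ennreal e" if n: "n >= N" for n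
 proof (rule Lpow_fatou)
 show "AE x in M. (%k. f n x - f (r k) x) ----> f n x - g x"
 using lim by eventually_elim (intro tendsto_intros)
 show "\<forall>\<^sub>F k in sequentially. Lpow 2 M (%x. f n x - f (r k) x) <= ennreal e"
 using eventually_ge_at_top[of N]
 by eventually_elim (use N n rk order_trans in blast)
 qed auto
 thus "\<forall>\<^sub>F n in sequentially. Lpow 2 M (%x. f n x - g x) <= ennreal e"
 unfolding eventually_sequentially by blast
 qed
 thus ?thesis using gm by blast
qed


text \<open>Scheffe's lemma gives L1 convergence of the p-th powers. The excess \<open>?r\<close> of
  the p-th power of the difference over \<open>2 powr p\<close> times the error of the powers is at
  most a fixed multiple of the p-th power of the limit, so dominated convergence removes it. Serves
  the continuity of the propagator in time, where all norms are equal.\<close>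

lemma Lpow_scheffe:
 fixes F :: "nat => 'a => complex"
 assumes p: "1 <= p" and [measurable]: "!!n. F n : borel_measurable M" "G : borel_measurable M"
 and lim: "AE x in M. (%n. F n x) ----> G x"
 and le: "!!n. Lpow p M (F n) <= Lpow p M G" and fin: "Lpow p M G < \<infinity>"
 shows "(%n. Lpow p M (%x. F n x - G x)) ----> 0"
proof -
 let ?u = "%n x. norm (F n x) powr p" and ?v = "%x. norm (G x) powr p"
 let ?w = "%n x. norm (?u n x - ?v x)"
 let ?r = "%n x. max 0 (norm (F n x - G x) powr p - 2 powr p * ?w n x)"
 have limp: "AE x in M. (%n. ?u n x) ----> ?v x"
 using lim by eventually_elim (intro tendsto_powr' tendsto_norm; use p in auto)
 have w0: "(%n. \<integral>\<^sup>+x. ennreal (?w n x) \<partial>M) ----> 0"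
 proof (rule Scheffe_lemma1)
 have "Lpow p M (F n) < \<infinity>" for n using le[of n] fin by (rule order.strict_trans1)
 thus "integrable M (?u n)" for n
 by (intro integrableI_bounded) (auto simp: Lpow_def)
 show "integrable M ?v"
 using fin by (intro integrableI_bounded) (auto simp: Lpow_def)
 show "AE x in M. (%n. ?u n x) ----> ?v x" by fact
 show "limsup (%n. \<integral>\<^sup>+ x. en (?u n x) \<partial>M) <= (\<integral>\<^sup>+ x. en (?v x) \<partial>M)"
 using le by (intro Limsup_bounded) (auto simp: Lpow_def)
 qed
 have r0: "(%n. \<integral>\<^sup>+x. ennreal (?r n x) \<partial>M) ----> (\<integral>\<^sup>+x. 0 \<partial>M)"
 proof (rule nn_integral_dominated_convergence[where w="%x. ennreal (2 * 2 powr p) * ennreal (?v x)"])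
 show "AE x in M. ennreal (?r n x) <= ennreal (2 * 2 powr p) * ennreal (?v x)" for n
 proof (rule AE_I2)
 fix x
 have "norm (F n x - G x) powr p <= (norm (F n x) + norm (G x)) powr p"
 using p by (intro powr_mono2) (auto intro: norm_triangle_ineq4)
 also have "... <= 2 powr p * (?u n x + ?v x)"
 by (intro powr_add_le p) auto
 also have "... <= 2 powr p * (2 * ?v x + ?w n x)"
 by (intro mult_left_mono) auto
 finally have "?r n x <= 2 * 2 powr p * ?v x"
 by (simp add: algebra_simps)
 thus "ennreal (?r n x) <= ennreal (2 * 2 powr p) * ennreal (?v x)"
 by (simp add: ennreal_leI flip: ennreal_mult)
 qed
 show "(\<integral>\<^sup>+x. ennreal (2 * 2 powr p) * ennreal (?v x) \<partial>M) < \<infinity>"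
 using fin by (subst nn_integral_cmult) (auto simp: Lpow_def ennreal_mult_less_top)
 show "AE x in M. (%n. ennreal (?r n x)) ----> 0"
 using lim limp
 proof eventually_elim
 case (elim x)
 have "(%n. norm (F n x - G x) powr p) ----> norm (G x - G x) powr p"
 using p by (intro tendsto_powr' tendsto_norm tendsto_diff elim(1) tendsto_const) auto
 moreover have "(%n. ?w n x) ----> norm (?v x - ?v x)"
 by (intro tendsto_norm[OF tendsto_diff[OF elim(2) tendsto_const]])
 ultimately have "(%n. ?r n x) ----> max 0 (norm (G x - G x) powr p - 2 powr p * norm (?v x - ?v x))"
 by (intro tendsto_max tendsto_diff tendsto_mult tendsto_const)
 hence "(%n. ennreal (?r n x)) ----> ennreal 0"
 using p by (intro tendsto_ennrealI) simp
 thus ?case by simp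
 qed
 qed auto
 have le': "Lpow p M (%x. F n x - G x) <= (\<integral>\<^sup>+x. ennreal (?r n x) \<partial>M) + ennreal (2 powr p) * (\<integral>\<^sup>+x. ennreal (?w n x) \<partial>M)" for n
 proof -
 have "Lpow p M (%x. F n x - G x) <= (\<integral>\<^sup>+x. ennreal (?r n x) + ennreal (2 powr p) * ennreal (?w n x) \<partial>M)"
 unfolding Lpow_def
 proof (intro nn_integral_mono)
 fix x
 show "ennreal (norm (F n x - G x) powr p) <= ennreal (?r n x) + ennreal (2 powr p) * ennreal (?w n x)"
 proof -
 have nn: "0 <= ?r n x" "0 <= 2 powr p * ?w n x" by auto
 have "norm (F n x - G x) powr p <= ?r n x + 2 powr p * ?w n x"
 by linarith
 hence "ennreal (norm (F n x - G x) powr p) <= ennreal (?r n x + 2 powr p * ?w n x)"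
 by (rule ennreal_leI)
 also have "... = ennreal (?r n x) + ennreal (2 powr p * ?w n x)"
 using nn by (rule ennreal_plus)
 also have "ennreal (2 powr p * ?w n x) = ennreal (2 powr p) * ennreal (?w n x)"
 by (rule ennreal_mult) auto
 finally show ?thesis .
 qed
 qed
 also have "... = (\<integral>\<^sup>+x. ennreal (?r n x) \<partial>M) + ennreal (2 powr p) * (\<integral>\<^sup>+x. ennreal (?w n x) \<partial>M)"
 by (subst nn_integral_add) (auto simp: nn_integral_cmult)
 finally show ?thesis .
 qed
 have "(%n. (\<integral>\<^sup>+x. ennreal (?r n x) \<partial>M) + ennreal (2 powr p) * (\<integral>\<^sup>+x. ennreal (?w n x) \<partial>M)) ----> 0 + ennreal (2 powr p) * 0"
 using r0 by (intro tendsto_add ennreal_tendsto_cmult w0) auto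
 hence "(%n. (\<integral>\<^sup>+x. ennreal (?r n x) \<partial>M) + ennreal (2 powr p) * (\<integral>\<^sup>+x. ennreal (?w n x) \<partial>M)) ----> 0"
 by simp
 thus ?thesis
 by (rule tendsto_sandwich[OF _ _ tendsto_const, rotated 2]) (use le' in auto)
qed

section \<open>Shears and rotations of phase space\<close>

lemma borel_comp:
 assumes "H : BM" "continuous_on UNIV T"
 shows "(%z. H (T z)) : BM"
 using borel_cont[OF assms(2)] assms(1) by (rule measurable_compose)

lemma nn_integral_lborel_pair:
 fixes H :: "'a::euclidean_space \<times> 'b::euclidean_space => ennreal"
 assumes H: "H : BM"
 shows "(LNINT z. H z) = (LNINT x. (LNINT y. H (x, y)))"
 and "(LNINT z. H z) = (LNINT y. (LNINT x. H (x, y)))"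
proof -
 have m: "H : borel_measurable (lborel \<Otimes>\<^sub>M lborel)"
 using H by (simp add: lborel_prod)
 show "(LNINT z. H z) = (LNINT x. (LNINT y. H (x, y)))"
 using lborel.nn_integral_fst[OF m] by (simp add: lborel_prod)
 show "(LNINT z. H z) = (LNINT y. (LNINT x. H (x, y)))"
 using lborel_pair.nn_integral_snd[OF m] by (simp add: lborel_prod)
qed

lemma nn_integral_shear1:
 fixes H :: "'a::euclidean_space \<times> 'a => ennreal"
 assumes H: "H : BM"
 shows "(LNINT z. H (fst z + a *r snd z, snd z)) = (LNINT z. H z)"
proof -
 have m: "(%z. H (fst z + a *r snd z, snd z)) : BM"
 by (intro borel_comp[OF H] continuous_intros)
 have "(%x. H (x, y)) : BM" for y
 by (intro borel_comp[OF H] continuous_intros)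
 thus ?thesis
 unfolding nn_integral_lborel_pair(2)[OF m] nn_integral_lborel_pair(2)[OF H]
 by (simp add: nn_translate[of "%x. H (x, _)"])
qed

lemma nn_integral_shear2:
 fixes H :: "'a::euclidean_space \<times> 'a => ennreal"
 assumes H: "H : BM"
 shows "(LNINT z. H (fst z, snd z + a *r fst z)) = (LNINT z. H z)"
proof -
 have m: "(%z. H (fst z, snd z + a *r fst z)) : BM"
 by (intro borel_comp[OF H] continuous_intros)
 have "(%y. H (x, y)) : BM" for x
 by (intro borel_comp[OF H] continuous_intros)
 thus ?thesis
 unfolding nn_integral_lborel_pair(1)[OF m] nn_integral_lborel_pair(1)[OF H]
 by (simp add: nn_translate[of "%y. H (_, y)"])
qed

text \<open>A rotation is a product of three shears unless it is \<open>\<plusminus>1\<close>.\<close>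

lemma nn_integral_rotate:
 fixes H :: "'a::euclidean_space \<times> 'a => ennreal"
 assumes H: "H : BM" and cs: "c\<^sup>2 + s\<^sup>2 = 1"
 shows "(LNINT z. H (c *r fst z - s *r snd z, s *r fst z + c *r snd z)) = (LNINT z. H z)"
proof (cases "s = 0")
 case True
 hence "c = 1 \<or> c = -1" using cs by (simp add: power2_eq_1_iff)
 thus ?thesis
 using True lborel_nn_integral_reflect[OF H, of 0] by (auto simp: zero_prod_def minus_prod_def)
next
 case False
 \<comment> \<open>Minus the tangent of half the angle: the rotation shears the first coordinate by
   \<open>a\<close>, then the second by \<open>s\<close>, then the first by \<open>a\<close>
   again.\<close>
 define a where "a = (c - 1) / s"
 have as: "a * s = c - 1" using False by (simp add: a_def)
 have aa: "a * (c + 1) = - s"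
 proof -
 have "a * (c + 1) = (c\<^sup>2 - 1) / s"
 by (simp add: a_def power2_eq_square algebra_simps)
 also have "c\<^sup>2 - 1 = - s * s" using cs by (simp add: power2_eq_square algebra_simps)
 finally show ?thesis using False by simp
 qed
 let ?H1 = "%z. H (fst z + a *r snd z, snd z)"
 let ?H2 = "%z. ?H1 (fst z, snd z + s *r fst z)"
 let ?H3 = "%z. ?H2 (fst z + a *r snd z, snd z)"
 have "(LNINT z. ?H3 z) = (LNINT z. ?H2 z)"
 by (rule nn_integral_shear1, intro borel_comp[OF H] continuous_intros)
 also have "... = (LNINT z. ?H1 z)"
 by (rule nn_integral_shear2, intro borel_comp[OF H] continuous_intros)
 also have "... = (LNINT z. H z)"
 by (rule nn_integral_shear1, intro borel_comp[OF H] continuous_intros)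
 finally have *: "(LNINT z. ?H3 z) = (LNINT z. H z)" .
 have "?H3 z = H (c *r fst z - s *r snd z, s *r fst z + c *r snd z)" for z
 proof -
 obtain x y where z: "z = (x, y)" by (cases z)
 have 1: "y + s *r (x + a *r y) = s *r x + c *r y"
 proof -
 have "y + s *r (x + a *r y) = s *r x + (1 + a * s) *r y"
 by (simp add: algebra_simps)
 thus ?thesis by (simp add: as)
 qed
 have 2: "x + a *r y + a *r (s *r x + c *r y) = c *r x - s *r y"
 proof -
 have "x + a *r y + a *r (s *r x + c *r y) = (1 + a * s) *r x + (a * (c + 1)) *r y"
 by (simp add: algebra_simps)
 thus ?thesis by (simp only: as aa) simp
 qed
 show ?thesis by (simp add: z 1 2)
 qed
 with * show ?thesis by simp
qed

section \<open>Schwartz functions\<close>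

lemma partial_deriv_eq:
 assumes "(f has_derivative f') (at x)"
 shows "partial_deriv i f x = f' (axis i 1)"
 and "((%t. f (x + t *r axis i 1)) has_vector_derivative f' (axis i 1)) (at 0)"
proof -
 have "((%t. x + t *r axis i 1) has_derivative (%t. t *r axis i 1)) (at 0)"
 by (auto intro!: derivative_eq_intros)
 moreover have "(f has_derivative f') (at (x + 0 *r axis i 1))" using assms by simp
 ultimately have "((%t. f (x + t *r axis i 1)) has_derivative (%t. f' (t *r axis i 1))) (at 0)"
 by (rule has_derivative_compose)
 moreover have "f' (t *r axis i 1) = t *r f' (axis i 1)" for t
 using has_derivative_linear[OF assms] by (simp add: linear_cmul)
 ultimately show v: "((%t. f (x + t *r axis i 1)) has_vector_derivative f' (axis i 1)) (at 0)"
 by (simp add: has_vector_derivative_def)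
 show "partial_deriv i f x = f' (axis i 1)"
 unfolding partial_deriv_def using v by (rule vector_derivative_at)
qed

lemma partial_deriv_has_vector_derivative:
 assumes "!!x. f differentiable at x"
 shows "((%t. f (x + t *r axis i 1)) has_vector_derivative partial_deriv i f (x + s *r axis i 1)) (at s)"
proof -
 obtain f' where f': "(f has_derivative f') (at (x + s *r axis i 1))"
 using assms unfolding differentiable_def by blast
 have "((%t. f ((x + s *r axis i 1) + t *r axis i 1)) has_vector_derivative partial_deriv i f (x + s *r axis i 1)) (at 0)"
 using partial_deriv_eq[OF f', of i] by simp
 hence "((%t. f ((x + s *r axis i 1) + t *r axis i 1)) has_vector_derivative partial_deriv i f (x + s *r axis i 1)) (at (s - s))"
 by simp
 moreover have "((%t. t - s) has_vector_derivative 1) (at s)"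
 by (auto intro!: derivative_eq_intros)
 ultimately have "((%t. f ((x + s *r axis i 1) + t *r axis i 1)) \<circ> (%t. t - s) has_vector_derivative 1 *r partial_deriv i f (x + s *r axis i 1)) (at s)"
 by (intro vector_diff_chain_at)
 thus ?thesis
 by (simp add: o_def algebra_simps)
qed

lemma partial_deriv_add:
 assumes "f differentiable at x" "g differentiable at x"
 shows "partial_deriv i (%x. f x + g x) x = partial_deriv i f x + partial_deriv i g x"
proof -
 obtain f' g' where f: "(f has_derivative f') (at x)" and g: "(g has_derivative g') (at x)"
 using assms unfolding differentiable_def by blast
 show ?thesis
 using partial_deriv_eq(1)[OF has_derivative_add[OF f g]] partial_deriv_eq(1)[OF f] partial_deriv_eq(1)[OF g]
 by simp
qed

lemma partial_deriv_mult:
 assumes "f differentiable at x" "g differentiable at x"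
 shows "partial_deriv i (%x. f x * g x) x = partial_deriv i f x * g x + f x * partial_deriv i g x"
proof -
 obtain f' g' where f: "(f has_derivative f') (at x)" and g: "(g has_derivative g') (at x)"
 using assms unfolding differentiable_def by blast
 show ?thesis
 using partial_deriv_eq(1)[OF has_derivative_mult[OF f g]] partial_deriv_eq(1)[OF f] partial_deriv_eq(1)[OF g]
 by (simp add: add.commute)
qed

lemma partial_deriv_const: "partial_deriv i (%x. c) x = 0"
 using partial_deriv_eq(1)[OF has_derivative_const] .

lemma partial_deriv_cmult:
 assumes "f differentiable at x"
 shows "partial_deriv i (%x. c * f x) x = c * partial_deriv i f x"
 using partial_deriv_mult[OF differentiable_const assms] by (simp add: partial_deriv_const)

lemma partial_deriv_cnj:
 assumes "f differentiable at x"
 shows "partial_deriv i (%x. cnj (f x)) x = cnj (partial_deriv i f x)"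
proof -
 obtain f' where f: "(f has_derivative f') (at x)"
 using assms unfolding differentiable_def by blast
 show ?thesis
 using partial_deriv_eq(1)[OF has_derivative_cnj[OF f]] partial_deriv_eq(1)[OF f] by simp
qed

lemma partial_deriv_translate: "partial_deriv i (%x. f (x - a)) x = partial_deriv i f (x - a)"
 by (simp add: partial_deriv_def algebra_simps)

lemma differentiable_cnj_at:
 "f differentiable at x ==> (%x. cnj (f x)) differentiable at x"
 unfolding differentiable_def using has_derivative_cnj by blast

lemma differentiable_translate_at:
 fixes f :: "'a::real_normed_vector => 'b::real_normed_vector"
 assumes "f differentiable at (x - a)"
 shows "(%x. f (x - a)) differentiable at x"
proof -
 have "(f \<circ> (%x. x - a)) differentiable at x"
 by (rule differentiable_chain_at) (use assms in auto)
 thus ?thesis by (simp add: o_def)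
qed

text \<open>A set of functions closed under partial derivatives with the defining bounds consists of
 Schwartz functions; most closure properties below are instances of this.\<close>

lemma partial_derivs_closed:
 assumes "!!f i. f : A ==> partial_deriv i f : A" "f : A"
 shows "partial_derivs js f : A"
 unfolding partial_derivs_def using assms by (induction js) auto

lemma partial_derivs_Nil [simp]: "partial_derivs [] f = f"
 and partial_derivs_Cons [simp]: "partial_derivs (i # js) f = partial_deriv i (partial_derivs js f)"
 and partial_derivs_append: "partial_derivs (is @ js) f = partial_derivs is (partial_derivs js f)"
 by (simp_all add: partial_derivs_def)

lemma schw_coinduct:
 assumes "f : A"
 and "!!f x. f : A ==> f differentiable at x"
 and bnd: "!!f N. f : A ==> EX C. ALL x. (1 + norm x) ^ N * norm (f x) <= C"
 and cl: "!!f i. f : A ==> partial_deriv i f : A"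
 shows "f : Schw"
proof -
 have "partial_derivs js f : A" for js
 using cl assms(1) by (rule partial_derivs_closed)
 moreover have "bounded (range (%x. (1 + norm x) ^ N *r f x))" if "f : A" for f N
 using bnd[OF that, of N] unfolding bounded_iff by (auto simp: power_abs[symmetric] abs_of_nonneg)
 ultimately show ?thesis
 using assms(2) unfolding schwartz_space_def by blast
qed

lemma schw_differentiable: "f : Schw ==> f differentiable at x"
 unfolding schwartz_space_def using partial_derivs_Nil by (metis (mono_tags, lifting) mem_Collect_eq)

lemma schw_bound:
 assumes "f : Schw"
 obtains C where "C > 0" "!!x. (1 + norm x) ^ N * norm (f x) <= C"
proof -
 have "bounded (range (%x. (1 + norm x) ^ N *r partial_derivs [] f x))"
 using assms unfolding schwartz_space_def by blast
 then obtain C where "C > 0" "!!x. norm ((1 + norm x) ^ N *r f x) <= C"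
 unfolding bounded_pos by auto
 thus thesis
 by (intro that[of C]) (auto simp: power_abs[symmetric] abs_of_nonneg)
qed

lemma schw_bound':
 "f : Schw ==> EX C. ALL x. (1 + norm x) ^ N * norm (f x) <= C"
 by (metis schw_bound)

lemma schw_partial_derivs:
 "f : Schw ==> partial_derivs js f : Schw"
 unfolding schwartz_space_def by (simp add: partial_derivs_append[symmetric])

lemma schw_partial_deriv:
 "f : Schw ==> partial_deriv i f : Schw"
 using schw_partial_derivs[of f "[i]"] by simp

lemma schw_continuous: "f : Schw ==> continuous_on A f"
 by (meson continuous_at_imp_continuous_on differentiable_imp_continuous_within schw_differentiable)

lemma schw_borel [measurable_dest]: "f : Schw ==> f : BM"
 by (intro borel_cont schw_continuous)

text \<open>The multipliers of the Schwartz space, usually written O_M: the degree \<open>N\<close>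
  may depend on the derivative \<open>js\<close>.\<close>

definition tempgr :: "(real^'n => complex) set" where
 "tempgr = {a. ALL js. (ALL x. partial_derivs js a differentiable at x) \<and>
 (EX N C. ALL x. norm (partial_derivs js a x) <= C * (1 + norm x) ^ N)}"

lemma tempgr_coinduct:
 assumes "f : A"
 and "!!f x. f : A ==> f differentiable at x"
 and "!!f. f : A ==> EX N C. ALL x. norm (f x) <= C * (1 + norm x) ^ N"
 and cl: "!!f i. f : A ==> partial_deriv i f : A"
 shows "f : tempgr"
proof -
 have "partial_derivs js f : A" for js
 using cl assms(1) by (rule partial_derivs_closed)
 thus ?thesis
 using assms(2,3) unfolding tempgr_def by blast
qed

lemma tempgr_differentiable: "a : tempgr ==> a differentiable at x"
 unfolding tempgr_def using partial_derivs_Nil by (metis (mono_tags, lifting) mem_Collect_eq)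

lemma tempgr_bound:
 assumes "a : tempgr" shows "EX N C. ALL x. norm (a x) <= C * (1 + norm x) ^ N"
proof -
 have "EX N C. ALL x. norm (partial_derivs [] a x) <= C * (1 + norm x) ^ N"
 using assms unfolding tempgr_def by blast
 thus ?thesis by simp
qed

lemma tempgr_partial_deriv:
 assumes "f : tempgr" shows "partial_deriv i f : tempgr"
proof -
 have "partial_derivs js (partial_deriv i f) = partial_derivs (js @ [i]) f" for js
 by (simp add: partial_derivs_append)
 thus ?thesis using assms unfolding tempgr_def by auto
qed

lemma tempgr_add:
 assumes "f : tempgr" "g : tempgr"
 shows "(%x. f x + g x) : tempgr"
proof (rule tempgr_coinduct[where A="{%x. f x + g x |f g. f : tempgr & g : tempgr}"], goal_cases)
 case (3 F)
 then obtain f g where F: "F = (%x. f x + g x)" and fg: "f : tempgr" "g : tempgr" by blast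
 obtain N C N' C' where b: "!!x. norm (f x) <= C * (1 + norm x) ^ N" "!!x. norm (g x) <= C' * (1 + norm x) ^ N'"
 using tempgr_bound fg by metis
 have "norm (f x + g x) <= (\<bar>C\<bar> + \<bar>C'\<bar>) * (1 + norm x) ^ (N + N')" for x
 proof -
 have "norm (f x) <= \<bar>C\<bar> * (1 + norm x) ^ (N + N')"
 by (rule order_trans[OF b(1)]) (intro mult_mono power_increasing, auto)
 moreover have "norm (g x) <= \<bar>C'\<bar> * (1 + norm x) ^ (N + N')"
 by (rule order_trans[OF b(2)]) (intro mult_mono power_increasing, auto)
 ultimately show ?thesis
 using norm_triangle_ineq[of "f x" "g x"] by (simp add: distrib_right)
 qed
 thus ?case unfolding F by blast
next
 case (4 F i)
 then obtain f g where F: "F = (%x. f x + g x)" and fg: "f : tempgr" "g : tempgr" by blast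
 have "partial_deriv i F = (%x. partial_deriv i f x + partial_deriv i g x)"
 unfolding F using fg by (intro ext partial_deriv_add tempgr_differentiable)
 thus ?case using fg tempgr_partial_deriv by blast
qed (use assms in \<open>auto intro: differentiable_add tempgr_differentiable\<close>)

text \<open>By Leibniz' rule a derivative of a product is a sum of products, so closing products
  under sums gives a set invariant under partial derivatives.\<close>

inductive_set prod_span :: "(real^'n => complex) set => (real^'n => complex) set => (real^'n => complex) set"
 for A B where
 prod: "a : A ==> b : B ==> (%x. a x * b x) : prod_span A B"
| add: "f : prod_span A B ==> g : prod_span A B ==> (%x. f x + g x) : prod_span A B"

lemma prod_span_differentiable:
 assumes "f : prod_span A B" "!!a x. a : A ==> a differentiable at x" "!!b x. b : B ==> b differentiable at x"
 shows "f differentiable at x"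
 using assms by (induction) (auto intro: differentiable_add differentiable_mult)

lemma prod_span_partial_deriv:
 assumes "f : prod_span A B" and d: "!!a x. a : A ==> a differentiable at x" "!!b x. b : B ==> b differentiable at x"
 and "!!a i. a : A ==> partial_deriv i a : A" "!!b i. b : B ==> partial_deriv i b : B"
 shows "partial_deriv i f : prod_span A B"
 using assms(1)
proof induction
 case (prod a b)
 have "partial_deriv i (%x. a x * b x) = (%x. partial_deriv i a x * b x + a x * partial_deriv i b x)"
 using prod d by (intro ext partial_deriv_mult)
 thus ?case
 by (simp only:) (intro prod_span.add prod_span.prod prod assms(4,5))
next
 case (add f g)
 have "partial_deriv i (%x. f x + g x) = (%x. partial_deriv i f x + partial_deriv i g x)"
 using prod_span_differentiable[OF add(1) d] prod_span_differentiable[OF add(2) d]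
 by (intro ext partial_deriv_add)
 thus ?case
 by (simp only:) (intro prod_span.add add)
qed

lemma schw_mult:
 assumes a: "a : tempgr" and f: "f : Schw"
 shows "(%x. a x * f x) : Schw"
proof (rule schw_coinduct[where A="prod_span tempgr schwartz_space"])
 show "(%x. a x * f x) : prod_span tempgr schwartz_space"
 using assms by (rule prod_span.prod)
 fix f N assume "f : prod_span tempgr schwartz_space"
 thus "EX C. ALL x. (1 + norm x) ^ N * norm (f x) <= C"
 proof induction
 case (prod a f)
 obtain M C where C: "!!x. norm (a x) <= C * (1 + norm x) ^ M"
 using tempgr_bound prod by metis
 obtain D where D: "!!x. (1 + norm x) ^ (N + M) * norm (f x) <= D" "D > 0"
 using schw_bound prod by metis
 have "(1 + norm x) ^ N * norm (a x * f x) <= \<bar>C\<bar> * D" for x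
 proof -
 have "(1 + norm x) ^ N * norm (a x * f x) <= (1 + norm x) ^ N * ((\<bar>C\<bar> * (1 + norm x) ^ M) * norm (f x))"
 unfolding norm_mult
 by (intro mult_left_mono mult_right_mono order_trans[OF C]) auto
 also have "... = \<bar>C\<bar> * ((1 + norm x) ^ (N + M) * norm (f x))"
 by (simp add: power_add mult_ac)
 also have "... <= \<bar>C\<bar> * D" by (intro mult_left_mono D) auto
 finally show ?thesis .
 qed
 thus ?case by blast
 next
 case (add f g)
 then obtain C D where "!!x. (1 + norm x) ^ N * norm (f x) <= C" "!!x. (1 + norm x) ^ N * norm (g x) <= D"
 by metis
 hence "(1 + norm x) ^ N * norm (f x + g x) <= C + D" for x
 by (smt (verit) distrib_left mult_left_mono norm_ge_zero norm_triangle_ineq zero_le_power)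
 thus ?case by blast
 qed
qed (auto intro: prod_span_differentiable prod_span_partial_deriv tempgr_differentiable
 schw_differentiable tempgr_partial_deriv schw_partial_deriv)

lemma tempgr_mult:
 assumes a: "a : tempgr" and f: "f : tempgr"
 shows "(%x. a x * f x) : tempgr"
proof (rule tempgr_coinduct[where A="prod_span tempgr tempgr"])
 show "(%x. a x * f x) : prod_span tempgr tempgr"
 using assms by (rule prod_span.prod)
 fix f :: "real^'n => complex" assume "f : prod_span tempgr tempgr"
 thus "EX N C. ALL x. norm (f x) <= C * (1 + norm x) ^ N"
 proof induction
 case (prod f g)
 obtain N C N' C' where b: "!!x. norm (f x) <= C * (1 + norm x) ^ N" "!!x. norm (g x) <= C' * (1 + norm x) ^ N'"
 using tempgr_bound prod by metis
 have "norm (f x * g x) <= (C * C') * (1 + norm x) ^ (N + N')" for x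
 proof -
 have "norm (f x * g x) <= (C * (1 + norm x) ^ N) * (C' * (1 + norm x) ^ N')"
 unfolding norm_mult by (intro mult_mono b order_trans[OF norm_ge_zero b(1)]) auto
 thus ?thesis by (simp add: power_add mult_ac)
 qed
 thus ?case by blast
 next
 case (add f g)
 then obtain N C N' C' where b: "!!x. norm (f x) <= C * (1 + norm x) ^ N" "!!x. norm (g x) <= C' * (1 + norm x) ^ N'"
 by metis
 have "norm (f x + g x) <= (\<bar>C\<bar> + \<bar>C'\<bar>) * (1 + norm x) ^ (N + N')" for x
 proof -
 have "norm (f x) <= \<bar>C\<bar> * (1 + norm x) ^ (N + N')"
 by (rule order_trans[OF b(1)]) (intro mult_mono power_increasing, auto)
 moreover have "norm (g x) <= \<bar>C'\<bar> * (1 + norm x) ^ (N + N')"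
 by (rule order_trans[OF b(2)]) (intro mult_mono power_increasing, auto)
 ultimately show ?thesis
 using norm_triangle_ineq[of "f x" "g x"] by (simp add: distrib_right)
 qed
 thus ?case by blast
 qed
qed (auto intro: prod_span_differentiable prod_span_partial_deriv tempgr_differentiable
 tempgr_partial_deriv)

lemma tempgr_const: "(%x. c) : tempgr"
proof (rule tempgr_coinduct[where A="range (%c x. c)"])
 fix f :: "real^'n => complex" and i assume "f : range (%c x. c)"
 then obtain c where f: "f = (%x. c)" by blast
 show "EX N C. ALL x. norm (f x) <= C * (1 + norm x) ^ N"
 unfolding f by (rule exI[of _ 0], rule exI[of _ "norm c"]) simp
 show "partial_deriv i f : range (%c x. c)"
 unfolding f using partial_deriv_const[of i c] by (auto simp: fun_eq_iff)
qed auto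

lemma tempgr_inner:
 fixes y :: "real^'n" shows "(%x. cx (y \<bullet> x)) : tempgr"
proof (rule tempgr_coinduct[where A="insert (%x. cx (y \<bullet> x)) tempgr"])
 have hd: "((%x. cx (y \<bullet> x)) has_derivative (%x. cx (y \<bullet> x))) (at x)" for x
 by (auto intro!: derivative_eq_intros)
 fix f :: "real^'n => complex" and i x assume f: "f : insert (%x. cx (y \<bullet> x)) tempgr"
 show "f differentiable at x"
 using f hd tempgr_differentiable by (auto simp: differentiable_def)
 have "norm (cx (y \<bullet> x)) <= norm y * (1 + norm x) ^ 1" for x
 using Cauchy_Schwarz_ineq2[of y x] by (simp add: distrib_left add_increasing)
 thus "EX N C. ALL x. norm (f x) <= C * (1 + norm x) ^ N"
 using f tempgr_bound by blast
 have "partial_deriv i (%x. cx (y \<bullet> x)) = (%x. cx (y \<bullet> axis i 1))"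
 by (intro ext partial_deriv_eq(1) hd)
 thus "partial_deriv i f : insert (%x. cx (y \<bullet> x)) tempgr"
 using f tempgr_const[of "cx (y \<bullet> axis i 1)"] tempgr_partial_deriv by auto
qed auto

lemma has_derivative_cis_inner:
 fixes y :: "'a::real_inner"
 shows "((%x. cis (y \<bullet> x)) has_derivative (%h. (\<i> * cx (y \<bullet> h)) * cis (y \<bullet> x))) (at x)"
proof -
 have "((%x. \<i> * cx (y \<bullet> x)) has_derivative (%h. \<i> * cx (y \<bullet> h))) (at x)"
 by (auto intro!: derivative_eq_intros)
 moreover have "(exp has_derivative (*) (exp (\<i> * cx (y \<bullet> x)))) (at (\<i> * cx (y \<bullet> x)))"
 using DERIV_exp unfolding has_field_derivative_def by blast
 ultimately show ?thesis
 unfolding cis_conv_exp by (rule has_derivative_compose[THEN has_derivative_eq_rhs]) (simp add: fun_eq_iff)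
qed

lemma partial_deriv_cis:
 "partial_deriv i (%x. cis (y \<bullet> x)) x = (\<i> * cx (y $ i)) * cis (y \<bullet> x)"
 by (subst partial_deriv_eq(1)[OF has_derivative_cis_inner]) (simp add: cart_eq_inner_axis)

lemma tempgr_cis:
 fixes y :: "real^'n" shows "(%x. cis (y \<bullet> x)) : tempgr"
proof (rule tempgr_coinduct[where A="range (%c x. c * cis (y \<bullet> x))"])
 show "(%x. cis (y \<bullet> x)) : range (%c x. c * cis (y \<bullet> x))"
 by (rule range_eqI[of _ _ 1]) simp
 have d: "(%x. cis (y \<bullet> x)) differentiable at x" for x
 using has_derivative_cis_inner unfolding differentiable_def by blast
 fix f :: "real^'n => complex" and i x assume "f : range (%c x. c * cis (y \<bullet> x))"
 then obtain c where f: "f = (%x. c * cis (y \<bullet> x))" by blast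
 show "f differentiable at x"
 unfolding f by (intro differentiable_mult differentiable_const d)
 show "EX N C. ALL x. norm (f x) <= C * (1 + norm x) ^ N"
 unfolding f by (rule exI[of _ 0], rule exI[of _ "norm c"]) (simp add: norm_mult)
 show "partial_deriv i f : range (%c x. c * cis (y \<bullet> x))"
 unfolding f partial_deriv_cmult[OF d] partial_deriv_cis
 by (rule range_eqI[of _ _ "c * (\<i> * cx (y $ i))"])
 (auto simp: fun_eq_iff partial_deriv_cmult[OF d] partial_deriv_cis mult_ac)
qed

section \<open>Closure properties of the Schwartz space\<close>

lemma schw_tempgr: "f : Schw ==> f : tempgr"
 by (rule tempgr_coinduct[where A=schwartz_space])
 (use schw_bound'[of _ 0] in \<open>auto intro!: schw_differentiable schw_partial_deriv exI[of _ "0::nat"] simp: mult.commute\<close>)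

lemma schw_cmult: "f : Schw ==> (%x. c * f x) : Schw"
 by (rule schw_mult[OF tempgr_const])

lemma schw_add:
 assumes "f : Schw" "g : Schw"
 shows "(%x. f x + g x) : Schw"
proof (rule schw_coinduct[where A="{%x. f x + g x |f g. f : Schw & g : Schw}"], goal_cases)
 case (3 F N)
 then obtain f g where F: "F = (%x. f x + g x)" and fg: "f : Schw" "g : Schw" by blast
 obtain C D where "!!x. (1 + norm x) ^ N * norm (f x) <= C" "!!x. (1 + norm x) ^ N * norm (g x) <= D"
 using schw_bound' fg by metis
 hence "(1 + norm x) ^ N * norm (f x + g x) <= C + D" for x
 by (smt (verit) distrib_left mult_left_mono norm_ge_zero norm_triangle_ineq zero_le_power)
 thus ?case unfolding F by blast
next
 case (4 F i)
 then obtain f g where F: "F = (%x. f x + g x)" and fg: "f : Schw" "g : Schw" by blast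
 have "partial_deriv i F = (%x. partial_deriv i f x + partial_deriv i g x)"
 unfolding F using fg by (intro ext partial_deriv_add schw_differentiable)
 thus ?case using fg schw_partial_deriv by blast
qed (use assms in \<open>auto intro: differentiable_add schw_differentiable\<close>)

lemma schw_diff:
 assumes "f : Schw" "g : Schw"
 shows "(%x. f x - g x) : Schw"
 using schw_add[OF assms(1) schw_cmult[OF assms(2), of "-1"]] by simp

lemma schw_zero: "(%x. 0) : Schw"
proof (rule schw_coinduct[where A="{%x. 0}"], goal_cases)
 case (4 f i)
 hence "partial_deriv i f = (%x. 0)" by (intro ext) (simp add: partial_deriv_const)
 thus ?case by simp
qed auto

lemma schw_sum:
 assumes "!!i. i : I ==> f i : Schw"
 shows "(%x. \<Sum>i\<in>I. f i x) : Schw"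
 using assms by (induction I rule: infinite_finite_induct) (auto intro: schw_add schw_zero)

lemma schw_cnj:
 assumes "f : Schw"
 shows "(%x. cnj (f x)) : Schw"
proof (rule schw_coinduct[where A="{%x. cnj (f x) |f. f : Schw}"], goal_cases)
 case (4 F i)
 then obtain f where F: "F = (%x. cnj (f x))" and f: "f : Schw" by blast
 have "partial_deriv i F = (%x. cnj (partial_deriv i f x))"
 unfolding F using f by (intro ext partial_deriv_cnj schw_differentiable)
 thus ?case using f schw_partial_deriv by blast
qed (use assms schw_bound' in \<open>auto intro: differentiable_cnj_at schw_differentiable\<close>)

text \<open>Peetre's inequality: the weight is submultiplicative, so translations cost a polynomial
  factor only.\<close>

lemma weight_translate: "(1 + norm (x + a :: 'a::real_normed_vector)) ^ N <= (1 + norm x) ^ N * (1 + norm a) ^ N"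
proof -
 have "1 + norm (x + a) <= (1 + norm x) * (1 + norm a)"
 proof -
 have "(1 + norm x) * (1 + norm a) = 1 + norm x + norm a + norm x * norm a" by (simp add: algebra_simps)
 thus ?thesis
 using norm_triangle_ineq[of x a] mult_nonneg_nonneg[OF norm_ge_zero[of x] norm_ge_zero[of a]] by linarith
 qed
 hence "(1 + norm (x + a)) ^ N <= ((1 + norm x) * (1 + norm a)) ^ N"
 by (intro power_mono) auto
 thus ?thesis by (simp add: power_mult_distrib)
qed

lemma schw_translate:
 assumes "f : Schw"
 shows "(%x. f (x - a)) : Schw"
proof (rule schw_coinduct[where A="{%x. f (x - a) |f. f : Schw}"], goal_cases)
 case (3 F N)
 then obtain f where F: "F = (%x. f (x - a))" and f: "f : Schw" by blast
 obtain C where C: "!!x. (1 + norm x) ^ N * norm (f x) <= C"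
 using schw_bound' f by metis
 have "(1 + norm x) ^ N * norm (f (x - a)) <= (1 + norm a) ^ N * C" for x
 proof -
 have "(1 + norm x) ^ N * norm (f (x - a)) <= ((1 + norm (x - a)) ^ N * (1 + norm a) ^ N) * norm (f (x - a))"
 using weight_translate[of "x - a" a N] by (intro mult_right_mono) auto
 also have "... = (1 + norm a) ^ N * ((1 + norm (x - a)) ^ N * norm (f (x - a)))" by simp
 also have "... <= (1 + norm a) ^ N * C" by (intro mult_left_mono C) auto
 finally show ?thesis .
 qed
 thus ?case unfolding F by blast
next
 case (4 F i)
 then obtain f where F: "F = (%x. f (x - a))" and f: "f : Schw" by blast
 have "partial_deriv i F = (%x. partial_deriv i f (x - a))"
 unfolding F by (intro ext partial_deriv_translate)
 thus ?case using f schw_partial_deriv by blast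
qed (use assms in \<open>auto intro: differentiable_translate_at schw_differentiable\<close>)

lemma schw_integrable:
 assumes "f : Schw" shows "L1 f"
proof -
 obtain C where "!!x. (1 + norm x) ^ (2 * DIM(real^'a)) * norm (f x) <= C"
 using schw_bound assms by metis
 thus ?thesis
 using assms by (intro integrable_weight_bound[of f C]) (auto simp: mult.commute)
qed

lemma schw_bounded: "f : Schw ==> \<exists>C>0. ALL x. norm (f x) <= C"
 using schw_bound[of f 0] by (metis mult_1 power_0)

lemma power_exp_bounded: "EX C. ALL u::real. u >= 0 --> (1 + u) ^ N * exp (- u\<^sup>2 / 2) <= C"
proof -
 have "(1 + u) ^ N * exp (- u\<^sup>2 / 2) <= fact N * exp 2" if u: "u >= 0" for u :: real
 proof -
 have "(1 + u) ^ N / fact N <= exp (1 + u)"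
 proof -
 have s: "(%n. (1 + u) ^ n /\<^sub>R fact n) sums exp (1 + u)" by (rule exp_converges)
 have "sum (%n. (1 + u) ^ n /\<^sub>R fact n) {N} <= exp (1 + u)"
 unfolding sums_unique[OF s] using u by (intro sum_le_suminf sums_summable[OF s]) auto
 thus ?thesis by (simp add: divide_inverse mult.commute)
 qed
 hence "(1 + u) ^ N <= fact N * exp (1 + u)"
 by (simp add: pos_divide_le_eq mult.commute)
 hence "(1 + u) ^ N * exp (- u\<^sup>2 / 2) <= fact N * exp (1 + u) * exp (- u\<^sup>2 / 2)"
 by (intro mult_right_mono) auto
 also have "... = fact N * exp (1 + u - u\<^sup>2 / 2)"
 by (simp add: exp_add[symmetric] exp_diff exp_minus field_simps)
 also have "... <= fact N * exp 2"
 proof -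
 have "0 <= (u - 1)^2" by simp
 hence "1 + u - u\<^sup>2 / 2 <= 2" unfolding power2_diff by (simp add: field_simps)
 thus ?thesis by simp
 qed
 finally show ?thesis .
 qed
 thus ?thesis by blast
qed

lemma has_derivative_gauss: "(gauss has_derivative (%h. - cx (x \<bullet> h) * gauss x)) (at x)"
proof -
 have "((%x. cx (exp (- (x \<bullet> x) / 2))) has_derivative (%h. - cx (x \<bullet> h) * cx (exp (- (x \<bullet> x) / 2)))) (at x)"
 by (auto intro!: derivative_eq_intros simp: inner_commute mult_ac)
 thus ?thesis by (simp add: gauss_def[abs_def] power2_norm_eq_inner)
qed

text \<open>A derivative of a multiple of the Gaussian is again one, with a multiplier of tempered
  growth; the exponential absorbs every such multiplier.\<close>

lemma schw_gauss: "gauss : Schw"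
proof (rule schw_coinduct[where A="{%x. a x * gauss x |a. a : tempgr}"], goal_cases)
 case 1
 thus ?case using tempgr_const[of 1] by force
next
 case (2 F x)
 have "gauss differentiable at x"
 using has_derivative_gauss unfolding differentiable_def by blast
 thus ?case using 2 tempgr_differentiable by (auto intro!: differentiable_mult)
next
 case (3 F N)
 then obtain a where F: "F = (%x. a x * gauss x)" and a: "a : tempgr" by blast
 obtain M C where C: "!!x. norm (a x) <= C * (1 + norm x) ^ M"
 using tempgr_bound a by metis
 obtain D where D: "!!u::real. u >= 0 ==> (1 + u) ^ (N + M) * exp (- u\<^sup>2 / 2) <= D"
 using power_exp_bounded by metis
 have "(1 + norm x) ^ N * norm (a x * gauss x) <= \<bar>C\<bar> * D" for x
 proof -
 have "(1 + norm x) ^ N * norm (a x * gauss x) <= (1 + norm x) ^ N * ((\<bar>C\<bar> * (1 + norm x) ^ M) * norm (gauss x))"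
 unfolding norm_mult
 by (intro mult_left_mono mult_right_mono order_trans[OF C]) auto
 also have "... = \<bar>C\<bar> * ((1 + norm x) ^ (N + M) * exp (- (norm x)\<^sup>2 / 2))"
 by (simp add: power_add mult_ac gauss_def)
 also have "... <= \<bar>C\<bar> * D" by (intro mult_left_mono D) auto
 finally show ?thesis .
 qed
 thus ?case unfolding F by blast
next
 case (4 F i)
 then obtain a where F: "F = (%x. a x * gauss x)" and a: "a : tempgr" by blast
 have d: "gauss differentiable at x" for x :: "real^'a"
 using has_derivative_gauss unfolding differentiable_def by blast
 have pg: "partial_deriv i gauss x = - cx (axis i 1 \<bullet> x) * gauss x" for x
 by (simp add: partial_deriv_eq(1)[OF has_derivative_gauss] inner_commute)
 have "partial_deriv i F = (%x. (partial_deriv i a x + (- 1) * (a x * cx (axis i 1 \<bullet> x))) * gauss x)"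
 unfolding F by (intro ext, subst partial_deriv_mult[OF tempgr_differentiable[OF a] d])
 (simp add: pg algebra_simps)
 moreover have "(%x. partial_deriv i a x + (- 1) * (a x * cx (axis i 1 \<bullet> x))) : tempgr"
 by (intro tempgr_add tempgr_partial_deriv[OF a] tempgr_mult[OF tempgr_const]
 tempgr_mult[OF a] tempgr_inner)
 ultimately show ?case by (intro CollectI exI conjI)
qed

section \<open>The Fourier transform of Schwartz functions\<close>

lemma continuous_cis [continuous_intros]: "continuous_on A f ==> continuous_on A (%x. cis (f x))"
 unfolding cis_conv_exp by (intro continuous_intros)

lemma borel_cis [measurable]: "cis : BM"
 by (intro borel_cont continuous_intros)

lemma continuous_on_integral_dominated:
 fixes f :: "'a::metric_space => 'b => complex"
 assumes cont: "!!s. continuous_on UNIV (%z. f z s)" and [measurable]: "!!z. f z : borel_measurable M"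
 and bnd: "!!z s. norm (f z s) <= w s" and w: "integrable M w"
 shows "continuous_on UNIV (%z. \<integral>s. f z s \<partial>M)"
proof (rule continuous_at_imp_continuous_on, safe)
 fix z
 show "isCont (%z. \<integral>s. f z s \<partial>M) z"
 unfolding continuous_at_sequentially comp_def
 proof safe
 fix X assume X: "X ----> z"
 show "(%n. \<integral>s. f (X n) s \<partial>M) ----> (\<integral>s. f z s \<partial>M)"
 proof (rule integral_dominated_convergence[where w=w])
 show "AE s in M. (%n. f (X n) s) ----> f z s"
 using continuous_on_tendsto_compose[OF cont X] by auto
 qed (use bnd w in auto)
 qed
qed

text \<open>Sign plus and no constant, which is the shape in which the coefficients
  \<open>dual_coef\<close> occur; \<open>fourier\<close> and \<open>inv_fourier\<close> differ by a
  constant and, for the first, a reflection.\<close>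

definition ft :: "(real^'n => complex) => real^'n => complex" where
 "ft f y = (LBINT s. f s * cis (y \<bullet> s))"

lemma integrable_mult_cis:
 assumes "L1 f"
 shows "L1 (%s. f s * cis (y \<bullet> s))"
proof (rule integrable_bound[OF assms])
 have [measurable]: "f : BM" using borel_measurable_integrable[OF assms] by simp
 show "(%s. f s * cis (y \<bullet> s)) : LM" by measurable
qed (simp add: norm_mult)

lemma ft_bound: "norm (ft f y) <= (LBINT s. norm (f s))"
 unfolding ft_def by (rule order_trans[OF integral_norm_bound]) (simp add: norm_mult)

lemma ft_cmult: "ft (%s. c * f s) y = c * ft f y"
 by (simp add: ft_def mult.assoc)

lemma schw_coord_mult:
 assumes "f : Schw"
 shows "(%s. cx (s $ i) * f s) : Schw"
 using schw_mult[OF tempgr_inner[of "axis i 1"] assms] by (simp add: inner_commute cart_eq_inner_axis)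

text \<open>Integration by parts: the derivative of \<open>cis (y \<bullet> s) * f s\<close> along a
  coordinate has integral zero.\<close>

lemma ft_deriv_mult:
 assumes f: "f : Schw"
 shows "ft (partial_deriv i f) y = - \<i> * cx (y $ i) * ft f y"
proof -
 let ?F = "%s. cis (y \<bullet> s) * f s"
 have F: "?F : Schw" by (rule schw_mult[OF tempgr_cis f])
 have pd: "partial_deriv i ?F s = \<i> * cx (y $ i) * (f s * cis (y \<bullet> s)) + partial_deriv i f s * cis (y \<bullet> s)" for s
 by (subst partial_deriv_mult[OF tempgr_differentiable[OF tempgr_cis] schw_differentiable[OF f]])
 (simp add: partial_deriv_cis algebra_simps)
 have "(LBINT s. partial_deriv i ?F s) = 0"
 by (rule integral_directional_derivative[where F="?F" and v="axis i 1"])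
 (intro schw_integrable F schw_partial_deriv schw_continuous
 partial_deriv_has_vector_derivative schw_differentiable)+
 hence "\<i> * cx (y $ i) * ft f y + ft (partial_deriv i f) y = 0"
 unfolding pd ft_def
 by (subst (asm) Bochner_Integration.integral_add)
 (simp_all add: integrable_mult_cis[OF schw_integrable[OF f]]
 integrable_mult_cis[OF schw_integrable[OF schw_partial_deriv[OF f]]])
 thus ?thesis by (simp add: add_eq_0_iff)
qed

lemma ft_deriv_mult_power:
 assumes f: "f : Schw"
 shows "norm (ft (partial_derivs (replicate m i) f) y) = \<bar>y $ i\<bar> ^ m * norm (ft f y)"
 using ft_deriv_mult[OF schw_partial_derivs[OF f]]
 by (induction m) (simp_all add: norm_mult)

text \<open>Reduces a radial weight to pure powers of single coordinates, so that only the repeated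
  derivatives \<open>replicate N i\<close> have to be estimated.\<close>

lemma norm_power_le_coords:
 fixes y :: "real^'n"
 shows "(1 + norm y) ^ N <= real (CARD('n) + 1) ^ N * (1 + (\<Sum>i\<in>UNIV. \<bar>y $ i\<bar> ^ N))"
proof -
 define m where "m = Max (insert 1 (range (%i. \<bar>y $ i\<bar>)))"
 have m: "1 <= m" "!!i. \<bar>y $ i\<bar> <= m" unfolding m_def by (rule Max_ge; simp)+
 have "norm y <= (\<Sum>i\<in>UNIV. \<bar>y $ i\<bar>)" by (rule norm_le_l1_cart)
 also have "... <= real CARD('n) * m" using sum_bounded_above[of UNIV "%i. \<bar>y $ i\<bar>" m] m by simp
 finally have "1 + norm y <= real (CARD('n) + 1) * m" using m by (simp add: distrib_right)
 hence "(1 + norm y) ^ N <= (real (CARD('n) + 1) * m) ^ N" by (intro power_mono) auto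
 also have "... = real (CARD('n) + 1) ^ N * m ^ N" by (rule power_mult_distrib)
 also have "m ^ N <= 1 + (\<Sum>i\<in>UNIV. \<bar>y $ i\<bar> ^ N)"
 proof -
 have "m : insert 1 (range (%i. \<bar>y $ i\<bar>))" unfolding m_def by (intro Max_in) auto
 then consider "m = 1" | i where "m = \<bar>y $ i\<bar>" by blast
 thus ?thesis
 proof cases
 case 2
 have "\<bar>y $ i\<bar> ^ N <= (\<Sum>i\<in>UNIV. \<bar>y $ i\<bar> ^ N)" by (rule member_le_sum) auto
 thus ?thesis using 2 by simp
 qed (simp add: sum_nonneg)
 qed
 finally show ?thesis by (simp add: mult_left_mono)
qed

text \<open>The constant depends on \<open>f\<close> only through L1 norms of derivatives. This
  uniformity is what \<open>conv_span_ft_decay\<close> exploits for families of functions with a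
  parameter.\<close>

lemma ft_weighted_bound:
 assumes f: "f : Schw"
 and C: "!!js. length js <= N ==> (LBINT s. norm (partial_derivs js f s)) <= C"
 shows "(1 + norm y) ^ N * norm (ft (f :: real^'n => complex) y) <= real (CARD('n) + 1) ^ N * ((1 + real CARD('n)) * C)"
proof -
 have "(1 + norm y) ^ N * norm (ft f y) <= (real (CARD('n) + 1) ^ N * (1 + (\<Sum>i\<in>UNIV. \<bar>y $ i\<bar> ^ N))) * norm (ft f y)"
 by (intro mult_right_mono norm_power_le_coords) auto
 also have "... = real (CARD('n) + 1) ^ N * (norm (ft f y) + (\<Sum>i\<in>UNIV. \<bar>y $ i\<bar> ^ N * norm (ft f y)))"
 by (simp add: distrib_right sum_distrib_right)
 also have "... <= real (CARD('n) + 1) ^ N * (C + (\<Sum>i\<in>(UNIV::'n set). C))"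
 proof (intro mult_left_mono add_mono sum_mono)
 show "norm (ft f y) <= C" using order_trans[OF ft_bound C[of "[]"]] by simp
 fix i
 have "\<bar>y $ i\<bar> ^ N * norm (ft f y) = norm (ft (partial_derivs (replicate N i) f) y)"
 by (simp add: ft_deriv_mult_power[OF f])
 also have "... <= C" using ft_bound C[of "replicate N i"] order_trans by fastforce
 finally show "\<bar>y $ i\<bar> ^ N * norm (ft f y) <= C" .
 qed auto
 also have "... = real (CARD('n) + 1) ^ N * ((1 + real CARD('n)) * C)"
 by (simp add: distrib_right)
 finally show ?thesis .
qed

lemma finite_lists_length_le': "finite {js :: 'n::finite list. length js <= N}"
 using finite_lists_length_le[of "UNIV :: 'n set" N] by simp

lemma cis_remainder: "norm (cis a - 1 - \<i> * cx a) <= a\<^sup>2"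
proof -
 have "norm (iexp a - (\<Sum>k\<le>1. (\<i> * cx a)^k / fact k)) <= \<bar>a\<bar>^2 / fact 2"
 using iexp_approx1[of a 1] by (simp add: numeral_2_eq_2)
 also have "... <= a\<^sup>2" by simp
 finally show ?thesis by (simp add: cis_conv_exp diff_diff_eq)
qed

text \<open>The Schwartz space is defined with total differentiability, so a Frechet derivative is
  wanted and not just partial ones. The remainder of \<open>cis\<close> is quadratic, and
  \<open>f s\<close> times the square of \<open>norm s\<close> is integrable.\<close>

lemma ft_has_derivative:
 assumes f: "f : Schw"
 shows "(ft f has_derivative (%h. LBINT s. f s * (\<i> * cx (h \<bullet> s) * cis (y \<bullet> s)))) (at y)"
proof -
 let ?D = "%h. LBINT s. f s * (\<i> * cx (h \<bullet> s) * cis (y \<bullet> s))"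
 have i0: "L1 (%s. f s * cis (y \<bullet> s))" for y
 by (intro integrable_mult_cis schw_integrable f)
 have i1: "L1 (%s. f s * (\<i> * cx (h \<bullet> s) * cis (y \<bullet> s)))" for h
 using integrable_mult_right[OF integrable_mult_cis[OF schw_integrable[OF schw_mult[OF tempgr_inner[of h] f]], of y], of \<i>]
 by (simp add: mult_ac)
 obtain C where C: "!!s. (1 + norm s) ^ (2 * DIM(real^'a) + 2) * norm (f s) <= C"
 using schw_bound f by metis
 have i2: "L1 (%s. norm (f s) * (norm s)^2)"
 proof (rule integrable_weight_bound[where C=C])
 show "norm (norm (f s) * (norm s)^2) * (1 + norm s) ^ (2 * DIM(real^'a)) <= C" for s
 proof -
 have "norm (norm (f s) * (norm s)^2) * (1 + norm s) ^ (2 * DIM(real^'a)) <= norm (f s) * (1 + norm s)^2 * (1 + norm s) ^ (2 * DIM(real^'a))"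
 by (auto intro!: mult_right_mono mult_left_mono power_mono simp: abs_mult)
 also have "... = (1 + norm s) ^ (2 * DIM(real^'a) + 2) * norm (f s)"
 by (simp add: power_add power2_eq_square mult_ac)
 finally show ?thesis using C[of s] by linarith
 qed
 show "(%s. norm (f s) * (norm s)^2) : BM"
 using f by measurable
 qed
 define A where "A = (LBINT s. norm (f s) * (norm s)^2)"
 have A0: "A >= 0" unfolding A_def by (intro integral_nonneg_AE) auto
 have lin: "linear ?D"
 proof (rule linearI)
 show "?D (a + b) = ?D a + ?D b" for a b
 by (subst Bochner_Integration.integral_add[OF i1[of a] i1[of b], symmetric]) (simp add: inner_add_left algebra_simps)
 show "?D (r *r b) = r *r ?D b" for r b
 by (subst integral_scaleR_right[symmetric]) (simp add: scaleR_conv_of_real[where ?'a=complex] mult_ac)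
 qed
 have est: "norm (ft f (y + h) - ft f y - ?D h) <= A * (norm h)^2" for h
 proof -
 have "ft f (y + h) - ft f y - ?D h = (LBINT s. f s * cis (y \<bullet> s) * (cis (h \<bullet> s) - 1 - \<i> * cx (h \<bullet> s)))"
 unfolding ft_def
 by (subst Bochner_Integration.integral_diff[symmetric], rule i0, rule i0,
 subst Bochner_Integration.integral_diff[symmetric], intro Bochner_Integration.integrable_diff i0, rule i1)
 (simp add: inner_add_left cis_mult[symmetric] algebra_simps)
 also have "norm ... <= (LBINT s. (norm (f s) * (norm s)^2) * (norm h)^2)"
 proof (rule Bochner_Integration.integral_norm_bound_integral)
 show "L1 (%s. f s * cis (y \<bullet> s) * (cis (h \<bullet> s) - 1 - \<i> * cx (h \<bullet> s)))"
 using Bochner_Integration.integrable_diff[OF Bochner_Integration.integrable_diff[OF i0[of "y + h"] i0[of y]] i1[of h]]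
 by (simp add: inner_add_left cis_mult[symmetric] algebra_simps)
 show "L1 (%s. norm (f s) * (norm s)^2 * (norm h)^2)"
 using i2 by simp
 fix s
 have "norm (cis (h \<bullet> s) - 1 - \<i> * cx (h \<bullet> s)) <= (h \<bullet> s)^2" by (rule cis_remainder)
 also have "... <= (norm h * norm s)^2"
 using power_mono[OF Cauchy_Schwarz_ineq2[of h s], of 2] by simp
 finally have "norm (f s) * norm (cis (h \<bullet> s) - 1 - \<i> * cx (h \<bullet> s)) <= norm (f s) * (norm h * norm s)^2"
 by (rule mult_left_mono) auto
 thus "norm (f s * cis (y \<bullet> s) * (cis (h \<bullet> s) - 1 - \<i> * cx (h \<bullet> s))) <= norm (f s) * (norm s)^2 * (norm h)^2"
 by (simp add: norm_mult power_mult_distrib mult_ac)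
 qed
 also have "... = A * (norm h)^2" by (simp add: A_def)
 finally show ?thesis .
 qed
 show ?thesis
 unfolding has_derivative_at
 proof (intro conjI)
 show "bounded_linear ?D" using lin linear_conv_bounded_linear by blast
 have "(%h::real^'a. A * norm h) \<midarrow>0\<rightarrow> A * norm (0::real^'a)"
 by (intro tendsto_intros)
 hence l: "(%h::real^'a. A * norm h) \<midarrow>0\<rightarrow> 0" by simp
 show "(%h. norm (ft f (y + h) - ft f y - ?D h) / norm h) \<midarrow>0\<rightarrow> 0"
 proof (rule tendsto_sandwich[OF _ _ tendsto_const l])
 show "\<forall>\<^sub>F h in at 0. norm (ft f (y + h) - ft f y - ?D h) / norm h <= A * norm h"
 proof (rule always_eventually, rule allI)
 fix h
 show "norm (ft f (y + h) - ft f y - ?D h) / norm h <= A * norm h"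
 using est[of h] A0 by (cases "h = 0") (auto simp: pos_divide_le_eq power2_eq_square mult_ac)
 qed
 qed (auto intro: always_eventually)
 qed
qed

lemma partial_deriv_ft:
 assumes f: "f : Schw"
 shows "partial_deriv i (ft f) = ft (%s. \<i> * (cx (s $ i) * f s))"
proof
 fix y
 show "partial_deriv i (ft f) y = ft (%s. \<i> * (cx (s $ i) * f s)) y"
 by (subst partial_deriv_eq(1)[OF ft_has_derivative[OF f]])
 (simp add: ft_def inner_commute mult_ac flip: cart_eq_inner_axis)
qed

lemma schw_ft:
 assumes "f : Schw" shows "ft f : Schw"
proof (rule schw_coinduct[where A="ft ` schwartz_space"], goal_cases)
 case (2 F x)
 thus ?case using ft_has_derivative unfolding differentiable_def by blast
next
 case (3 F N)
 then obtain f where F: "F = ft f" and f: "f : Schw" by blast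
 let ?S = "{js :: 'a list. length js <= N}"
 have "(LBINT s. norm (partial_derivs js f s)) <= (\<Sum>js\<in>?S. LBINT s. norm (partial_derivs js f s))" if "length js <= N" for js
 using that finite_lists_length_le' by (intro member_le_sum) (auto intro!: integral_nonneg_AE)
 thus ?case unfolding F using ft_weighted_bound[OF f] by blast
next
 case (4 F i)
 then obtain f where F: "F = ft f" and f: "f : Schw" by blast
 show ?case unfolding F partial_deriv_ft[OF f]
 by (intro imageI schw_cmult schw_coord_mult f)
qed (use assms in auto)

lemma gauss_scaled_fourier:
 fixes v :: "real^'n"
 assumes e: "e > 0"
 shows "(LBINT y. gauss (e *r y) * cis (y \<bullet> v))
 = cx ((2 * pi) powr (real CARD('n) / 2) / e ^ CARD('n)) * gauss (v /\<^sub>R e)"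
proof -
 have [measurable]: "gauss : borel_measurable (borel :: (real^'n) measure)"
 using schw_borel schw_gauss .
 have "(LBINT y. gauss y * cis (y \<bullet> (v /\<^sub>R e))) = \<bar>e\<bar> ^ DIM(real^'n) *r (LBINT y. gauss (0 + e *r y) * cis ((0 + e *r y) \<bullet> (v /\<^sub>R e)))"
 using e by (intro lborel_affine_scale) auto
 moreover have "(0 + e *r y) \<bullet> (v /\<^sub>R e) = y \<bullet> v" for y using e by simp
 ultimately have "cx ((2 * pi) powr (real CARD('n) / 2)) * gauss (v /\<^sub>R e)
 = cx (e ^ CARD('n)) * (LBINT y. gauss (e *r y) * cis (y \<bullet> v))"
 using e by (simp only: gauss_fourier) (simp add: scaleR_conv_of_real[of "_ ^ _"])
 thus ?thesis using e by (simp add: field_simps)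
qed

lemma gauss_integral: "(LBINT y. gauss (y::real^'n)) = cx ((2 * pi) powr (real CARD('n) / 2))"
 using gauss_fourier[of "0::real^'n"] by (simp add: gauss_def)

lemma lborel_integrable_scale:
 fixes f :: "'a::euclidean_space => 'b::{banach, second_countable_topology}"
 assumes f: "L1 f" and c: "c ~= 0"
 shows "L1 (%x. f (c *r x))"
proof -
 have [measurable]: "f : BM" using borel_measurable_integrable[OF f] by simp
 have "integrable (density (distr lborel borel (%x. 0 + c *r x)) (%_. ennreal (\<bar>c\<bar> ^ DIM('a)))) f"
 using f by (subst (asm) lborel_affine[OF c, of 0]) simp
 hence "integrable (distr lborel borel (%x. 0 + c *r x)) (%x. \<bar>c\<bar> ^ DIM('a) *r f x)"
 by (subst (asm) integrable_density) auto
 hence "L1 (%x. \<bar>c\<bar> ^ DIM('a) *r f (0 + c *r x))"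
 by (subst (asm) integrable_distr_eq) auto
 hence "L1 (%x. inverse (\<bar>c\<bar> ^ DIM('a)) *r (\<bar>c\<bar> ^ DIM('a) *r f (0 + c *r x)))"
 by (rule integrable_scaleR_right)
 thus ?thesis using c by simp
qed

lemma ft_continuous:
 assumes "L1 f" shows "continuous_on UNIV (ft f)"
proof -
 have [measurable]: "f : BM" using borel_measurable_integrable[OF assms] by simp
 show ?thesis unfolding ft_def[abs_def]
 by (rule continuous_on_integral_dominated[where w="%s. norm (f s)"])
 (use assms in \<open>auto simp: norm_mult intro!: continuous_intros\<close>)
qed

lemma ft_borel: "L1 f ==> ft f : BM"
 by (intro borel_cont ft_continuous)

lemma ft_multiplication:
 assumes f: "L1 f" and w: "L1 w"
 shows "(LBINT y. ft f y * w y) = (LBINT s. f s * ft w s)"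
 and "L1 (%y. ft f y * w y)"
proof -
 have [measurable]: "f : BM" "w : BM" "ft f : BM"
 using f w ft_borel by auto
 let ?h = "%(s, y). f s * (w y * cis (y \<bullet> s))"
 have ih: "integrable (lborel \<Otimes>\<^sub>M lborel) ?h"
 proof (rule lborel_pair.Fubini_integrable)
 show "?h : borel_measurable (lborel \<Otimes>\<^sub>M lborel)" by measurable
 show "L1 (%s. LBINT y. norm (?h (s, y)))" using f by (simp add: norm_mult)
 show "AE s in lborel. L1 (%y. ?h (s, y))"
 using integrable_mult_right[OF integrable_mult_cis[OF w]] by (intro AE_I2) (simp add: inner_commute)
 qed
 have "(LBINT y. ft f y * w y) = (LBINT y. (LBINT s. ?h (s, y)))"
 unfolding ft_def by (subst integral_mult_left_zero[symmetric]) (simp add: mult_ac)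
 also have "... = (LBINT s. (LBINT y. ?h (s, y)))"
 using lborel_pair.Fubini_integral[of "%s y. ?h (s, y)"] ih by (simp add: split_def)
 also have "... = (LBINT s. f s * ft w s)" by (simp add: ft_def inner_commute)
 finally show "(LBINT y. ft f y * w y) = (LBINT s. f s * ft w s)" .
 show "L1 (%y. ft f y * w y)"
 proof (rule integrable_bound[OF integrable_mult_right[OF integrable_norm[OF w], of "LBINT s. norm (f s)"]])
 show "AE y in lborel. norm (ft f y * w y) <= norm ((LBINT s. norm (f s)) * norm (w y))"
 using ft_bound[of f] by (auto simp: norm_mult intro!: mult_right_mono order_trans[OF ft_bound[of f]])
 qed measurable
qed

lemma ft_modulated_gauss:
 assumes e: "e > 0"
 shows "ft (%y. gauss (e *r y) * cis ((- t) \<bullet> y)) s = cx ((2 * pi) powr (real CARD('n) / 2) / e ^ CARD('n)) * gauss ((s - t :: real^'n) /\<^sub>R e)"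
proof -
 have "cis ((- t) \<bullet> y) * cis (s \<bullet> y) = cis (y \<bullet> (s - t))" for y by (simp add: cis_mult inner_diff_right inner_commute)
 thus ?thesis by (simp add: ft_def mult.assoc gauss_scaled_fourier[OF e])
qed

text \<open>Gaussian summation: insert \<open>gauss (\<epsilon> y)\<close>, apply the multiplication formula, and let \<open>\<epsilon> \<rightarrow> 0\<close> on both sides.\<close>

lemma fourier_inversion_schwartz:
 fixes f :: "real^'n => complex"
 assumes f: "f : Schw"
 shows "ft (ft f) (- t) = cx ((2 * pi) powr real CARD('n)) * f t"
proof -
 define c where "c = cx ((2 * pi) powr (real CARD('n) / 2))"
 define e where "e n = 1 / real (Suc n)" for n
 have e: "e n > 0" for n by (simp add: e_def)
 have e0: "e ----> 0" unfolding e_def using LIMSEQ_inverse_real_of_nat by (simp add: inverse_eq_divide)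
 have [measurable]: "gauss : borel_measurable (borel :: (real^'n) measure)" "f : BM" "ft f : BM"
 using schw_borel schw_gauss schw_ft f by auto
 have g1: "norm (gauss v) <= 1" for v :: "real^'n" by (simp add: gauss_def)
 have gc: "isCont gauss v" for v :: "real^'n"
 using schw_continuous[OF schw_gauss[where ?'a='n], of UNIV] by (simp add: continuous_on_eq_continuous_at)
 have fc: "isCont f v" for v
 using schw_continuous[OF f, of UNIV] by (simp add: continuous_on_eq_continuous_at)
 have gi: "L1 (%y::real^'n. gauss (e n *r y))" for n
 using lborel_integrable_scale[OF schw_integrable[OF schw_gauss], of "e n"] e[of n] by auto
 let ?I = "%n. LBINT y. ft f y * cis ((- t) \<bullet> y) * gauss (e n *r y)"
 have "?I ----> (LBINT y. ft f y * cis ((- t) \<bullet> y))"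
 proof (rule integral_dominated_convergence[where w="%y. norm (ft f y)"])
 show "AE y in lborel. (%n. ft f y * cis ((- t) \<bullet> y) * gauss (e n *r y)) ----> ft f y * cis ((- t) \<bullet> y)"
 proof (rule AE_I2)
 fix y :: "real^'n"
 have "(%n. gauss (e n *r y)) ----> gauss (0 *r y)"
 by (intro isCont_tendsto_compose[OF gc] tendsto_intros e0)
 hence "(%n. ft f y * cis ((- t) \<bullet> y) * gauss (e n *r y)) ----> ft f y * cis ((- t) \<bullet> y) * gauss (0 *r y)"
 by (intro tendsto_intros)
 thus "(%n. ft f y * cis ((- t) \<bullet> y) * gauss (e n *r y)) ----> ft f y * cis ((- t) \<bullet> y)"
 by (simp add: gauss_def)
 qed
 show "L1 (%y. norm (ft f y))" using schw_integrable[OF schw_ft[OF f]] by simp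
 show "AE y in lborel. norm (ft f y * cis ((- t) \<bullet> y) * gauss (e n *r y)) <= norm (ft f y)" for n
 using g1 by (auto simp: norm_mult intro!: mult_left_le)
 qed measurable
 moreover have "?I n = c * (LBINT v. f (t + e n *r v) * gauss v)" for n
 proof -
 let ?w = "%y. gauss (e n *r y) * cis ((- t) \<bullet> y)"
 have "?I n = (LBINT y. ft f y * ?w y)" by (simp only: mult.assoc mult.commute[of "cis _"])
 also have "... = (LBINT s. f s * ft ?w s)" by (rule ft_multiplication(1)[OF schw_integrable[OF f] integrable_mult_cis[OF gi]])
 also have "... = (LBINT s. f s * (c / e n ^ CARD('n) * gauss ((s - t) /\<^sub>R e n)))"
 unfolding ft_modulated_gauss[OF e] c_def by simp
 also have "... = \<bar>e n\<bar> ^ DIM(real^'n) *r (LBINT v. f (t + e n *r v) * (c / e n ^ CARD('n) * gauss ((t + e n *r v - t) /\<^sub>R e n)))"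
 by (rule lborel_affine_scale) (measurable, use e[of n] in auto)
 also have "... = c * (LBINT v. f (t + e n *r v) * gauss v)"
 proof -
 have "(t + e n *r v - t) /\<^sub>R e n = v" for v using e[of n] by simp
 hence "(LBINT v. f (t + e n *r v) * (c / e n ^ CARD('n) * gauss ((t + e n *r v - t) /\<^sub>R e n)))
 = (c / e n ^ CARD('n)) * (LBINT v. f (t + e n *r v) * gauss v)"
 by (subst integral_mult_right_zero[symmetric]) (simp add: mult_ac)
 thus ?thesis using e[of n] by (simp add: scaleR_conv_of_real[where ?'a=complex])
 qed
 finally show ?thesis .
 qed
 moreover have "(%n. c * (LBINT v. f (t + e n *r v) * gauss v)) ----> c * (LBINT v. f t * gauss (v::real^'n))"
 proof (rule tendsto_mult_left)
 obtain C where C: "C > 0" "!!x. norm (f x) <= C" using schw_bounded[OF f] by metis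
 show "(%n. LBINT v. f (t + e n *r v) * gauss v) ----> (LBINT v. f t * gauss (v::real^'n))"
 proof (rule integral_dominated_convergence[where w="%v::real^'n. C * norm (gauss v)"])
 show "AE v in lborel. (%n. f (t + e n *r v) * gauss v) ----> f t * gauss v"
 proof (rule AE_I2)
 fix v :: "real^'n"
 have "(%n. f (t + e n *r v) * gauss v) ----> f (t + 0 *r v) * gauss v"
 by (intro tendsto_mult isCont_tendsto_compose[OF fc] tendsto_intros e0)
 thus "(%n. f (t + e n *r v) * gauss v) ----> f t * gauss v" by simp
 qed
 show "L1 (%v::real^'n. C * norm (gauss v))"
 by (intro integrable_mult_right integrable_norm schw_integrable schw_gauss)
 show "AE v in lborel. norm (f (t + e n *r v) * gauss v) <= C * norm (gauss v)" for n
 using C by (auto simp: norm_mult intro!: mult_right_mono)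
 qed measurable
 qed
 ultimately have "(LBINT y. ft f y * cis ((- t) \<bullet> y)) = c * (LBINT v. f t * gauss (v::real^'n))"
 using LIMSEQ_unique by force
 also have "... = (c * c) * f t" by (simp add: gauss_integral c_def)
 finally have "ft (ft f) (- t) = (c * c) * f t" by (simp add: ft_def)
 moreover have "c * c = cx ((2 * pi) powr real CARD('n))"
 by (simp add: c_def flip: of_real_mult powr_add)
 ultimately show ?thesis by simp
qed

section \<open>Tempered distributions\<close>

text \<open>The complex conjugate of the time-frequency shift \<open>M_y T_x g\<close> at z = (x,
  y): distributions act bilinearly, so the conjugation in \<open>bracket\<close> is built into the
  test function.\<close>

definition atom :: "(real^'n => complex) => (real^'n) \<times> (real^'n) => real^'n => complex" where
 "atom g z t = cis (- (snd z \<bullet> t)) * cnj (g (t - fst z))"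

lemma schw_atom:
 assumes "g : Schw" shows "atom g z : Schw"
proof -
 have "(%t. cis ((- snd z) \<bullet> t) * cnj (g (t - fst z))) : Schw"
 by (intro schw_mult tempgr_cis schw_cnj schw_translate assms)
 thus ?thesis by (simp add: atom_def[abs_def])
qed

text \<open>Families depending continuously and with polynomial growth on the parameter \<open>z\<close>, in the
 topology of the Schwartz space.\<close>

definition tame_family :: "('z::euclidean_space => real^'n => complex) => bool" where
 "tame_family F \<longleftrightarrow> continuous_on UNIV (%p. F (fst p) (snd p)) \<and>
 (ALL N. EX C M. ALL z t. (1 + norm t) ^ N * norm (F z t) <= C * (1 + norm z) ^ M)"

lemma tame_bound: "tame_family F ==> EX C M. ALL z t. (1 + norm t) ^ N * norm (F z t) <= C * (1 + norm z) ^ M"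
 by (simp add: tame_family_def)

text \<open>Differentiating an atom in \<open>t\<close> either multiplies it by a frequency
  coordinate or differentiates the window; sums of such terms with polynomially bounded coefficients
  are stable.\<close>

inductive_set atom_span :: "((real^'n) \<times> (real^'n) => real^'n => complex) set" where
 base: "f : Schw ==> continuous_on UNIV a ==> (EX C M. ALL y. norm (a y) <= C * (1 + norm y) ^ M) ==>
 (%z t. a (snd z) * (cis (- (snd z \<bullet> t)) * f (t - fst z))) : atom_span"
| add: "F : atom_span ==> G : atom_span ==> (%z t. F z t + G z t) : atom_span"

lemma atom_in_span:
 assumes "g : Schw" shows "atom g : atom_span"
proof -
 have "(%z t. (%_. 1) (snd z) * (cis (- (snd z \<bullet> t)) * (%x. cnj (g x)) (t - fst z))) : atom_span"
 by (rule atom_span.base) (auto intro!: schw_cnj assms exI[of _ 1] exI[of _ "0::nat"])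
 thus ?thesis by (simp add: atom_def[abs_def])
qed

lemma atom_span_differentiable:
 "F : atom_span ==> F z differentiable at t"
proof (induction rule: atom_span.induct)
 case (base f a)
 have "(%t. cis ((- snd z) \<bullet> t)) differentiable at t"
 by (intro tempgr_differentiable tempgr_cis)
 hence "(%t. cis (- (snd z \<bullet> t))) differentiable at t" by simp
 thus ?case
 by (intro differentiable_mult differentiable_const differentiable_translate_at schw_differentiable[OF base(1)])
qed (auto intro: differentiable_add)

lemma atom_span_partial_deriv:
 "F : atom_span ==> (%z. partial_deriv i (F z)) : atom_span"
proof (induction rule: atom_span.induct)
 case (base f a)
 obtain C M where C: "!!y. norm (a y) <= C * (1 + norm y) ^ M" using base by blast
 have eq: "partial_deriv i (%t. a (snd z) * (cis (- (snd z \<bullet> t)) * f (t - fst z))) =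
 (%t. (%y. a y * (- \<i> * cx (y $ i))) (snd z) * (cis (- (snd z \<bullet> t)) * f (t - fst z)) +
 a (snd z) * (cis (- (snd z \<bullet> t)) * partial_deriv i f (t - fst z)))" for z
 proof
 fix t
 have d1: "(%t. cis ((- snd z) \<bullet> t)) differentiable at t"
 by (intro tempgr_differentiable tempgr_cis)
 have d2: "(%t. f (t - fst z)) differentiable at t"
 using base by (intro differentiable_translate_at schw_differentiable)
 have "partial_deriv i (%t. a (snd z) * (cis ((- snd z) \<bullet> t) * f (t - fst z))) t
 = a (snd z) * (partial_deriv i (%t. cis ((- snd z) \<bullet> t)) t * f (t - fst z) + cis ((- snd z) \<bullet> t) * partial_deriv i (%t. f (t - fst z)) t)"
 by (subst partial_deriv_cmult[OF differentiable_mult[OF d1 d2]], subst partial_deriv_mult[OF d1 d2]) simp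
 thus "partial_deriv i (%t. a (snd z) * (cis (- (snd z \<bullet> t)) * f (t - fst z))) t =
 (%y. a y * (- \<i> * cx (y $ i))) (snd z) * (cis (- (snd z \<bullet> t)) * f (t - fst z)) +
 a (snd z) * (cis (- (snd z \<bullet> t)) * partial_deriv i f (t - fst z))"
 unfolding partial_deriv_cis partial_deriv_translate by (simp add: algebra_simps)
 qed
 have "norm (a y * (- \<i> * cx (y $ i))) <= \<bar>C\<bar> * (1 + norm y) ^ (M + 1)" for y
 proof -
 have "norm (a y) * \<bar>y $ i\<bar> <= (\<bar>C\<bar> * (1 + norm y) ^ M) * (1 + norm y)"
 using component_le_norm_cart[of y i]
 by (intro mult_mono order_trans[OF C] mult_right_mono) auto
 thus ?thesis by (simp add: norm_mult mult_ac)
 qed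
 hence b: "EX C M. ALL y. norm (a y * (- \<i> * cx (y $ i))) <= C * (1 + norm y) ^ M" by blast
 show ?case unfolding eq
 by (intro atom_span.add atom_span.base base schw_partial_deriv b continuous_intros)
next
 case (add F G)
 have "partial_deriv i (%t. F z t + G z t) = (%t. partial_deriv i (F z) t + partial_deriv i (G z) t)" for z
 by (intro ext partial_deriv_add atom_span_differentiable add)
 thus ?case using add by (simp only: atom_span.add)
qed

lemma atom_span_partial_derivs:
 "F : atom_span ==> (%z. partial_derivs js (F z)) : atom_span"
 by (induction js) (auto intro: atom_span_partial_deriv)

lemma norm_fst_snd_le: "norm (fst z) <= norm z" "norm (snd z) <= norm z"
 by (metis norm_fst_le prod.collapse, metis norm_snd_le prod.collapse)

lemma atom_span_tame: "F : atom_span ==> tame_family F"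
proof (induction rule: atom_span.induct)
 case (base f a)
 obtain C M where C: "!!y. norm (a y) <= C * (1 + norm y) ^ M" using base by blast
 have "EX C M. ALL z t. (1 + norm t) ^ N * norm (a (snd z) * (cis (- (snd z \<bullet> t)) * f (t - fst z))) <= C * (1 + norm z) ^ M" for N
 proof -
 obtain D where D: "D > 0" "!!x. (1 + norm x) ^ N * norm (f x) <= D" using schw_bound[OF base(1)] by metis
 have "(1 + norm t) ^ N * norm (a (snd z) * (cis (- (snd z \<bullet> t)) * f (t - fst z))) <= (\<bar>C\<bar> * D) * (1 + norm z) ^ (M + N)" for z t
 proof -
 have "(1 + norm t) ^ N * norm (f (t - fst z)) <= ((1 + norm (t - fst z)) ^ N * (1 + norm (fst z)) ^ N) * norm (f (t - fst z))"
 using weight_translate[of "t - fst z" "fst z" N] by (intro mult_right_mono) auto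
 also have "... = (1 + norm (fst z)) ^ N * ((1 + norm (t - fst z)) ^ N * norm (f (t - fst z)))" by simp
 also have "... <= (1 + norm z) ^ N * D"
 using D norm_fst_snd_le[of z] by (intro mult_mono power_mono) auto
 finally have 1: "(1 + norm t) ^ N * norm (f (t - fst z)) <= (1 + norm z) ^ N * D" .
 have 2: "norm (a (snd z)) <= \<bar>C\<bar> * (1 + norm z) ^ M"
 using norm_fst_snd_le[of z] by (intro order_trans[OF C] mult_mono power_mono) auto
 have "norm (a (snd z)) * ((1 + norm t) ^ N * norm (f (t - fst z))) <= (\<bar>C\<bar> * (1 + norm z) ^ M) * ((1 + norm z) ^ N * D)"
 by (intro mult_mono 1 2) auto
 thus ?thesis by (simp add: norm_mult power_add mult_ac)
 qed
 thus ?thesis by blast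
 qed
 moreover have "continuous_on UNIV (%p. a (snd (fst p)) * (cis (- (snd (fst p) \<bullet> snd p)) * f (snd p - fst (fst p))))"
 by (intro continuous_intros continuous_on_compose2[OF base(2)] continuous_on_compose2[OF schw_continuous[OF base(1), of UNIV]]) auto
 ultimately show ?case by (simp add: tame_family_def)
next
 case (add F G)
 have "EX C M. ALL z t. (1 + norm t) ^ N * norm (F z t + G z t) <= C * (1 + norm z) ^ M" for N
 proof -
 obtain C M D L where C: "!!z t. (1 + norm t) ^ N * norm (F z t) <= C * (1 + norm z) ^ M"
 and D: "!!z t. (1 + norm t) ^ N * norm (G z t) <= D * (1 + norm z) ^ L"
 using tame_bound[OF add.IH(1), of N] tame_bound[OF add.IH(2), of N] by blast
 have "(1 + norm t) ^ N * norm (F z t + G z t) <= (\<bar>C\<bar> + \<bar>D\<bar>) * (1 + norm z) ^ (M + L)" for z t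
 proof -
 have "(1 + norm t) ^ N * norm (F z t + G z t) <= (1 + norm t) ^ N * norm (F z t) + (1 + norm t) ^ N * norm (G z t)"
 unfolding distrib_left[symmetric] by (intro mult_left_mono norm_triangle_ineq) auto
 also have "... <= \<bar>C\<bar> * (1 + norm z) ^ (M + L) + \<bar>D\<bar> * (1 + norm z) ^ (M + L)"
 by (intro add_mono order_trans[OF C] order_trans[OF D] mult_mono power_increasing) auto
 finally show ?thesis by (simp add: distrib_right)
 qed
 thus ?thesis by blast
 qed
 thus ?case using add by (auto simp: tame_family_def intro!: continuous_on_add)
qed

text \<open>Uniformity in \<open>t\<close> is the point. The bound for the weight
  \<open>Suc N\<close> makes everything outside a ball of radius \<open>2 * K / e\<close> small, and
  inside it uniform continuity on a compact set applies.\<close>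

lemma tame_family_continuous:
 fixes F :: "'z::euclidean_space => real^'n => complex"
 assumes F: "tame_family F" and e: "e > 0"
 shows "\<exists>d>0. ALL z. dist z z0 < d --> (ALL t. (1 + norm t) ^ N * norm (F z t - F z0 t) <= e)"
proof -
 obtain C M where C: "!!z t. (1 + norm t) ^ (Suc N) * norm (F z t) <= C * (1 + norm z) ^ M"
 using tame_bound[OF F, of "Suc N"] by blast
 define K where "K = \<bar>C\<bar> * (2 + norm z0) ^ M"
 have K: "(1 + norm t) ^ (Suc N) * norm (F z t) <= K" if "dist z z0 <= 1" for z t
 proof -
 have "norm z <= 1 + norm z0" using that norm_triangle_sub[of z z0] by (simp add: dist_norm)
 thus ?thesis unfolding K_def
 by (intro order_trans[OF C] mult_mono power_mono) auto
 qed
 have K0: "K >= 0" by (simp add: K_def)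
 define R where "R = 2 * K / e"
 have "R >= 0" using K0 e by (simp add: R_def)
 have "compact (cball z0 1 \<times> cball (0::real^'n) R)" by (intro compact_Times compact_cball)
 moreover have "continuous_on (cball z0 1 \<times> cball (0::real^'n) R) (%p. F (fst p) (snd p))"
 using F unfolding tame_family_def using continuous_on_subset by blast
 ultimately have uc: "uniformly_continuous_on (cball z0 1 \<times> cball (0::real^'n) R) (%p. F (fst p) (snd p))"
 by (intro compact_uniformly_continuous)
 have "e / (1 + R) ^ N > 0" using e \<open>R >= 0\<close> by simp
 then obtain d where d: "d > 0" and ud: "!!p q. p : cball z0 1 \<times> cball 0 R ==> q : cball z0 1 \<times> cball 0 R ==>
 dist p q < d ==> dist (F (fst p) (snd p)) (F (fst q) (snd q)) < e / (1 + R) ^ N"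
 using uc unfolding uniformly_continuous_on_def by metis
 show ?thesis
 proof (intro exI[of _ "min d 1"] conjI allI impI)
 show "min d 1 > 0" using d by simp
 fix z t assume z: "dist z z0 < min d 1"
 show "(1 + norm t) ^ N * norm (F z t - F z0 t) <= e"
 proof (cases "norm t <= R")
 case True
 have "dist (F z t) (F z0 t) < e / (1 + R) ^ N"
 using ud[of "(z, t)" "(z0, t)"] z True by (auto simp: dist_commute dist_Pair_Pair)
 hence "(1 + norm t) ^ N * norm (F z t - F z0 t) <= (1 + R) ^ N * (e / (1 + R) ^ N)"
 using True \<open>R >= 0\<close> by (intro mult_mono power_mono) (auto simp: dist_norm)
 thus ?thesis using \<open>R >= 0\<close> by simp
 next
 case False
 have "(1 + norm t) ^ Suc N * norm (F z t - F z0 t) <= (1 + norm t) ^ Suc N * norm (F z t) + (1 + norm t) ^ Suc N * norm (F z0 t)"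
 unfolding distrib_left[symmetric] by (intro mult_left_mono norm_triangle_ineq4) auto
 also have "... <= K + K" using z by (intro add_mono K) auto
 finally have "(1 + norm t) * ((1 + norm t) ^ N * norm (F z t - F z0 t)) <= 2 * K" by (simp add: mult.assoc)
 hence "(1 + norm t) ^ N * norm (F z t - F z0 t) <= 2 * K / (1 + norm t)"
 by (subst pos_le_divide_eq) (auto simp: mult.commute add_pos_nonneg)
 also have "... <= e"
 proof (subst pos_divide_le_eq)
 have "2 * K = e * R" using e by (simp add: R_def)
 also have "... <= e * (1 + norm t)" using e False by (intro mult_left_mono) auto
 finally show "2 * K <= e * (1 + norm t)" .
 qed (auto simp: add_pos_nonneg)
 finally show ?thesis .
 qed
 qed
qed

section \<open>Schwartz seminorms and the continuity of tempered distributions\<close>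

lemma schwartz_seminorm_bdd:
 "ph : Schw ==> bdd_above (range (%x. (1 + norm x) ^ N * norm (partial_derivs js ph x)))"
 using schw_bound'[OF schw_partial_derivs] by (auto simp: bdd_above_def)

lemma schwartz_seminorm_le:
 "(!!x. (1 + norm x) ^ N * norm (partial_derivs js ph x) <= c) ==> schwartz_seminorm N js ph <= c"
 unfolding schwartz_seminorm_def by (rule cSUP_least) auto

lemma schwartz_seminorm_ge:
 "ph : Schw ==> (1 + norm x) ^ N * norm (partial_derivs js ph x) <= schwartz_seminorm N js ph"
 unfolding schwartz_seminorm_def by (rule cSUP_upper) (auto intro: schwartz_seminorm_bdd)

lemma schwartz_seminorm_nonneg: "ph : Schw ==> 0 <= schwartz_seminorm N js ph"
 by (rule order_trans[OF _ schwartz_seminorm_ge[where x=0]]) auto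

lemma partial_derivs_add:
 assumes "f : Schw" "g : Schw"
 shows "partial_derivs js (%x. f x + g x) = (%x. partial_derivs js f x + partial_derivs js g x)"
proof (induction js)
 case (Cons i js)
 show ?case unfolding partial_derivs_Cons Cons
 by (intro ext partial_deriv_add schw_differentiable schw_partial_derivs assms)
qed simp

lemma partial_derivs_cmult:
 assumes "f : Schw"
 shows "partial_derivs js (%x. c * f x) = (%x. c * partial_derivs js f x)"
proof (induction js)
 case (Cons i js)
 show ?case unfolding partial_derivs_Cons Cons
 by (intro ext partial_deriv_cmult schw_differentiable schw_partial_derivs assms)
qed simp

lemma partial_derivs_diff:
 assumes "f : Schw" "g : Schw"
 shows "partial_derivs js (%x. f x - g x) = (%x. partial_derivs js f x - partial_derivs js g x)"
 using partial_derivs_add[OF assms(1) schw_cmult[OF assms(2), of "-1"]] partial_derivs_cmult[OF assms(2), of _ "-1"]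
 by simp

lemma partial_derivs_zero: "partial_derivs js (%x. 0) = (%x. 0)"
 by (induction js) (auto simp: partial_deriv_const)

lemma partial_derivs_sum:
 assumes "!!i. i : I ==> f i : Schw"
 shows "partial_derivs js (%x. \<Sum>i\<in>I. c i * f i x) = (%x. \<Sum>i\<in>I. c i * partial_derivs js (f i) x)"
 using assms
proof (induction I rule: infinite_finite_induct)
 case (insert a I)
 thus ?case
 by (simp add: partial_derivs_add schw_cmult schw_sum partial_derivs_cmult)
qed (auto simp: partial_derivs_zero)

lemma schwartz_seminorm_cmult:
 assumes "ph : Schw"
 shows "schwartz_seminorm N js (%x. c * ph x) = norm c * schwartz_seminorm N js ph"
proof -
 have "schwartz_seminorm N js (%x. c * ph x) <= norm c * schwartz_seminorm N js ph" if "ph : Schw" for c ph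
 by (rule schwartz_seminorm_le)
 (use schwartz_seminorm_ge[OF that] in \<open>simp add: partial_derivs_cmult[OF that] norm_mult mult.left_commute mult_left_mono\<close>)
 note le = this
 show ?thesis
 proof (cases "c = 0")
 case True
 thus ?thesis using le[OF assms, of 0] schwartz_seminorm_nonneg[OF schw_zero, of N js] by simp
 next
 case False
 have "norm c * schwartz_seminorm N js (%x. inverse c * (c * ph x)) <= norm c * (norm (inverse c) * schwartz_seminorm N js (%x. c * ph x))"
 by (intro mult_left_mono le schw_cmult assms) auto
 thus ?thesis using le[OF assms, of c] False by (simp add: mult.assoc[symmetric] norm_inverse)
 qed
qed

lemma tempered_add: "T : tempered ==> ph : Schw ==> ps : Schw ==> T (%x. ph x + ps x) = T ph + T ps"
 and tempered_cmult: "T : tempered ==> ph : Schw ==> T (%x. c * ph x) = c * T ph"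
 and tempered_off: "T : tempered ==> ph \<notin> schwartz_space ==> T ph = 0"
 unfolding tempered_def by auto

lemma tempered_seq:
 assumes "T : tempered" "!!n. \<Phi> n : Schw" "!!N js. (%n. schwartz_seminorm N js (\<Phi> n)) ----> 0"
 shows "(%n. T (\<Phi> n)) ----> 0"
 using assms unfolding tempered_def by auto

lemma tempered_zero: "T : tempered ==> T (%x. 0) = 0"
 using tempered_cmult[OF _ schw_zero, of T 0] by simp

lemma tempered_diff:
 assumes "T : tempered" "ph : Schw" "ps : Schw"
 shows "T (%x. ph x - ps x) = T ph - T ps"
 using tempered_add[OF assms(1,2) schw_cmult[OF assms(3), of "-1"]] tempered_cmult[OF assms(1,3), of "-1"] by simp

lemma tempered_sum:
 assumes "T : tempered" "!!i. i : I ==> f i : Schw"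
 shows "T (%x. \<Sum>i\<in>I. c i * f i x) = (\<Sum>i\<in>I. c i * T (f i))"
 using assms(2)
proof (induction I rule: infinite_finite_induct)
 case (insert a I)
 thus ?case
 by (simp add: tempered_add[OF assms(1)] tempered_cmult[OF assms(1)] schw_cmult schw_sum)
qed (auto simp: tempered_zero assms)

text \<open>The index pairs are countable; an enumeration turns the directed family of seminorms
  into the finite sums of \<open>tempered_bound\<close>.\<close>

definition seminorm_nth :: "nat => (real^'n => complex) => real" where
 "seminorm_nth k = (case (from_nat k :: nat \<times> ('n::finite) list) of (N, js) => schwartz_seminorm N js)"

lemma seminorm_nth_nonneg: "ph : Schw ==> 0 <= seminorm_nth k ph"
 by (simp add: seminorm_nth_def schwartz_seminorm_nonneg split: prod.split)

text \<open>If no finite sum of seminorms controlled \<open>T\<close>, there would be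
  \<open>ph m\<close> with value larger than \<open>Suc m\<close> times the sum of the first
  \<open>m\<close> seminorms. Dividing by the value gives a sequence that tends to 0 in every
  seminorm but has value 1 throughout.\<close>

lemma tempered_bound:
 fixes T :: "('n::finite) dist"
 assumes T: "T : tempered"
 shows "EX C m. ALL ph:schwartz_space. norm (T ph) <= C * (\<Sum>k<m. seminorm_nth k ph)"
proof (rule ccontr)
 assume "\<not> ?thesis"
 hence "ALL m. EX ph:schwartz_space. norm (T ph) > real (Suc m) * (\<Sum>k<m. seminorm_nth k ph)"
 by (meson not_le)
 then obtain ph where ph: "!!m. ph m : Schw"
 and big: "!!m. norm (T (ph m)) > real (Suc m) * (\<Sum>k<m. seminorm_nth k (ph m))" by metis
 have pos: "norm (T (ph m)) > 0" for m
 by (rule le_less_trans[OF _ big]) (auto intro!: mult_nonneg_nonneg sum_nonneg seminorm_nth_nonneg ph)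
 define ps where "ps m x = inverse (T (ph m)) * ph m x" for m x
 have ps: "ps m : Schw" for m unfolding ps_def by (intro schw_cmult ph)
 have "(%m. T (ps m)) ----> 0"
 proof (rule tempered_seq[OF T ps])
 fix N :: nat and js :: "'n list"
 define k where "k = to_nat (N, js)"
 have sk: "schwartz_seminorm N js = seminorm_nth k" by (simp add: seminorm_nth_def k_def)
 have le: "schwartz_seminorm N js (ps m) <= inverse (real (Suc m))" if "m > k" for m
 proof -
 have "seminorm_nth k (ph m) <= (\<Sum>k<m. seminorm_nth k (ph m))"
 using that by (intro member_le_sum seminorm_nth_nonneg ph) auto
 hence "real (Suc m) * seminorm_nth k (ph m) <= real (Suc m) * (\<Sum>k<m. seminorm_nth k (ph m))"
 by (intro mult_left_mono) auto
 hence "real (Suc m) * seminorm_nth k (ph m) <= norm (T (ph m))"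
 using big[of m] by linarith
 hence "seminorm_nth k (ph m) / norm (T (ph m)) <= inverse (real (Suc m))"
 using pos[of m] by (simp add: divide_simps mult.commute del: of_nat_Suc)
 thus ?thesis
 unfolding ps_def schwartz_seminorm_cmult[OF ph] by (simp add: sk norm_inverse divide_inverse mult.commute)
 qed
 show "(%m. schwartz_seminorm N js (ps m)) ----> 0"
 proof (rule tendsto_sandwich[OF _ _ tendsto_const LIMSEQ_inverse_real_of_nat])
 show "\<forall>\<^sub>F m in sequentially. schwartz_seminorm N js (ps m) <= inverse (real (Suc m))"
 using eventually_gt_at_top[of k] by eventually_elim (rule le)
 qed (simp add: schwartz_seminorm_nonneg ps)
 qed
 moreover have "T (ps m) = 1" for m
 unfolding ps_def using tempered_cmult[OF T ph] pos[of m] by simp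
 ultimately show False using LIMSEQ_unique[OF _ tendsto_const] by fastforce
qed

lemma tame_seminorm_continuous:
 fixes E :: "'z::euclidean_space => real^'n => complex"
 assumes S: "!!z. E z : Schw" and tame: "!!js. tame_family (%z. partial_derivs js (E z))"
 shows tame_seminorm_continuous_on: "continuous_on UNIV (%z. schwartz_seminorm N js (%t. E z t - E p t))"
 and tame_seminorm_tendsto: "X ----> z ==> (%n. schwartz_seminorm N js (%t. E (X n) t - E z t)) ----> 0"
proof -
 let ?q = "%z p. schwartz_seminorm N js (%t. E z t - E p t)"
 have d: "partial_derivs js (%t. E z t - E p t) = (%t. partial_derivs js (E z) t - partial_derivs js (E p) t)" for z p
 by (intro partial_derivs_diff S)
 have small: "\<exists>d>0. ALL z. dist z z0 < d --> ?q z z0 <= e" if e: "e > 0" for e z0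
 proof -
 obtain \<delta> where "\<delta> > 0" and "!!z t. dist z z0 < \<delta> ==> (1 + norm t) ^ N * norm (partial_derivs js (E z) t - partial_derivs js (E z0) t) <= e"
 using tame_family_continuous[OF tame[of js] e, of z0 N] by blast
 thus ?thesis by (intro exI[of _ \<delta>]) (auto intro!: schwartz_seminorm_le simp: d)
 qed
 have nn: "0 <= ?q z p" for z p by (intro schwartz_seminorm_nonneg schw_diff S)
 have tri: "?q z p <= ?q z w + ?q w p" for z w p
 proof (rule schwartz_seminorm_le)
 fix x
 have "(1 + norm x) ^ N * norm (partial_derivs js (%t. E z t - E p t) x) \<le>
 (1 + norm x) ^ N * norm (partial_derivs js (%t. E z t - E w t) x) + (1 + norm x) ^ N * norm (partial_derivs js (%t. E w t - E p t) x)"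
 unfolding d distrib_left[symmetric] by (intro mult_left_mono) (auto intro: norm_triangle_sub order_trans[OF _ norm_triangle_ineq])
 also have "... <= ?q z w + ?q w p"
 by (intro add_mono schwartz_seminorm_ge schw_diff S)
 finally show "(1 + norm x) ^ N * norm (partial_derivs js (%t. E z t - E p t) x) <= ?q z w + ?q w p" .
 qed
 have sym: "?q z p = ?q p z" for z p
 unfolding schwartz_seminorm_def d by (simp add: norm_minus_commute)
 show "continuous_on UNIV (%z. ?q z p)"
 unfolding continuous_on_iff
 proof safe
 fix z0 and e :: real assume "e > 0"
 then obtain \<delta> where "\<delta> > 0" and \<delta>: "!!z. dist z z0 < \<delta> ==> ?q z z0 <= e / 2"
 using small[of "e / 2"] by (metis half_gt_zero)
 have "dist (?q z p) (?q z0 p) < e" if "dist z z0 < \<delta>" for z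
 using \<delta>[OF that] tri[of z p z0] tri[of z0 p z] sym[of z0 z] \<open>e > 0\<close> by (simp add: dist_real_def abs_le_iff abs_less_iff)
 thus "\<exists>d>0. ALL z:UNIV. dist z z0 < d --> dist (?q z p) (?q z0 p) < e"
 using \<open>\<delta> > 0\<close> by blast
 qed
 show "(%n. ?q (X n) z) ----> 0" if X: "X ----> z"
 proof (rule LIMSEQ_I)
 fix e :: real assume "e > 0"
 then obtain \<delta> where "\<delta> > 0" and \<delta>: "!!w. dist w z < \<delta> ==> ?q w z <= e / 2"
 using small[of "e / 2"] by (metis half_gt_zero)
 obtain n0 where "!!n. n >= n0 ==> dist (X n) z < \<delta>" using X \<open>\<delta> > 0\<close> unfolding lim_sequentially by blast
 thus "EX no. \<forall>n\<ge>no. norm (?q (X n) z - 0) < e"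
 using \<delta> nn \<open>e > 0\<close> by (intro exI[of _ n0]) fastforce
 qed
qed

lemma simple_sum_indicator:
 fixes s :: "'z => 'z" and G :: "'z => 'b::real_vector"
 assumes "finite (range s)"
 shows "(\<Sum>p\<in>range s. indicator {z. s z = p} z *r G p) = G (s z)"
proof -
 have "(\<Sum>p\<in>range s. indicator {z. s z = p} z *r G p) = (\<Sum>p\<in>range s. if p = s z then G p else 0)"
 by (intro sum.cong refl) (auto simp: indicator_def)
 thus ?thesis using assms by simp
qed

lemma integrable_weight_subst:
 fixes b :: "'z::euclidean_space => complex"
 assumes "L1 (%z. norm (b z) * (1 + norm z) ^ M)" and [measurable]: "h : BM"
 and "b : BM" and h: "!!z. norm (h z) <= C * (1 + norm z) ^ M"
 shows "L1 (%z. b z * (h z :: complex))"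
proof (rule integrable_bound[OF integrable_mult_right[OF assms(1), of C]])
 show "(%z. b z * h z) : LM" using assms(3) by simp
 have "norm (b z * h z) <= norm (C * (norm (b z) * (1 + norm z) ^ M))" for z
 proof -
 have "norm (b z * h z) <= norm (b z) * (C * (1 + norm z) ^ M)"
 unfolding norm_mult by (intro mult_left_mono h) auto
 also have "... <= norm (C * (norm (b z) * (1 + norm z) ^ M))"
 using abs_ge_self[of "C * (norm (b z) * (1 + norm z) ^ M)"] by (simp add: mult_ac)
 finally show ?thesis .
 qed
 thus "AE z in lborel. norm (b z * h z) <= norm (C * (norm (b z) * (1 + norm z) ^ M))" by simp
qed

lemma tame_family_continuous_param:
 assumes "tame_family F" shows "continuous_on UNIV (%z. F z t)"
proof -
 have "continuous_on UNIV (%p. F (fst p) (snd p))" using assms by (simp add: tame_family_def)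
 hence "continuous_on UNIV (%z. F (fst (z, t)) (snd (z, t)))"
 by (rule continuous_on_compose2) (auto intro!: continuous_intros)
 thus ?thesis by simp
qed

text \<open>Finitely many seminorms control \<open>T\<close>, and each of them grows polynomially
  along the family; continuity is inherited from the seminorms.\<close>

lemma tempered_tame:
 fixes E :: "'z::euclidean_space => real^'n => complex" and T :: "('n::finite) dist"
 assumes T: "T : tempered" and S: "!!z. E z : Schw"
 and tame: "!!js. tame_family (%z. partial_derivs js (E z))"
 shows tempered_tame_continuous: "continuous_on UNIV (%z. T (E z))"
 and tempered_tame_bound: "EX C M. ALL z. norm (T (E z)) <= C * (1 + norm z) ^ M"
proof -
 show "continuous_on UNIV (%z. T (E z))"
 proof (rule continuous_at_imp_continuous_on, safe)
 fix z
 show "isCont (%z. T (E z)) z"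
 unfolding continuous_at_sequentially comp_def
 proof safe
 fix X assume X: "X ----> z"
 have "(%n. T (%t. E (X n) t - E z t)) ----> 0"
 by (intro tempered_seq[OF T] schw_diff S tame_seminorm_tendsto[of E, OF S tame X])
 hence "(%n. T (E (X n)) - T (E z)) ----> 0"
 by (simp add: tempered_diff[OF T S S])
 thus "(%n. T (E (X n))) ----> T (E z)" by (simp add: LIM_zero_iff)
 qed
 qed
 obtain C m where Cm: "!!ph. ph : Schw ==> norm (T ph) <= C * (\<Sum>k<m. seminorm_nth k ph)"
 using tempered_bound[OF T] by blast
 have "EX C M. ALL z. seminorm_nth k (E z) <= C * (1 + norm z) ^ M" for k
 proof -
 obtain N js where k: "(from_nat k :: nat \<times> 'n list) = (N, js)"
 using surj_pair[of "from_nat k :: nat \<times> 'n list"] by blast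
 obtain C M where "!!z t. (1 + norm t) ^ N * norm (partial_derivs js (E z) t) <= C * (1 + norm z) ^ M"
 using tame_bound[OF tame[of js], of N] by blast
 hence "schwartz_seminorm N js (E z) <= C * (1 + norm z) ^ M" for z by (rule schwartz_seminorm_le)
 thus ?thesis by (auto simp: seminorm_nth_def k)
 qed
 then obtain D L where DL: "!!k z. seminorm_nth k (E z) <= D k * (1 + norm z) ^ L k" by metis
 have "norm (T (E z)) <= (\<bar>C\<bar> * (\<Sum>k<m. \<bar>D k\<bar>)) * (1 + norm z) ^ (\<Sum>k<m. L k)" for z
 proof -
 have "norm (T (E z)) <= \<bar>C\<bar> * (\<Sum>k<m. seminorm_nth k (E z))"
 using Cm[OF S, of z] by (rule order_trans) (intro mult_right_mono sum_nonneg seminorm_nth_nonneg S, auto)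
 also have "... <= \<bar>C\<bar> * (\<Sum>k<m. \<bar>D k\<bar> * (1 + norm z) ^ (\<Sum>k<m. L k))"
 proof (intro mult_left_mono sum_mono)
 fix k assume "k : {..<m}"
 hence "L k <= (\<Sum>k<m. L k)" by (intro member_le_sum) auto
 thus "seminorm_nth k (E z) <= \<bar>D k\<bar> * (1 + norm z) ^ (\<Sum>k<m. L k)"
 by (intro order_trans[OF DL] mult_mono power_increasing) auto
 qed auto
 finally show ?thesis by (simp add: sum_distrib_right mult.assoc)
 qed
 thus "EX C M. ALL z. norm (T (E z)) <= C * (1 + norm z) ^ M" by blast
qed

text \<open>Replace \<open>E z\<close> by \<open>E (s\<^sub>i z)\<close> for simple functions \<open>s\<^sub>i \<rightarrow> id\<close>: the integrals become finite
 sums, and they converge in every Schwartz seminorm by dominated convergence.\<close>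

lemma tempered_integral_commute:
 fixes E :: "'z::euclidean_space => real^'n => complex" and T :: "('n::finite) dist"
 assumes T: "T : tempered" and S: "!!z. E z : Schw"
 and tame: "!!js. tame_family (%z. partial_derivs js (E z))"
 and b[measurable]: "b : BM"
 and bi: "!!M. L1 (%z. norm (b z) * (1 + norm z) ^ M)"
 and ph: "ph : Schw"
 and rep: "!!js t. partial_derivs js ph t = (LBINT z. b z * partial_derivs js (E z) t)"
 shows "L1 (%z. b z * T (E z))" and "T ph = (LBINT z. b z * T (E z))"
proof -
 obtain CT MT where CT: "!!z. norm (T (E z)) <= CT * (1 + norm z) ^ MT"
 using tempered_tame_bound[of T E, OF T S tame] by blast
 have CT0: "CT >= 0" using order_trans[OF norm_ge_zero CT[of 0]] by simp
 have TEm[measurable]: "(%z. T (E z)) : BM"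
 by (intro borel_cont tempered_tame_continuous[of T E, OF T S tame])
 show "L1 (%z. b z * T (E z))"
 by (rule integrable_weight_subst[OF bi _ b CT]) measurable
 have "(%z::'z. z) : LM" by simp
 from borel_measurable_implies_sequence_metric[OF this, of 0]
 obtain s :: "nat => 'z => 'z" where s0: "(ALL i. simple_function lborel (s i)) & (ALL z:space lborel. (%i. s i z) ----> z) \<and>
 (ALL i. ALL z:space lborel. dist (s i z) 0 <= 2 * dist z 0)" by blast
 have s: "!!i. simple_function lborel (s i)" and slim: "!!z. (%i. s i z) ----> z"
 and sb: "!!i z. dist (s i z) 0 <= 2 * dist z 0" using s0 by auto
 have fin: "finite (range (s i))" for i using simple_functionD(1)[OF s, of i] by simp
 have sm[measurable]: "s i : BM" for i using borel_measurable_simple_function[OF s, of i] by simp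
 have sle: "1 + norm (s i z) <= 2 * (1 + norm z)" for i z using sb[of i z] by simp
 define \<beta> where "\<beta> i p = (LBINT z. b z * indicator {z. s i z = p} z)" for i p
 have b1: "L1 b"
 using bi[of 0] by (simp add: integrable_norm_iff)
 have bind: "L1 (%z. b z * indicator {z. s i z = p} z)" for i p
 by (rule integrable_bound[OF b1]) (auto simp: indicator_def)
 have simple: "(\<Sum>p\<in>range (s i). \<beta> i p * G p) = (LBINT z. b z * G (s i z))" for i and G :: "'z => complex"
 proof -
 have "(LBINT z. b z * G (s i z)) = (LBINT z. (\<Sum>p\<in>range (s i). (b z * indicator {z. s i z = p} z) * G p))"
 proof (rule int_cong[OF refl])
 fix z
 have "b z * G (s i z) = b z * (\<Sum>p\<in>range (s i). indicator {z. s i z = p} z *r G p)"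
 by (simp add: simple_sum_indicator[OF fin])
 also have "... = (\<Sum>p\<in>range (s i). (b z * indicator {z. s i z = p} z) * G p)"
 unfolding sum_distrib_left by (intro sum.cong refl) (auto simp: indicator_def)
 finally show "b z * G (s i z) = (\<Sum>p\<in>range (s i). (b z * indicator {z. s i z = p} z) * G p)" .
 qed
 also have "... = (\<Sum>p\<in>range (s i). LBINT z. (b z * indicator {z. s i z = p} z) * G p)"
 by (rule Bochner_Integration.integral_sum) (intro integrable_mult_left bind)
 finally show ?thesis by (simp add: \<beta>_def)
 qed
 have comp_meas[measurable]: "(%z. G (s i z)) : BM" for i and G :: "'z => complex"
 using simple_function_compose1[OF s[of i], of G] borel_measurable_simple_function by fastforce
 define \<Phi> where "\<Phi> i t = ph t - (\<Sum>p\<in>range (s i). \<beta> i p * E p t)" for i t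
 have \<Phi>S: "\<Phi> i : Schw" for i
 unfolding \<Phi>_def by (intro schw_diff ph schw_sum schw_cmult S)
 have lim0: "(%i. T (\<Phi> i)) ----> 0"
 proof (rule tempered_seq[OF T \<Phi>S])
 fix N js
 let ?q = "%z p. schwartz_seminorm N js (%t. E z t - E p t)"
 let ?D = "%z. partial_derivs js (E z)"
 have qnn: "0 <= ?q z p" for z p by (intro schwartz_seminorm_nonneg schw_diff S)
 have qge: "(1 + norm t) ^ N * norm (?D z t - ?D p t) <= ?q z p" for z p t
 using schwartz_seminorm_ge[OF schw_diff[OF S S], where x=t] by (simp add: partial_derivs_diff S)
 obtain C M where CM: "!!z t. (1 + norm t) ^ N * norm (?D z t) <= C * (1 + norm z) ^ M"
 using tame_bound[OF tame[of js], of N] by blast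
 have C0: "C >= 0" using order_trans[OF _ CM[of 0 0]] by simp
 have qle: "?q z (s i z) <= (C * (1 + 2 ^ M)) * (1 + norm z) ^ M" for z i
 proof (rule schwartz_seminorm_le)
 fix t
 have "(1 + norm t) ^ N * norm (partial_derivs js (%t. E z t - E (s i z) t) t) <= (1 + norm t) ^ N * norm (?D z t) + (1 + norm t) ^ N * norm (?D (s i z) t)"
 unfolding partial_derivs_diff[OF S S] distrib_left[symmetric]
 by (intro mult_left_mono norm_triangle_ineq4) auto
 also have "... <= C * (1 + norm z) ^ M + C * (1 + norm (s i z)) ^ M" by (intro add_mono CM)
 also have "... <= C * (1 + norm z) ^ M + C * (2 * (1 + norm z)) ^ M"
 by (intro add_left_mono mult_left_mono power_mono sle C0) auto
 also have "... = (C * (1 + 2 ^ M)) * (1 + norm z) ^ M"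
 by (simp only: power_mult_distrib) (simp add: distrib_left distrib_right mult_ac)
 finally show "(1 + norm t) ^ N * norm (partial_derivs js (%t. E z t - E (s i z) t) t) <= (C * (1 + 2 ^ M)) * (1 + norm z) ^ M" .
 qed
 have qm[measurable]: "(%z. ?q z (s i z)) : BM" for i
 proof -
 have "(%z. \<Sum>p\<in>range (s i). indicator {z. s i z = p} z *r ?q z p) : BM"
 proof (intro borel_measurable_sum borel_measurable_scaleR)
 show "(%z. ?q z p) : BM" for p
 by (intro borel_cont tame_seminorm_continuous_on[of E, OF S tame])
 qed measurable
 moreover have "(\<Sum>p\<in>range (s i). indicator {z. s i z = p} z *r ?q z p) = ?q z (s i z)" for z
 by (rule simple_sum_indicator[OF fin])
 ultimately show ?thesis by simp
 qed
 let ?w = "%z. norm (b z) * ((C * (1 + 2 ^ M)) * (1 + norm z) ^ M)"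
 have wi: "L1 ?w"
 using integrable_mult_right[OF bi[of M], of "C * (1 + 2 ^ M)"] by (simp add: mult_ac)
 have bq: "L1 (%z. norm (b z) * ?q z (s i z))" for i
 proof (rule integrable_bound[OF wi])
 show "AE z in lborel. norm (norm (b z) * ?q z (s i z)) <= norm (?w z)"
 proof (rule AE_I2)
 fix z
 have "norm (norm (b z) * ?q z (s i z)) = norm (b z) * ?q z (s i z)" using qnn by (simp add: abs_mult)
 also have "... <= ?w z" by (intro mult_left_mono qle) auto
 also have "... <= norm (?w z)" unfolding real_norm_def by (rule abs_ge_self)
 finally show "norm (norm (b z) * ?q z (s i z)) <= norm (?w z)" .
 qed
 qed measurable
 have "(%i. LBINT z. norm (b z) * ?q z (s i z)) ----> (\<integral>z. 0 \<partial>(lborel :: 'z measure))"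
 proof (rule integral_dominated_convergence[where w="?w"])
 show "AE z in lborel. (%i. norm (b z) * ?q z (s i z)) ----> 0"
 proof (rule AE_I2)
 fix z
 have "(%i. ?q (s i z) z) ----> 0"
 by (rule tame_seminorm_tendsto[of E, OF S tame slim])
 moreover have "?q (s i z) z = ?q z (s i z)" for i
 unfolding schwartz_seminorm_def partial_derivs_diff[OF S S] by (simp add: norm_minus_commute)
 ultimately show "(%i. norm (b z) * ?q z (s i z)) ----> 0" by (simp add: tendsto_mult_right_zero)
 qed
 show "AE z in lborel. norm (norm (b z) * ?q z (s i z)) <= ?w z" for i
 using qle qnn by (auto simp: abs_mult intro!: mult_left_mono)
 qed (use wi in auto)
 hence lim: "(%i. LBINT z. norm (b z) * ?q z (s i z)) ----> 0" by simp
 have le: "schwartz_seminorm N js (\<Phi> i) <= (LBINT z. norm (b z) * ?q z (s i z))" for i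
 proof (rule schwartz_seminorm_le)
 fix t
 have Dm: "(%z. ?D z t) : BM"
 by (intro borel_cont tame_family_continuous_param[OF tame])
 obtain C' M' where C': "!!z t. (1 + norm t) ^ 0 * norm (?D z t) <= C' * (1 + norm z) ^ M'"
 using tame_bound[OF tame[of js], of 0] by blast
 have C'0: "C' >= 0" using order_trans[OF _ C'[of 0 0]] by simp
 have bD: "L1 (%z. b z * ?D z t)"
 by (rule integrable_weight_subst[OF bi Dm b]) (use C' in simp)
 have "norm (?D (s i z) t) <= (C' * 2 ^ M') * (1 + norm z) ^ M'" for z
 proof -
 have "norm (?D (s i z) t) <= C' * (1 + norm (s i z)) ^ M'" using C'[of t "s i z"] by simp
 also have "... <= C' * (2 * (1 + norm z)) ^ M'" by (intro mult_left_mono power_mono sle C'0) auto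
 finally show ?thesis by (simp only: power_mult_distrib mult.assoc)
 qed
 hence bDs: "L1 (%z. b z * ?D (s i z) t)"
 by (intro integrable_weight_subst[OF bi _ b]) (use comp_meas[of "%z. ?D z t" i] in auto)
 have "partial_derivs js (\<Phi> i) t = partial_derivs js ph t - (\<Sum>p\<in>range (s i). \<beta> i p * ?D p t)"
 unfolding \<Phi>_def by (subst partial_derivs_diff) (auto intro!: ph schw_sum schw_cmult S simp: partial_derivs_sum S)
 also have "... = (LBINT z. b z * (?D z t - ?D (s i z) t))"
 using simple[of i "%p. ?D p t"] Bochner_Integration.integral_diff[OF bD bDs] by (simp add: rep right_diff_distrib)
 finally have "(1 + norm t) ^ N * norm (partial_derivs js (\<Phi> i) t) = norm (LBINT z. (1 + norm t) ^ N *r (b z * (?D z t - ?D (s i z) t)))"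
 by (simp add: abs_of_nonneg)
 also have "... <= (LBINT z. norm (b z) * ?q z (s i z))"
 proof (rule Bochner_Integration.integral_norm_bound_integral)
 show "L1 (%z. (1 + norm t) ^ N *r (b z * (?D z t - ?D (s i z) t)))"
 using Bochner_Integration.integrable_diff[OF bD bDs] by (simp add: right_diff_distrib)
 show "norm ((1 + norm t) ^ N *r (b z * (?D z t - ?D (s i z) t))) <= norm (b z) * ?q z (s i z)" for z
 using mult_left_mono[OF qge[of t z "s i z"], of "norm (b z)"] by (simp add: norm_mult mult_ac abs_of_nonneg)
 qed (rule bq)
 finally show "(1 + norm t) ^ N * norm (partial_derivs js (\<Phi> i) t) <= (LBINT z. norm (b z) * ?q z (s i z))" .
 qed
 show "(%i. schwartz_seminorm N js (\<Phi> i)) ----> 0"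
 by (rule tendsto_sandwich[OF _ _ tendsto_const lim]) (use le schwartz_seminorm_nonneg[OF \<Phi>S] in auto)
 qed
 have TP: "T (\<Phi> i) = T ph - (LBINT z. b z * T (E (s i z)))" for i
 proof -
 have "T (\<Phi> i) = T ph - T (%t. \<Sum>p\<in>range (s i). \<beta> i p * E p t)"
 unfolding \<Phi>_def by (intro tempered_diff T ph schw_sum schw_cmult S)
 also have "T (%t. \<Sum>p\<in>range (s i). \<beta> i p * E p t) = (\<Sum>p\<in>range (s i). \<beta> i p * T (E p))"
 by (intro tempered_sum T S)
 also have "... = (LBINT z. b z * T (E (s i z)))" by (rule simple)
 finally show ?thesis .
 qed
 have "(%i. T ph - T (\<Phi> i)) ----> T ph - 0" by (intro tendsto_intros lim0)
 moreover have "T ph - T (\<Phi> i) = (LBINT z. b z * T (E (s i z)))" for i by (simp only: TP) simp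
 ultimately have A: "(%i. LBINT z. b z * T (E (s i z))) ----> T ph" by simp
 have "(%i. LBINT z. b z * T (E (s i z))) ----> (LBINT z. b z * T (E z))"
 proof (rule integral_dominated_convergence[where w="%z. norm (b z) * ((CT * 2 ^ MT) * (1 + norm z) ^ MT)"])
 show "AE z in lborel. (%i. b z * T (E (s i z))) ----> b z * T (E z)"
 by (intro AE_I2 tendsto_mult_left continuous_on_tendsto_compose[OF tempered_tame_continuous[of T E, OF T S tame] slim]) auto
 show "L1 (%z. norm (b z) * ((CT * 2 ^ MT) * (1 + norm z) ^ MT))"
 using integrable_mult_right[OF bi[of MT], of "CT * 2 ^ MT"] by (simp add: mult_ac)
 show "(%z. b z * T (E (s i z))) : LM" for i
 using comp_meas[of "%z. T (E z)" i] by simp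
 show "AE z in lborel. norm (b z * T (E (s i z))) <= norm (b z) * ((CT * 2 ^ MT) * (1 + norm z) ^ MT)" for i
 proof (rule AE_I2)
 fix z
 have "norm (T (E (s i z))) <= CT * (2 * (1 + norm z)) ^ MT"
 by (rule order_trans[OF CT]) (intro mult_left_mono power_mono sle CT0, auto)
 hence "norm (T (E (s i z))) <= (CT * 2 ^ MT) * (1 + norm z) ^ MT"
 by (simp only: power_mult_distrib mult.assoc)
 thus "norm (b z * T (E (s i z))) <= norm (b z) * ((CT * 2 ^ MT) * (1 + norm z) ^ MT)"
 unfolding norm_mult by (intro mult_left_mono) auto
 qed
 qed measurable
 thus "T ph = (LBINT z. b z * T (E z))" using A by (rule LIMSEQ_unique[rotated])
qed

section \<open>Reconstruction from the short-time Fourier transform\<close>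

text \<open>The integrands of the coefficients of \<open>f\<close> against windows shifted by
  \<open>x\<close>, closed under derivatives in \<open>s\<close>.\<close>

inductive_set conv_span :: "(real^'n => real^'n => complex) set" where
 base: "f : Schw ==> g : Schw ==> (%x s. f s * g (s - x)) : conv_span"
| add: "F : conv_span ==> G : conv_span ==> (%x s. F x s + G x s) : conv_span"

lemma conv_span_schwartz: "F : conv_span ==> F x : Schw"
 by (induction rule: conv_span.induct)
 (auto intro!: schw_add schw_mult[OF schw_tempgr] schw_translate)

lemma conv_span_partial_deriv: "F : conv_span ==> (%x. partial_deriv i (F x)) : conv_span"
proof (induction rule: conv_span.induct)
 case (base f g)
 have "partial_deriv i (%s. f s * g (s - x)) = (%s. partial_deriv i f s * g (s - x) + f s * partial_deriv i g (s - x))" for x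
 by (intro ext, subst partial_deriv_mult)
 (auto intro!: schw_differentiable base differentiable_translate_at simp: partial_deriv_translate)
 thus ?case
 by (simp only:) (intro conv_span.add conv_span.base base schw_partial_deriv)
next
 case (add F G)
 have "partial_deriv i (%s. F x s + G x s) = (%s. partial_deriv i (F x) s + partial_deriv i (G x) s)" for x
 by (intro ext partial_deriv_add schw_differentiable conv_span_schwartz add)
 thus ?case using add by (simp only: conv_span.add)
qed

lemma conv_span_partial_derivs: "F : conv_span ==> (%x. partial_derivs js (F x)) : conv_span"
 by (induction js) (auto intro: conv_span_partial_deriv)

text \<open>Decay in \<open>x\<close> comes from Peetre's inequality: if \<open>x\<close> is large,
  then \<open>s\<close> or \<open>s - x\<close> is large, and one of the two factors is
  small.\<close>

lemma conv_span_bound: "F : conv_span ==> EX C. ALL x s. (1 + norm x) ^ M * (1 + norm s) ^ M * norm (F x s) <= C"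
proof (induction rule: conv_span.induct)
 case (base f g)
 obtain C D where C: "C > 0" "!!x. (1 + norm x) ^ (M + M) * norm (f x) <= C"
 and D: "D > 0" "!!x. (1 + norm x) ^ M * norm (g x) <= D" using schw_bound base by metis
 have "(1 + norm x) ^ M * (1 + norm s) ^ M * norm (f s * g (s - x)) <= C * D" for x s
 proof -
 have "(1 + norm x) ^ M <= (1 + norm s) ^ M * (1 + norm (s - x)) ^ M"
 using weight_translate[of s "- (s - x)" M] norm_minus_commute[of x s] by simp
 hence "(1 + norm x) ^ M * (1 + norm s) ^ M * norm (f s * g (s - x)) \<le>
 ((1 + norm s) ^ M * (1 + norm (s - x)) ^ M) * (1 + norm s) ^ M * norm (f s * g (s - x))"
 by (intro mult_right_mono) auto
 also have "... = ((1 + norm s) ^ (M + M) * norm (f s)) * ((1 + norm (s - x)) ^ M * norm (g (s - x)))"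
 by (simp add: power_add norm_mult mult_ac)
 also have "... <= C * D" using C D by (intro mult_mono) auto
 finally show ?thesis .
 qed
 thus ?case by blast
next
 case (add F G)
 then obtain C D where C: "!!x s. (1 + norm x) ^ M * (1 + norm s) ^ M * norm (F x s) <= C"
 and D: "!!x s. (1 + norm x) ^ M * (1 + norm s) ^ M * norm (G x s) <= D" by blast
 have "(1 + norm x) ^ M * (1 + norm s) ^ M * norm (F x s + G x s) <= C + D" for x s
 proof -
 have "(1 + norm x) ^ M * (1 + norm s) ^ M * norm (F x s + G x s) \<le>
 (1 + norm x) ^ M * (1 + norm s) ^ M * norm (F x s) + (1 + norm x) ^ M * (1 + norm s) ^ M * norm (G x s)"
 unfolding distrib_left[symmetric] by (intro mult_left_mono norm_triangle_ineq) auto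
 thus ?thesis using C[of x s] D[of x s] by linarith
 qed
 thus ?case by blast
qed

text \<open>Smoothness in \<open>s\<close> becomes decay in \<open>y\<close>, and the L1 norms of
  the derivatives already decay in \<open>x\<close>; together the coefficients decay in all of phase
  space.\<close>

lemma conv_span_ft_decay:
 fixes F :: "real^'n => real^'n => complex"
 assumes F: "F : conv_span"
 shows "EX C. ALL x y. (1 + norm x) ^ M * (1 + norm y) ^ N * norm (ft (F x) y) <= C"
proof -
 let ?D = "2 * DIM(real^'n)"
 define I where "I = (LBINT s. 1 / (1 + norm (s::real^'n)) ^ ?D)"
 have "EX K. ALL x. (1 + norm x) ^ M * (LBINT s. norm (partial_derivs js (F x) s)) <= K" for js
 proof -
 obtain C where C: "!!x s. (1 + norm x) ^ (M + ?D) * (1 + norm s) ^ (M + ?D) * norm (partial_derivs js (F x) s) <= C"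
 using conv_span_bound[OF conv_span_partial_derivs[OF F, of js], of "M + ?D"] by blast
 have C0: "C >= 0" by (rule order_trans[OF _ C[of 0 0]]) simp
 have "(1 + norm x) ^ M * (LBINT s. norm (partial_derivs js (F x) s)) <= C * I" for x
 proof -
 have "(LBINT s. norm (partial_derivs js (F x) s)) <= (LBINT s. (C / (1 + norm x) ^ M) * (1 / (1 + norm (s::real^'n)) ^ ?D))"
 proof (rule integral_mono)
 show "L1 (%s. norm (partial_derivs js (F x) s))"
 by (intro integrable_norm schw_integrable schw_partial_derivs conv_span_schwartz F)
 show "L1 (%s::real^'n. (C / (1 + norm x) ^ M) * (1 / (1 + norm s) ^ ?D))"
 by (intro integrable_mult_right integrable_weight)
 fix s
 have "(1 + norm x) ^ M * (1 + norm s) ^ ?D * norm (partial_derivs js (F x) s) <= (1 + norm x) ^ (M + ?D) * (1 + norm s) ^ (M + ?D) * norm (partial_derivs js (F x) s)"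
 by (intro mult_right_mono mult_mono power_increasing) auto
 also have "... <= C" by (rule C)
 finally have "norm (partial_derivs js (F x) s) * ((1 + norm x) ^ M * (1 + norm s) ^ ?D) <= C" by (simp add: mult_ac)
 hence "norm (partial_derivs js (F x) s) <= C / ((1 + norm x) ^ M * (1 + norm s) ^ ?D)"
 by (subst pos_le_divide_eq) (auto intro!: mult_pos_pos zero_less_power add_pos_nonneg)
 thus "norm (partial_derivs js (F x) s) <= (C / (1 + norm x) ^ M) * (1 / (1 + norm s) ^ ?D)" by simp
 qed
 also have "... = (C / (1 + norm x) ^ M) * I" unfolding I_def by (rule integral_mult_right_zero)
 finally have "(1 + norm x) ^ M * (LBINT s. norm (partial_derivs js (F x) s)) <= (1 + norm x) ^ M * ((C / (1 + norm x) ^ M) * I)"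
 by (intro mult_left_mono) auto
 also have "... = C * I"
 proof -
 have "(1 + norm x) ^ M ~= 0" by (metis add_pos_nonneg norm_ge_zero power_not_zero zero_less_one less_irrefl)
 thus ?thesis by simp
 qed
 finally show ?thesis .
 qed
 thus ?thesis by blast
 qed
 then obtain K where K: "!!js x. (1 + norm x) ^ M * (LBINT s. norm (partial_derivs js (F x) s)) <= K js" by metis
 have K0: "K js >= 0" for js by (rule order_trans[OF _ K[of 0]]) (auto intro!: mult_nonneg_nonneg integral_nonneg_AE)
 define S where "S = (\<Sum>js\<in>{js :: 'n list. length js <= N}. K js)"
 have "(1 + norm x) ^ M * (1 + norm y) ^ N * norm (ft (F x) y) <= real (CARD('n) + 1) ^ N * ((1 + real CARD('n)) * S)" for x y
 proof -
 have pos: "(1 + norm x) ^ M > 0" by (intro zero_less_power add_pos_nonneg) auto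
 have "(1 + norm y) ^ N * norm (ft (F x) y) <= real (CARD('n) + 1) ^ N * ((1 + real CARD('n)) * (S / (1 + norm x) ^ M))"
 proof (rule ft_weighted_bound[OF conv_span_schwartz[OF F]])
 fix js :: "'n list" assume "length js <= N"
 hence "K js <= S" unfolding S_def using finite_lists_length_le' K0 by (intro member_le_sum) auto
 hence "(1 + norm x) ^ M * (LBINT s. norm (partial_derivs js (F x) s)) <= S" using K order_trans by blast
 thus "(LBINT s. norm (partial_derivs js (F x) s)) <= S / (1 + norm x) ^ M"
 using pos by (simp add: pos_le_divide_eq mult.commute)
 qed
 hence "(1 + norm x) ^ M * ((1 + norm y) ^ N * norm (ft (F x) y)) <= (1 + norm x) ^ M * (real (CARD('n) + 1) ^ N * ((1 + real CARD('n)) * (S / (1 + norm x) ^ M)))"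
 using pos by (intro mult_left_mono) auto
 also have "... = real (CARD('n) + 1) ^ N * ((1 + real CARD('n)) * S)" using pos by (simp add: add_nonneg_eq_0_iff)
 finally show ?thesis by (simp add: mult.assoc)
 qed
 thus ?thesis by blast
qed

text \<open>The integral of \<open>ph\<close> against the conjugate of \<open>atom g z\<close>.
  These are the weights with which atoms are superposed to recover \<open>ph\<close>.\<close>

definition dual_coef :: "(real^'n => complex) => (real^'n => complex) => (real^'n) \<times> (real^'n) => complex" where
 "dual_coef g ph z = ft (%s. ph s * g (s - fst z)) (snd z)"

lemma dual_coef_decay2:
 assumes "g : Schw" "ph : Schw"
 shows "EX C. ALL z. (1 + norm (fst z)) ^ M * (1 + norm (snd z)) ^ N * norm (dual_coef g ph z) <= C"
 using conv_span_ft_decay[OF conv_span.base[OF assms(2,1)], of M N] unfolding dual_coef_def by blast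

lemma weight_pair: "(1 + norm z) ^ M <= (1 + norm (fst z)) ^ M * (1 + norm (snd z)) ^ M"
proof -
 have "1 + norm z <= (1 + norm (fst z)) * (1 + norm (snd z))"
 proof -
 have "(1 + norm (fst z)) * (1 + norm (snd z)) = 1 + norm (fst z) + norm (snd z) + norm (fst z) * norm (snd z)"
 by (simp add: algebra_simps)
 moreover have "norm z <= norm (fst z) + norm (snd z)" using norm_Pair_le[of "fst z" "snd z"] by simp
 ultimately show ?thesis using mult_nonneg_nonneg[OF norm_ge_zero[of "fst z"] norm_ge_zero[of "snd z"]] by linarith
 qed
 hence "(1 + norm z) ^ M <= ((1 + norm (fst z)) * (1 + norm (snd z))) ^ M" by (intro power_mono) auto
 thus ?thesis by (simp add: power_mult_distrib)
qed

lemma dual_coef_decay: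
 assumes "g : Schw" "ph : Schw"
 shows "EX C. ALL z. norm (dual_coef g ph z) * (1 + norm z) ^ M <= C"
proof -
 obtain C where C: "!!z. (1 + norm (fst z)) ^ M * (1 + norm (snd z)) ^ M * norm (dual_coef g ph z) <= C"
 using dual_coef_decay2[OF assms] by blast
 have "norm (dual_coef g ph z) * (1 + norm z) ^ M <= C" for z
 using mult_left_mono[OF weight_pair[of z M] norm_ge_zero[of "dual_coef g ph z"]] C[of z] by (simp add: mult_ac)
 thus ?thesis by blast
qed

lemma dual_coef_continuous:
 assumes g: "g : Schw" and ph: "ph : Schw"
 shows "continuous_on UNIV (dual_coef g ph)"
proof -
 obtain C where C: "C > 0" "!!x. norm (g x) <= C" using schw_bounded[OF g] by metis
 have [measurable]: "g : BM" "ph : BM" using assms schw_borel by auto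
 have "continuous_on UNIV (%z. LBINT s. (ph s * g (s - fst z)) * cis (snd z \<bullet> s))"
 proof (rule continuous_on_integral_dominated[where w="%s. norm (ph s) * C"])
 show "continuous_on UNIV (%z. ph s * g (s - fst z) * cis (snd z \<bullet> s))" for s
 by (intro continuous_intros continuous_on_compose2[OF schw_continuous[OF g, of UNIV]]) auto
 show "norm (ph s * g (s - fst z) * cis (snd z \<bullet> s)) <= norm (ph s) * C" for z s
 using C by (auto simp: norm_mult intro!: mult_left_mono)
 show "L1 (%s. norm (ph s) * C)"
 by (intro integrable_mult_left integrable_norm schw_integrable ph)
 qed measurable
 thus ?thesis by (simp add: dual_coef_def[abs_def] ft_def)
qed

lemma dual_coef_weight_integrable:
 assumes "g : Schw" "ph : Schw"
 shows "L1 (%z. norm (dual_coef g ph z) * (1 + norm z) ^ M)"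
proof -
 obtain C where C: "!!z. norm (dual_coef g ph z) * (1 + norm z) ^ (M + 2 * DIM((real^'a) \<times> (real^'a))) <= C"
 using dual_coef_decay[OF assms] by blast
 have [measurable]: "dual_coef g ph : BM"
 by (intro borel_cont dual_coef_continuous assms)
 show ?thesis
 by (rule integrable_weight_bound[where C=C]) (use C in \<open>auto simp: power_add abs_mult mult.assoc abs_of_nonneg\<close>)
qed

text \<open>The power of \<open>2 * pi\<close> comes from inverting the unnormalised
  \<open>ft\<close>, the integral from averaging the squared window over all positions.\<close>

definition recon_const :: "(real^'n => complex) => real" where
 "recon_const g = (2 * pi) powr real CARD('n) * (LBINT s. (norm (g s))^2)"

lemma schw_sq_integrable:
 assumes "g : Schw"
 shows "L1 (%s. (norm (g s))^2)"
proof -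
 have "(%s. g s * cnj (g s)) : Schw"
 by (intro schw_mult schw_tempgr schw_cnj assms)
 from integrable_norm[OF schw_integrable[OF this]] show ?thesis
 by (simp add: norm_mult power2_eq_square)
qed

lemma recon_const_pos:
 assumes g: "g : Schw" and nz: "g ~= (%_. 0)"
 shows "recon_const g > 0"
proof -
 have c: "continuous_on UNIV (%s. (norm (g s))^2)" by (intro continuous_intros schw_continuous g)
 have "(LBINT s. (norm (g s))^2) ~= 0"
 proof
 assume "(LBINT s. (norm (g s))^2) = 0"
 hence "AE s in lborel. (norm (g s))^2 = 0"
 using integral_nonneg_eq_0_iff_AE[OF schw_sq_integrable[OF g]] by simp
 hence "AE s in lborel. g s = 0" by simp
 hence "AE s in lebesgue. s : {s. g s = 0}" by (simp add: AE_completion)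
 moreover have "closed {s. g s = 0}"
 by (intro closed_Collect_eq schw_continuous g continuous_on_const)
 ultimately have "g s = 0" for s using mem_closed_if_AE_lebesgue by blast
 thus False using nz by auto
 qed
 thus ?thesis
 unfolding recon_const_def using integral_ge_0_AE[where M=lborel and f="%s. (norm (g s))^2"] by (simp add: less_le)
qed

text \<open>At a fixed position the frequency integral is Fourier inversion of \<open>ph\<close>
  times the shifted window, leaving \<open>ph t\<close> times the squared modulus of the window at
  \<open>t - x\<close>; the position integral then yields the constant.\<close>

lemma atom_reconstruct0:
 assumes g: "g : Schw" and ph: "ph : Schw"
 shows "(LBINT z. dual_coef g ph z * atom g z t) = cx (recon_const g) * ph (t::real^'n)"
proof -
 have at: "tame_family (atom g)" by (intro atom_span_tame atom_in_span g)
 have [measurable]: "dual_coef g ph : BM" "(%z. atom g z t) : BM"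
 by (intro borel_cont dual_coef_continuous tame_family_continuous_param assms at)+
 obtain C M where C: "!!z t. (1 + norm t) ^ 0 * norm (atom g z t) <= C * (1 + norm z) ^ M"
 using tame_bound[OF at, of 0] by blast
 have int: "L1 (%z. dual_coef g ph z * atom g z t)"
 by (rule integrable_weight_subst[OF dual_coef_weight_integrable[OF assms, of M]]) (use C in auto)
 have "(LBINT z. dual_coef g ph z * atom g z t) = (LBINT x. (LBINT y. dual_coef g ph (x, y) * atom g (x, y) t))"
 using lborel_pair.integral_fst'[of "%z. dual_coef g ph z * atom g z t"] int by (simp add: lborel_prod)
 also have "... = (LBINT x. cx ((2 * pi) powr real CARD('n)) * ph t * cx ((norm (g (t - x)))^2))"
 proof (rule int_cong[OF refl])
 fix x
 let ?f = "%s. ph s * g (s - x)"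
 have f: "?f : Schw" by (intro schw_mult schw_tempgr schw_translate assms)
 have "(LBINT y. dual_coef g ph (x, y) * atom g (x, y) t) = (LBINT y. cnj (g (t - x)) * (ft ?f y * cis ((- t) \<bullet> y)))"
 by (intro int_cong refl) (simp add: dual_coef_def atom_def inner_commute)
 also have "... = cnj (g (t - x)) * ft (ft ?f) (- t)" by (simp add: ft_def)
 also have "... = cx ((2 * pi) powr real CARD('n)) * ph t * (g (t - x) * cnj (g (t - x)))"
 by (simp add: fourier_inversion_schwartz[OF f])
 also have "g (t - x) * cnj (g (t - x)) = cx ((norm (g (t - x)))^2)" by (rule complex_norm_square[symmetric])
 finally show "(LBINT y. dual_coef g ph (x, y) * atom g (x, y) t) = cx ((2 * pi) powr real CARD('n)) * ph t * cx ((norm (g (t - x)))^2)" .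
 qed
 also have "... = cx ((2 * pi) powr real CARD('n)) * ph t * cx (LBINT x. (norm (g (t - x)))^2)"
 by (subst integral_mult_right_zero) (simp only: integral_complex_of_real)
 also have "(LBINT x. (norm (g (t - x)))^2) = (LBINT s. (norm (g s))^2)"
 using lborel_affine_scale[of "%s. (norm (g s))^2" "-1" t] schw_borel[OF g] by simp
 finally show ?thesis by (simp add: recon_const_def mult_ac)
qed

text \<open>All derivatives are included because the superposition of atoms has to converge in every
  Schwartz seminorm before a distribution may be moved under the integral.\<close>

lemma atom_reconstruct:
 assumes g: "g : Schw" and ph: "ph : Schw"
 shows "partial_derivs js (%t. cx (recon_const g) * ph t) t = (LBINT z. dual_coef g ph z * partial_derivs js (atom g z) t)"
proof -
 let ?\<Phi> = "%t. LBINT z. dual_coef g ph z * atom g z t"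
 have [measurable]: "dual_coef g ph : BM"
 by (intro borel_cont dual_coef_continuous assms)
 have "partial_derivs js ?\<Phi> t = (LBINT z. dual_coef g ph z * partial_derivs js (atom g z) t)" for t
 proof (induction js arbitrary: t)
 case (Cons i js)
 let ?F = "%z. partial_derivs js (atom g z)"
 have F: "?F : atom_span" and dF: "(%z. partial_deriv i (?F z)) : atom_span"
 by (intro atom_span_partial_deriv atom_span_partial_derivs atom_in_span g)+
 obtain C M where C: "!!z t. (1 + norm t) ^ 0 * norm (partial_deriv i (?F z) t) <= C * (1 + norm z) ^ M"
 using tame_bound[OF atom_span_tame[OF dF], of 0] by blast
 obtain C' M' where C': "!!z t. (1 + norm t) ^ 0 * norm (?F z t) <= C' * (1 + norm z) ^ M'"
 using tame_bound[OF atom_span_tame[OF F], of 0] by blast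
 have "((%s. LBINT z. dual_coef g ph z * ?F z (t + s *r axis i 1)) has_vector_derivative
 (LBINT z. dual_coef g ph z * partial_deriv i (?F z) (t + 0 *r axis i 1))) (at 0)"
 proof (rule has_vector_derivative_integral[where w="%z. C * (norm (dual_coef g ph z) * (1 + norm z) ^ M)"])
 show "L1 (%z. dual_coef g ph z * ?F z (t + s *r axis i 1))" for s
 by (rule integrable_weight_subst[OF dual_coef_weight_integrable[OF assms, of M']])
 (use C' in \<open>auto intro!: borel_cont tame_family_continuous_param atom_span_tame F\<close>)
 show "((%s. dual_coef g ph z * ?F z (t + s *r axis i 1)) has_vector_derivative
 dual_coef g ph z * partial_deriv i (?F z) (t + s *r axis i 1)) (at s)" for s z
 by (intro has_vector_derivative_mult_right partial_deriv_has_vector_derivative atom_span_differentiable[OF F])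
 show "norm (dual_coef g ph z * partial_deriv i (?F z) (t + s *r axis i 1)) <= C * (norm (dual_coef g ph z) * (1 + norm z) ^ M)" for s z
 using mult_left_mono[OF C[of "t + s *r axis i 1" z] norm_ge_zero[of "dual_coef g ph z"]]
 by (simp add: norm_mult mult_ac)
 show "L1 (%z. C * (norm (dual_coef g ph z) * (1 + norm z) ^ M))"
 by (intro integrable_mult_right dual_coef_weight_integrable assms)
 qed
 hence "partial_deriv i (%t. LBINT z. dual_coef g ph z * ?F z t) t = (LBINT z. dual_coef g ph z * partial_deriv i (?F z) t)"
 unfolding partial_deriv_def[of i "%t. LBINT z. dual_coef g ph z * ?F z t"]
 by (simp add: vector_derivative_at)
 moreover have "partial_derivs js ?\<Phi> = (%t. LBINT z. dual_coef g ph z * ?F z t)"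
 by (rule ext) (rule Cons)
 ultimately show ?case by (simp only: partial_derivs_Cons)
 qed simp
 thus ?thesis by (simp only: atom_reconstruct0[OF assms])
qed

text \<open>The short-time Fourier transform without its constant, as one function on phase
  space.\<close>

definition voice :: "(real^'n => complex) => ('n::finite) dist => (real^'n) \<times> (real^'n) => complex" where
 "voice g T z = T (atom g z)"

lemma stft_voice: "stft g T x y = cx ((2 * pi) powr (- real CARD('n) / 2)) * voice g T (x, y :: real^'n)"
 by (simp add: stft_def voice_def bracket_def atom_def[abs_def] cis_cnj)

lemma atom_partial_derivs_tame: "g : Schw ==> tame_family (%z. partial_derivs js (atom g z))"
 by (intro atom_span_tame atom_span_partial_derivs atom_in_span)

lemma voice_continuous: "T : tempered ==> g : Schw ==> continuous_on UNIV (voice g T)"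
 unfolding voice_def[abs_def] by (intro tempered_tame_continuous schw_atom atom_partial_derivs_tame)

lemma voice_borel: "T : tempered ==> g : Schw ==> voice g T : BM"
 by (intro borel_cont voice_continuous)

lemma voice_reconstruct:
 fixes T :: "('n::finite) dist"
 assumes T: "T : tempered" and g: "g : Schw" and ph: "ph : Schw"
 shows "L1 (%z. dual_coef g ph z * voice g T z)"
 and "cx (recon_const g) * T ph = (LBINT z. dual_coef g ph z * voice g T z)"
proof -
 have b: "dual_coef g ph : BM"
 by (intro borel_cont dual_coef_continuous assms)
 note * = tempered_integral_commute[OF T schw_atom[OF g] atom_partial_derivs_tame[OF g] b
 dual_coef_weight_integrable[OF g ph] schw_cmult[OF ph] atom_reconstruct[OF g ph]]
 show "L1 (%z. dual_coef g ph z * voice g T z)"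
 unfolding voice_def by (rule *(1))
 show "cx (recon_const g) * T ph = (LBINT z. dual_coef g ph z * voice g T z)"
 unfolding voice_def using *(2) tempered_cmult[OF T ph] by simp
qed

section \<open>Square integrability and change of window\<close>

lemma ennpowr_ennreal: "0 <= a ==> ennpowr (ennreal a) r = ennreal (a powr r)"
 by (simp add: ennpowr_def)

lemma ennpowr_top: "ennpowr \<infinity> r = \<infinity>" "ennpowr top r = top"
 by (simp_all add: ennpowr_def)

lemma ennpowr_inverse:
 assumes "p > 0" shows "ennpowr (ennpowr x (1 / p)) p = x" "ennpowr (ennpowr x p) (1 / p) = x"
 using assms by (cases x; simp add: ennpowr_ennreal ennpowr_top powr_powr)+

lemma Lnorm_ennreal:
 assumes "p > 0"
 shows "Lnorm (ennreal p) M (%x. en (f x)) = ennpowr (Lpow p M f) (1 / p)"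
 using assms by (simp add: Lnorm_def Lpow_def ennpowr_ennreal)

lemma Lpow2_eq: "Lpow 2 M f = (\<integral>\<^sup>+x. ennreal ((norm (f x))^2) \<partial>M)"
 by (simp add: Lpow_def)

definition L2 :: "('a::euclidean_space => complex) => bool" where
 "L2 f \<longleftrightarrow> f : BM & Lpow 2 lborel f < \<infinity>"

definition l2norm :: "('a::euclidean_space => complex) => real" where
 "l2norm f = sqrt (enn2real (Lpow 2 lborel f))"

lemma L2_borel [measurable_dest]: "L2 f ==> f : BM"
 by (simp add: L2_def)

lemma l2norm_nonneg [simp]: "0 <= l2norm f"
 by (simp add: l2norm_def)

lemma Lpow2_l2norm: "L2 f ==> Lpow 2 lborel f = ennreal ((l2norm f)^2)"
 by (simp add: L2_def l2norm_def)

lemma L2_Lspace: "L2 f \<longleftrightarrow> f : Lspace 2"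
proof -
 have "Lnorm (ennreal 2) lborel (%x. en (f x)) = ennpowr (Lpow 2 lborel f) (1 / 2)"
 by (rule Lnorm_ennreal) simp
 hence "Lnorm 2 lborel (%x. en (f x)) = ennpowr (Lpow 2 lborel f) (1 / 2)" by simp
 moreover have "ennpowr x (1/2) < \<infinity> \<longleftrightarrow> x < \<infinity>" for x
 by (cases x) (auto simp: ennpowr_ennreal ennpowr_top)
 ultimately show ?thesis by (simp add: L2_def Lspace_def)
qed

lemma Lnorm2_l2norm:
 assumes "L2 f" shows "Lnorm 2 lborel (%x. en (f x)) = ennreal (l2norm f)"
proof -
 have "Lnorm (ennreal 2) lborel (%x. en (f x)) = ennpowr (Lpow 2 lborel f) (1 / 2)"
 by (rule Lnorm_ennreal) simp
 thus ?thesis by (simp add: Lpow2_l2norm[OF assms] ennpowr_ennreal powr_half_sqrt)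
qed

lemma l2norm_sq: "L2 f ==> (l2norm f)\<^sup>2 = (LBINT x. (norm (f x))^2)"
 by (subst integral_eq_nn_integral) (auto simp: l2norm_def Lpow2_eq)

lemma L2_cmult: "L2 f ==> L2 (%x. c * f x)"
 by (auto simp: L2_def Lpow_cmult ennreal_mult_less_top)

lemma l2norm_cmult: "L2 f ==> l2norm (%x. c * f x) = norm c * l2norm f"
 by (simp add: l2norm_def Lpow_cmult enn2real_mult real_sqrt_mult L2_def)

lemma L2_add: "L2 f ==> L2 h ==> L2 (%x. f x + h x)"
proof -
 assume "L2 f" "L2 h"
 hence "Lpow 2 lborel (%x. f x + h x) <= ennreal (2 powr 2) * (Lpow 2 lborel f + Lpow 2 lborel h)"
 by (intro Lpow_add) (auto simp: L2_def)
 also have "... < \<infinity>" using \<open>L2 f\<close> \<open>L2 h\<close> by (auto simp: L2_def ennreal_mult_less_top)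
 finally show "L2 (%x. f x + h x)"
 using \<open>L2 f\<close> \<open>L2 h\<close> by (auto simp: L2_def)
qed

lemma L2_diff: "L2 f ==> L2 h ==> L2 (%x. f x - h x)"
 using L2_add[of f "%x. (-1) * h x"] L2_cmult[of h "-1"] by simp

lemma L2_cnj:
 assumes "L2 f"
 shows "L2 (%x. cnj (f x))" "l2norm (%x. cnj (f x)) = l2norm f"
proof -
 have "cnj : BM"
 by (intro borel_cont continuous_intros)
 hence "(%x. cnj (f x)) : BM"
 using measurable_compose[OF L2_borel[OF assms]] by blast
 thus "L2 (%x. cnj (f x))" "l2norm (%x. cnj (f x)) = l2norm f"
 using assms by (auto simp: L2_def l2norm_def Lpow_def)
qed

lemma Cauchy_Schwarz_lborel:
 assumes f: "L2 f" and h: "L2 h"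
 shows "L1 (%x. f x * h x)" "(LNINT x. ennreal (norm (f x) * norm (h x))) <= ennreal (l2norm f * l2norm h)"
 "norm (LBINT x. f x * h x) <= l2norm f * l2norm h"
proof -
 note [measurable] = L2_borel[OF f] L2_borel[OF h]
 have "(LNINT x. en (f x) * en (h x))^2 \<le>
 (LNINT x. en (f x) ^ 2) * (LNINT x. en (h x) ^ 2)"
 by (rule Cauchy_Schwarz_nn_integral) measurable
 also have "... = ennreal ((l2norm f * l2norm h)^2)"
 using Lpow2_l2norm[OF f] Lpow2_l2norm[OF h] by (simp add: Lpow2_eq ennreal_power power_mult_distrib ennreal_mult)
 finally have le: "(LNINT x. en (f x) * en (h x))^2 <= ennreal ((l2norm f * l2norm h)^2)" .
 have "(LNINT x. en (f x) * en (h x)) <= ennreal (l2norm f * l2norm h)"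
 proof (cases "LNINT x. en (f x) * en (h x)")
 case (real r)
 hence "r\<^sup>2 <= (l2norm f * l2norm h)^2" using le by (simp add: ennreal_power)
 hence "r <= l2norm f * l2norm h" by (rule power2_le_imp_le) simp
 thus ?thesis using real by (simp add: ennreal_leI)
 next
 case top
 thus ?thesis using le by (simp add: top_power_ennreal top_unique)
 qed
 thus 2: "(LNINT x. ennreal (norm (f x) * norm (h x))) <= ennreal (l2norm f * l2norm h)"
 by (simp add: ennreal_mult)
 show i: "L1 (%x. f x * h x)"
 proof (rule integrableI_bounded)
 show "(LNINT x. en (f x * h x)) < \<infinity>"
 using le_less_trans[OF 2 ennreal_less_top] by (simp add: norm_mult)
 qed measurable
 have "en (LBINT x. f x * h x) <= (LNINT x. en (f x * h x))"
 by (rule integral_norm_bound_ennreal[OF i])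
 also have "... <= ennreal (l2norm f * l2norm h)" using 2 by (simp add: norm_mult)
 finally show "norm (LBINT x. f x * h x) <= l2norm f * l2norm h" by simp
qed

lemma l2norm_triangle:
 assumes f: "L2 f" and h: "L2 h"
 shows "l2norm (%x. f x + h x) <= l2norm f + l2norm h"
proof -
 note [measurable] = L2_borel[OF f] L2_borel[OF h]
 have "Lpow 2 lborel (%x. f x + h x) <= (LNINT x. ennreal ((norm (f x))^2) + ennreal ((norm (h x))^2) + ennreal 2 * ennreal (norm (f x) * norm (h x)))"
 unfolding Lpow2_eq
 proof (intro nn_integral_mono)
 fix x
 have "(norm (f x + h x))^2 <= (norm (f x) + norm (h x))^2" by (intro power_mono norm_triangle_ineq) auto
 hence "ennreal ((norm (f x + h x))^2) <= ennreal ((norm (f x))^2 + (norm (h x))^2 + 2 * (norm (f x) * norm (h x)))"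
 by (intro ennreal_leI) (simp add: power2_sum)
 thus "ennreal ((norm (f x + h x))^2) <= ennreal ((norm (f x))^2) + ennreal ((norm (h x))^2) + ennreal 2 * ennreal (norm (f x) * norm (h x))"
 by (simp only: ennreal_plus ennreal_mult zero_le_power2 norm_ge_zero mult_nonneg_nonneg add_nonneg_nonneg zero_le_numeral)
 qed
 also have "... = Lpow 2 lborel f + Lpow 2 lborel h + ennreal 2 * (LNINT x. ennreal (norm (f x) * norm (h x)))"
 unfolding Lpow2_eq by (simp add: nn_integral_add nn_integral_cmult)
 also have "... <= ennreal ((l2norm f)^2) + ennreal ((l2norm h)^2) + ennreal 2 * ennreal (l2norm f * l2norm h)"
 unfolding Lpow2_l2norm[OF f] Lpow2_l2norm[OF h] by (intro add_left_mono mult_left_mono Cauchy_Schwarz_lborel f h) auto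
 also have "... = ennreal ((l2norm f)^2 + (l2norm h)^2 + 2 * (l2norm f * l2norm h))"
 by (simp only: ennreal_plus ennreal_mult zero_le_power2 l2norm_nonneg mult_nonneg_nonneg add_nonneg_nonneg zero_le_numeral)
 also have "... = ennreal ((l2norm f + l2norm h)^2)"
 by (simp add: power2_sum mult.assoc)
 finally have "(l2norm (%x. f x + h x))^2 <= (l2norm f + l2norm h)^2"
 unfolding Lpow2_l2norm[OF L2_add[OF f h]] by simp
 thus ?thesis by (rule power2_le_imp_le) simp
qed

lemma schw_L2: "f : Schw ==> L2 f"
 using schw_sq_integrable[of f] by (auto simp: L2_def Lpow2_eq integrable_iff_bounded schw_borel)

lemma l2norm_schwartz_seminorm:
 fixes ph :: "real^'n => complex"
 shows "EX C. ALL ph:schwartz_space. l2norm (ph :: real^'n => complex) <= C * schwartz_seminorm (DIM(real^'n)) [] ph"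
proof -
 let ?d = "DIM(real^'n)"
 define I where "I = (LBINT s. 1 / (1 + norm (s::real^'n)) ^ (2 * ?d))"
 have I0: "I >= 0" unfolding I_def by (intro integral_ge_0_AE) auto
 have "l2norm ph <= sqrt I * schwartz_seminorm ?d [] ph" if ph: "ph : Schw" for ph :: "real^'n => complex"
 proof -
 let ?s = "schwartz_seminorm ?d [] ph"
 have s0: "?s >= 0" by (rule schwartz_seminorm_nonneg[OF ph])
 have "(l2norm ph)^2 = (LBINT x. (norm (ph x))^2)" by (rule l2norm_sq[OF schw_L2[OF ph]])
 also have "... <= (LBINT x. ?s\<^sup>2 * (1 / (1 + norm (x::real^'n)) ^ (2 * ?d)))"
 proof (rule integral_mono)
 show "L1 (%x. (norm (ph x))^2)" by (rule schw_sq_integrable[OF ph])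
 show "L1 (%x::real^'n. ?s\<^sup>2 * (1 / (1 + norm x) ^ (2 * ?d)))" by (intro integrable_mult_right integrable_weight)
 fix x
 have "((1 + norm x) ^ ?d * norm (ph x))^2 <= ?s\<^sup>2"
 using schwartz_seminorm_ge[OF ph, of x ?d "[]"] by (intro power_mono) auto
 hence "(norm (ph x))^2 * (1 + norm x) ^ (2 * ?d) <= ?s\<^sup>2"
 by (simp add: power_mult_distrib power_mult[symmetric] mult.commute)
 thus "(norm (ph x))^2 <= ?s\<^sup>2 * (1 / (1 + norm x) ^ (2 * ?d))"
 by (simp add: pos_le_divide_eq add_pos_nonneg)
 qed
 also have "... = (sqrt I * ?s)^2"
 unfolding integral_mult_right_zero I_def[symmetric] using I0 by (simp add: power_mult_distrib)
 finally show ?thesis by (rule power2_le_imp_le) (use s0 I0 in auto)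
 qed
 thus ?thesis by blast
qed

text \<open>The L2 norm is dominated by a single Schwartz seminorm, so an L2 bound implies the
  required sequential continuity.\<close>

lemma l2_bounded_tempered:
 fixes T :: "('n::finite) dist"
 assumes off: "!!ph. ph \<notin> schwartz_space ==> T ph = 0"
 and add: "!!ph ps. ph : Schw ==> ps : Schw ==> T (%x. ph x + ps x) = T ph + T ps"
 and cmult: "!!c ph. ph : Schw ==> T (%x. c * ph x) = c * T ph"
 and bnd: "!!ph. ph : Schw ==> norm (T ph) <= C * l2norm ph"
 shows "T : tempered"
proof -
 obtain D where D: "!!ph. ph : Schw ==> l2norm ph <= D * schwartz_seminorm (DIM(real^'n)) [] (ph :: real^'n => complex)"
 using l2norm_schwartz_seminorm by blast
 have "(%n. T (\<Phi> n)) ----> 0" if \<Phi>: "!!n. \<Phi> n : Schw" and lim: "!!N js. (%n. schwartz_seminorm N js (\<Phi> n)) ----> 0" for \<Phi> :: "nat => real^'n => complex"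
 proof (rule Lim_null_comparison)
 show "\<forall>\<^sub>F n in sequentially. norm (T (\<Phi> n)) <= \<bar>C\<bar> * (D * schwartz_seminorm (DIM(real^'n)) [] (\<Phi> n))"
 proof (rule always_eventually, rule allI)
 fix n
 have "norm (T (\<Phi> n)) <= \<bar>C\<bar> * l2norm (\<Phi> n)" by (rule order_trans[OF bnd[OF \<Phi>]]) (intro mult_right_mono, auto)
 also have "... <= \<bar>C\<bar> * (D * schwartz_seminorm (DIM(real^'n)) [] (\<Phi> n))" by (intro mult_left_mono D \<Phi>) auto
 finally show "norm (T (\<Phi> n)) <= \<bar>C\<bar> * (D * schwartz_seminorm (DIM(real^'n)) [] (\<Phi> n))" .
 qed
 show "(%n. \<bar>C\<bar> * (D * schwartz_seminorm (DIM(real^'n)) [] (\<Phi> n))) ----> 0"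
 using tendsto_mult_left[OF tendsto_mult_left[OF lim[of "DIM(real^'n)" "[]"], of D], of "\<bar>C\<bar>"] by simp
 qed
 thus ?thesis unfolding tempered_def using off add cmult by auto
qed

lemma dist_of_fun_apply: "ph : Schw ==> dist_of_fun f ph = (LBINT x. f x * ph x)"
 by (simp add: dist_of_fun_def)

lemma dist_of_fun_l2_bound: "L2 f ==> ph : Schw ==> norm (dist_of_fun f ph) <= l2norm f * l2norm ph"
 by (simp add: dist_of_fun_apply Cauchy_Schwarz_lborel schw_L2)

lemma dist_of_fun_tempered:
 assumes f: "L2 f" shows "dist_of_fun f : tempered"
proof (rule l2_bounded_tempered[where C="l2norm f"])
 note i = Cauchy_Schwarz_lborel(1)[OF f schw_L2]
 show "dist_of_fun f (%x. ph x + ps x) = dist_of_fun f ph + dist_of_fun f ps" if "ph : Schw" "ps : Schw" for ph ps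
 using that i[OF that(1)] i[OF that(2)] by (simp add: dist_of_fun_apply schw_add distrib_left)
 show "dist_of_fun f (%x. c * ph x) = c * dist_of_fun f ph" if "ph : Schw" for c ph
 using that by (simp add: dist_of_fun_apply schw_cmult mult.left_commute)
qed (use dist_of_fun_l2_bound[OF f] in \<open>auto simp: dist_of_fun_def\<close>)

text \<open>Moyal's identity as a special case of reconstruction: for the distribution given by the
  conjugate of \<open>ph\<close>, the voice is the conjugate of \<open>dual_coef g ph\<close>, so
  the reconstruction integral is an integral of squares.\<close>

lemma dual_coef_L2:
 assumes "g : Schw" "ph : Schw"
 shows "L2 (dual_coef g ph)"
 and "(l2norm (dual_coef g ph))^2 = recon_const g * (l2norm ph)^2"
proof -
 let ?T = "dist_of_fun (%x. cnj (ph x))"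
 have S: "L2 (%x. cnj (ph x))" by (intro schw_L2 schw_cnj assms)
 have T: "?T : tempered" by (rule dist_of_fun_tempered[OF S])
 have v: "voice g ?T z = cnj (dual_coef g ph z)" for z
 unfolding voice_def dual_coef_def ft_def dist_of_fun_apply[OF schw_atom[OF assms(1)]]
 by (subst int_cnj[symmetric]) (simp add: atom_def cis_cnj mult_ac)
 have m: "dual_coef g ph : BM"
 by (intro borel_cont dual_coef_continuous assms)
 have e: "dual_coef g ph z * voice g ?T z = cx ((norm (dual_coef g ph z))^2)" for z
 unfolding v by (rule complex_norm_square[symmetric])
 have i: "L1 (%z. cx ((norm (dual_coef g ph z))^2))"
 using voice_reconstruct(1)[OF T assms] unfolding e .
 hence i': "L1 (%z. (norm (dual_coef g ph z))^2)"
 using integrable_norm[OF i] by (simp add: norm_power)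
 thus s: "L2 (dual_coef g ph)"
 using m by (simp add: L2_def Lpow2_eq integrable_iff_bounded)
 have "cx (recon_const g) * ?T ph = cx (LBINT z. (norm (dual_coef g ph z))^2)"
 using voice_reconstruct(2)[OF T assms] unfolding e by (simp only: integral_complex_of_real)
 moreover have "?T ph = cx (LBINT z. (norm (ph z))^2)"
 unfolding dist_of_fun_apply[OF assms(2)] by (simp only: mult.commute[of "cnj _"] complex_norm_square[symmetric] integral_complex_of_real)
 ultimately have "cx (recon_const g * (l2norm ph)^2) = cx ((l2norm (dual_coef g ph))^2)"
 using l2norm_sq[OF s] l2norm_sq[OF schw_L2[OF assms(2)]] by simp
 thus "(l2norm (dual_coef g ph))^2 = recon_const g * (l2norm ph)^2" by (simp only: of_real_eq_iff)
qed

text \<open>Cauchy-Schwarz in phase space together with Moyal's identity for the coefficients: a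
  square integrable voice forces the distribution to be bounded in L2.\<close>

lemma voice_square_bound:
 fixes T :: "('n::finite) dist"
 assumes T: "T : tempered" and g: "g : Schw" and V: "L2 (voice g T)" and ph: "ph : Schw"
 shows "recon_const g * norm (T ph) <= l2norm (voice g T) * (sqrt (recon_const g) * l2norm ph)"
proof -
 have r: "recon_const g >= 0" unfolding recon_const_def by (intro mult_nonneg_nonneg integral_ge_0_AE) auto
 have "l2norm (dual_coef g ph) = sqrt (recon_const g) * l2norm ph"
 using dual_coef_L2(2)[OF g ph] by (metis abs_of_nonneg l2norm_nonneg real_sqrt_abs real_sqrt_mult)
 moreover have "norm (LBINT z. dual_coef g ph z * voice g T z) <= l2norm (dual_coef g ph) * l2norm (voice g T)"
 by (intro Cauchy_Schwarz_lborel dual_coef_L2 g ph V)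
 ultimately show ?thesis
 using r by (simp add: voice_reconstruct(2)[OF T g ph, symmetric] norm_mult mult_ac)
qed

lemma voice_injective:
 fixes T :: "('n::finite) dist"
 assumes T: "T : tempered" and g: "g : Schw" "g ~= (%_. 0)" and "!!z. voice g T z = 0"
 shows "T = (%_. 0)"
proof
 fix ph
 show "T ph = 0"
 proof (cases "ph : Schw")
 case True
 hence "cx (recon_const g) * T ph = 0"
 using voice_reconstruct(2)[OF T g(1) True] assms(4) by simp
 thus ?thesis using recon_const_pos[OF g] by simp
 qed (use tempered_off[OF T] in auto)
qed

text \<open>Time-frequency shifts compose up to a phase, so the modulus depends on the difference of
  the two points only. This makes the change of window a convolution in phase space.\<close>

lemma dual_coef_atom:
 assumes "g1 : Schw" "g2 : Schw"
 shows "norm (dual_coef g1 (atom g2 z') z) = norm (dual_coef g1 (%t. cnj (g2 t)) (z - z'))"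
proof -
 obtain x y x' y' where z: "z = (x, y)" "z' = (x', y')" by (metis surj_pair)
 let ?f = "%s. cis (- (y' \<bullet> s)) * cnj (g2 (s - x')) * g1 (s - x) * cis (y \<bullet> s)"
 have "dual_coef g1 (atom g2 z') z = (LBINT s. ?f s)"
 by (simp add: dual_coef_def ft_def atom_def z)
 also have "... = (LBINT s. ?f (s + x'))" by (rule lborel_integral_translate[symmetric])
 also have "... = (LBINT s. cis ((y - y') \<bullet> x') * (cnj (g2 s) * g1 (s - (x - x')) * cis ((y - y') \<bullet> s)))"
 proof (intro int_cong refl)
 fix s
 have c: "cis (- (y' \<bullet> (s + x'))) * cis (y \<bullet> (s + x')) = cis ((y - y') \<bullet> x') * cis ((y - y') \<bullet> s)"
 by (simp add: cis_mult inner_add_right inner_diff_left algebra_simps)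
 have a: "s + x' - x = s - (x - x')" by simp
 have "?f (s + x') = cnj (g2 s) * g1 (s - (x - x')) * (cis (- (y' \<bullet> (s + x'))) * cis (y \<bullet> (s + x')))"
 by (simp add: a[symmetric] mult_ac)
 thus "?f (s + x') = cis ((y - y') \<bullet> x') * (cnj (g2 s) * g1 (s - (x - x')) * cis ((y - y') \<bullet> s))"
 unfolding c by (simp add: mult_ac)
 qed
 also have "... = cis ((y - y') \<bullet> x') * dual_coef g1 (%t. cnj (g2 t)) (z - z')"
 by (simp add: dual_coef_def ft_def z)
 finally show ?thesis by (simp add: norm_mult)
qed

text \<open>The product form makes the kernel integrable over phase space and also over frequencies
  alone, uniformly in the position.\<close>

definition pair_weight :: "(real^'n) \<times> (real^'n) => real" where
 "pair_weight z = 1 / (1 + norm (fst z)) ^ (2 * DIM(real^'n)) * (1 / (1 + norm (snd z)) ^ (2 * DIM(real^'n)))"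

lemma pair_weight_borel [measurable]: "pair_weight : BM"
 unfolding pair_weight_def[abs_def]
 by (intro borel_cont continuous_intros) (auto simp: add_nonneg_eq_0_iff)

lemma weight_le_one: "1 / (1 + norm x) ^ m <= 1"
 by (subst divide_le_eq_1_pos) (auto intro!: one_le_power zero_less_power add_pos_nonneg)

lemma pair_weight_bounds: "0 <= pair_weight z" "pair_weight z <= 1" "pair_weight (z - z') = pair_weight (z' - z)"
proof -
 show "0 <= pair_weight z" by (simp add: pair_weight_def)
 show "pair_weight z <= 1" unfolding pair_weight_def by (intro mult_le_one weight_le_one) auto
 show "pair_weight (z - z') = pair_weight (z' - z)"
 by (simp add: pair_weight_def norm_minus_commute)
qed

lemma pair_weight_integral:
 obtains K where "K > 0" "!!z::(real^'n) \<times> (real^'n). (LNINT z'. ennreal (pair_weight (z' - z))) <= ennreal K"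
 "!!x y. (LNINT y'. ennreal (pair_weight (x, y' - y :: real^'n))) <= ennreal K"
proof -
 define J where "J = (LBINT x. 1 / (1 + norm (x::real^'n)) ^ (2 * DIM(real^'n)))"
 have J0: "J >= 0" unfolding J_def by (intro integral_ge_0_AE) auto
 have nJ: "(LNINT x. ennreal (1 / (1 + norm (x::real^'n)) ^ (2 * DIM(real^'n)))) = ennreal J"
 unfolding J_def by (intro nn_integral_eq_integral integrable_weight) auto
 have nJ': "(LNINT x. ennreal (1 / (1 + norm (x - a :: real^'n)) ^ (2 * DIM(real^'n)))) = ennreal J" for a
 using nn_translate[of "%x. ennreal (1 / (1 + norm (x::real^'n)) ^ (2 * DIM(real^'n)))" "- a"] nJ by simp
 have y: "(LNINT y'. ennreal (pair_weight (x, y' - y :: real^'n))) = ennreal (1 / (1 + norm x) ^ (2 * DIM(real^'n))) * ennreal J" for x y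
 unfolding nJ'[of y, symmetric] by (subst nn_integral_cmult[symmetric]) (auto simp: pair_weight_def ennreal_mult[symmetric])
 show thesis
 proof (rule that[of "J + J * J + 1"])
 show "J + J * J + 1 > 0" using J0 by (simp add: add_nonneg_pos)
 show "(LNINT y'. ennreal (pair_weight (x, y' - y :: real^'n))) <= ennreal (J + J * J + 1)" for x y
 proof -
 have "1 / (1 + norm x) ^ (2 * DIM(real^'n)) * J <= 1 * J"
 by (intro mult_right_mono J0 weight_le_one)
 thus ?thesis unfolding y using J0 by (simp add: ennreal_leI add_increasing2 flip: ennreal_mult)
 qed
 fix z :: "(real^'n) \<times> (real^'n)"
 have m: "(%z'. ennreal (pair_weight (z' - z))) : BM" by measurable
 have "(LNINT z'. ennreal (pair_weight (z' - z))) = (LNINT x. (LNINT y. ennreal (pair_weight (x - fst z, y - snd z))))"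
 by (subst nn_integral_lborel_pair(1)[OF m]) (simp add: minus_prod_def)
 also have "... = (LNINT x. ennreal (1 / (1 + norm (x - fst z)) ^ (2 * DIM(real^'n))) * ennreal J)"
 by (simp only: y)
 also have "... = ennreal J * ennreal J" by (subst nn_integral_multc) (auto simp: nJ'[simplified])
 also have "... <= ennreal (J + J * J + 1)" using J0 by (simp add: ennreal_leI flip: ennreal_mult)
 finally show "(LNINT z'. ennreal (pair_weight (z' - z))) <= ennreal (J + J * J + 1)" .
 qed
qed

text \<open>Applying the reconstruction with window \<open>g1\<close> to the test function
  \<open>atom g2 z'\<close> shows the new voice as an integral of the old one against a rapidly
  decaying kernel in \<open>z - z'\<close>; \<open>kernel_power\<close> moves the power inside. Sup
  bounds, norm equivalence and slice bounds all follow from this one estimate.\<close>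

lemma voice_change_window:
 assumes g1: "g1 : Schw" "g1 ~= (%_. 0)" and g2: "g2 : Schw" and p: "1 <= p"
 shows "\<exists>C>0. ALL T:(tempered :: ('n::finite) dist set). ALL z'. ennreal (norm (voice g2 T z') powr p) \<le>
 ennreal C * (LNINT z. ennreal (norm (voice g1 T z) powr p * pair_weight (z - z')))"
proof -
 let ?c = "recon_const g1"
 have c: "?c > 0" by (rule recon_const_pos[OF g1])
 obtain D where D: "!!z. (1 + norm (fst z)) ^ (2 * DIM(real^'n)) * (1 + norm (snd z)) ^ (2 * DIM(real^'n)) * norm (dual_coef g1 (%t. cnj (g2 t)) z) <= D"
 using dual_coef_decay2[OF g1(1) schw_cnj[OF g2]] by blast
 define B where "B = \<bar>D\<bar> / ?c + 1"
 have B: "B > 0" unfolding B_def using c by (simp add: add_nonneg_pos)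
 have kb: "norm (dual_coef g1 (%t. cnj (g2 t)) z) / ?c <= B * pair_weight z" for z
 proof -
 have pos: "(1 + norm (fst z)) ^ (2 * DIM(real^'n)) * (1 + norm (snd z)) ^ (2 * DIM(real^'n)) > 0"
 by (intro mult_pos_pos zero_less_power add_pos_nonneg) auto
 have "norm (dual_coef g1 (%t. cnj (g2 t)) z) <= D * pair_weight z"
 using D[of z] pos unfolding pair_weight_def by (simp add: pos_le_divide_eq mult_ac)
 also have "... <= \<bar>D\<bar> * pair_weight z" by (intro mult_right_mono pair_weight_bounds) auto
 finally have "norm (dual_coef g1 (%t. cnj (g2 t)) z) / ?c <= \<bar>D\<bar> * pair_weight z / ?c"
 using c by (intro divide_right_mono) auto
 also have "... <= B * pair_weight z" unfolding B_def using pair_weight_bounds(1)[of z] by (simp add: distrib_right)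
 finally show ?thesis .
 qed
 obtain K where K: "K > 0" "!!z::(real^'n) \<times> (real^'n). (LNINT z'. ennreal (pair_weight (z' - z))) <= ennreal K"
 "!!x y. (LNINT y'. ennreal (pair_weight (x, y' - y :: real^'n))) <= ennreal K"
 using pair_weight_integral by blast
 let ?C = "2 powr p * (B * K) powr (p - 1) * B"
 have "ennreal (norm (voice g2 T z') powr p) <= ennreal ?C * (LNINT z. ennreal (norm (voice g1 T z) powr p * pair_weight (z - z')))"
 if T: "T : tempered" for T :: "'n dist" and z'
 proof -
 note [measurable] = voice_borel[OF T g1(1)]
 have a: "atom g2 z' : Schw" by (rule schw_atom[OF g2])
 have "norm (voice g2 T z') = norm (LBINT z. dual_coef g1 (atom g2 z') z * voice g1 T z) / ?c"
 using c by (simp add: voice_reconstruct(2)[OF T g1(1) a, symmetric] norm_mult voice_def[of g2])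
 hence "en (voice g2 T z') = en (LBINT z. dual_coef g1 (atom g2 z') z * voice g1 T z) * ennreal (1 / ?c)"
 using c by (simp flip: ennreal_mult)
 also have "... <= (LNINT z. en (dual_coef g1 (atom g2 z') z * voice g1 T z)) * ennreal (1 / ?c)"
 by (intro mult_right_mono integral_norm_bound_ennreal voice_reconstruct(1) T g1(1) a) auto
 also have "... = (LNINT z. en (dual_coef g1 (atom g2 z') z * voice g1 T z) * ennreal (1 / ?c))"
 by (subst nn_integral_multc) (auto intro!: borel_cont continuous_on_norm continuous_on_mult
 dual_coef_continuous voice_continuous g1 a T)
 also have "... <= (LNINT z. ennreal (norm (voice g1 T z) * (B * pair_weight (z - z'))))"
 proof (intro nn_integral_mono)
 fix z
 have "norm (dual_coef g1 (atom g2 z') z * voice g1 T z) * (1 / ?c) <= norm (voice g1 T z) * (B * pair_weight (z - z'))"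
 using mult_left_mono[OF kb[of "z - z'"] norm_ge_zero[of "voice g1 T z"]]
 by (simp add: norm_mult dual_coef_atom[OF g1(1) g2] mult_ac)
 thus "en (dual_coef g1 (atom g2 z') z * voice g1 T z) * ennreal (1 / ?c) <= ennreal (norm (voice g1 T z) * (B * pair_weight (z - z')))"
 using c by (simp add: ennreal_leI flip: ennreal_mult)
 qed
 finally have h: "en (voice g2 T z') <= (LNINT z. ennreal (norm (voice g1 T z) * (B * pair_weight (z - z'))))" .
 have kK: "(LNINT z. ennreal (B * pair_weight (z - z'))) <= ennreal (B * K)"
 proof -
 have "(LNINT z. ennreal (B * pair_weight (z - z'))) = ennreal B * (LNINT z. ennreal (pair_weight (z - z')))"
 by (subst nn_integral_cmult[symmetric], measurable) (simp add: ennreal_mult[OF less_imp_le[OF B] pair_weight_bounds(1)])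
 also have "... <= ennreal B * ennreal K" by (intro mult_left_mono K) auto
 finally show ?thesis using B K(1) by (simp add: ennreal_mult)
 qed
 have "ennreal (norm (voice g2 T z') powr p) <= ennreal (2 powr p * (B * K) powr (p - 1)) * (LNINT z. ennreal (norm (voice g1 T z) powr p * (B * pair_weight (z - z'))))"
 proof (rule kernel_power[OF p _ norm_ge_zero _ _ norm_ge_zero _ kK h])
 show "0 < B * K" using B K(1) by simp
 show "0 <= B * pair_weight (z - z')" for z by (intro mult_nonneg_nonneg less_imp_le[OF B] pair_weight_bounds(1))
 qed measurable
 also have "(LNINT z. ennreal (norm (voice g1 T z) powr p * (B * pair_weight (z - z')))) = ennreal B * (LNINT z. ennreal (norm (voice g1 T z) powr p * pair_weight (z - z')))"
 proof -
 have "ennreal (norm (voice g1 T z) powr p * (B * pair_weight (z - z'))) = ennreal B * ennreal (norm (voice g1 T z) powr p * pair_weight (z - z'))" for z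
 by (subst ennreal_mult[symmetric]) (simp_all add: less_imp_le[OF B] pair_weight_bounds(1) mult_ac)
 thus ?thesis by (simp add: nn_integral_cmult)
 qed
 finally show ?thesis using B by (simp add: mult.assoc ennreal_mult)
 qed
 moreover have "?C > 0" using B K(1) by simp
 ultimately show ?thesis by blast
qed

section \<open>Modulation spaces\<close>

text \<open>For equal exponents the iterated norm is a single integral over phase space. The
  associated \<open>Mnorm\<close> omits the constant of \<open>stft\<close>, which
  \<open>mod_space_Mspace\<close> restores.\<close>

definition Mspace :: "real => (real^'n => complex) => ('n::finite) dist set" where
 "Mspace p g = {T : tempered. Lpow p lborel (voice g T) < \<infinity>}"

definition Mnorm :: "real => (real^'n => complex) => ('n::finite) dist => real" where
 "Mnorm p g T = enn2real (Lpow p lborel (voice g T)) powr (1 / p)"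

lemma Mspace_tempered: "T : Mspace p g ==> T : tempered"
 by (simp add: Mspace_def)

lemma Mnorm_nonneg [simp]: "0 <= Mnorm p g T"
 by (simp add: Mnorm_def)

lemma Lpow_Mnorm: "T : Mspace p g ==> 1 <= p ==> Lpow p lborel (voice g T) = ennreal (Mnorm p g T powr p)"
 by (simp add: Mspace_def Mnorm_def powr_powr)

lemma Mnorm_leI:
 assumes "Lpow p lborel (voice g T) <= ennreal (c powr p)" "0 <= c" "1 <= p"
 shows "Mnorm p g T <= c"
proof -
 have "enn2real (Lpow p lborel (voice g T)) <= c powr p" using assms by (intro enn2real_leI) auto
 hence "Mnorm p g T <= (c powr p) powr (1 / p)" unfolding Mnorm_def using assms by (intro powr_mono2) auto
 thus ?thesis using assms by (simp add: powr_powr)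
qed

lemma mod_norm_voice:
 fixes T :: "('n::finite) dist"
 assumes T: "T : tempered" and g: "g : Schw" and p: "1 <= p"
 defines "c \<equiv> (2 * pi) powr (- real CARD('n) / 2)"
 shows "mod_norm g (ennreal p) (ennreal p) T = ennpowr (ennreal (c powr p) * Lpow p lborel (voice g T)) (1 / p)"
proof -
 note [measurable] = voice_borel[OF T g]
 have c: "c > 0" by (simp add: c_def)
 let ?h = "%z. ennreal (norm (voice g T z) powr p)"
 have m: "?h : BM" by measurable
 have inner: "Lpow p lborel (%x. stft g T x y) = ennreal (c powr p) * (LNINT x. ?h (x, y))" for y
 proof -
 have "(%x. voice g T (x, y)) : BM"
 by (intro borel_comp[OF voice_borel[OF T g]] continuous_intros)
 hence "Lpow p lborel (%x. cx c * voice g T (x, y)) = ennreal (c powr p) * Lpow p lborel (%x. voice g T (x, y))"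
 using c by (subst Lpow_cmult) auto
 thus ?thesis by (simp add: stft_voice c_def Lpow_def)
 qed
 have my: "(%y. LNINT x. ?h (x, y)) : LM"
 proof -
 have "(%(y, x). ?h (x, y)) : borel_measurable (lborel \<Otimes>\<^sub>M lborel)"
 using borel_comp[OF m, of "%z. (snd z, fst z)"]
 by (simp add: lborel_prod case_prod_beta' continuous_on_Pair continuous_on_fst continuous_on_snd continuous_on_id)
 thus ?thesis by (rule lborel.borel_measurable_nn_integral)
 qed
 have "mod_norm g (ennreal p) (ennreal p) T = Lnorm (ennreal p) lborel (%y. ennpowr (Lpow p lborel (%x. stft g T x y)) (1 / p))"
 using p by (simp add: mod_norm_def Lnorm_ennreal)
 also have "... = ennpowr (LNINT y. Lpow p lborel (%x. stft g T x y)) (1 / p)"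
 using p by (simp add: Lnorm_def ennpowr_inverse)
 also have "(LNINT y. Lpow p lborel (%x. stft g T x y)) = ennreal (c powr p) * (LNINT y. (LNINT x. ?h (x, y)))"
 unfolding inner by (rule nn_integral_cmult[OF my])
 also have "(LNINT y. (LNINT x. ?h (x, y))) = Lpow p lborel (voice g T)"
 unfolding Lpow_def by (rule nn_integral_lborel_pair(2)[OF m, symmetric])
 finally show ?thesis .
qed

lemma mod_space_Mspace:
 fixes g :: "real^'n => complex"
 assumes g: "g : Schw" and p: "1 <= p"
 shows "mod_space g (ennreal p) (ennreal p) = Mspace p g"
 and "T : Mspace p g ==> mod_norm g (ennreal p) (ennreal p) T = ennreal ((2 * pi) powr (- real CARD('n) / 2) * Mnorm p g T)"
proof -
 let ?c = "(2 * pi) powr (- real CARD('n) / 2)"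
 have c: "?c > 0" by simp
 have fin: "ennpowr (ennreal (?c powr p) * x) (1 / p) < \<infinity> \<longleftrightarrow> x < \<infinity>" for x
 using c by (cases x) (auto simp: ennpowr_ennreal ennpowr_top ennreal_mult_top simp flip: ennreal_mult)
 show "mod_space g (ennreal p) (ennreal p) = Mspace p g"
 unfolding mod_space_def Mspace_def using mod_norm_voice[OF _ g p] fin by auto
 show "mod_norm g (ennreal p) (ennreal p) T = ennreal (?c * Mnorm p g T)" if T: "T : Mspace p g"
 using p c Lpow_Mnorm[OF T p]
 by (simp add: mod_norm_voice[OF Mspace_tempered[OF T] g p] ennpowr_ennreal powr_mult powr_powr flip: ennreal_mult)
qed

lemma tempered_lincomb:
 assumes "S : tempered" "T : tempered"
 shows "(%ph. a * S ph + b * T ph) : tempered"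
proof -
 have "(%n. a * S (\<Phi> n) + b * T (\<Phi> n)) ----> 0"
 if "!!n. \<Phi> n : Schw" "!!N js. (%n. schwartz_seminorm N js (\<Phi> n)) ----> 0" for \<Phi>
 using tendsto_add[OF tendsto_mult_right_zero[OF tempered_seq[OF assms(1) that], of a] tendsto_mult_right_zero[OF tempered_seq[OF assms(2) that], of b]]
 by simp
 thus ?thesis
 unfolding tempered_def
 by (auto simp: tempered_off assms tempered_add[OF assms(1)] tempered_add[OF assms(2)] tempered_cmult[OF assms(1)] tempered_cmult[OF assms(2)] algebra_simps)
qed

lemma voice_lincomb: "voice g (%ph. a * S ph + b * T ph) z = a * voice g S z + b * voice g T z"
 by (simp add: voice_def)

lemma Mspace_lincomb:
 assumes S: "S : Mspace p g" and T: "T : Mspace p g" and g: "g : Schw" and p: "1 <= p"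
 shows "(%ph. a * S ph + b * T ph) : Mspace p g"
proof -
 note [measurable] = voice_borel[OF Mspace_tempered[OF S] g] voice_borel[OF Mspace_tempered[OF T] g]
 have "Lpow p lborel (%z. a * voice g S z + b * voice g T z) <= ennreal (2 powr p) * (Lpow p lborel (%z. a * voice g S z) + Lpow p lborel (%z. b * voice g T z))"
 by (rule Lpow_add) (use p in auto)
 also have "... < \<infinity>" using S T by (simp add: Lpow_cmult Mspace_def ennreal_mult_less_top)
 finally show ?thesis
 using tempered_lincomb[OF Mspace_tempered[OF S] Mspace_tempered[OF T]] by (simp add: Mspace_def voice_lincomb[abs_def])
qed

lemma Mspace_diff:
 assumes "S : Mspace p g" "T : Mspace p g" "g : Schw" "1 <= p"
 shows "(%ph. S ph - T ph) : Mspace p g"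
 using Mspace_lincomb[OF assms, of 1 "-1"] by simp

lemma Mspace_cmult:
 assumes "T : Mspace p g" "g : Schw" "1 <= p"
 shows "(%ph. c * T ph) : Mspace p g"
 using Mspace_lincomb[OF assms(1) assms(1) assms(2,3), of c 0] by simp

lemma Mspace_zero: "1 <= p ==> (%_. 0) : Mspace p g"
 by (simp add: Mspace_def tempered_def voice_def Lpow_def)

lemma Mspace_sum:
 assumes "!!i. i : I ==> T i : Mspace p g" "g : Schw" "1 <= p"
 shows "(%ph. \<Sum>i\<in>I. c i * T i ph) : Mspace p g"
 using assms(1)
proof (induction I rule: infinite_finite_induct)
 case (insert x F)
 thus ?case using Mspace_lincomb[of "T x" p g "%ph. \<Sum>i\<in>F. c i * T i ph" "c x" 1] assms by simp
qed (use assms Mspace_zero in auto)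

lemma Mnorm_cmult:
 assumes "T : Mspace p g" "g : Schw" "1 <= p"
 shows "Mnorm p g (%ph. c * T ph) = norm c * Mnorm p g T"
proof -
 have "Lpow p lborel (voice g (%ph. c * T ph)) = ennreal (norm c powr p) * Lpow p lborel (voice g T)"
 using Lpow_cmult[of "voice g T" lborel p c] voice_borel[OF Mspace_tempered[OF assms(1)] assms(2)]
 by (simp add: voice_def[abs_def])
 thus ?thesis using assms by (simp add: Mnorm_def enn2real_mult powr_mult powr_powr)
qed

lemma Mnorm_zero: "1 <= p ==> Mnorm p g (%_. 0) = 0"
 by (simp add: Mnorm_def voice_def Lpow_def)

lemma voice_weighted_le_Lpow:
 "(LNINT z. ennreal (norm (voice g1 T z) powr p * pair_weight (z - z'))) <= Lpow p lborel (voice g1 T)"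
 unfolding Lpow_def by (intro nn_integral_mono ennreal_leI mult_left_le pair_weight_bounds(2) powr_ge_zero)

lemma voice_sup_bound:
 assumes g1: "g1 : Schw" "g1 ~= (%_. 0)" and g2: "g2 : Schw" and p: "1 <= p"
 shows "\<exists>C>0. ALL T:Mspace p g1. ALL z. norm (voice g2 T z) <= C * Mnorm p g1 (T :: ('n::finite) dist)"
proof -
 obtain C where C: "C > 0" and star: "!!T z'. T : (tempered :: 'n dist set) ==> ennreal (norm (voice g2 T z') powr p) \<le>
 ennreal C * (LNINT z. ennreal (norm (voice g1 T z) powr p * pair_weight (z - z')))"
 using voice_change_window[OF assms] by blast
 have "norm (voice g2 T z) <= C powr (1/p) * Mnorm p g1 T" if T: "T : Mspace p g1" for T :: "'n dist" and z
 proof -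
 have "ennreal (norm (voice g2 T z) powr p) <= ennreal C * Lpow p lborel (voice g1 T)"
 by (rule order_trans[OF star[OF Mspace_tempered[OF T]]]) (intro mult_left_mono voice_weighted_le_Lpow, simp)
 also have "... = ennreal (C * Mnorm p g1 T powr p)" using C by (simp add: Lpow_Mnorm[OF T p] ennreal_mult)
 finally have "norm (voice g2 T z) powr p <= C * Mnorm p g1 T powr p" using C by simp
 hence "(norm (voice g2 T z) powr p) powr (1/p) <= (C * Mnorm p g1 T powr p) powr (1/p)"
 using p by (intro powr_mono2) auto
 thus ?thesis using p C by (simp add: powr_powr powr_mult)
 qed
 thus ?thesis using C by (intro exI[of _ "C powr (1/p)"]) auto
qed

text \<open>The window estimate is integrated along a map \<open>h\<close> into phase space, with
  Tonelli. The identity gives the full norm, and \<open>y \<mapsto> (x, y)\<close> gives the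
  frequency slices at one position.\<close>

lemma voice_Lpow_bound:
 assumes g1: "g1 : Schw" "g1 ~= (%_. 0)" and g2: "g2 : Schw" and p: "1 <= p"
 shows "\<exists>C>0. ALL T:(tempered :: ('n::finite) dist set). Lpow p lborel (voice g2 T) <= ennreal C * Lpow p lborel (voice g1 T)
 & (ALL x. (LNINT y. ennreal (norm (voice g2 T (x, y)) powr p)) <= ennreal C * Lpow p lborel (voice g1 T))"
proof -
 obtain C where C: "C > 0" and star: "!!T z'. T : (tempered :: 'n dist set) ==> ennreal (norm (voice g2 T z') powr p) \<le>
 ennreal C * (LNINT z. ennreal (norm (voice g1 T z) powr p * pair_weight (z - z')))"
 using voice_change_window[OF assms] by blast
 obtain K where K: "K > 0" "!!z::(real^'n) \<times> (real^'n). (LNINT z'. ennreal (pair_weight (z' - z))) <= ennreal K"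
 "!!x y. (LNINT y'. ennreal (pair_weight (x, y' - y :: real^'n))) <= ennreal K"
 using pair_weight_integral by blast
 have A: "Lpow p lborel (voice g2 T) <= ennreal (C * K) * Lpow p lborel (voice g1 T)"
 and B: "(LNINT y. ennreal (norm (voice g2 T (x, y)) powr p)) <= ennreal (C * K) * Lpow p lborel (voice g1 T)"
 if T: "T : tempered" for T :: "'n dist" and x :: "real^'n"
 proof -
 note [measurable] = voice_borel[OF T g1(1)]
 let ?V = "%z. ennreal (norm (voice g1 T z) powr p)"
 have gen: "(LNINT a. ennreal (norm (voice g2 T (h a)) powr p)) <= ennreal (C * K) * Lpow p lborel (voice g1 T)"
 if h[measurable]: "h : BM" and hK: "!!z. (LNINT a. ennreal (pair_weight (z - h a))) <= ennreal K"
 for h :: "'z::euclidean_space => (real^'n) \<times> (real^'n)"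
 proof -
 have "(LNINT a. ennreal (norm (voice g2 T (h a)) powr p)) <= (LNINT a. ennreal C * (LNINT z. ?V z * ennreal (pair_weight (z - h a))))"
 by (intro nn_integral_mono) (simp only: ennreal_mult[OF powr_ge_zero pair_weight_bounds(1), symmetric], rule star[OF T])
 also have "... = ennreal C * (LNINT a. (LNINT z. ?V z * ennreal (pair_weight (z - h a))))"
 by (rule nn_integral_cmult) measurable
 also have "(LNINT a. (LNINT z. ?V z * ennreal (pair_weight (z - h a))))
 = (LNINT z. (LNINT a. ?V z * ennreal (pair_weight (z - h a))))"
 by (rule lborel_pair.Fubini') measurable
 also have "... = (LNINT z. ?V z * (LNINT a. ennreal (pair_weight (z - h a))))"
 by (intro nn_integral_cong nn_integral_cmult) measurable
 also have "... <= (LNINT z. ?V z * ennreal K)" by (intro nn_integral_mono mult_left_mono hK) auto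
 also have "... = Lpow p lborel (voice g1 T) * ennreal K" unfolding Lpow_def by (rule nn_integral_multc) measurable
 finally have "(LNINT a. ennreal (norm (voice g2 T (h a)) powr p)) <= ennreal C * (Lpow p lborel (voice g1 T) * ennreal K)"
 by (simp add: mult_left_mono)
 thus ?thesis using C K(1) by (simp add: ennreal_mult mult_ac)
 qed
 have hz: "(LNINT a. ennreal (pair_weight (z - a))) <= ennreal K" for z :: "(real^'n) \<times> (real^'n)"
 using K(2)[of z] by (simp only: pair_weight_bounds(3)[of z])
 show "Lpow p lborel (voice g2 T) <= ennreal (C * K) * Lpow p lborel (voice g1 T)"
 unfolding Lpow_def[of p lborel "voice g2 T"]
 by (rule gen[of "%z. z", OF _ hz]) simp
 have hx: "(LNINT y. ennreal (pair_weight (z - (x, y)))) <= ennreal K" for z :: "(real^'n) \<times> (real^'n)"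
 using K(3)[of "x - fst z" "snd z"] by (simp only: pair_weight_bounds(3)[of z]) (simp add: minus_prod_def)
 show "(LNINT y. ennreal (norm (voice g2 T (x, y)) powr p)) <= ennreal (C * K) * Lpow p lborel (voice g1 T)"
 by (rule gen[of "%y. (x, y)", OF _ hx]) (intro borel_cont continuous_intros)
 qed
 show ?thesis using A B C K(1) by (intro exI[of _ "C * K"]) auto
qed

lemma Mspace_change_window:
 assumes g1: "g1 : Schw" "g1 ~= (%_. 0)" and g2: "g2 : Schw" and p: "1 <= p"
 shows "\<exists>C>0. ALL T:Mspace p g1. T : Mspace p g2 & Mnorm p g2 T <= C * Mnorm p g1 (T :: ('n::finite) dist)"
proof -
 obtain C where C: "C > 0" and le: "!!T. T : (tempered :: 'n dist set) ==> Lpow p lborel (voice g2 T) <= ennreal C * Lpow p lborel (voice g1 T)"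
 using voice_Lpow_bound[OF assms] by blast
 have "T : Mspace p g2 & Mnorm p g2 T <= C powr (1/p) * Mnorm p g1 T" if T: "T : Mspace p g1" for T :: "'n dist"
 proof
 have l: "Lpow p lborel (voice g2 T) <= ennreal C * Lpow p lborel (voice g1 T)" using le Mspace_tempered[OF T] .
 also have "... < \<infinity>" using T by (simp add: Mspace_def ennreal_mult_less_top)
 finally show "T : Mspace p g2" using T by (simp add: Mspace_def)
 have "ennreal C * Lpow p lborel (voice g1 T) = ennreal ((C powr (1/p) * Mnorm p g1 T) powr p)"
 using C p by (simp add: Lpow_Mnorm[OF T p] powr_mult powr_powr ennreal_mult)
 thus "Mnorm p g2 T <= C powr (1/p) * Mnorm p g1 T"
 using l p by (intro Mnorm_leI) auto
 qed
 thus ?thesis using C by (intro exI[of _ "C powr (1/p)"]) auto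
qed

text \<open>A voice is bounded by its own norm, so the power \<open>s\<close> splits into
  \<open>s - p\<close> factors estimated by the supremum and \<open>p\<close> factors that are
  integrated. The same splitting on slices uses the slice bound.\<close>

lemma voice_interpolate:
 assumes g: "g : Schw" "g ~= (%_. 0)" and p: "1 <= p" and s: "p <= s"
 shows "\<exists>C>0. ALL T:Mspace p g. (ALL z. norm (voice g T z) <= C * Mnorm p g T)
 & Lpow s lborel (voice g (T :: ('n::finite) dist)) <= ennreal ((C * Mnorm p g T) powr s)
 & (ALL x. (LNINT y. ennreal (norm (voice g T (x, y)) powr s)) <= ennreal ((C * Mnorm p g T) powr s))"
proof -
 obtain A where A: "A > 0" and supA: "!!T z. T : Mspace p g ==> norm (voice g (T :: 'n dist) z) <= A * Mnorm p g T"
 using voice_sup_bound[OF g g(1) p] by blast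
 obtain B where B: "B > 0" and xB: "!!T x. T : (tempered :: 'n dist set) ==>
 (LNINT y. ennreal (norm (voice g T (x, y)) powr p)) <= ennreal B * Lpow p lborel (voice g T)"
 using voice_Lpow_bound[OF g g(1) p] by blast
 \<comment> \<open>The entries serve positivity, the supremum, the phase space integral
   (\<open>D = 1\<close> in \<open>fin\<close>) and the slice integral
   (\<open>D = B\<close>).\<close>
 define C where "C = max 1 (max A (max (A powr ((s - p) / s)) (A powr ((s - p) / s) * B powr (1 / s))))"
 have C: "C >= 1" "A <= C" "A powr ((s - p) / s) <= C" "A powr ((s - p) / s) * B powr (1 / s) <= C" by (auto simp: C_def)
 have s0: "s > 0" using p s by simp
 have pw: "ennreal (norm (voice g T z) powr s) <= ennreal ((A * Mnorm p g T) powr (s - p)) * ennreal (norm (voice g T z) powr p)"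
 if T: "T : Mspace p g" for T :: "'n dist" and z
 proof -
 have "norm (voice g T z) powr s = norm (voice g T z) powr (s - p) * norm (voice g T z) powr p"
 by (simp add: powr_add[symmetric])
 also have "... <= (A * Mnorm p g T) powr (s - p) * norm (voice g T z) powr p"
 using s supA[OF T] by (intro mult_right_mono powr_mono2) auto
 finally show ?thesis by (simp add: ennreal_leI flip: ennreal_mult)
 qed
 have fin: "(A * Mnorm p g T) powr (s - p) * (D * Mnorm p g T powr p) <= (C * Mnorm p g T) powr s"
 if D: "D >= 0" "A powr ((s - p) / s) * D powr (1 / s) <= C" for T :: "'n dist" and D
 proof -
 have "(A * Mnorm p g T) powr (s - p) * (D * Mnorm p g T powr p) = (A powr (s - p) * D) * Mnorm p g T powr s"
 using A by (simp add: powr_mult powr_add[symmetric] mult_ac)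
 also have "A powr (s - p) * D = (A powr ((s - p) / s) * D powr (1 / s)) powr s"
 using s0 A D by (simp add: powr_mult powr_powr)
 also have "... <= C powr s" using D s0 A by (intro powr_mono2) auto
 finally show ?thesis using C(1) by (simp add: powr_mult mult_right_mono)
 qed
 have "Lpow s lborel (voice g T) <= ennreal ((C * Mnorm p g T) powr s)" if T: "T : Mspace p g" for T :: "'n dist"
 proof -
 note [measurable] = voice_borel[OF Mspace_tempered[OF T] g(1)]
 have "Lpow s lborel (voice g T) <= (LNINT z. ennreal ((A * Mnorm p g T) powr (s - p)) * ennreal (norm (voice g T z) powr p))"
 unfolding Lpow_def[of s] by (intro nn_integral_mono pw T)
 also have "... = ennreal ((A * Mnorm p g T) powr (s - p)) * Lpow p lborel (voice g T)"
 unfolding Lpow_def by (rule nn_integral_cmult) measurable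
 also have "... = ennreal ((A * Mnorm p g T) powr (s - p) * (1 * Mnorm p g T powr p))" by (simp add: Lpow_Mnorm[OF T p] ennreal_mult)
 also have "... <= ennreal ((C * Mnorm p g T) powr s)" by (intro ennreal_leI fin) (use C in auto)
 finally show ?thesis .
 qed
 moreover have "(LNINT y. ennreal (norm (voice g T (x, y)) powr s)) <= ennreal ((C * Mnorm p g T) powr s)"
 if T: "T : Mspace p g" for T :: "'n dist" and x
 proof -
 have m: "(%y. voice g T (x, y)) : BM"
 by (intro borel_comp[OF voice_borel[OF Mspace_tempered[OF T] g(1)]] continuous_intros)
 have "(LNINT y. ennreal (norm (voice g T (x, y)) powr s)) <= (LNINT y. ennreal ((A * Mnorm p g T) powr (s - p)) * ennreal (norm (voice g T (x, y)) powr p))"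
 by (intro nn_integral_mono pw T)
 also have "... = ennreal ((A * Mnorm p g T) powr (s - p)) * (LNINT y. ennreal (norm (voice g T (x, y)) powr p))"
 by (rule nn_integral_cmult) (use m in measurable)
 also have "... <= ennreal ((A * Mnorm p g T) powr (s - p)) * (ennreal B * Lpow p lborel (voice g T))"
 by (intro mult_left_mono xB Mspace_tempered[OF T]) auto
 also have "... = ennreal ((A * Mnorm p g T) powr (s - p) * (B * Mnorm p g T powr p))"
 using B by (simp add: Lpow_Mnorm[OF T p] ennreal_mult)
 also have "... <= ennreal ((C * Mnorm p g T) powr s)" by (intro ennreal_leI fin) (use B C in auto)
 finally show ?thesis .
 qed
 moreover have "norm (voice g T z) <= C * Mnorm p g T" if T: "T : Mspace p g" for T :: "'n dist" and z
 by (rule order_trans[OF supA[OF T]]) (intro mult_right_mono C, simp)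
 ultimately show ?thesis using C(1) by (intro exI[of _ C]) auto
qed

text \<open>Interpolation with \<open>s = 2\<close> makes the voice square integrable; the
  reconstruction constant then turns this into a bound on test values.\<close>

lemma Mspace_l2_bound:
 assumes g: "g : Schw" "g ~= (%_. 0)" and p: "1 <= p" "p <= 2"
 shows "\<exists>C>0. ALL T:Mspace p g. L2 (voice g (T :: ('n::finite) dist)) & l2norm (voice g T) <= C * Mnorm p g T
 & (ALL ph:schwartz_space. norm (T ph) <= C * Mnorm p g T * l2norm ph)"
proof -
 let ?r = "recon_const g"
 have r: "?r > 0" by (rule recon_const_pos[OF g])
 obtain C where C: "C > 0" and L: "!!T. T : Mspace p g ==> Lpow 2 lborel (voice g (T :: 'n dist)) <= ennreal ((C * Mnorm p g T) powr 2)"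
 using voice_interpolate[OF g p] by blast
 define D where "D = max C (C * sqrt ?r / ?r)"
 have D: "C <= D" "C * sqrt ?r / ?r <= D" by (auto simp: D_def)
 have "L2 (voice g T) & l2norm (voice g T) <= D * Mnorm p g T & (ALL ph:schwartz_space. norm (T ph) <= D * Mnorm p g T * l2norm ph)"
 if T: "T : Mspace p g" for T :: "'n dist"
 proof (intro conjI ballI)
 show sq: "L2 (voice g T)"
 using le_less_trans[OF L[OF T] ennreal_less_top] voice_borel[OF Mspace_tempered[OF T] g(1)] by (simp add: L2_def)
 have "(l2norm (voice g T))^2 <= (C * Mnorm p g T)^2"
 using L[OF T] C unfolding Lpow2_l2norm[OF sq] by simp
 hence l: "l2norm (voice g T) <= C * Mnorm p g T" by (rule power2_le_imp_le) (use C in simp)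
 also have "... <= D * Mnorm p g T" by (intro mult_right_mono D) auto
 finally show "l2norm (voice g T) <= D * Mnorm p g T" .
 fix ph :: "real^'n => complex" assume ph: "ph : Schw"
 have "?r * norm (T ph) <= l2norm (voice g T) * (sqrt ?r * l2norm ph)"
 by (rule voice_square_bound[OF Mspace_tempered[OF T] g(1) sq ph])
 also have "... <= (C * Mnorm p g T) * (sqrt ?r * l2norm ph)" using r by (intro mult_right_mono l) auto
 finally have "norm (T ph) <= ((C * Mnorm p g T) * (sqrt ?r * l2norm ph)) / ?r" using r by (simp add: pos_le_divide_eq mult.commute)
 also have "... = (C * sqrt ?r / ?r) * (Mnorm p g T * l2norm ph)" by simp
 also have "... <= D * (Mnorm p g T * l2norm ph)" by (intro mult_right_mono D) auto
 finally show "norm (T ph) <= D * Mnorm p g T * l2norm ph" by (simp add: mult.assoc)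
 qed
 moreover have "D > 0" using C D by linarith
 ultimately show ?thesis by blast
qed

text \<open>Test values are Cauchy because they are bounded by \<open>Mnorm\<close> times
  \<open>l2norm\<close>, and the same bound makes the pointwise limit tempered. Voices are test
  values, hence converge pointwise, and Fatou gives convergence in norm.\<close>

lemma Mspace_complete:
 fixes T :: "nat => ('n::finite) dist"
 assumes g: "g : Schw" "g ~= (%_. 0)" and p: "1 <= p" "p <= 2"
 and T: "!!n. T n : Mspace p g"
 and cauchy: "!!e. e > 0 ==> EX N. \<forall>m\<ge>N. \<forall>n\<ge>N. Mnorm p g (%ph. T m ph - T n ph) < e"
 shows "EX S:Mspace p g. (%n. Mnorm p g (%ph. T n ph - S ph)) ----> 0"
proof -
 obtain C where C: "C > 0" and bnd: "!!T ph. T : Mspace p g ==> ph : Schw ==> norm ((T :: 'n dist) ph) <= C * Mnorm p g T * l2norm ph"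
 using Mspace_l2_bound[OF g p] by blast
 have dif: "(%ph. T m ph - T n ph) : Mspace p g" for m n by (intro Mspace_diff T g p)
 have conv: "convergent (%n. T n ph)" for ph
 proof (cases "ph : Schw")
 case True
 have "Cauchy (%n. T n ph)"
 proof (rule metric_CauchyI)
 fix e :: real assume e: "e > 0"
 have pos: "C * (l2norm ph + 1) > 0" using C by (simp add: add_nonneg_pos)
 then obtain N where N: "!!m n. m >= N ==> n >= N ==> Mnorm p g (%ph. T m ph - T n ph) < e / (C * (l2norm ph + 1))"
 using cauchy[of "e / (C * (l2norm ph + 1))"] e by (metis divide_pos_pos)
 have "dist (T m ph) (T n ph) < e" if "m >= N" "n >= N" for m n
 proof -
 have "dist (T m ph) (T n ph) <= C * Mnorm p g (%ph. T m ph - T n ph) * l2norm ph"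
 unfolding dist_norm by (rule bnd[OF dif True])
 also have "... <= C * (l2norm ph + 1) * Mnorm p g (%ph. T m ph - T n ph)"
 using C by (simp add: algebra_simps)
 also have "... < C * (l2norm ph + 1) * (e / (C * (l2norm ph + 1)))"
 using pos N[OF that] by (intro mult_strict_left_mono) auto
 also have "... = e"
 using pos by (simp only: times_divide_eq_right nonzero_mult_div_cancel_left[OF less_imp_neq[OF pos, symmetric]])
 finally show ?thesis .
 qed
 thus "EX M. \<forall>m\<ge>M. \<forall>n\<ge>M. dist (T m ph) (T n ph) < e" by blast
 qed
 thus ?thesis by (simp add: Cauchy_convergent_iff)
 next
 case False
 hence "T n ph = 0" for n by (rule tempered_off[OF Mspace_tempered[OF T]])
 thus ?thesis by (simp add: convergent_const)
 qed
 define S where "S ph = lim (%n. T n ph)" for ph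
 have lim: "(%n. T n ph) ----> S ph" for ph unfolding S_def using conv convergent_LIMSEQ_iff by blast
 note temp = Mspace_tempered[OF T]
 obtain N1 where N1: "!!m n. m >= N1 ==> n >= N1 ==> Mnorm p g (%ph. T m ph - T n ph) < 1"
 using cauchy[of 1] by auto
 have St: "S : tempered"
 proof (rule l2_bounded_tempered[where C="C * Mnorm p g (T N1) + C"])
 show "S ph = 0" if "ph \<notin> schwartz_space" for ph
 using lim[of ph] tempered_off[OF temp that] LIMSEQ_unique[OF _ tendsto_const] by fastforce
 show "S (%x. ph x + ps x) = S ph + S ps" if "ph : Schw" "ps : Schw" for ph ps
 using lim[of "%x. ph x + ps x"] tendsto_add[OF lim[of ph] lim[of ps]] by (simp add: tempered_add[OF temp that] LIMSEQ_unique)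
 show "S (%x. c * ph x) = c * S ph" if "ph : Schw" for c ph
 using lim[of "%x. c * ph x"] tendsto_mult_left[OF lim[of ph], of c] by (simp add: tempered_cmult[OF temp that] LIMSEQ_unique)
 fix ph :: "real^'n => complex" assume ph: "ph : Schw"
 have "norm (T n ph) <= (C * Mnorm p g (T N1) + C) * l2norm ph" if "n >= N1" for n
 proof -
 have "norm (T n ph) <= norm (T N1 ph) + norm (T n ph - T N1 ph)" using norm_triangle_ineq[of "T N1 ph" "T n ph - T N1 ph"] by simp
 also have "... <= C * Mnorm p g (T N1) * l2norm ph + C * Mnorm p g (%ph. T n ph - T N1 ph) * l2norm ph"
 by (intro add_mono bnd[OF T ph] bnd[OF dif ph])
 also have "... <= C * Mnorm p g (T N1) * l2norm ph + C * 1 * l2norm ph"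
 using N1[OF that order_refl] C by (intro add_left_mono mult_right_mono mult_left_mono) auto
 finally show ?thesis by (simp add: distrib_right)
 qed
 thus "norm (S ph) <= (C * Mnorm p g (T N1) + C) * l2norm ph"
 by (intro LIMSEQ_le_const2[OF tendsto_norm[OF lim]]) blast
 qed
 have small: "Lpow p lborel (voice g (%ph. T n ph - S ph)) <= ennreal (e powr p)"
 if "e > 0" and N: "!!m. m >= N ==> Mnorm p g (%ph. T n ph - T m ph) < e" for e N n
 proof (rule Lpow_fatou[OF _ _ _ p(1)])
 show "voice g (%ph. T n ph - T m ph) : LM" for m
 using voice_borel[OF Mspace_tempered[OF dif] g(1)] by simp
 show "AE z in lborel. (%m. voice g (%ph. T n ph - T m ph) z) ----> voice g (%ph. T n ph - S ph) z"
 unfolding voice_def by (intro AE_I2 tendsto_intros lim)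
 show "\<forall>\<^sub>F m in sequentially. Lpow p lborel (voice g (%ph. T n ph - T m ph)) <= ennreal (e powr p)"
 using eventually_ge_at_top[of N]
 proof eventually_elim
 case (elim m)
 thus ?case unfolding Lpow_Mnorm[OF dif p(1)] using N[of m] p \<open>e > 0\<close> by (intro ennreal_leI powr_mono2) auto
 qed
 qed
 have SM: "S : Mspace p g"
 proof -
 have "Lpow p lborel (voice g (%ph. T N1 ph - S ph)) <= ennreal (1 powr p)"
 by (rule small[of 1 N1]) (use N1 in auto)
 hence fin: "Lpow p lborel (voice g (%ph. T N1 ph - S ph)) < \<infinity>" by (rule le_less_trans) simp
 have "(%ph. T N1 ph - S ph) : Mspace p g"
 using fin tempered_lincomb[OF temp[of N1] St, of 1 "-1"] by (simp add: Mspace_def)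
 from Mspace_diff[OF T this g(1) p(1), of N1] show ?thesis by simp
 qed
 have "(%n. Mnorm p g (%ph. T n ph - S ph)) ----> 0"
 proof (rule LIMSEQ_I)
 fix e :: real assume e: "e > 0"
 then obtain N where N: "!!m n. m >= N ==> n >= N ==> Mnorm p g (%ph. T m ph - T n ph) < e / 2"
 using cauchy[OF half_gt_zero[OF e]] by blast
 have "Mnorm p g (%ph. T n ph - S ph) <= e / 2" if "n >= N" for n
 by (rule Mnorm_leI[OF small[of "e/2" N]]) (use N that e p in auto)
 thus "EX no. \<forall>n\<ge>no. norm (Mnorm p g (%ph. T n ph - S ph) - 0) < e"
 using e by (intro exI[of _ N]) fastforce
 qed
 thus ?thesis using SM by blast
qed

section \<open>Hermite functions\<close>

text \<open>The physicists' Hermite polynomials, generated by differentiating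
  \<open>exp (- x\<^sup>2)\<close>.\<close>

fun herm_poly :: "nat => real poly" where
 "herm_poly 0 = 1"
| "herm_poly (Suc n) = [:0, 2:] * herm_poly n - pderiv (herm_poly n)"

lemma pderiv_herm_poly: "pderiv (herm_poly (Suc n)) = smult (2 * real (Suc n)) (herm_poly n)"
proof (induction n)
 case 0
 show ?case by (simp add: pderiv_pCons one_pCons)
next
 case (Suc n)
 have "pderiv (herm_poly (Suc (Suc n))) = smult 2 (herm_poly (Suc n)) + [:0, 2:] * pderiv (herm_poly (Suc n)) - pderiv (pderiv (herm_poly (Suc n)))"
 unfolding herm_poly.simps(2)[of "Suc n"] by (simp add: pderiv_mult pderiv_diff pderiv_pCons pderiv_smult del: herm_poly.simps)
 also have "... = smult 2 (herm_poly (Suc n)) + smult (2 * real (Suc n)) ([:0, 2:] * herm_poly n - pderiv (herm_poly n))"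
 unfolding Suc by (simp add: pderiv_smult smult_diff_right del: herm_poly.simps)
 also have "[:0, 2:] * herm_poly n - pderiv (herm_poly n) = herm_poly (Suc n)" by simp
 also have "smult 2 (herm_poly (Suc n)) + smult (2 * real (Suc n)) (herm_poly (Suc n)) = smult (2 * real (Suc (Suc n))) (herm_poly (Suc n))"
 by (simp add: smult_add_left[symmetric] algebra_simps del: herm_poly.simps)
 finally show ?case .
qed

lemma poly_gauss_deriv:
 "((%x. poly (herm_poly n) x * exp (- x\<^sup>2)) has_real_derivative - (poly (herm_poly (Suc n)) x * exp (- x\<^sup>2))) (at x)"
 by (auto intro!: derivative_eq_intros poly_DERIV simp: algebra_simps)

lemma gauss_iterated_deriv: "(deriv ^^ n) (%y::real. exp (- y\<^sup>2)) = (%x. (- 1) ^ n * (poly (herm_poly n) x * exp (- x\<^sup>2)))"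
proof (induction n)
 case (Suc n)
 show ?case
 proof
 fix x :: real
 have "((%x. (- 1) ^ n * (poly (herm_poly n) x * exp (- x\<^sup>2))) has_real_derivative (- 1) ^ n * (- (poly (herm_poly (Suc n)) x * exp (- x\<^sup>2)))) (at x)"
 by (intro DERIV_cmult poly_gauss_deriv)
 thus "(deriv ^^ Suc n) (%y. exp (- y\<^sup>2)) x = (- 1) ^ Suc n * (poly (herm_poly (Suc n)) x * exp (- x\<^sup>2))"
 by (simp add: Suc DERIV_imp_deriv)
 qed
qed simp

definition herm_const :: "nat => real" where
 "herm_const n = 1 / sqrt (sqrt pi * 2 ^ n * fact n)"

lemma hermite_fun_poly: "hermite_fun n x = herm_const n * (poly (herm_poly n) x * exp (- x\<^sup>2 / 2))"
proof -
 have e: "exp (x\<^sup>2 / 2) * exp (- x\<^sup>2) = exp (- x\<^sup>2 / 2)" by (simp add: exp_add[symmetric])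
 have "hermite_fun n x = ((- 1) ^ n * (- 1) ^ n) * herm_const n * (poly (herm_poly n) x * (exp (x\<^sup>2 / 2) * exp (- x\<^sup>2)))"
 unfolding hermite_fun_def gauss_iterated_deriv herm_const_def by simp
 thus ?thesis unfolding e by (simp add: power_mult_distrib[symmetric])
qed

lemma poly_growth: "EX C M. ALL x::real. \<bar>poly p x\<bar> <= C * (1 + \<bar>x\<bar>) ^ M"
proof (induction p)
 case 0
 show ?case by (intro exI[of _ 0]) simp
next
 case (pCons a p)
 then obtain C M where C: "!!x. \<bar>poly p x\<bar> <= C * (1 + \<bar>x\<bar>) ^ M" by blast
 have "\<bar>poly (pCons a p) x\<bar> <= (\<bar>a\<bar> + \<bar>C\<bar>) * (1 + \<bar>x\<bar>) ^ (Suc M)" for x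
 proof -
 have 1: "1 <= (1 + \<bar>x\<bar>) ^ (Suc M)" by (intro one_le_power) auto
 have "\<bar>poly (pCons a p) x\<bar> <= \<bar>a\<bar> * 1 + \<bar>x\<bar> * \<bar>poly p x\<bar>" by (simp add: abs_mult[symmetric] abs_triangle_ineq)
 also have "... <= \<bar>a\<bar> * (1 + \<bar>x\<bar>) ^ (Suc M) + (1 + \<bar>x\<bar>) * (\<bar>C\<bar> * (1 + \<bar>x\<bar>) ^ M)"
 by (intro add_mono mult_left_mono 1 mult_mono order_trans[OF C] mult_right_mono) auto
 also have "... = (\<bar>a\<bar> + \<bar>C\<bar>) * (1 + \<bar>x\<bar>) ^ (Suc M)" by (simp add: distrib_right mult_ac)
 finally show ?thesis .
 qed
 thus ?case by blast
qed

lemma poly_gauss_integrable: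
 assumes f[measurable]: "f : BM" and b: "!!t. norm (f t) <= \<bar>poly p t\<bar> * exp (- (t - a)\<^sup>2 / 2)"
 shows "L1 (f :: real => complex)"
proof -
 obtain C M where C: "!!x. \<bar>poly p x\<bar> <= C * (1 + \<bar>x\<bar>) ^ M" using poly_growth by blast
 obtain D where D: "!!u::real. u >= 0 ==> (1 + u) ^ (M + 2) * exp (- u\<^sup>2 / 2) <= D" using power_exp_bounded by metis
 show ?thesis
 proof (rule integrable_weight_bound[where C="\<bar>C\<bar> * (1 + \<bar>a\<bar>) ^ (M + 2) * D"])
 fix t :: real
 have w: "(1 + \<bar>t\<bar>) ^ (M + 2) <= (1 + \<bar>t - a\<bar>) ^ (M + 2) * (1 + \<bar>a\<bar>) ^ (M + 2)"
 using weight_translate[of "t - a" a "M + 2"] by simp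
 have "norm (f t) * (1 + \<bar>t\<bar>) ^ 2 <= (\<bar>C\<bar> * (1 + \<bar>t\<bar>) ^ M * exp (- (t - a)\<^sup>2 / 2)) * (1 + \<bar>t\<bar>) ^ 2"
 by (intro mult_right_mono order_trans[OF b] order_trans[OF C]) auto
 also have "... = \<bar>C\<bar> * (1 + \<bar>t\<bar>) ^ (M + 2) * exp (- (t - a)\<^sup>2 / 2)"
 unfolding power_add[of _ M 2] by (simp only: mult_ac)
 also have "... <= \<bar>C\<bar> * ((1 + \<bar>t - a\<bar>) ^ (M + 2) * (1 + \<bar>a\<bar>) ^ (M + 2)) * exp (- (t - a)\<^sup>2 / 2)"
 by (intro mult_right_mono mult_left_mono w) auto
 also have "... = \<bar>C\<bar> * (1 + \<bar>a\<bar>) ^ (M + 2) * ((1 + \<bar>t - a\<bar>) ^ (M + 2) * exp (- \<bar>t - a\<bar>\<^sup>2 / 2))"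
 by (simp only: mult_ac power2_abs)
 also have "... <= \<bar>C\<bar> * (1 + \<bar>a\<bar>) ^ (M + 2) * D" by (intro mult_left_mono D) auto
 finally show "norm (f t) * (1 + norm t) ^ (2 * DIM(real)) <= \<bar>C\<bar> * (1 + \<bar>a\<bar>) ^ (M + 2) * D" by simp
 qed measurable
qed

lemma poly_borel [measurable]: "(%x. poly p x) : borel_measurable (borel :: real measure)"
 by (intro borel_cont continuous_intros)

text \<open>One family for two computations: \<open>b = 0\<close> gives the inner products of
  Hermite functions, and \<open>b = x - \<i> y\<close> their pairing with a Gaussian atom at (x,
  y).\<close>

definition herm_exp :: "complex => real poly => real => complex" where
 "herm_exp b p t = exp (b * cx t) * cx (poly p t * exp (- t\<^sup>2))"

lemma herm_exp_continuous: "continuous_on A (herm_exp b p)"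
 unfolding herm_exp_def by (intro continuous_intros)

lemma herm_exp_integrable: "L1 (herm_exp b p)"
proof (rule poly_gauss_integrable[where p="smult (exp ((Re b)^2 / 2)) p" and a="Re b"])
 show "herm_exp b p : BM" by (intro borel_cont herm_exp_continuous)
 fix t
 have "Re b * t - t\<^sup>2 <= (Re b)^2 / 2 + - (t - Re b)\<^sup>2 / 2"
 using zero_le_power2[of t] by (simp add: power2_diff field_simps)
 hence "exp (Re b * t - t\<^sup>2) <= exp ((Re b)^2 / 2) * exp (- (t - Re b)\<^sup>2 / 2)"
 by (simp only: exp_le_cancel_iff exp_add[symmetric])
 hence "\<bar>poly p t\<bar> * exp (Re b * t - t\<^sup>2) <= \<bar>poly p t\<bar> * (exp ((Re b)^2 / 2) * exp (- (t - Re b)\<^sup>2 / 2))"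
 by (rule mult_left_mono) auto
 moreover have "norm (herm_exp b p t) = \<bar>poly p t\<bar> * exp (Re b * t - t\<^sup>2)"
 by (simp add: herm_exp_def norm_mult abs_mult norm_exp_eq_Re exp_diff exp_minus divide_inverse norm_inverse)
 ultimately show "norm (herm_exp b p t) <= \<bar>poly (smult (exp ((Re b)^2 / 2)) p) t\<bar> * exp (- (t - Re b)\<^sup>2 / 2)"
 by (simp add: abs_mult mult_ac)
qed

lemma integral_derivative_zero_real:
 fixes F F' :: "real => complex"
 assumes "L1 F" "L1 F'" "!!t. (F has_vector_derivative F' t) (at t)" "continuous_on UNIV F'"
 shows "(LBINT t. F' t) = 0"
proof (rule integral_directional_derivative[where v=1 and F=F])
 fix x s
 have "((%s. x + s) has_vector_derivative 1) (at s)" by (auto intro!: derivative_eq_intros)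
 from vector_diff_chain_at[OF this assms(3)]
 show "((%s. F (x + s *r 1)) has_vector_derivative F' (x + s *r 1)) (at s)" by (simp add: o_def)
qed (use assms in auto)

lemma herm_exp_deriv:
 "(herm_exp b (herm_poly n * q) has_vector_derivative
 (b * herm_exp b (herm_poly n * q) t - herm_exp b (herm_poly (Suc n) * q) t + herm_exp b (herm_poly n * pderiv q) t)) (at t)"
proof -
 have 1: "((%t. exp (b * cx t)) has_vector_derivative b * exp (b * cx t)) (at t)"
 proof -
 have "((%z. exp (b * z)) has_field_derivative b * exp (b * cx t)) (at (cx t))"
 by (auto intro!: derivative_eq_intros)
 thus ?thesis using has_vector_derivative_real_field by blast
 qed
 have 2: "((%t. poly (herm_poly n * q) t * exp (- t\<^sup>2)) has_real_derivative
 (- (poly (herm_poly (Suc n)) t * exp (- t\<^sup>2)) * poly q t + (poly (herm_poly n) t * exp (- t\<^sup>2)) * poly (pderiv q) t)) (at t)"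
 using DERIV_mult[OF poly_gauss_deriv[of n t] poly_DERIV[of q t]] by (simp add: mult_ac add.commute del: herm_poly.simps)
 have 3: "((%t. cx (poly (herm_poly n * q) t * exp (- t\<^sup>2))) has_vector_derivative
 cx (- (poly (herm_poly (Suc n)) t * exp (- t\<^sup>2)) * poly q t + (poly (herm_poly n) t * exp (- t\<^sup>2)) * poly (pderiv q) t)) (at t)"
 using 2 by (intro has_vector_derivative_of_real) (simp add: has_real_derivative_iff_has_vector_derivative)
 show ?thesis
 unfolding herm_exp_def[abs_def]
 by (rule has_vector_derivative_eq_rhs[OF has_vector_derivative_mult[OF 1 3]]) (simp add: algebra_simps del: herm_poly.simps)
qed

text \<open>Raising the index is minus a derivative of \<open>herm_poly n\<close> times the
  Gaussian; integration by parts moves it to the exponential, giving the factor \<open>b\<close>,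
  and to \<open>q\<close>.\<close>

lemma herm_exp_parts:
 "(LBINT t. herm_exp b (herm_poly (Suc n) * q) t) = b * (LBINT t. herm_exp b (herm_poly n * q) t) + (LBINT t. herm_exp b (herm_poly n * pderiv q) t)"
proof -
 have "(LBINT t. b * herm_exp b (herm_poly n * q) t - herm_exp b (herm_poly (Suc n) * q) t + herm_exp b (herm_poly n * pderiv q) t) = 0"
 by (rule integral_derivative_zero_real[OF herm_exp_integrable _ herm_exp_deriv])
 (intro Bochner_Integration.integrable_add Bochner_Integration.integrable_diff integrable_mult_right
 herm_exp_integrable continuous_intros herm_exp_continuous)+
 hence "b * (LBINT t. herm_exp b (herm_poly n * q) t) - (LBINT t. herm_exp b (herm_poly (Suc n) * q) t) + (LBINT t. herm_exp b (herm_poly n * pderiv q) t) = 0"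
 using herm_exp_integrable[of b] by (simp del: herm_poly.simps)
 thus ?thesis by (simp add: algebra_simps del: herm_poly.simps)
qed

lemma exp_cis: "exp ((cx x - \<i> * cx y) * cx t) = cx (exp (x * t)) * cis (- (y * t))"
 by (simp only: cis_conv_exp exp_of_real[symmetric] exp_add[symmetric]) (simp add: algebra_simps)

text \<open>The real part of the exponent is completed to a square by
  \<open>t = x / 2 + u / sqrt 2\<close>; the imaginary part stays as an oscillation, so the known
  Fourier integral of the Gaussian finishes the computation.\<close>

lemma herm_exp_zero: "(LBINT t. herm_exp (cx x - \<i> * cx y) 1 t)
 = cx (sqrt pi * exp (x\<^sup>2 / 4 - y\<^sup>2 / 4)) * cis (- (x * y / 2))"
proof -
 let ?b = "cx x - \<i> * cx y"
 have "(LBINT t. herm_exp ?b 1 t) = \<bar>1 / sqrt 2\<bar> ^ DIM(real) *r (LBINT u. herm_exp ?b 1 (x / 2 + (1 / sqrt 2) *r u))"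
 by (rule lborel_affine_scale) (auto intro!: borel_cont herm_exp_continuous)
 also have "(%u. herm_exp ?b 1 (x / 2 + (1 / sqrt 2) *r u)) = (%u. (cx (exp (x\<^sup>2 / 4)) * cis (- (x * y / 2))) * (cx (exp (- u\<^sup>2 / 2)) * cis (u * (- y / sqrt 2))))"
 proof
 fix u :: real
 define t where "t = x / 2 + u / sqrt 2"
 have e: "x * t - t\<^sup>2 = x\<^sup>2 / 4 + - u\<^sup>2 / 2"
 unfolding t_def by (simp add: power2_sum power_divide field_simps power2_eq_square)
 have "herm_exp ?b 1 t = cx (exp (x * t) * exp (- t\<^sup>2)) * cis (- (y * t))"
 unfolding herm_exp_def exp_cis by (simp add: mult_ac)
 also have "exp (x * t) * exp (- t\<^sup>2) = exp (x\<^sup>2 / 4) * exp (- u\<^sup>2 / 2)"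
 by (simp only: exp_add[symmetric] e[symmetric]) simp
 also have "cis (- (y * t)) = cis (- (x * y / 2)) * cis (u * (- y / sqrt 2))"
 unfolding t_def cis_mult by (simp add: algebra_simps)
 finally show "herm_exp ?b 1 (x / 2 + (1 / sqrt 2) *r u) = (cx (exp (x\<^sup>2 / 4)) * cis (- (x * y / 2))) * (cx (exp (- u\<^sup>2 / 2)) * cis (u * (- y / sqrt 2)))"
 by (simp add: t_def mult_ac)
 qed
 also have "(LBINT u. (cx (exp (x\<^sup>2 / 4)) * cis (- (x * y / 2))) * (cx (exp (- u\<^sup>2 / 2)) * cis (u * (- y / sqrt 2))))
 = (cx (exp (x\<^sup>2 / 4)) * cis (- (x * y / 2))) * cx (sqrt (2 * pi) * exp (- (- y / sqrt 2)\<^sup>2 / 2))"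
 by (subst integral_mult_right_zero) (simp only: gauss_fourier1(2))
 also have "- (- y / sqrt 2)\<^sup>2 / 2 = - (y\<^sup>2 / 4)" by (simp add: power_divide)
 finally show ?thesis
 proof -
 assume *: "(LBINT t. herm_exp ?b 1 t) = \<bar>1 / sqrt 2\<bar> ^ DIM(real) *r (cx (exp (x\<^sup>2 / 4)) * cis (- (x * y / 2)) * cx (sqrt (2 * pi) * exp (- (y\<^sup>2 / 4))))"
 have "exp (x\<^sup>2 / 4 - y\<^sup>2 / 4) = exp (x\<^sup>2 / 4) * exp (- (y\<^sup>2 / 4))" by (simp add: exp_add[symmetric])
 thus ?thesis unfolding * by (simp add: scaleR_conv_of_real real_sqrt_mult mult_ac)
 qed
qed

lemma herm_exp_coef:
 "(LBINT t. herm_exp b (herm_poly n) t) = b ^ n * (LBINT t. herm_exp b 1 t)"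
proof (induction n)
 case (Suc n)
 thus ?case using herm_exp_parts[of b n 1] by (simp add: herm_exp_def del: herm_poly.simps)
qed simp

text \<open>With \<open>b = 0\<close> each integration by parts lowers both indices by one and
  yields \<open>2 * n\<close>, until one of them is 0.\<close>

lemma herm_orthogonal:
 "(LBINT t. herm_exp 0 (herm_poly m * herm_poly n) t) = (if m = n then cx (sqrt pi * 2 ^ n * fact n) else 0)"
proof -
 have z: "(LBINT t. herm_exp 0 0 t) = 0" by (simp add: herm_exp_def)
 have sm: "herm_exp 0 (herm_poly m * smult c q) t = cx c * herm_exp 0 (herm_poly m * q) t" for m c q t
 by (simp add: herm_exp_def mult_ac)
 show ?thesis
 proof (induction m arbitrary: n)
 case 0
 show ?case
 proof (cases n)
 case 0
 thus ?thesis using herm_exp_zero[of 0 0] by (simp add: cis_def complex_eq_iff)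
 next
 case (Suc k)
 thus ?thesis using herm_exp_coef[of 0 n] by (simp del: herm_poly.simps(2))
 qed
 next
 case (Suc m)
 show ?case
 proof (cases n)
 case 0
 thus ?thesis using herm_exp_coef[of 0 "Suc m"] by (simp del: herm_poly.simps(2))
 next
 case (Suc k)
 have "(LBINT t. herm_exp 0 (herm_poly (Suc m) * herm_poly n) t) = (LBINT t. herm_exp 0 (herm_poly m * pderiv (herm_poly n)) t)"
 by (subst herm_exp_parts) simp
 also have "... = cx (2 * real (Suc k)) * (LBINT t. herm_exp 0 (herm_poly m * herm_poly k) t)"
 unfolding Suc pderiv_herm_poly sm by simp
 finally show ?thesis unfolding Suc.IH using Suc by (simp add: field_simps del: herm_poly.simps)
 qed
 qed
qed

lemma hermite_fun_mult_integrable: "L1 (%t. cx (hermite_fun m t * hermite_fun n t))"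
 and hermite_fun_orthonormal: "(LBINT t. cx (hermite_fun m t * hermite_fun n t)) = (if m = n then 1 else 0)"
proof -
 have eq: "cx (hermite_fun m t * hermite_fun n t) = cx (herm_const m * herm_const n) * herm_exp 0 (herm_poly m * herm_poly n) t" for t
 proof -
 have "exp (- t\<^sup>2 / 2) * exp (- t\<^sup>2 / 2) = exp (- t\<^sup>2)" by (simp add: exp_add[symmetric])
 thus ?thesis by (simp add: hermite_fun_poly herm_exp_def mult_ac flip: of_real_mult)
 qed
 show "L1 (%t. cx (hermite_fun m t * hermite_fun n t))"
 unfolding eq by (intro integrable_mult_right herm_exp_integrable)
 have "herm_const n * herm_const n * (sqrt pi * 2 ^ n * fact n) = 1"
 by (simp add: herm_const_def field_simps)
 thus "(LBINT t. cx (hermite_fun m t * hermite_fun n t)) = (if m = n then 1 else 0)"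
 unfolding eq integral_mult_right_zero herm_orthogonal by (simp flip: of_real_mult)
qed

text \<open>The Bargmann monomial of degree n with its Gaussian weight. The dependence on the index
  is a power of x - iy, which is why the flow acts by rotation.\<close>

definition herm_coef :: "nat => real => real => complex" where
 "herm_coef n x y = cx (herm_const n * sqrt pi * exp (- (x\<^sup>2 + y\<^sup>2) / 4)) * (cx x - \<i> * cx y) ^ n * cis (- (x * y / 2))"

lemma hermite_atom_integrable: "L1 (%t. cis (- (y * t)) * cx (exp (- (t - x)\<^sup>2 / 2)) * cx (hermite_fun n t))"
 and hermite_atom_coef: "(LBINT t. cis (- (y * t)) * cx (exp (- (t - x)\<^sup>2 / 2)) * cx (hermite_fun n t)) = herm_coef n x y"
proof -
 let ?b = "cx x - \<i> * cx y"
 have eq: "cis (- (y * t)) * cx (exp (- (t - x)\<^sup>2 / 2)) * cx (hermite_fun n t)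
 = cx (herm_const n * exp (- x\<^sup>2 / 2)) * herm_exp ?b (herm_poly n) t" for t
 proof -
 have "exp (- (t - x)\<^sup>2 / 2) * exp (- t\<^sup>2 / 2) = exp (- x\<^sup>2 / 2) * (exp (x * t) * exp (- t\<^sup>2))"
 unfolding exp_add[symmetric] by (simp add: power2_diff field_simps)
 thus ?thesis
 unfolding hermite_fun_poly herm_exp_def exp_cis by (simp add: mult_ac flip: of_real_mult)
 qed
 show "L1 (%t. cis (- (y * t)) * cx (exp (- (t - x)\<^sup>2 / 2)) * cx (hermite_fun n t))"
 unfolding eq by (intro integrable_mult_right herm_exp_integrable)
 have "exp (- x\<^sup>2 / 2) * exp (x\<^sup>2 / 4 - y\<^sup>2 / 4) = exp (- (x\<^sup>2 + y\<^sup>2) / 4)"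
 unfolding exp_add[symmetric] by (simp add: field_simps)
 thus "(LBINT t. cis (- (y * t)) * cx (exp (- (t - x)\<^sup>2 / 2)) * cx (hermite_fun n t)) = herm_coef n x y"
 unfolding eq integral_mult_right_zero herm_exp_coef[of ?b n] herm_exp_zero herm_coef_def
 by (simp add: mult_ac flip: of_real_mult)
qed

text \<open>The squares are \<open>sqrt pi\<close> times Poisson weights with mean
  \<open>(x\<^sup>2 + y\<^sup>2) / 2\<close>. The sum \<open>sqrt pi\<close> is the squared L2 norm
  of the one-dimensional atom, so this is Parseval's identity.\<close>

lemma herm_coef_sq_sums: "(%n. (norm (herm_coef n x y))^2) sums sqrt pi"
proof -
 let ?r = "(x\<^sup>2 + y\<^sup>2) / 2"
 have nb: "(norm (cx x - \<i> * cx y))^2 = x\<^sup>2 + y\<^sup>2"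
 by (simp add: cmod_def)
 have eq: "(norm (herm_coef n x y))^2 = sqrt pi * exp (- ?r) * (?r ^ n /\<^sub>R fact n)" for n
 proof -
 have e: "(exp (- (x\<^sup>2 + y\<^sup>2) / 4))^2 = exp (- ?r)" by (simp add: power2_eq_square exp_add[symmetric] field_simps)
 have c: "(herm_const n * sqrt pi)^2 = sqrt pi / (2 ^ n * fact n)"
 proof -
 have "(herm_const n * sqrt pi)^2 = (sqrt pi * sqrt pi) / (sqrt pi * 2 ^ n * fact n)"
 by (simp add: herm_const_def power_mult_distrib power_divide)
 also have "... = sqrt pi / (2 ^ n * fact n)" by (simp del: real_sqrt_mult_self)
 finally show ?thesis .
 qed
 have "(norm (herm_coef n x y))^2 = (herm_const n * sqrt pi)^2 * (exp (- (x\<^sup>2 + y\<^sup>2) / 4))^2 * ((norm (cx x - \<i> * cx y))^2) ^ n"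
 unfolding herm_coef_def by (simp add: norm_mult norm_power power_mult_distrib mult.commute[of n] power_mult[symmetric])
 also have "... = sqrt pi * exp (- ?r) * (?r ^ n /\<^sub>R fact n)"
 proof -
 have "sqrt pi / (2 ^ n * fact n) * e * q ^ n = sqrt pi * e * ((q / 2) ^ n /\<^sub>R fact n)" for q e :: real
 by (simp add: power_divide field_simps)
 thus ?thesis unfolding e c nb .
 qed
 finally show ?thesis .
 qed
 have "(%n. sqrt pi * exp (- ?r) * (?r ^ n /\<^sub>R fact n)) sums (sqrt pi * exp (- ?r) * exp ?r)"
 by (intro sums_mult exp_converges)
 moreover have "sqrt pi * exp (- ?r) * exp ?r = sqrt pi" by (simp add: exp_minus)
 ultimately show ?thesis unfolding eq by (simp only:)
qed

section \<open>Hermite functions in several variables\<close>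

lemma tempgr_prod: "(!!i. i : I ==> f i : tempgr) ==> (%x. \<Prod>i\<in>I. f i x) : tempgr"
 by (induction I rule: infinite_finite_induct) (auto intro: tempgr_const tempgr_mult)

lemma tempgr_poly: "(%x. cx (poly p (x $ i))) : tempgr"
proof (induction p)
 case 0
 show ?case by (simp add: tempgr_const[of 0, simplified])
next
 case (pCons a p)
 have "(%x. cx (axis i 1 \<bullet> x) * cx (poly p (x $ i))) : tempgr"
 by (intro tempgr_mult tempgr_inner pCons)
 from tempgr_add[OF tempgr_const[of "cx a"] this]
 show ?case by (simp add: inner_commute cart_eq_inner_axis)
qed

lemma schw_hermite: "hermite al : Schw"
proof -
 have "hermite al = (%x. (cx (\<Prod>i\<in>UNIV. herm_const (al i)) * (\<Prod>i\<in>UNIV. cx (poly (herm_poly (al i)) (x $ i)))) * gauss x)"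
 by (simp add: fun_eq_iff hermite_def hermite_fun_poly gauss_prod prod.distrib mult_ac)
 thus ?thesis
 by (simp only:) (intro schw_mult tempgr_mult tempgr_const tempgr_prod tempgr_poly schw_gauss)
qed

lemma cnj_hermite [simp]: "cnj (hermite al x) = hermite al x"
 by (simp add: hermite_def)

lemma hermite_orthonormal:
 "(LBINT x. hermite al x * hermite \<beta> x) = (if al = \<beta> then 1 else 0)"
proof -
 have "(LBINT x. hermite al x * hermite \<beta> x) = (LBINT x. (\<Prod>i\<in>UNIV. cx (hermite_fun (al i) (x $ i) * hermite_fun (\<beta> i) (x $ i))))"
 by (simp add: hermite_def prod.distrib)
 also have "... = (\<Prod>i\<in>UNIV. if al i = \<beta> i then 1 else 0)"
 by (subst lborel_integral_prod_cart, rule hermite_fun_mult_integrable, simp only: hermite_fun_orthonormal)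
 also have "... = (if al = \<beta> then 1 else 0)"
 by (cases "al = \<beta>") (auto simp: fun_eq_iff)
 finally show ?thesis .
qed

definition herm_atom_coef :: "('n::finite => nat) => (real^'n) \<times> (real^'n) => complex" where
 "herm_atom_coef al z = (\<Prod>i\<in>UNIV. herm_coef (al i) (fst z $ i) (snd z $ i))"

lemma atom_gauss_hermite: "(LBINT t. atom gauss z t * hermite al t) = herm_atom_coef al z"
proof -
 have "atom gauss z t * hermite al t = (\<Prod>i\<in>UNIV. cis (- (snd z $ i * t $ i)) * cx (exp (- (t $ i - fst z $ i)\<^sup>2 / 2)) * cx (hermite_fun (al i) (t $ i)))" for t
 by (simp add: atom_def gauss_prod hermite_def inner_vec_def cis_sum[symmetric] sum_negf prod.distrib)
 thus ?thesis
 unfolding herm_atom_coef_def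
 by (simp only:) (subst lborel_integral_prod_cart, rule hermite_atom_integrable, simp only: hermite_atom_coef)
qed

lemma herm_atom_coef_has_sum:
 "((%al. (norm (herm_atom_coef al (z :: (real^'n) \<times> (real^'n))))^2) has_sum sqrt pi ^ CARD('n)) UNIV"
proof -
 let ?f = "%i n. (norm (herm_coef n (fst z $ i) (snd z $ i)))^2"
 have hs: "(?f i has_sum sqrt pi) UNIV" for i
 using herm_coef_sq_sums by (intro sums_nonneg_imp_has_sum) auto
 have ab: "(%n. norm (?f i n)) summable_on UNIV" for i
 using has_sum_imp_summable[OF hs[of i]] by simp
 have pie: "PiE (UNIV :: 'n set) (%_. UNIV :: nat set) = UNIV" by auto
 have eq: "(norm (herm_atom_coef al z))^2 = (\<Prod>i\<in>UNIV. ?f i (al i))" for al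
 by (simp add: herm_atom_coef_def prod_norm[symmetric] prod_power_distrib)
 have "infsum (%al. \<Prod>i\<in>UNIV. ?f i (al i)) (PiE UNIV (%_. UNIV)) = (\<Prod>i\<in>(UNIV::'n set). infsum (?f i) UNIV)"
 by (rule infsum_prod_PiE_abs) (use ab in auto)
 also have "... = sqrt pi ^ CARD('n)" by (simp add: infsumI[OF hs])
 finally have inf: "infsum (%al. (norm (herm_atom_coef al z))^2) UNIV = sqrt pi ^ CARD('n)"
 unfolding eq pie .
 hence "(%al. (norm (herm_atom_coef al z))^2) summable_on UNIV"
 using infsum_not_exists[of "%al. (norm (herm_atom_coef al z))^2" UNIV] by fastforce
 from has_sum_infsum[OF this] show ?thesis unfolding inf .
qed

section \<open>Hermite expansions in L2\<close>

lemma l2norm_eq_0: "L2 f ==> l2norm f = 0 ==> AE x in lborel. f x = 0"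
proof -
 assume f: "L2 f" and "l2norm f = 0"
 hence "Lpow 2 lborel f = 0" by (simp add: Lpow2_l2norm)
 thus "AE x in lborel. f x = 0"
 unfolding Lpow2_eq using L2_borel[OF f] by (subst (asm) nn_integral_0_iff_AE) auto
qed

lemma L2_zero: "L2 (%x. 0)"
 by (simp add: L2_def Lpow_def)

lemma l2norm_zero: "l2norm (%x. 0) = 0"
 by (simp add: l2norm_def Lpow_def)

lemma L2_sum: "(!!i. i : I ==> L2 (f i)) ==> L2 (%x. \<Sum>i\<in>I. f i x)"
 by (induction I rule: infinite_finite_induct) (auto intro: L2_add L2_zero)

lemma L2_hermite_sum: "L2 (%x. \<Sum>al\<in>A. a al * hermite al x)"
 by (intro L2_sum L2_cmult schw_L2 schw_hermite)

lemma hermite_sum_inner: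
 assumes "finite A" and f: "L2 f"
 shows "(LBINT x. f x * (\<Sum>al\<in>A. c al * hermite al x)) = (\<Sum>al\<in>A. c al * (LBINT x. f x * hermite al x))"
proof -
 have i: "L1 (%x. f x * hermite al x)" for al
 by (intro Cauchy_Schwarz_lborel f schw_L2 schw_hermite)
 have "(LBINT x. f x * (\<Sum>al\<in>A. c al * hermite al x)) = (LBINT x. (\<Sum>al\<in>A. c al * (f x * hermite al x)))"
 by (simp add: sum_distrib_left mult_ac)
 also have "... = (\<Sum>al\<in>A. c al * (LBINT x. f x * hermite al x))"
 by (subst Bochner_Integration.integral_sum) (auto intro!: integrable_mult_right i)
 finally show ?thesis .
qed

lemma hermite_expansion_error:
 assumes f: "L2 f" and A: "finite A"
 defines "a \<equiv> %al. LBINT x. f x * hermite al x"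
 shows "(l2norm (%x. f x - (\<Sum>al\<in>A. a al * hermite al x)))^2 = (l2norm f)^2 - (\<Sum>al\<in>A. (norm (a al))^2)"
proof -
 let ?S = "%x. \<Sum>al\<in>A. a al * hermite al x" and ?S' = "%x. \<Sum>al\<in>A. cnj (a al) * hermite al x"
 have S: "L2 ?S" "L2 ?S'" by (rule L2_hermite_sum)+
 have cS: "cnj (?S x) = ?S' x" for x by simp
 have f': "L2 (%x. cnj (f x))" by (rule L2_cnj[OF f])
 note i = Cauchy_Schwarz_lborel(1)
 let ?q = "\<Sum>al\<in>A. cx ((norm (a al))^2)"
 have aa: "(LBINT x. f x * hermite al x) = a al" for al by (simp add: a_def)
 have 1: "(LBINT x. f x * ?S' x) = ?q"
 unfolding hermite_sum_inner[OF A f] aa by (intro sum.cong refl) (simp only: complex_norm_square mult.commute)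
 have ca: "(LBINT x. cnj (f x) * hermite al x) = cnj (a al)" for al
 unfolding a_def by (subst int_cnj[symmetric]) simp
 have 2: "(LBINT x. cnj (f x) * ?S x) = ?q"
 unfolding hermite_sum_inner[OF A f'] ca by (intro sum.cong refl) (simp only: complex_norm_square mult.commute)
 have sa: "(LBINT x. ?S' x * hermite al x) = cnj (a al)" if "al : A" for al
 proof -
 have "(LBINT x. ?S' x * hermite al x) = (LBINT x. hermite al x * ?S' x)" by (simp only: mult.commute)
 also have "... = (\<Sum>\<beta>\<in>A. cnj (a \<beta>) * (if al = \<beta> then 1 else 0))"
 by (simp only: hermite_sum_inner[OF A schw_L2[OF schw_hermite]] hermite_orthonormal)
 also have "... = (\<Sum>\<beta>\<in>A. if al = \<beta> then cnj (a \<beta>) else 0)" by (intro sum.cong refl) simp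
 also have "... = cnj (a al)" using A that by simp
 finally show ?thesis .
 qed
 have 3: "(LBINT x. ?S' x * ?S x) = ?q"
 unfolding hermite_sum_inner[OF A S(2)] by (intro sum.cong refl) (simp only: sa, simp only: complex_norm_square mult.commute)
 have "cx ((l2norm (%x. f x - ?S x))^2) = (LBINT x. (f x - ?S x) * cnj (f x - ?S x))"
 unfolding l2norm_sq[OF L2_diff[OF f S(1)]] complex_norm_square[symmetric] by (simp only: integral_complex_of_real)
 also have "... = (LBINT x. f x * cnj (f x) - f x * ?S' x - (cnj (f x) * ?S x - ?S' x * ?S x))"
 by (intro int_cong refl) (simp only: complex_cnj_diff cS, simp add: algebra_simps)
 also have "... = (LBINT x. f x * cnj (f x)) - (LBINT x. f x * ?S' x) - ((LBINT x. cnj (f x) * ?S x) - (LBINT x. ?S' x * ?S x))"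
 by (simp only: Bochner_Integration.integral_diff Bochner_Integration.integrable_diff i[OF f f'] i[OF f S(2)] i[OF f' S(1)] i[OF S(2) S(1)])
 also have "(LBINT x. f x * cnj (f x)) = cx ((l2norm f)^2)"
 unfolding l2norm_sq[OF f] complex_norm_square[symmetric] by (simp only: integral_complex_of_real)
 finally have "cx ((l2norm (%x. f x - ?S x))^2) = cx ((l2norm f)^2 - (\<Sum>al\<in>A. (norm (a al))^2))"
 unfolding 1 2 3 by simp
 thus ?thesis by (simp only: of_real_eq_iff)
qed

lemma hermite_sum_norm:
 assumes A: "finite A"
 shows "(l2norm (%x. \<Sum>al\<in>A. a al * hermite al x))^2 = (\<Sum>al\<in>A. (norm (a al))^2)"
proof -
 let ?S = "%x. \<Sum>al\<in>A. a al * hermite al x"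
 have "(LBINT x. ?S x * hermite al x) = a al" if "al : A" for al
 proof -
 have "(LBINT x. ?S x * hermite al x) = (LBINT x. hermite al x * ?S x)" by (simp only: mult.commute)
 also have "... = (\<Sum>\<beta>\<in>A. a \<beta> * (if al = \<beta> then 1 else 0))"
 by (simp only: hermite_sum_inner[OF A schw_L2[OF schw_hermite]] hermite_orthonormal)
 also have "... = (\<Sum>\<beta>\<in>A. if al = \<beta> then a \<beta> else 0)" by (intro sum.cong refl) simp
 also have "... = a al" using A that by simp
 finally show ?thesis .
 qed
 hence "(l2norm (%x. ?S x - ?S x))^2 = (l2norm ?S)^2 - (\<Sum>al\<in>A. (norm (a al))^2)"
 using hermite_expansion_error[OF L2_hermite_sum A, of a A] by (simp cong: sum.cong)
 thus ?thesis by (simp add: l2norm_zero)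
qed

text \<open>By Pythagoras the squared error is the squared norm minus a partial sum of squared
  coefficients; the explicit sum of all of them equals the norm of the atom. Atoms are thus in the
  closed span of the Hermite functions.\<close>

lemma atom_gauss_expansion:
 "((%A. l2norm (%t. atom gauss z t - (\<Sum>al\<in>A. herm_atom_coef al z * hermite al t))) ~~> 0) (finite_subsets_at_top UNIV)"
proof -
 let ?E = "atom gauss z :: real^'a => complex"
 have E: "L2 ?E" by (intro schw_L2 schw_atom schw_gauss)
 have nE: "(l2norm ?E)^2 = sqrt pi ^ CARD('a)"
 proof -
 have "cx ((l2norm ?E)^2) = (LBINT t. gauss (t - fst z) * gauss (t - fst z))"
 unfolding l2norm_sq[OF E]
 by (subst integral_complex_of_real[symmetric]) (simp add: atom_def norm_mult gauss_def power2_eq_square)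
 also have "... = (\<integral>t. gauss t * gauss t \<partial>(lborel :: (real^'a) measure))"
 using lborel_integral_translate[of "%t::real^'a. gauss t * gauss t" "- fst z"] by simp
 also have "... = (\<integral>t. (\<Prod>i\<in>UNIV. herm_exp 0 1 (t $ i)) \<partial>(lborel :: (real^'a) measure))"
 proof (intro int_cong refl)
 fix t :: "real^'a"
 have "cx (exp (- u\<^sup>2 / 2)) * cx (exp (- u\<^sup>2 / 2)) = herm_exp 0 1 u" for u
 by (simp add: herm_exp_def exp_add[symmetric] flip: of_real_mult)
 thus "gauss t * gauss t = (\<Prod>i\<in>UNIV. herm_exp 0 1 (t $ i))"
 by (simp only: gauss_prod prod.distrib[symmetric])
 qed
 also have "... = (\<Prod>i\<in>(UNIV::'a set). cx (sqrt pi))"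
 using herm_exp_zero[of 0 0] by (subst lborel_integral_prod_cart) (auto simp: herm_exp_integrable)
 also have "... = cx (sqrt pi ^ CARD('a))" by simp
 finally show ?thesis by (simp only: of_real_eq_iff)
 qed
 have er: "(l2norm (%t. ?E t - (\<Sum>al\<in>A. herm_atom_coef al z * hermite al t)))^2 = sqrt pi ^ CARD('a) - (\<Sum>al\<in>A. (norm (herm_atom_coef al z))^2)"
 if "finite A" for A
 using hermite_expansion_error[OF E that] by (simp only: nE atom_gauss_hermite)
 have "((%A. sqrt (sqrt pi ^ CARD('a) - (\<Sum>al\<in>A. (norm (herm_atom_coef al z))^2))) ~~> sqrt (sqrt pi ^ CARD('a) - sqrt pi ^ CARD('a))) (finite_subsets_at_top UNIV)"
 using herm_atom_coef_has_sum[of z] unfolding has_sum_def by (intro tendsto_intros)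
 hence "((%A. sqrt (sqrt pi ^ CARD('a) - (\<Sum>al\<in>A. (norm (herm_atom_coef al z))^2))) ~~> 0) (finite_subsets_at_top UNIV)" by simp
 thus ?thesis
 proof (rule Lim_transform_eventually)
 show "\<forall>\<^sub>F A in finite_subsets_at_top UNIV. sqrt (sqrt pi ^ CARD('a) - (\<Sum>al\<in>A. (norm (herm_atom_coef al z))^2)) = l2norm (%t. ?E t - (\<Sum>al\<in>A. herm_atom_coef al z * hermite al t))"
 by (rule eventually_finite_subsets_at_top_weakI) (simp add: er[symmetric])
 qed
qed

section \<open>The Hermite propagator\<close>

lemma hermite_sum_diff_bound:
 assumes B: "finite B" and C: "finite C"
 shows "(l2norm (%x. (\<Sum>al\<in>B. a al * hermite al x) - (\<Sum>al\<in>C. a al * hermite al x)))^2 <= (\<Sum>al\<in>(B \<union> C) - (B \<inter> C). (norm (a al))^2)"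
proof -
 let ?c = "%al. (if al : B then a al else 0) - (if al : C then a al else 0)"
 have "(\<Sum>al\<in>B. a al * hermite al x) - (\<Sum>al\<in>C. a al * hermite al x) = (\<Sum>al\<in>B \<union> C. ?c al * hermite al x)" for x
 proof -
 have "(\<Sum>al\<in>B. a al * hermite al x) = (\<Sum>al\<in>B \<union> C. (if al : B then a al else 0) * hermite al x)"
 using B C by (intro sum.mono_neutral_cong_left) auto
 moreover have "(\<Sum>al\<in>C. a al * hermite al x) = (\<Sum>al\<in>B \<union> C. (if al : C then a al else 0) * hermite al x)"
 using B C by (intro sum.mono_neutral_cong_left) auto
 ultimately show ?thesis by (simp only: sum_subtractf[symmetric] left_diff_distrib)
 qed
 hence "(l2norm (%x. (\<Sum>al\<in>B. a al * hermite al x) - (\<Sum>al\<in>C. a al * hermite al x)))^2 = (\<Sum>al\<in>B \<union> C. (norm (?c al))^2)"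
 using hermite_sum_norm[of "B \<union> C" ?c] B C by simp
 also have "... = (\<Sum>al\<in>(B \<union> C) - (B \<inter> C). (norm (a al))^2)"
 using B C by (intro sum.mono_neutral_cong_right) auto
 finally show ?thesis by simp
qed

text \<open>Convergence is along the net of all finite index sets. An increasing sequence of sets
  with small tails reduces existence of a limit to \<open>L2_complete\<close>, and the tails then
  control every larger set.\<close>

lemma hermite_series_converges:
 assumes bnd: "!!A. finite A ==> (\<Sum>al\<in>A. (norm (a al))^2) <= c"
 shows "EX h. L2 h & ((%A. l2norm (%x. (\<Sum>al\<in>A. a al * hermite al x) - h x)) ~~> 0) (finite_subsets_at_top UNIV)"
proof -
 let ?S = "%A x. \<Sum>al\<in>A. a al * hermite al x"
 have sq: "L2 (?S A)" for A by (rule L2_hermite_sum)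
 have "(%al. (norm (a al))^2) summable_on UNIV"
 by (rule nonneg_bdd_above_summable_on) (auto simp: bdd_above_def intro!: exI[of _ c] bnd)
 then obtain s where s: "((%al. (norm (a al))^2) has_sum s) UNIV" by (auto simp: summable_on_def)
 have tail: "EX A0. finite A0 & (ALL B. finite B --> B \<inter> A0 = {} --> (\<Sum>al\<in>B. (norm (a al))^2) <= e)" if e: "e > 0" for e
 proof -
 have "\<forall>\<^sub>F A in finite_subsets_at_top UNIV. dist (\<Sum>al\<in>A. (norm (a al))^2) s < e / 2"
 using s half_gt_zero[OF e] unfolding has_sum_def tendsto_iff by blast
 then obtain A0 where A0: "finite A0" and d: "!!A. finite A ==> A0 \<subseteq> A ==> dist (\<Sum>al\<in>A. (norm (a al))^2) s < e / 2"
 by (auto simp: eventually_finite_subsets_at_top)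
 have "(\<Sum>al\<in>B. (norm (a al))^2) <= e" if B: "finite B" "B \<inter> A0 = {}" for B
 proof -
 have "(\<Sum>al\<in>A0 \<union> B. (norm (a al))^2) = (\<Sum>al\<in>A0. (norm (a al))^2) + (\<Sum>al\<in>B. (norm (a al))^2)"
 using A0 B by (intro sum.union_disjoint) auto
 moreover have "dist (\<Sum>al\<in>A0 \<union> B. (norm (a al))^2) s < e / 2" using d[of "A0 \<union> B"] A0 B by simp
 moreover have "dist (\<Sum>al\<in>A0. (norm (a al))^2) s < e / 2" using d[of A0] A0 by simp
 ultimately show ?thesis unfolding dist_real_def abs_less_iff by linarith
 qed
 thus ?thesis using A0 by blast
 qed
 have "EX A0. finite A0 & (ALL B. finite B --> B \<inter> A0 = {} --> (\<Sum>al\<in>B. (norm (a al))^2) <= 1 / real (Suc n))" for n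
 by (rule tail) simp
 then obtain N where N: "!!n. finite (N n)" and Nt: "!!n B. finite B ==> B \<inter> N n = {} ==> (\<Sum>al\<in>B. (norm (a al))^2) <= 1 / real (Suc n)"
 by metis
 define F where "F n = (\<Union>k\<le>n. N k)" for n
 have F: "finite (F n)" and NF: "k <= n ==> N k \<subseteq> F n" for k n using N by (auto simp: F_def)
 have diff: "(l2norm (%x. ?S B x - ?S C x))^2 <= 1 / real (Suc n)" if "finite B" "finite C" "N n \<subseteq> B" "N n \<subseteq> C" for B C n
 by (rule order_trans[OF hermite_sum_diff_bound[OF that(1,2)]]) (rule Nt, use that in auto)
 have "EX g:borel_measurable lborel. (%n. Lpow 2 lborel (%x. ?S (F n) x - g x)) ----> 0"
 proof (rule L2_complete)
 show "?S (F n) : LM" for n using L2_borel[OF sq[of "F n"]] by simp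
 fix e :: real assume e: "e > 0"
 obtain n where n: "1 / real (Suc n) < e" using nat_approx_posE[OF e] by auto
 have "Lpow 2 lborel (%x. ?S (F m) x - ?S (F k) x) <= ennreal e" if "m >= n" "k >= n" for m k
 unfolding Lpow2_l2norm[OF L2_diff[OF sq sq]]
 using diff[OF F F NF[OF that(1)] NF[OF that(2)]] n by (intro ennreal_leI) linarith
 thus "EX n. \<forall>m\<ge>n. \<forall>k\<ge>n. Lpow 2 lborel (%x. ?S (F m) x - ?S (F k) x) <= ennreal e" by blast
 qed
 then obtain g where g[measurable]: "g : BM" and lim: "(%n. Lpow 2 lborel (%x. ?S (F n) x - g x)) ----> 0" by auto
 have "\<forall>\<^sub>F n in sequentially. Lpow 2 lborel (%x. ?S (F n) x - g x) < 1"
 using order_tendstoD(2)[OF lim, of 1] by simp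
 then obtain n0 where "Lpow 2 lborel (%x. ?S (F n0) x - g x) < 1" by (auto simp: eventually_sequentially)
 hence "Lpow 2 lborel (%x. ?S (F n0) x - g x) < \<infinity>" using less_trans ennreal_one_less_top by fastforce
 hence "L2 (%x. ?S (F n0) x - g x)"
 unfolding L2_def using L2_borel[OF sq[of "F n0"]] by auto
 from L2_diff[OF sq[of "F n0"] this] have gs: "L2 g" by simp
 have "((%A. l2norm (%x. ?S A x - g x)) ~~> 0) (finite_subsets_at_top UNIV)"
 proof (rule tendstoI)
 fix e :: real assume e: "e > 0"
 obtain n1 where n1: "1 / real (Suc n1) < (e / 2)^2" using nat_approx_posE[of "(e/2)^2"] e by auto
 have "ennreal ((e/2)^2) > 0" using e by simp
 from order_tendstoD(2)[OF lim this] obtain n2 where n2: "!!n. n >= n2 ==> Lpow 2 lborel (%x. ?S (F n) x - g x) < ennreal ((e/2)^2)"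
 by (auto simp: eventually_sequentially)
 let ?n = "max n1 n2"
 have "l2norm (%x. ?S A x - g x) < e" if A: "finite A" "F n1 \<subseteq> A" for A
 proof -
 have "(l2norm (%x. ?S A x - ?S (F ?n) x))^2 < (e / 2)^2"
 proof -
 have "N n1 \<subseteq> A" "N n1 \<subseteq> F ?n" using NF[of n1 n1] NF[of n1 ?n] A by auto
 from diff[OF A(1) F this] n1 show ?thesis by linarith
 qed
 hence 1: "l2norm (%x. ?S A x - ?S (F ?n) x) < e / 2" by (rule power_less_imp_less_base) (use e in simp)
 have "(l2norm (%x. ?S (F ?n) x - g x))^2 < (e / 2)^2"
 using n2[of ?n] e unfolding Lpow2_l2norm[OF L2_diff[OF sq gs]] by (simp add: ennreal_less_iff)
 hence 2: "l2norm (%x. ?S (F ?n) x - g x) < e / 2" by (rule power_less_imp_less_base) (use e in simp)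
 show ?thesis
 using l2norm_triangle[OF L2_diff[OF sq sq] L2_diff[OF sq gs], of A "F ?n" "F ?n"] 1 2 by simp
 qed
 thus "\<forall>\<^sub>F A in finite_subsets_at_top UNIV. dist (l2norm (%x. ?S A x - g x)) 0 < e"
 using F[of n1] by (auto simp: eventually_finite_subsets_at_top intro!: exI[of _ "F n1"])
 qed
 thus ?thesis using gs by blast
qed

lemma l2norm_minus_commute: "l2norm (%x. f x - g x) = l2norm (%x. g x - f x)"
 unfolding l2norm_def by (subst Lpow_minus_commute) (rule refl)

lemma l2_limit_unique:
 assumes S: "!!A. L2 (S A)" and h: "L2 h" "L2 h'"
 and "((%A. l2norm (%x. S A x - h x)) ~~> 0) F" "((%A. l2norm (%x. S A x - h' x)) ~~> 0) F" "F ~= bot"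
 shows "AE x in lborel. h x = h' x"
proof -
 have le: "l2norm (%x. h x - h' x) <= l2norm (%x. S A x - h x) + l2norm (%x. S A x - h' x)" for A
 using l2norm_triangle[OF L2_diff[OF h(1) S] L2_diff[OF S h(2)], of A A] l2norm_minus_commute[of h "S A"] by simp
 have "((%A. l2norm (%x. S A x - h x) + l2norm (%x. S A x - h' x)) ~~> 0 + 0) F"
 by (intro tendsto_add assms)
 hence "l2norm (%x. h x - h' x) <= 0 + 0"
 by (rule tendsto_le[OF assms(6) _ tendsto_const]) (use le in auto)
 hence "l2norm (%x. h x - h' x) = 0" using l2norm_nonneg[of "%x. h x - h' x"] by linarith
 from l2norm_eq_0[OF L2_diff[OF h] this] show ?thesis by simp
qed

lemma dist_of_fun_cong_AE:
 assumes "L2 h" "L2 h'" "AE x in lborel. h x = h' x"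
 shows "dist_of_fun h = dist_of_fun h'"
proof
 fix ph :: "real^'a => complex"
 have "(LBINT x. h x * ph x) = (LBINT x. h' x * ph x)" if "ph : Schw"
 using assms(3) L2_borel[OF assms(1)] L2_borel[OF assms(2)] schw_borel[OF that]
 by (intro integral_cong_AE) auto
 thus "dist_of_fun h ph = dist_of_fun h' ph" by (simp add: dist_of_fun_def)
qed

text \<open>The angle is \<open>2 * t\<close> because the eigenvalues of the Hermite operator grow
  by 2 with each unit of the multi-index.\<close>

definition rot :: "real => (real^'n) \<times> (real^'n) => (real^'n) \<times> (real^'n)" where
 "rot t z = (cos (2 * t) *r fst z - sin (2 * t) *r snd z, sin (2 * t) *r fst z + cos (2 * t) *r snd z)"

text \<open>The first factor belongs to the lowest eigenvalue; the second repairs the factor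
  \<open>cis (- (x * y / 2))\<close> of \<open>herm_coef\<close>, which is not invariant under
  rotation.\<close>

definition rot_phase :: "real => (real^'n) \<times> (real^'n) => complex" where
 "rot_phase t z = cis (- t * real CARD('n)) * cis ((fst (rot t z) \<bullet> snd (rot t z) - fst z \<bullet> snd z) / 2)"

text \<open>Rotating (x, y) multiplies x - iy by \<open>cis (- 2 * t)\<close> and keeps the Gaussian
  weight, so the n-th power absorbs the evolution factor up to the mismatch of the phases.\<close>

lemma herm_coef_rotate:
 fixes t :: real
 defines "c \<equiv> cos (2 * t)" and "s \<equiv> sin (2 * t)"
 shows "cis (- 2 * t * real n) * herm_coef n x y = cis (((c * x - s * y) * (s * x + c * y) - x * y) / 2) * herm_coef n (c * x - s * y) (s * x + c * y)"
proof -
 let ?x = "c * x - s * y" and ?y = "s * x + c * y"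
 have cs: "c\<^sup>2 + s\<^sup>2 = 1" by (simp add: c_def s_def)
 have "?x\<^sup>2 + ?y\<^sup>2 = (c\<^sup>2 + s\<^sup>2) * (x\<^sup>2 + y\<^sup>2)" by (simp add: power2_eq_square algebra_simps)
 hence q: "?x\<^sup>2 + ?y\<^sup>2 = x\<^sup>2 + y\<^sup>2" by (simp add: cs)
 have b: "cx ?x - \<i> * cx ?y = cis (- 2 * t) * (cx x - \<i> * cx y)"
 by (simp add: complex_eq_iff c_def s_def algebra_simps)
 have p: "(cis (- 2 * t)) ^ n = cis (- 2 * t * real n)" using Complex.DeMoivre[of "- 2 * t" n] by (simp only: mult.commute[of "real n"])
 have "cis ((?x * ?y - x * y) / 2) * cis (- (?x * ?y / 2)) = cis (- (x * y / 2))"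
 by (simp add: cis_mult diff_divide_distrib)
 thus ?thesis
 unfolding herm_coef_def q b power_mult_distrib p by (simp add: mult_ac)
qed

lemma herm_atom_coef_rotate:
 fixes z :: "(real^'n) \<times> (real^'n)"
 shows "cis (- t * (2 * real (\<Sum>i\<in>UNIV. al i) + real CARD('n))) * herm_atom_coef al z = rot_phase t z * herm_atom_coef al (rot t z)"
proof -
 let ?c = "cos (2 * t)" and ?s = "sin (2 * t)"
 let ?x = "%i. fst z $ i" and ?y = "%i. snd z $ i"
 have "cis (- t * (2 * real (\<Sum>i\<in>UNIV. al i) + real CARD('n))) = cis (- t * real CARD('n)) * (\<Prod>i\<in>UNIV. cis (- 2 * t * real (al i)))"
 by (subst cis_sum[symmetric]) (auto simp: cis_mult algebra_simps sum_distrib_left)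
 hence "cis (- t * (2 * real (\<Sum>i\<in>UNIV. al i) + real CARD('n))) * herm_atom_coef al z
 = cis (- t * real CARD('n)) * (\<Prod>i\<in>UNIV. cis (- 2 * t * real (al i)) * herm_coef (al i) (?x i) (?y i))"
 by (simp add: herm_atom_coef_def prod.distrib mult.assoc)
 also have "... = cis (- t * real CARD('n)) * ((\<Prod>i\<in>UNIV. cis (((?c * ?x i - ?s * ?y i) * (?s * ?x i + ?c * ?y i) - ?x i * ?y i) / 2)) * herm_atom_coef al (rot t z))"
 unfolding herm_coef_rotate by (simp add: herm_atom_coef_def prod.distrib rot_def)
 also have "(\<Prod>i\<in>UNIV. cis (((?c * ?x i - ?s * ?y i) * (?s * ?x i + ?c * ?y i) - ?x i * ?y i) / 2)) = cis ((fst (rot t z) \<bullet> snd (rot t z) - fst z \<bullet> snd z) / 2)"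
 by (subst cis_sum[symmetric]) (auto simp: rot_def inner_vec_def sum_subtractf sum_divide_distrib[symmetric])
 finally show ?thesis by (simp add: rot_phase_def mult.assoc)
qed

text \<open>Bessel's inequality by duality: \<open>T\<close> is tested on the Hermite sum whose
  coefficients are the conjugates of its own values.\<close>

lemma bessel_dist:
 fixes T :: "('n::finite) dist"
 assumes T: "T : tempered" and bnd: "!!ph. ph : Schw ==> norm (T ph) <= C * l2norm ph" and A: "finite A"
 shows "(\<Sum>al\<in>A. (norm (T (hermite al)))^2) <= C\<^sup>2"
proof -
 define q where "q = (\<Sum>al\<in>A. (norm (T (hermite al)))^2)"
 have q0: "q >= 0" unfolding q_def by (intro sum_nonneg) auto
 let ?ph = "%x. \<Sum>al\<in>A. cnj (T (hermite al)) * hermite al x"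
 have "T ?ph = (\<Sum>al\<in>A. cnj (T (hermite al)) * T (hermite al))" by (intro tempered_sum T schw_hermite)
 also have "... = (\<Sum>al\<in>A. cx ((norm (T (hermite al)))^2))"
 by (intro sum.cong refl) (simp only: complex_norm_square mult.commute)
 also have "... = cx q" by (simp add: q_def)
 finally have "norm (T ?ph) = q" using q0 by simp
 moreover have "norm (T ?ph) <= C * l2norm ?ph" by (intro bnd schw_sum schw_cmult schw_hermite)
 moreover have "l2norm ?ph = sqrt q"
 using hermite_sum_norm[OF A, of "%al. cnj (T (hermite al))"] by (simp add: q_def real_sqrt_unique[symmetric])
 ultimately have "q <= C * sqrt q" by simp
 have "q <= C\<^sup>2"
 proof (cases "q = 0")
 case False
 hence "sqrt q * sqrt q <= C * sqrt q" "sqrt q > 0" using \<open>q <= C * sqrt q\<close> q0 by auto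
 hence "sqrt q <= C" by (rule mult_right_le_imp_le)
 hence "(sqrt q)^2 <= C\<^sup>2" using q0 by (intro power_mono) auto
 thus ?thesis using q0 by simp
 qed simp
 thus ?thesis by (simp add: q_def)
qed

text \<open>The voice of the evolved distribution is a limit of sums of Hermite values times atom
  coefficients. The evolution factor can be moved from the value to the atom coefficient, where it
  becomes a rotation of the point. The partial sums also provide Schwartz approximations in L2,
  which Fourier arguments use later.\<close>

lemma hermite_propagator_voice:
 fixes T :: "('n::finite) dist"
 assumes T: "T : tempered" and bnd: "!!ph. ph : Schw ==> norm (T ph) <= C * l2norm ph"
 shows "EX h. L2 h & hermite_propagator t T = dist_of_fun h \<and>
 (ALL z. voice gauss (dist_of_fun h) z = rot_phase t z * voice gauss T (rot t z)) \<and>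
 (EX ps. (ALL n::nat. ps n : Schw) & (%n. l2norm (%x. ps n x - h x)) ----> 0)"
proof -
 let ?e = "%al::'n => nat. cis (- t * (2 * real (\<Sum>i\<in>UNIV. al i) + real CARD('n)))"
 let ?a = "%al. ?e al * T (hermite al)"
 let ?S = "%A x. \<Sum>al\<in>A. ?a al * hermite al x"
 let ?F = "finite_subsets_at_top (UNIV :: ('n => nat) set)"
 have br: "bracket T (hermite al) = T (hermite al)" for al by (simp add: bracket_def)
 have Ssq: "L2 (?S A)" for A by (rule L2_hermite_sum)
 have "(\<Sum>al\<in>A. (norm (?a al))^2) <= C\<^sup>2" if "finite A" for A
 using bessel_dist[OF T bnd that] by (simp add: norm_mult)
 then obtain h where h: "L2 h" and lim: "((%A. l2norm (%x. ?S A x - h x)) ~~> 0) ?F"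
 using hermite_series_converges[of ?a] by blast
 have Ln: "((%A. Lnorm 2 lborel (%x. en (?S A x - k x))) ~~> 0) ?F \<longleftrightarrow> ((%A. l2norm (%x. ?S A x - k x)) ~~> 0) ?F"
 if k: "L2 k" for k
 using tendsto_ennreal_iff[of "%A. l2norm (%x. ?S A x - k x)" ?F 0]
 unfolding Lnorm2_l2norm[OF L2_diff[OF Ssq k]] by simp
 have pr: "hermite_propagator t T = dist_of_fun h"
 unfolding hermite_propagator_def br
 proof (rule the_equality)
 show "EX k:Lspace 2. dist_of_fun h = dist_of_fun k & ((%A. Lnorm 2 lborel (%x. en (?S A x - k x))) ~~> 0) ?F"
 using h lim Ln[OF h] by (auto simp: L2_Lspace[symmetric])
 fix R assume "EX k:Lspace 2. R = dist_of_fun k & ((%A. Lnorm 2 lborel (%x. en (?S A x - k x))) ~~> 0) ?F"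
 then obtain k where k: "L2 k" "R = dist_of_fun k" and l: "((%A. l2norm (%x. ?S A x - k x)) ~~> 0) ?F"
 using Ln by (auto simp: L2_Lspace[symmetric])
 have "AE x in lborel. k x = h x"
 by (rule l2_limit_unique[OF Ssq k(1) h l lim]) simp
 thus "R = dist_of_fun h" unfolding k(2) by (rule dist_of_fun_cong_AE[OF k(1) h])
 qed
 have voice: "voice gauss (dist_of_fun h) z = rot_phase t z * voice gauss T (rot t z)" for z
 proof -
 let ?E = "atom gauss z :: real^'n => complex" and ?E' = "atom gauss (rot t z) :: real^'n => complex"
 have E: "?E : Schw" "?E' : Schw" by (intro schw_atom schw_gauss)+
 note Es = schw_L2[OF E(1)]
 have sum1: "(LBINT x. ?S A x * ?E x) = (\<Sum>al\<in>A. ?a al * herm_atom_coef al z)" if "finite A" for A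
 proof -
 have "(LBINT x. ?S A x * ?E x) = (LBINT x. ?E x * ?S A x)" by (simp only: mult.commute)
 thus ?thesis by (simp only: hermite_sum_inner[OF that Es] atom_gauss_hermite)
 qed
 have "((%A. LBINT x. (?S A x - h x) * ?E x) ~~> 0) ?F"
 proof (rule Lim_null_comparison)
 show "\<forall>\<^sub>F A in ?F. norm (LBINT x. (?S A x - h x) * ?E x) <= l2norm (%x. ?S A x - h x) * l2norm ?E"
 by (intro always_eventually allI Cauchy_Schwarz_lborel L2_diff Ssq h Es)
 show "((%A. l2norm (%x. ?S A x - h x) * l2norm ?E) ~~> 0) ?F" by (intro tendsto_mult_left_zero lim)
 qed
 moreover have "(LBINT x. (?S A x - h x) * ?E x) = (LBINT x. ?S A x * ?E x) - (LBINT x. h x * ?E x)" for A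
 by (simp only: left_diff_distrib Bochner_Integration.integral_diff[OF Cauchy_Schwarz_lborel(1)[OF Ssq Es] Cauchy_Schwarz_lborel(1)[OF h Es]])
 ultimately have "((%A. LBINT x. ?S A x * ?E x) ~~> voice gauss (dist_of_fun h) z) ?F"
 by (simp add: LIM_zero_iff voice_def dist_of_fun_apply[OF E(1)])
 hence 1: "((%A. \<Sum>al\<in>A. ?a al * herm_atom_coef al z) ~~> voice gauss (dist_of_fun h) z) ?F"
 by (rule Lim_transform_eventually) (rule eventually_finite_subsets_at_top_weakI, rule sum1)
 \<comment> \<open>The L2 bound on \<open>T\<close> allows it to be applied term by term to the
   Hermite expansion of the atom at the rotated point.\<close>
 have "((%A. T (%x. ?E' x - (\<Sum>al\<in>A. herm_atom_coef al (rot t z) * hermite al x))) ~~> 0) ?F"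
 proof (rule Lim_null_comparison)
 show "\<forall>\<^sub>F A in ?F. norm (T (%x. ?E' x - (\<Sum>al\<in>A. herm_atom_coef al (rot t z) * hermite al x))) <= C * l2norm (%x. ?E' x - (\<Sum>al\<in>A. herm_atom_coef al (rot t z) * hermite al x))"
 by (intro always_eventually allI bnd schw_diff E schw_sum schw_cmult schw_hermite)
 show "((%A. C * l2norm (%x. ?E' x - (\<Sum>al\<in>A. herm_atom_coef al (rot t z) * hermite al x))) ~~> 0) ?F"
 by (intro tendsto_mult_right_zero atom_gauss_expansion)
 qed
 moreover have "T (%x. ?E' x - (\<Sum>al\<in>A. herm_atom_coef al (rot t z) * hermite al x)) = T ?E' - (\<Sum>al\<in>A. herm_atom_coef al (rot t z) * T (hermite al))" for A
 by (subst tempered_diff[OF T E(2) schw_sum[OF schw_cmult[OF schw_hermite]]], subst tempered_sum[OF T schw_hermite]) simp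
 ultimately have "((%A. T ?E' - (T ?E' - (\<Sum>al\<in>A. herm_atom_coef al (rot t z) * T (hermite al)))) ~~> T ?E' - 0) ?F"
 by (intro tendsto_diff tendsto_const) simp
 hence "((%A. \<Sum>al\<in>A. herm_atom_coef al (rot t z) * T (hermite al)) ~~> voice gauss T (rot t z)) ?F"
 by (simp add: voice_def)
 hence "((%A. rot_phase t z * (\<Sum>al\<in>A. herm_atom_coef al (rot t z) * T (hermite al))) ~~> rot_phase t z * voice gauss T (rot t z)) ?F"
 by (intro tendsto_mult_left)
 moreover have "rot_phase t z * (\<Sum>al\<in>A. herm_atom_coef al (rot t z) * T (hermite al)) = (\<Sum>al\<in>A. ?a al * herm_atom_coef al z)" for A
 unfolding sum_distrib_left
 proof (intro sum.cong refl)
 fix al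
 have "rot_phase t z * (herm_atom_coef al (rot t z) * T (hermite al)) = (?e al * herm_atom_coef al z) * T (hermite al)"
 unfolding herm_atom_coef_rotate by simp
 thus "rot_phase t z * (herm_atom_coef al (rot t z) * T (hermite al)) = ?a al * herm_atom_coef al z" by (simp only: mult_ac)
 qed
 ultimately have "((%A. \<Sum>al\<in>A. ?a al * herm_atom_coef al z) ~~> rot_phase t z * voice gauss T (rot t z)) ?F" by (simp only:)
 from tendsto_unique[OF _ 1 this] show ?thesis by simp
 qed
 have "EX ps. (ALL n::nat. ps n : Schw) & (%n. l2norm (%x. ps n x - h x)) ----> 0"
 proof -
 have "EX A. l2norm (%x. ?S A x - h x) < 1 / real (Suc n)" for n
 proof -
 have "\<forall>\<^sub>F A in ?F. l2norm (%x. ?S A x - h x) < 1 / real (Suc n)" using order_tendstoD(2)[OF lim] by simp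
 thus ?thesis by (rule eventually_happens'[OF finite_subsets_at_top_neq_bot])
 qed
 hence "EX A. ALL n. l2norm (%x. ?S (A n) x - h x) < 1 / real (Suc n)"
 by (intro choice allI)
 then obtain A where A: "ALL n. l2norm (%x. ?S (A n) x - h x) < 1 / real (Suc n)" ..
 have "(%n. l2norm (%x. ?S (A n) x - h x)) ----> 0"
 proof (rule tendsto_sandwich[OF _ _ tendsto_const LIMSEQ_inverse_real_of_nat])
 show "\<forall>\<^sub>F n in sequentially. 0 <= l2norm (%x. ?S (A n) x - h x)"
 by (intro always_eventually allI l2norm_nonneg)
 show "\<forall>\<^sub>F n in sequentially. l2norm (%x. ?S (A n) x - h x) <= inverse (real (Suc n))"
 unfolding inverse_eq_divide by (intro always_eventually allI less_imp_le A[rule_format])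
 qed
 moreover have "?S (A n) : Schw" for n by (intro schw_sum schw_cmult schw_hermite)
 ultimately show ?thesis by (intro exI[of _ "%n. ?S (A n)"]) (intro conjI allI)
 qed
 from h pr voice this show ?thesis by (intro exI[of _ h] conjI) (assumption | intro allI)+
qed

section \<open>The propagator on modulation spaces\<close>

lemma gauss_nonzero: "gauss ~= (%_. 0)"
 by (auto simp: fun_eq_iff gauss_def)

lemma norm_rot_phase [simp]: "norm (rot_phase t z) = 1"
 by (simp add: rot_phase_def norm_mult)

lemma rot_continuous: "continuous_on UNIV (%t. rot t z)"
 unfolding rot_def
 by (intro continuous_on_Pair continuous_on_add continuous_on_diff continuous_on_scaleR continuous_on_const continuous_on_cos continuous_on_sin continuous_on_mult_left continuous_on_id)

lemma rot_phase_continuous: "continuous_on UNIV (%t. rot_phase t z)"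
 unfolding rot_phase_def rot_def fst_conv snd_conv
 by (intro continuous_on_mult continuous_cis continuous_on_inner continuous_on_add continuous_on_diff continuous_on_scaleR continuous_on_const continuous_on_cos continuous_on_sin continuous_on_mult_left continuous_on_id continuous_on_divide continuous_on_minus) auto

lemma rot_zero [simp]: "rot 0 z = z" "rot_phase 0 z = 1"
 by (simp_all add: rot_def rot_phase_def)

lemma Lpow_voice_rotate:
 fixes T :: "('n::finite) dist"
 assumes T: "T : tempered"
 shows "Lpow p lborel (%z. rot_phase t z * voice gauss T (rot t z)) = Lpow p lborel (voice gauss T)"
proof -
 have "(LNINT z. ennreal (norm (f (cos (2 * t) *r fst z - sin (2 * t) *r snd z, sin (2 * t) *r fst z + cos (2 * t) *r snd z)) powr p)) = (LNINT z. ennreal (norm (f z) powr p))"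
 if [measurable]: "f : BM" for f :: "(real^'n) \<times> (real^'n) => complex"
 proof (rule nn_integral_rotate[where H="%z. ennreal (norm (f z) powr p)"])
 show "(%z. ennreal (norm (f z) powr p)) : BM" by measurable
 show "(cos (2 * t))^2 + (sin (2 * t))^2 = 1" by simp
 qed
 from this[OF voice_borel[OF T schw_gauss]] show ?thesis by (simp add: Lpow_def norm_mult rot_def)
qed

text \<open>The domain of the propagator.\<close>

definition l2_bounded :: "('n::finite) dist => bool" where
 "l2_bounded T \<longleftrightarrow> T : tempered & (EX C. ALL ph:schwartz_space. norm (T ph) <= C * l2norm ph)"

lemma Mspace_l2_bounded:
 assumes "g : Schw" "g ~= (%_. 0)" "1 <= p" "p <= 2" "T : Mspace p g"
 shows "l2_bounded T"
proof -
 obtain C where "ALL T:Mspace p g. L2 (voice g T) & l2norm (voice g T) <= C * Mnorm p g T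
 & (ALL ph:schwartz_space. norm (T ph) <= C * Mnorm p g T * l2norm ph)"
 using Mspace_l2_bound[OF assms(1-4)] by (elim exE conjE)
 from bspec[OF this assms(5)] have "ALL ph:schwartz_space. norm (T ph) <= (C * Mnorm p g T) * l2norm ph" by (elim conjE)
 thus ?thesis unfolding l2_bounded_def by (intro conjI exI Mspace_tempered[OF assms(5)])
qed

lemma propagator_l2:
 assumes "l2_bounded T"
 shows "EX h. L2 h & hermite_propagator t T = dist_of_fun h \<and>
 (EX ps. (ALL n::nat. ps n : Schw) & (%n. l2norm (%x. ps n x - h x)) ----> 0)"
 and propagator_voice: "voice gauss (hermite_propagator t T) z = rot_phase t z * voice gauss T (rot t z)"
 and propagator_tempered: "hermite_propagator t T : tempered"
proof -
 obtain C where T: "T : tempered" and C: "!!ph. ph : Schw ==> norm (T ph) <= C * l2norm ph"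
 using assms unfolding l2_bounded_def by blast
 obtain h where h: "L2 h" "hermite_propagator t T = dist_of_fun h"
 "!!z. voice gauss (dist_of_fun h) z = rot_phase t z * voice gauss T (rot t z)"
 "EX ps. (ALL n::nat. ps n : Schw) & (%n. l2norm (%x. ps n x - h x)) ----> 0"
 using hermite_propagator_voice[OF T C, of t] by blast
 show "EX h. L2 h & hermite_propagator t T = dist_of_fun h \<and>
 (EX ps. (ALL n::nat. ps n : Schw) & (%n. l2norm (%x. ps n x - h x)) ----> 0)" using h by blast
 show "voice gauss (hermite_propagator t T) z = rot_phase t z * voice gauss T (rot t z)" by (simp add: h)
 show "hermite_propagator t T : tempered" unfolding h(2) by (rule dist_of_fun_tempered[OF h(1)])
qed

lemma tempered_eqI:
 fixes S T :: "('n::finite) dist"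
 assumes "S : tempered" "T : tempered" "g : Schw" "g ~= (%_. 0)" "!!z. voice g S z = voice g T z"
 shows "S = T"
proof -
 have "(%ph. 1 * S ph + (-1) * T ph) = (%_. 0)"
 by (rule voice_injective[OF tempered_lincomb[OF assms(1,2)] assms(3,4)]) (simp only: voice_lincomb assms(5), simp)
 hence "1 * S ph + (-1) * T ph = 0" for ph by (rule fun_cong)
 thus ?thesis by (simp add: fun_eq_iff)
qed

lemma propagator_zero:
 assumes "l2_bounded T" shows "hermite_propagator 0 T = T"
proof (rule tempered_eqI[OF propagator_tempered[OF assms] _ schw_gauss gauss_nonzero])
 show "T : tempered" using assms by (simp only: l2_bounded_def)
 show "voice gauss (hermite_propagator 0 T) z = voice gauss T z" for z
 by (simp only: propagator_voice[OF assms] rot_zero mult_1_left)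
qed

lemma l2_bounded_lincomb:
 assumes "l2_bounded S" "l2_bounded T"
 shows "l2_bounded (%ph. a * S ph + b * T ph)"
proof -
 obtain C D where C: "!!ph. ph : Schw ==> norm (S ph) <= C * l2norm ph"
 and D: "!!ph. ph : Schw ==> norm (T ph) <= D * l2norm ph" using assms unfolding l2_bounded_def by blast
 have "norm (a * S ph + b * T ph) <= (norm a * C + norm b * D) * l2norm ph" if "ph : Schw" for ph
 proof -
 have "norm (a * S ph + b * T ph) <= norm a * norm (S ph) + norm b * norm (T ph)"
 by (metis norm_mult norm_triangle_ineq)
 also have "... <= norm a * (C * l2norm ph) + norm b * (D * l2norm ph)"
 by (intro add_mono mult_left_mono C D that) auto
 finally show ?thesis by (simp add: algebra_simps)
 qed
 thus ?thesis using assms tempered_lincomb unfolding l2_bounded_def by blast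
qed

lemma propagator_lincomb:
 assumes "l2_bounded S" "l2_bounded T"
 shows "hermite_propagator t (%ph. a * S ph + b * T ph) = (%ph. a * hermite_propagator t S ph + b * hermite_propagator t T ph)"
 by (rule tempered_eqI[OF propagator_tempered[OF l2_bounded_lincomb[OF assms]]
 tempered_lincomb[OF propagator_tempered[OF assms(1)] propagator_tempered[OF assms(2)]] schw_gauss gauss_nonzero])
 (simp only: propagator_voice[OF l2_bounded_lincomb[OF assms]] propagator_voice[OF assms(1)] propagator_voice[OF assms(2)] voice_lincomb distrib_left mult.left_commute)

text \<open>A Riesz representation read off at time 0: the propagator there is the identity, and its
  values are by construction given by L2 limits of Hermite sums.\<close>

lemma Mspace_fun:
 fixes T :: "('n::finite) dist"
 assumes "l2_bounded T"
 shows "EX h. L2 h & T = dist_of_fun h \<and>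
 (EX ps. (ALL n::nat. ps n : Schw) & (%n. l2norm (%x. ps n x - h x)) ----> 0)"
 using propagator_l2(1)[OF assms, of 0] by (simp only: propagator_zero[OF assms])

lemma propagator_Mspace:
 assumes g: "g : Schw" "g ~= (%_. 0)" and p: "1 <= p" "p <= 2"
 shows "\<exists>C>0. ALL T:Mspace p g. ALL t. hermite_propagator t T : Mspace p g & Mnorm p g (hermite_propagator t (T :: ('n::finite) dist)) <= C * Mnorm p g T"
proof -
 obtain A where A: "A > 0" "!!T. T : Mspace p g ==> T : Mspace p gauss & Mnorm p gauss T <= A * Mnorm p g (T :: 'n dist)"
 using Mspace_change_window[OF g schw_gauss p(1)] by blast
 obtain B where B: "B > 0" "!!T. T : Mspace p gauss ==> T : Mspace p g & Mnorm p g T <= B * Mnorm p gauss (T :: 'n dist)"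
 using Mspace_change_window[OF schw_gauss gauss_nonzero g(1) p(1)] by blast
 have "hermite_propagator t T : Mspace p g & Mnorm p g (hermite_propagator t T) <= (B * A) * Mnorm p g T"
 if T: "T : Mspace p g" for T :: "'n dist" and t
 proof -
 have b: "l2_bounded T" by (rule Mspace_l2_bounded[OF g p T])
 have "Lpow p lborel (voice gauss (hermite_propagator t T)) = Lpow p lborel (voice gauss T)"
 using Lpow_voice_rotate[OF Mspace_tempered[OF T], of p t] by (simp add: propagator_voice[OF b, abs_def])
 hence 1: "hermite_propagator t T : Mspace p gauss" "Mnorm p gauss (hermite_propagator t T) = Mnorm p gauss T"
 using A(2)[OF T] propagator_tempered[OF b] by (auto simp: Mspace_def Mnorm_def)
 have "Mnorm p g (hermite_propagator t T) <= B * (A * Mnorm p g T)"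
 by (rule order_trans[OF conjunct2[OF B(2)[OF 1(1)]]]) (unfold 1(2), intro mult_left_mono conjunct2[OF A(2)[OF T]] less_imp_le[OF B(1)])
 thus ?thesis using B(2)[OF 1(1)] by (simp add: mult.assoc)
 qed
 thus ?thesis using A(1) B(1) by (intro exI[of _ "B * A"]) auto
qed

text \<open>Voices converge pointwise because the rotated point and the phase depend continuously on
  time, and all of them have the same norm; hence \<open>Lpow_scheffe\<close> applies. A general
  window costs a constant.\<close>

lemma propagator_continuous:
 fixes T :: "('n::finite) dist"
 assumes g: "g : Schw" "g ~= (%_. 0)" and p: "1 <= p" "p <= 2" and T: "T : Mspace p g"
 shows "((%s. Mnorm p g (%ph. hermite_propagator s T ph - hermite_propagator t T ph)) ~~> 0) (at t)"
proof -
 obtain B where B: "B > 0" "!!T. T : Mspace p gauss ==> T : Mspace p g & Mnorm p g T <= B * Mnorm p gauss (T :: 'n dist)"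
 using Mspace_change_window[OF schw_gauss gauss_nonzero g(1) p(1)] by blast
 have Tg: "T : Mspace p gauss" using Mspace_change_window[OF g schw_gauss p(1)] T by blast
 have b: "l2_bounded T" by (rule Mspace_l2_bounded[OF g p T])
 note temp = Mspace_tempered[OF T]
 have Lr: "Lpow p lborel (voice gauss (hermite_propagator s T)) = Lpow p lborel (voice gauss T)" for s
 using Lpow_voice_rotate[OF temp, of p s] by (simp add: propagator_voice[OF b, abs_def])
 have U: "hermite_propagator s T : Mspace p gauss" for s
 using Tg propagator_tempered[OF b] by (simp add: Mspace_def Lr)
 have c: "continuous_on UNIV (%s. voice gauss (hermite_propagator s T) z)" for z
 unfolding propagator_voice[OF b]
 by (intro continuous_intros rot_phase_continuous continuous_on_compose2[OF voice_continuous[OF temp schw_gauss] rot_continuous]) auto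
 show ?thesis
 unfolding tendsto_at_iff_sequentially comp_def
 proof (intro allI impI)
 fix X :: "nat => real" assume X: "X ----> t"
 have "(%n. Lpow p lborel (%z. voice gauss (hermite_propagator (X n) T) z - voice gauss (hermite_propagator t T) z)) ----> 0"
 proof (rule Lpow_scheffe[OF p(1)])
 show "AE z in lborel. (%n. voice gauss (hermite_propagator (X n) T) z) ----> voice gauss (hermite_propagator t T) z"
 using continuous_on_tendsto_compose[OF c X] by auto
 show "Lpow p lborel (voice gauss (hermite_propagator t T)) < \<infinity>" using U[of t] by (simp add: Mspace_def)
 qed (auto simp: Lr intro: voice_borel[OF propagator_tempered[OF b] schw_gauss])
 hence "(%n. enn2real (Lpow p lborel (%z. voice gauss (hermite_propagator (X n) T) z - voice gauss (hermite_propagator t T) z))) ----> enn2real 0"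
 by (intro tendsto_enn2real) auto
 hence "(%n. enn2real (Lpow p lborel (%z. voice gauss (hermite_propagator (X n) T) z - voice gauss (hermite_propagator t T) z)) powr (1 / p)) ----> 0 powr (1 / p)"
 using p by (intro tendsto_powr'[OF _ tendsto_const]) (simp_all)
 hence l: "(%n. B * Mnorm p gauss (%ph. hermite_propagator (X n) T ph - hermite_propagator t T ph)) ----> 0"
 by (intro tendsto_mult_right_zero) (simp add: Mnorm_def voice_def[abs_def])
 show "(%n. Mnorm p g (%ph. hermite_propagator (X n) T ph - hermite_propagator t T ph)) ----> 0"
 proof (rule tendsto_sandwich[OF _ _ tendsto_const l])
 show "\<forall>\<^sub>F n in sequentially. 0 <= Mnorm p g (%ph. hermite_propagator (X n) T ph - hermite_propagator t T ph)"
 by (simp add: Mnorm_def)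
 show "\<forall>\<^sub>F n in sequentially. Mnorm p g (%ph. hermite_propagator (X n) T ph - hermite_propagator t T ph) <= B * Mnorm p gauss (%ph. hermite_propagator (X n) T ph - hermite_propagator t T ph)"
 by (intro always_eventually allI) (rule conjunct2[OF B(2)[OF Mspace_diff[OF U U schw_gauss p(1)]]])
 qed
 qed
qed

section \<open>The Fourier transform of integrable functions\<close>

text \<open>The multiplication formula makes \<open>f\<close> orthogonal to every scaled and
  translated Gaussian, by Fubini to every Gaussian mollification of \<open>ph\<close>, and in the
  limit to \<open>ph\<close>.\<close>

lemma ft_zero_imp_integral_zero:
 fixes f :: "real^'n => complex"
 assumes f: "L1 f" and z: "!!y. ft f y = 0"
 and cont: "continuous_on UNIV ph" and bnd: "!!x. norm (ph x) <= (B :: real)"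
 shows "(LBINT x. f x * ph x) = 0"
proof -
 have [measurable]: "f : BM" "ph : BM" "gauss : borel_measurable (borel :: (real^'n) measure)"
 using f cont schw_borel[OF schw_gauss] by (auto intro: borel_cont)
 define e where "e n = 1 / real (Suc n)" for n
 have e: "e n > 0" "e n ~= 0" for n by (simp_all add: e_def)
 have e0: "e ----> 0" unfolding e_def using LIMSEQ_inverse_real_of_nat by (simp add: inverse_eq_divide)
 have gsc: "L1 (%y::real^'n. gauss (c *r y))" if "c ~= 0" for c
 using lborel_integrable_scale[OF schw_integrable[OF schw_gauss] that] .
 have z1: "(LBINT x. f x * gauss ((x - t) /\<^sub>R e n)) = 0" for t n
 proof -
 let ?w = "%y. gauss (e n *r y) * cis ((- t) \<bullet> y)"
 have w: "L1 ?w" by (rule integrable_mult_cis[OF gsc[OF e(2)]])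
 have "0 = (LBINT x. cx ((2 * pi) powr (real CARD('n) / 2) / e n ^ CARD('n)) * (f x * gauss ((x - t) /\<^sub>R e n)))"
 using ft_multiplication(1)[OF f w] unfolding z ft_modulated_gauss[OF e(1)] by (simp add: mult_ac)
 thus ?thesis using e(1)[of n] by (subst (asm) integral_mult_right_zero) (auto simp: powr_def)
 qed
 have B: "0 <= B" using order_trans[OF norm_ge_zero bnd] .
 have z2: "(LBINT x. f x * (LBINT v. ph (x - e n *r v) * gauss v)) = 0" for n
 proof -
 let ?h = "%(x, t). f x * (ph t * gauss ((x - t) /\<^sub>R e n))"
 define J where "J = (LBINT t. norm (gauss (inverse (e n) *r t :: real^'n)))"
 have sym: "gauss ((x - t) /\<^sub>R e n) = gauss (inverse (e n) *r (t + - x))" for x t :: "real^'n"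
 by (simp add: gauss_def norm_minus_commute)
 have gt: "L1 (%t. gauss ((x - t) /\<^sub>R e n))" "(LBINT t. norm (gauss ((x - t) /\<^sub>R e n))) = J" for x :: "real^'n"
 using lborel_integrable_translate[OF gsc[of "inverse (e n)"], of "- x"] e[of n]
 lborel_integral_translate[of "%t. norm (gauss (inverse (e n) *r t :: real^'n))" "- x"]
 unfolding sym J_def by (auto simp: add.commute)
 have it: "L1 (%t. ph t * gauss ((x - t) /\<^sub>R e n))" for x
 by (rule integrable_bound[OF integrable_mult_right[OF integrable_norm[OF gt(1)[of x]], of B]])
 (use bnd B in \<open>auto simp: norm_mult intro!: mult_right_mono\<close>)
 have le: "norm (LBINT t. norm (?h (x, t))) <= norm (norm (f x) * (B * J))" for x
 proof -
 have "(LBINT t. norm (ph t * gauss ((x - t) /\<^sub>R e n))) <= (LBINT t. B * norm (gauss ((x - t) /\<^sub>R e n)))"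
 by (rule integral_mono[OF integrable_norm[OF it] integrable_mult_right[OF integrable_norm[OF gt(1)]]])
 (auto simp: norm_mult intro!: mult_right_mono bnd)
 hence "(LBINT t. norm (ph t * gauss ((x - t) /\<^sub>R e n))) <= B * J" by (simp add: gt(2))
 moreover have "0 <= (LBINT t. norm (ph t * gauss ((x - t) /\<^sub>R e n)))" by (intro integral_ge_0_AE) auto
 ultimately have "norm (f x) * (LBINT t. norm (ph t * gauss ((x - t) /\<^sub>R e n))) <= norm (f x) * (B * J)"
 "0 <= norm (f x) * (LBINT t. norm (ph t * gauss ((x - t) /\<^sub>R e n)))"
 by (intro mult_left_mono) auto
 thus ?thesis by (simp add: norm_mult)
 qed
 have fi: "L1 (%x. norm (f x) * (B * J))" using f by simp
 have hm: "?h : borel_measurable (lborel \<Otimes>\<^sub>M lborel)" by measurable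
 have m: "(%x. LBINT t. norm (?h (x, t))) : LM"
 proof (rule lborel.borel_measurable_lebesgue_integral)
 show "(%(x, t). norm (?h (x, t))) : borel_measurable (lborel \<Otimes>\<^sub>M lborel)"
 using measurable_compose[OF hm borel_measurable_norm] by (simp only: split_def fst_conv snd_conv)
 qed
 have ih: "integrable (lborel \<Otimes>\<^sub>M lborel) ?h"
 proof (rule lborel_pair.Fubini_integrable[OF hm])
 show "L1 (%x. LBINT t. norm (?h (x, t)))"
 by (rule integrable_bound[OF fi m AE_I2[OF le]])
 show "AE x in lborel. L1 (%t. ?h (x, t))"
 unfolding prod.case by (rule AE_I2) (rule integrable_mult_right[OF it])
 qed
 have "(LBINT x. f x * (LBINT v. ph (x - e n *r v) * gauss v)) = (LBINT x. f x * (inverse (e n ^ DIM(real^'n)) *r (LBINT t. ph t * gauss ((x - t) /\<^sub>R e n))))"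
 proof (intro int_cong refl arg_cong2[of _ _ _ _ "(*)"])
 fix x
 have "(LBINT t. ph t * gauss ((x - t) /\<^sub>R e n)) = \<bar>- e n\<bar> ^ DIM(real^'n) *r (LBINT v. ph (x + (- e n) *r v) * gauss ((x - (x + (- e n) *r v)) /\<^sub>R e n))"
 by (rule lborel_affine_scale) (use e[of n] in \<open>auto\<close>)
 thus "(LBINT v. ph (x - e n *r v) * gauss v) = inverse (e n ^ DIM(real^'n)) *r (LBINT t. ph t * gauss ((x - t) /\<^sub>R e n))"
 using e[of n] by simp
 qed
 also have "... = inverse (e n ^ DIM(real^'n)) *r (LBINT x. (LBINT t. ?h (x, t)))"
 by simp
 also have "(LBINT x. (LBINT t. ?h (x, t))) = (LBINT t. (LBINT x. ?h (x, t)))"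
 using lborel_pair.Fubini_integral[of "%x t. ?h (x, t)"] ih by (simp add: split_def)
 also have "... = (LBINT t. ph t * (LBINT x. f x * gauss ((x - t) /\<^sub>R e n)))"
 by (subst integral_mult_right_zero[symmetric]) (simp add: mult.left_commute)
 finally show ?thesis by (simp add: z1)
 qed
 have pc: "isCont ph x" for x using cont by (simp add: continuous_on_eq_continuous_at)
 have lim: "(%n. LBINT v. ph (x - e n *r v) * gauss v) ----> (LBINT v. ph x * gauss (v::real^'n))" for x
 proof (rule integral_dominated_convergence[where w="%v::real^'n. B * norm (gauss v)"])
 show "AE v in lborel. (%n. ph (x - e n *r v) * gauss v) ----> ph x * gauss v"
 proof (rule AE_I2)
 fix v :: "real^'n"
 have "(%n. ph (x - e n *r v) * gauss v) ----> ph (x - 0 *r v) * gauss v"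
 by (intro tendsto_mult isCont_tendsto_compose[OF pc] tendsto_intros e0)
 thus "(%n. ph (x - e n *r v) * gauss v) ----> ph x * gauss v" by simp
 qed
 show "L1 (%v::real^'n. B * norm (gauss v))"
 by (intro integrable_mult_right integrable_norm schw_integrable schw_gauss)
 show "AE v in lborel. norm (ph (x - e n *r v) * gauss v) <= B * norm (gauss v)" for n
 using bnd by (auto simp: norm_mult intro!: mult_right_mono)
 qed measurable
 define c where "c = cx ((2 * pi) powr (real CARD('n) / 2))"
 have c: "c ~= 0" by (simp add: c_def)
 have "(%n. LBINT x. f x * (LBINT v. ph (x - e n *r v) * gauss v)) ----> (LBINT x. f x * (ph x * c))"
 proof (rule integral_dominated_convergence[where w="%x. norm (f x) * (B * (LBINT v. norm (gauss (v::real^'n))))"])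
 show "AE x in lborel. (%n. f x * (LBINT v. ph (x - e n *r v) * gauss v)) ----> f x * (ph x * c)"
 using lim by (intro AE_I2 tendsto_mult_left) (simp add: gauss_integral c_def)
 show "AE x in lborel. norm (f x * (LBINT v. ph (x - e n *r v) * gauss v)) <= norm (f x) * (B * (LBINT v. norm (gauss (v::real^'n))))" for n
 proof (intro AE_I2)
 fix x
 have "norm (LBINT v. ph (x - e n *r v) * gauss v) <= (LBINT v. B * norm (gauss (v::real^'n)))"
 by (rule order_trans[OF integral_norm_bound integral_mono'[OF integrable_mult_right[OF integrable_norm[OF schw_integrable[OF schw_gauss]]]]])
 (use bnd B in \<open>auto simp: norm_mult intro!: mult_right_mono\<close>)
 thus "norm (f x * (LBINT v. ph (x - e n *r v) * gauss v)) <= norm (f x) * (B * (LBINT v. norm (gauss (v::real^'n))))"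
 by (simp add: norm_mult mult_left_mono)
 qed
 show "L1 (%x. norm (f x) * (B * (LBINT v. norm (gauss (v::real^'n)))))" using f by simp
 qed measurable
 hence "(LBINT x. f x * (ph x * c)) = 0" unfolding z2 using LIMSEQ_unique tendsto_const by blast
 hence "(LBINT x. f x * ph x) * c = 0" by (subst integral_mult_left_zero[symmetric]) (simp add: mult.assoc)
 thus ?thesis using c by simp
qed

text \<open>The bounded function \<open>cnj f / (1 + norm f)\<close> is an almost everywhere limit
  of continuous ones. Testing against it makes the integral of a nonnegative function vanish whose
  zeros are those of \<open>f\<close>.\<close>

lemma ft_injective:
 fixes f :: "real^'n => complex"
 assumes f: "L1 f" and z: "!!y. ft f y = 0"
 shows "AE x in lborel. f x = 0"
proof -
 have [measurable]: "f : BM" "cnj : BM"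
 using f by (auto intro!: borel_cont continuous_intros)
 let ?ph = "%x. cnj (f x) / cx (1 + norm (f x))"
 have "?ph : LM" by measurable
 hence "?ph : borel_measurable (lebesgue_on UNIV)"
 by (simp only: lebesgue_on_UNIV_eq measurable_completion)
 hence "?ph measurable_on UNIV" by (subst measurable_on_iff_borel_measurable) auto
 then obtain N h where N: "negligible N" and h: "!!n. continuous_on UNIV (h n)" "!!x. x \<notin> N ==> (%n. h n x) ----> ?ph x"
 unfolding measurable_on_def by auto
 \<comment> \<open>Radial truncation to the unit disc: it keeps the limit, whose norm is at most 1,
   and supplies the uniform bound.\<close>
 define k where "k n x = h n x / cx (max 1 (norm (h n x)))" for n :: nat and x
 have k1: "norm (k n x) <= 1" for n x by (simp add: k_def norm_divide divide_le_eq)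
 have kc: "continuous_on UNIV (k n)" for n
 unfolding k_def[abs_def] by (intro continuous_intros h(1)) auto
 have [measurable]: "k n : BM" for n by (rule borel_cont[OF kc])
 have "norm (?ph x) <= 1" for x
 proof -
 have "norm (cx (1 + norm (f x))) = 1 + norm (f x)" by (simp only: norm_of_real abs_of_nonneg add_nonneg_nonneg zero_le_one norm_ge_zero)
 thus ?thesis by (simp add: norm_divide divide_le_eq add_pos_nonneg del: of_real_add)
 qed
 hence kl: "(%n. k n x) ----> ?ph x" if "x \<notin> N" for x
 proof -
 have "(%n. k n x) ----> ?ph x / cx (max 1 (norm (?ph x)))"
 unfolding k_def by (intro tendsto_intros h(2)[OF that]) auto
 thus ?thesis using \<open>!!x. norm (?ph x) <= 1\<close>[of x] by (simp add: max_absorb1 del: of_real_add)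
 qed
 have "AE x in lebesgue. x \<notin> N" using N by (intro AE_not_in) (simp add: negligible_iff_null_sets)
 hence "AE x in lebesgue. (%n. k n x) ----> ?ph x" using kl by (auto elim: AE_mp)
 hence ae: "AE x in lborel. (%n. k n x) ----> ?ph x" by (simp add: AE_completion_iff)
 have "(%n. LBINT x. f x * k n x) ----> (LBINT x. f x * ?ph x)"
 proof (rule integral_dominated_convergence[where w="%x. norm (f x)"])
 show "AE x in lborel. (%n. f x * k n x) ----> f x * ?ph x" using ae by eventually_elim (intro tendsto_mult_left)
 show "AE x in lborel. norm (f x * k n x) <= norm (f x)" for n by (simp add: norm_mult k1 mult_left_le)
 qed (use f in auto)
 moreover have "(LBINT x. f x * k n x) = 0" for n by (rule ft_zero_imp_integral_zero[OF f z kc k1])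
 ultimately have 0: "(LBINT x. f x * ?ph x) = 0" using LIMSEQ_unique[OF _ tendsto_const] by auto
 let ?r = "%x. (norm (f x))^2 / (1 + norm (f x))"
 have r: "f x * ?ph x = cx (?r x)" for x by (simp add: complex_norm_square[symmetric] del: of_real_add)
 have ri: "L1 ?r"
 proof (rule integrable_bound[OF integrable_norm[OF f]])
 show "AE x in lborel. norm (?r x) <= norm (norm (f x))"
 proof (rule AE_I2)
 fix x
 have "1 + norm (f x) > 0" by (simp add: add_pos_nonneg)
 thus "norm (?r x) <= norm (norm (f x))" by (simp add: divide_le_eq power2_eq_square algebra_simps)
 qed
 qed measurable
 have "(LBINT x. ?r x) = 0" using 0 unfolding r by (simp del: of_real_add of_real_divide)
 moreover have nn: "AE x in lborel. 0 <= ?r x" by (intro AE_I2 divide_nonneg_nonneg) auto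
 ultimately have "AE x in lborel. ?r x = 0" by (simp only: integral_nonneg_eq_0_iff_AE[OF ri nn])
 thus ?thesis
 proof eventually_elim
 case (elim x)
 have "1 + norm (f x) > 0" by (simp add: add_pos_nonneg)
 thus ?case using elim by simp
 qed
qed

text \<open>Multiplying by the Gaussian makes \<open>f\<close> integrable without changing its
  zeros, and the transform of the product tests \<open>f\<close> against modulated Gaussians, which
  are Schwartz functions.\<close>

lemma schw_test_injective:
 fixes f :: "real^'n => complex"
 assumes f: "!!ph. ph : Schw ==> L1 (%x. f x * ph x)"
 and z: "!!ph. ph : Schw ==> (LBINT x. f x * ph x) = 0"
 shows "AE x in lborel. f x = 0"
proof -
 have "AE x in lborel. f x * gauss x = 0"
 proof (rule ft_injective[OF f[OF schw_gauss]])
 fix y :: "real^'n"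
 show "ft (%x. f x * gauss x) y = 0"
 using z[OF schw_mult[OF tempgr_cis[of y] schw_gauss]] by (simp add: ft_def mult_ac)
 qed
 thus ?thesis by (rule AE_mp) (simp add: gauss_def)
qed

text \<open>The functions that \<^const>\<open>fun_of_dist\<close> ranges over.\<close>

definition reg_fun :: "(real^'n => complex) => bool" where
 "reg_fun f \<longleftrightarrow> f : LM & (ALL ph:schwartz_space. L1 (%x. f x * ph x))"

text \<open>\<open>fun_of_dist\<close> chooses some representative; injectivity against test
  functions pins it down almost everywhere, so every later use has to pass through this
  equality.\<close>

lemma reg_fun_fun_of_dist:
 fixes f :: "real^'n => complex"
 assumes f: "reg_fun f"
 shows "reg_fun (fun_of_dist (dist_of_fun f))" "dist_of_fun (fun_of_dist (dist_of_fun f)) = dist_of_fun f"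
 and "AE x in lborel. fun_of_dist (dist_of_fun f) x = f x"
proof -
 let ?F = "fun_of_dist (dist_of_fun f)"
 have "?F : LM & (ALL ph:schwartz_space. L1 (%x. ?F x * ph x)) & dist_of_fun ?F = dist_of_fun f"
 unfolding fun_of_dist_def by (rule someI[of _ f]) (use f in \<open>auto simp: reg_fun_def\<close>)
 thus F: "reg_fun ?F" "dist_of_fun ?F = dist_of_fun f" by (auto simp: reg_fun_def)
 have "AE x in lborel. ?F x - f x = 0"
 proof (rule schw_test_injective)
 fix ph :: "real^'n => complex" assume ph: "ph : Schw"
 have i: "L1 (%x. ?F x * ph x)" "L1 (%x. f x * ph x)" using F(1) f ph by (auto simp: reg_fun_def)
 show "L1 (%x. (?F x - f x) * ph x)" using i by (simp add: left_diff_distrib)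
 show "(LBINT x. (?F x - f x) * ph x) = 0"
 using i fun_cong[OF F(2), of ph] ph by (simp add: left_diff_distrib dist_of_fun_apply)
 qed
 thus "AE x in lborel. ?F x = f x" by simp
qed

lemma reg_fun_L2: "L2 f ==> reg_fun f"
 using Cauchy_Schwarz_lborel(1)[of f] schw_L2 by (auto simp: reg_fun_def L2_borel)

lemma reg_fun_bounded:
 assumes "f : BM" "!!x. norm (f x) <= B"
 shows "reg_fun f"
proof -
 have "L1 (%x. f x * ph x)" if ph: "ph : Schw" for ph
 proof (rule integrable_bound[OF integrable_mult_right[OF integrable_norm[OF schw_integrable[OF ph]], of B]])
 show "(%x. f x * ph x) : LM" using assms(1) schw_borel[OF ph] by simp
 show "AE x in lborel. norm (f x * ph x) <= norm (B * norm (ph x))"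
 using order_trans[OF norm_ge_zero assms(2)] by (auto simp: norm_mult intro!: mult_right_mono assms(2))
 qed
 thus ?thesis using assms by (simp add: reg_fun_def)
qed

lemma reg_fun_integrable:
 assumes "L1 f" shows "reg_fun f"
proof -
 have "L1 (%x. f x * ph x)" if ph: "ph : Schw" for ph
 proof -
 obtain C where C: "C > 0" "!!x. norm (ph x) <= C" using schw_bounded[OF ph] by metis
 show ?thesis
 proof (rule integrable_bound[OF integrable_mult_right[OF integrable_norm[OF assms], of C]])
 show "(%x. f x * ph x) : LM" using assms schw_borel[OF ph] by simp
 show "AE x in lborel. norm (f x * ph x) <= norm (C * norm (f x))"
 using C by (auto simp: norm_mult mult.commute[of C] intro!: mult_left_mono)
 qed
 qed
 thus ?thesis using assms by (simp add: reg_fun_def)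
qed

lemma dist_of_fun_cong:
 assumes "reg_fun f" "reg_fun h" "AE x in lborel. f x = h x"
 shows "dist_of_fun f = dist_of_fun h"
proof
 fix ph
 have "(LBINT x. f x * ph x) = (LBINT x. h x * ph x)" if "ph : Schw"
 by (rule integral_cong_AE) (use assms that schw_borel[OF that] in \<open>auto simp: reg_fun_def\<close>)
 thus "dist_of_fun f ph = dist_of_fun h ph" by (simp add: dist_of_fun_def)
qed

section \<open>Fourier transforms of distributions given by integrable functions\<close>

lemma fourier_ft: "fourier f xi = cx ((2 * pi) powr (- real CARD('n) / 2)) * ft f (- xi :: real^'n)"
 by (simp add: fourier_def ft_def inner_commute)

lemma inv_fourier_ft: "inv_fourier f x = cx ((2 * pi) powr (- real CARD('n) / 2)) * ft f (x :: real^'n)"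
 by (simp add: inv_fourier_def ft_def)

lemma ft_reflect:
 assumes [measurable]: "f : BM"
 shows "ft (%s. f (- s)) y = ft f (- y)"
 using lborel_affine_scale[of "%s. f s * cis ((- y) \<bullet> s)" "-1" 0] by (simp add: ft_def)

lemma schw_reflect:
 fixes ph :: "real^'n => complex"
 assumes "ph : Schw" shows "(%t. ph (- t)) : Schw"
proof -
 have "(%t. cx (1 / (2 * pi) powr real CARD('n)) * ft (ft ph) t) = (%t. ph (- t))"
 using fourier_inversion_schwartz[OF assms, of "- t" for t] by (auto simp: fun_eq_iff powr_def)
 thus ?thesis using schw_cmult[OF schw_ft[OF schw_ft[OF assms]]] by metis
qed

lemma schw_fourier:
 fixes ph :: "real^'n => complex"
 assumes "ph : Schw"
 shows "fourier ph : Schw" "inv_fourier ph : Schw"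
 using schw_cmult[OF schw_reflect[OF schw_ft[OF assms]]] schw_cmult[OF schw_ft[OF assms]]
 by (auto simp: fourier_ft[abs_def] inv_fourier_ft[abs_def])

lemma fourier_properties:
 fixes f :: "real^'n => complex"
 assumes "L1 f"
 defines "c \<equiv> (2 * pi) powr (- real CARD('n) / 2)"
 shows "fourier f : BM" "inv_fourier f : BM"
 "norm (fourier f x) <= c * (LBINT s. norm (f s))" "norm (inv_fourier f x) <= c * (LBINT s. norm (f s))"
proof -
 note [measurable] = ft_borel[OF assms(1)]
 show "fourier f : BM" unfolding fourier_ft[abs_def] by measurable
 show "inv_fourier f : BM" unfolding inv_fourier_ft[abs_def] by measurable
 show "norm (fourier f x) <= c * (LBINT s. norm (f s))" "norm (inv_fourier f x) <= c * (LBINT s. norm (f s))"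
 unfolding c_def fourier_ft inv_fourier_ft by (auto simp: norm_mult intro!: mult_left_mono ft_bound)
qed

lemma reg_fun_fourier:
 assumes "L1 f" shows "reg_fun (fourier f)" "reg_fun (inv_fourier f)"
 using fourier_properties[OF assms] by (auto intro: reg_fun_bounded)

lemma dist_fourier_integrable:
 fixes f :: "real^'n => complex"
 assumes f: "L1 f"
 shows "dist_fourier (dist_of_fun f) = dist_of_fun (fourier f)" "dist_inv_fourier (dist_of_fun f) = dist_of_fun (inv_fourier f)"
proof -
 define c where "c = cx ((2 * pi) powr (- real CARD('n) / 2))"
 have [measurable]: "f : BM" using f by auto
 have "dist_of_fun f (fourier ph) = dist_of_fun (fourier f) ph & dist_of_fun f (inv_fourier ph) = dist_of_fun (inv_fourier f) ph"
 if ph: "ph : Schw" for ph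
 proof
 note i = schw_integrable[OF ph]
 have [measurable]: "ph : BM" using schw_borel[OF ph] .
 have ir: "L1 (%t. ph (- t))" by (rule schw_integrable[OF schw_reflect[OF ph]])
 have "(LBINT x. f x * inv_fourier ph x) = c * (LBINT x. f x * ft ph x)"
 unfolding inv_fourier_ft c_def[symmetric] by (subst integral_mult_right_zero[symmetric]) (simp add: mult_ac)
 also have "... = (LBINT x. inv_fourier f x * ph x)"
 unfolding inv_fourier_ft c_def[symmetric] ft_multiplication(1)[OF f i, symmetric] by (subst integral_mult_right_zero[symmetric]) (simp add: mult_ac)
 finally show "dist_of_fun f (inv_fourier ph) = dist_of_fun (inv_fourier f) ph"
 by (simp add: dist_of_fun_apply ph schw_fourier)
 have "(LBINT x. f x * fourier ph x) = c * (LBINT x. f x * ft (%t. ph (- t)) x)"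
 unfolding fourier_ft c_def[symmetric] ft_reflect[OF schw_borel[OF ph]] by (subst integral_mult_right_zero[symmetric]) (simp add: mult_ac)
 also have "... = c * (LBINT x. ft f (- x) * ph x)"
 unfolding ft_multiplication(1)[OF f ir, symmetric]
 using lborel_affine_scale[of "%x. ft f x * ph (- x)" "-1" 0] ft_borel[OF f] by simp
 also have "... = (LBINT x. fourier f x * ph x)"
 unfolding fourier_ft c_def[symmetric] by (subst integral_mult_right_zero[symmetric]) (simp add: mult_ac)
 finally show "dist_of_fun f (fourier ph) = dist_of_fun (fourier f) ph"
 by (simp add: dist_of_fun_apply ph schw_fourier)
 qed
 thus "dist_fourier (dist_of_fun f) = dist_of_fun (fourier f)" "dist_inv_fourier (dist_of_fun f) = dist_of_fun (inv_fourier f)"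
 by (auto simp: fun_eq_iff dist_fourier_def dist_inv_fourier_def) (auto simp: dist_of_fun_def)
qed

text \<open>Inversion holds on the test functions by \<open>fourier_inversion_schwartz\<close>, so
  both sides give the same distribution, and regular functions with the same distribution agree
  almost everywhere.\<close>

lemma fourier_inversion:
 fixes f :: "real^'n => complex"
 assumes f: "L1 f" and F: "L1 (fourier f)"
 shows "AE x in lborel. inv_fourier (fourier f) x = f x"
proof -
 note R = reg_fun_fourier(2)[OF F] reg_fun_integrable[OF f]
 have "dist_of_fun (inv_fourier (fourier f)) = dist_of_fun f"
 proof
 fix ph :: "real^'n => complex"
 define c where "c = cx ((2 * pi) powr (- real CARD('n) / 2))"
 have inv: "fourier (inv_fourier ph) = ph" if "ph : Schw"
 proof
 fix x
 have "c * c * cx ((2 * pi) powr real CARD('n)) = 1"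
 unfolding c_def of_real_mult[symmetric] powr_add[symmetric] by simp
 thus "fourier (inv_fourier ph) x = ph x"
 using fourier_inversion_schwartz[OF that, of x] unfolding fourier_ft inv_fourier_ft[abs_def] c_def[symmetric] ft_cmult
 by (simp add: mult.assoc)
 qed
 show "dist_of_fun (inv_fourier (fourier f)) ph = dist_of_fun f ph"
 unfolding dist_fourier_integrable(2)[OF F, symmetric] dist_fourier_integrable(1)[OF f, symmetric]
 using inv by (auto simp: dist_fourier_def dist_inv_fourier_def schw_fourier dist_of_fun_def)
 qed
 thus ?thesis using reg_fun_fun_of_dist(3)[OF R(1)] reg_fun_fun_of_dist(3)[OF R(2)] by (auto elim: AE_mp)
qed

section \<open>Fourier transforms of products\<close>

lemma Lpow_cong_AE: "AE x in M. f x = h x ==> Lpow p M f = Lpow p M h"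
 unfolding Lpow_def by (rule nn_integral_cong_AE) auto

lemma Mspace_fun_of_dist:
 fixes T :: "('n::finite) dist"
 assumes "g : Schw" "g ~= (%_. 0)" "1 <= p" "p <= 2" "T : Mspace p g"
 shows "L2 (fun_of_dist T)" "dist_of_fun (fun_of_dist T) = T"
 "EX ps. (ALL n::nat. ps n : Schw) & (%n. l2norm (%x. ps n x - fun_of_dist T x)) ----> 0"
proof -
 obtain h ps where h: "L2 h" "T = dist_of_fun h"
 and ps: "!!n::nat. ps n : Schw" "(%n. l2norm (%x. ps n x - h x)) ----> 0"
 using Mspace_fun[OF Mspace_l2_bounded[OF assms]] by blast
 note F = reg_fun_fun_of_dist[OF reg_fun_L2[OF h(1)], folded h(2)]
 have "Lpow 2 lborel (fun_of_dist T) = Lpow 2 lborel h" by (rule Lpow_cong_AE[OF F(3)])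
 thus "L2 (fun_of_dist T)" using F(1) h(1) by (simp add: L2_def reg_fun_def)
 show "dist_of_fun (fun_of_dist T) = T" by (rule F(2))
 have "l2norm (%x. ps n x - fun_of_dist T x) = l2norm (%x. ps n x - h x)" for n
 unfolding l2norm_def using F(3) by (intro arg_cong[where f="%t. sqrt (enn2real t)"] Lpow_cong_AE) auto
 thus "EX ps. (ALL n::nat. ps n : Schw) & (%n. l2norm (%x. ps n x - fun_of_dist T x)) ----> 0"
 using ps by (intro exI[of _ ps]) simp
qed

lemma voice_dist_of_fun: "g : Schw ==> voice g (dist_of_fun f) z = (LBINT t. f t * atom g z t)"
 by (simp add: voice_def dist_of_fun_apply schw_atom)

text \<open>Modulation of the test function becomes a shift in frequency; this is where the shift in
  \<open>fourier_corr\<close> comes from.\<close>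

lemma dual_coef_voice:
 fixes ps :: "real^'n => complex"
 assumes g: "g : Schw" and ps: "ps : Schw"
 shows "dual_coef g (%x. cnj (ps x) * cis (- (xi \<bullet> x))) z = cnj (voice g (dist_of_fun ps) (z - (0, xi)))"
proof -
 have "(cnj (ps s) * cis (- (xi \<bullet> s))) * g (s - fst z) * cis (snd z \<bullet> s) = cnj (ps s * atom g (z - (0, xi)) s)" for s
 proof -
 have "cnj (atom g (z - (0, xi)) s) = cis (snd z \<bullet> s - xi \<bullet> s) * g (s - fst z)"
 by (simp add: atom_def inner_diff_left cis_cnj)
 moreover have "cis (snd z \<bullet> s - xi \<bullet> s) = cis (- (xi \<bullet> s)) * cis (snd z \<bullet> s)" by (simp add: cis_mult)
 ultimately show ?thesis by (simp only: complex_cnj_mult mult_ac)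
 qed
 hence "dual_coef g (%x. cnj (ps x) * cis (- (xi \<bullet> x))) z = (LBINT s. cnj (ps s * atom g (z - (0, xi)) s))"
 unfolding dual_coef_def ft_def by (intro int_cong refl)
 thus ?thesis by (simp only: voice_dist_of_fun[OF g] int_cnj)
qed

text \<open>Moyal's identity is available for Schwartz functions. It controls the voices of
  \<open>ps n - ps m\<close>, and Fatou in \<open>m\<close> carries the estimate over to the limit
  function.\<close>

lemma voice_l2_limit:
 fixes f :: "real^'n => complex"
 assumes g: "g : Schw" and f: "L2 f" and ps: "!!n::nat. ps n : Schw"
 and lim: "(%n. l2norm (%x. ps n x - f x)) ----> 0" and V: "L2 (voice g (dist_of_fun f))"
 shows "(%n. l2norm (%z. voice g (dist_of_fun (ps n)) z - voice g (dist_of_fun f) z)) ----> 0"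
 and "L2 (voice g (dist_of_fun (ps n)))"
proof -
 let ?r = "recon_const g" and ?V = "%n. voice g (dist_of_fun (ps n))"
 have r: "?r >= 0" unfolding recon_const_def by (intro mult_nonneg_nonneg integral_ge_0_AE) auto
 have V_dual: "voice g (dist_of_fun ph) z = cnj (dual_coef g (%x. cnj (ph x)) z)" if "ph : Schw" for ph z
 using dual_coef_voice[OF g that, of 0 z] by (simp add: zero_prod_def[symmetric])
 have S: "L2 (voice g (dist_of_fun ph))" "(l2norm (voice g (dist_of_fun ph)))^2 = ?r * (l2norm ph)^2" if ph: "ph : Schw" for ph :: "real^'n => complex"
 using dual_coef_L2[OF g schw_cnj[OF ph]] L2_cnj[of "dual_coef g (%x. cnj (ph x))"] L2_cnj(2)[OF schw_L2[OF ph]]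
 by (simp_all add: V_dual[OF ph, abs_def])
 show Vs: "L2 (?V n)" for n by (rule S(1)[OF ps])
 note fs = L2_diff[OF schw_L2[OF ps] f]
 have lin: "voice g (dist_of_fun (%x. u x - v x)) z = voice g (dist_of_fun u) z - voice g (dist_of_fun v) z"
 if "L2 u" "L2 v" for u v :: "real^'n => complex" and z
 using Cauchy_Schwarz_lborel(1)[OF that(1) schw_L2[OF schw_atom[OF g]]] Cauchy_Schwarz_lborel(1)[OF that(2) schw_L2[OF schw_atom[OF g]]]
 by (simp add: voice_dist_of_fun[OF g] left_diff_distrib)
 have pw: "(%m. ?V m z) ----> voice g (dist_of_fun f) z" for z
 proof -
 have "(%m. ?V m z - voice g (dist_of_fun f) z) ----> 0"
 proof (rule Lim_null_comparison)
 show "\<forall>\<^sub>F m in sequentially. norm (?V m z - voice g (dist_of_fun f) z) <= l2norm (%x. ps m x - f x) * l2norm (atom g z)"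
 proof (intro always_eventually allI)
 fix m
 show "norm (?V m z - voice g (dist_of_fun f) z) <= l2norm (%x. ps m x - f x) * l2norm (atom g z)"
 using Cauchy_Schwarz_lborel(3)[OF fs schw_L2[OF schw_atom[OF g]], of m z]
 unfolding lin[OF schw_L2[OF ps] f, symmetric] unfolding voice_dist_of_fun[OF g] .
 qed
 show "(%m. l2norm (%x. ps m x - f x) * l2norm (atom g z)) ----> 0" by (rule tendsto_mult_left_zero[OF lim])
 qed
 thus ?thesis by (simp add: LIM_zero_iff)
 qed
 have key: "l2norm (%z. ?V n z - voice g (dist_of_fun f) z) <= sqrt ?r * (2 * e)" if e: "l2norm (%x. ps n x - f x) < e" for n e
 proof -
 have e0: "0 < e" using e l2norm_nonneg[of "%x. ps n x - f x"] by linarith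
 have "Lpow 2 lborel (%z. ?V n z - voice g (dist_of_fun f) z) <= ennreal ((sqrt ?r * (2 * e))^2)"
 proof (rule Lpow_fatou)
 show "(%z. ?V n z - ?V m z) : LM" for m
 using L2_borel[OF Vs] by measurable
 show "AE z in lborel. (%m. ?V n z - ?V m z) ----> ?V n z - voice g (dist_of_fun f) z" by (intro AE_I2 tendsto_diff tendsto_const pw)
 show "\<forall>\<^sub>F m in sequentially. Lpow 2 lborel (%z. ?V n z - ?V m z) <= ennreal ((sqrt ?r * (2 * e))^2)"
 using order_tendstoD(2)[OF lim e0]
 proof eventually_elim
 case (elim m)
 have d: "(%x. ps n x - ps m x) : Schw" by (intro schw_diff ps)
 have "l2norm (%x. ps n x - ps m x) <= l2norm (%x. ps n x - f x) + l2norm (%x. (-1) * (ps m x - f x))"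
 using l2norm_triangle[OF fs L2_cmult[OF fs, of "-1"], of n m] by simp
 also have "... <= 2 * e" using e elim unfolding l2norm_cmult[OF fs] by simp
 finally have le: "l2norm (%x. ps n x - ps m x) <= 2 * e" .
 have "Lpow 2 lborel (%z. ?V n z - ?V m z) = ennreal (?r * (l2norm (%x. ps n x - ps m x))^2)"
 proof -
 have "voice g (dist_of_fun (%x. ps n x - ps m x)) = (%z. ?V n z - ?V m z)"
 by (rule ext) (rule lin[OF schw_L2[OF ps] schw_L2[OF ps]])
 thus ?thesis using Lpow2_l2norm[OF S(1)[OF d]] unfolding S(2)[OF d] by (simp only:)
 qed
 also have "... <= ennreal ((sqrt ?r * (2 * e))^2)"
 using mult_left_mono[OF power_mono[OF le l2norm_nonneg, of 2] r] r by (simp only: power_mult_distrib[of "sqrt _"] real_sqrt_pow2 ennreal_leI)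
 finally show ?case .
 qed
 qed auto
 hence "(l2norm (%z. ?V n z - voice g (dist_of_fun f) z))^2 <= (sqrt ?r * (2 * e))^2"
 unfolding Lpow2_l2norm[OF L2_diff[OF Vs V]] by (simp add: ennreal_le_iff)
 thus ?thesis by (rule power2_le_imp_le) (use r e0 in auto)
 qed
 show "(%n. l2norm (%z. ?V n z - voice g (dist_of_fun f) z)) ----> 0"
 proof (rule tendsto_sandwich[OF _ _ tendsto_const])
 show "\<forall>\<^sub>F n in sequentially. l2norm (%z. ?V n z - voice g (dist_of_fun f) z) <= sqrt ?r * (2 * (l2norm (%x. ps n x - f x) + inverse (real (Suc n))))"
 by (intro always_eventually allI key) simp
 show "(%n. sqrt ?r * (2 * (l2norm (%x. ps n x - f x) + inverse (real (Suc n))))) ----> 0"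
 by (intro tendsto_mult_right_zero tendsto_add_zero lim LIMSEQ_inverse_real_of_nat)
 show "\<forall>\<^sub>F n in sequentially. 0 <= l2norm (%z. ?V n z - voice g (dist_of_fun f) z)" by simp
 qed
qed

text \<open>For \<open>S = T\<close> this is the density of a wave function; the polarised form
  gives access to differences and to higher powers.\<close>

abbreviation corr :: "('n::finite) dist => 'n dist => real^'n => complex" where
 "corr S T \<equiv> %x. fun_of_dist S x * cnj (fun_of_dist T x)"

lemma corr_integrable:
 assumes "g : Schw" "g ~= (%_. 0)" "1 <= p" "p <= 2" "S : Mspace p g" "T : Mspace p g"
 shows "L1 (corr S T)"
 by (intro Cauchy_Schwarz_lborel(1) L2_cnj Mspace_fun_of_dist(1)[OF assms(1-4)] assms)

text \<open>The Fourier integral of the product is \<open>S\<close> applied to a modulated conjugate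
  of \<open>T\<close>, and reconstruction expresses it by voices. The test function must be
  Schwartz, so \<open>T\<close> is replaced by an approximating sequence and both sides pass to the
  limit.\<close>

lemma fourier_corr:
 fixes S T :: "('n::finite) dist"
 assumes g: "g : Schw" "g ~= (%_. 0)" and p: "1 <= p" "p <= 2" and S: "S : Mspace p g" and T: "T : Mspace p g"
 shows "ennreal (recon_const g * norm (ft (corr S T) (- xi))) <= (LNINT z. ennreal (norm (voice g S z) * norm (voice g T (z - (0, xi)))))"
proof -
 let ?f = "fun_of_dist S" and ?h = "fun_of_dist T" and ?r = "cx (recon_const g)"
 note fS = Mspace_fun_of_dist[OF g p S] and fT = Mspace_fun_of_dist[OF g p T]
 have VS: "L2 (voice g S)" and VT: "L2 (voice g T)"
 using Mspace_l2_bound[OF g p] S T by blast+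
 obtain ps where ps: "!!n::nat. ps n : Schw" "(%n. l2norm (%x. ps n x - ?h x)) ----> 0" using fT(3) by blast
 note lim = voice_l2_limit[OF g(1) fT(1) ps, unfolded fT(2), OF VT]
 let ?c = "%x. cis (- (xi \<bullet> x))"
 have tr: "L2 (%z. v (z - (0, xi)))" "l2norm (%z. v (z - (0, xi))) = l2norm v" if "L2 v" for v :: "(real^'n) \<times> (real^'n) => complex"
 proof -
 have [measurable]: "v : BM" using that by (rule L2_borel)
 have "Lpow 2 lborel (%z. v (z - (0, xi))) = Lpow 2 lborel v"
 using nn_translate[of "%z. ennreal (norm (v z) powr 2)" "- (0, xi)"]
 by (simp only: Lpow_def diff_conv_add_uminus) measurable
 thus "L2 (%z. v (z - (0, xi)))" "l2norm (%z. v (z - (0, xi))) = l2norm v" using that by (auto simp: L2_def l2norm_def)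
 qed
 have mod: "L2 (%x. ?f x * ?c x)"
 using fS(1) by (auto simp: L2_def Lpow_def norm_mult)
 let ?A = "%n. LBINT x. (?f x * ?c x) * cnj (ps n x)"
 let ?Z = "%n. LBINT z. voice g S z * cnj (voice g (dist_of_fun (ps n)) (z - (0, xi)))"
 have AZ: "?r * ?A n = ?Z n" for n
 proof -
 have ph: "(%x. cnj (ps n x) * ?c x) : Schw"
 using schw_mult[OF tempgr_cis[of "- xi"] schw_cnj[OF ps(1)]] by (simp add: mult.commute)
 have "S (%x. cnj (ps n x) * ?c x) = dist_of_fun ?f (%x. cnj (ps n x) * ?c x)" by (simp only: fS(2))
 also have "... = ?A n" unfolding dist_of_fun_apply[OF ph] by (intro int_cong refl) (simp only: mult_ac)
 finally have "?r * ?A n = (LBINT z. dual_coef g (%x. cnj (ps n x) * ?c x) z * voice g S z)"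
 using voice_reconstruct(2)[OF Mspace_tempered[OF S] g(1) ph] by (simp only:)
 thus ?thesis by (simp only: dual_coef_voice[OF g(1) ps(1)] mult.commute)
 qed
 have l1: "?A ----> (LBINT x. (?f x * ?c x) * cnj (?h x))"
 proof -
 have "(%n. ?A n - (LBINT x. (?f x * ?c x) * cnj (?h x))) ----> 0"
 proof (rule Lim_null_comparison)
 show "\<forall>\<^sub>F n in sequentially. norm (?A n - (LBINT x. (?f x * ?c x) * cnj (?h x))) <= l2norm (%x. ?f x * ?c x) * l2norm (%x. ps n x - ?h x)"
 proof (intro always_eventually allI)
 fix n
 have "?A n - (LBINT x. (?f x * ?c x) * cnj (?h x)) = (LBINT x. (?f x * ?c x) * cnj (ps n x - ?h x))"
 unfolding complex_cnj_diff right_diff_distrib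
 by (rule Bochner_Integration.integral_diff[symmetric]) (intro Cauchy_Schwarz_lborel(1) mod L2_cnj schw_L2 ps fT(1))+
 thus "norm (?A n - (LBINT x. (?f x * ?c x) * cnj (?h x))) <= l2norm (%x. ?f x * ?c x) * l2norm (%x. ps n x - ?h x)"
 using Cauchy_Schwarz_lborel(3)[OF mod L2_cnj(1)[OF L2_diff[OF schw_L2[OF ps(1)] fT(1)]], of n]
 by (simp only: L2_cnj(2)[OF L2_diff[OF schw_L2[OF ps(1)] fT(1)]])
 qed
 show "(%n. l2norm (%x. ?f x * ?c x) * l2norm (%x. ps n x - ?h x)) ----> 0" by (rule tendsto_mult_right_zero[OF ps(2)])
 qed
 thus ?thesis by (simp add: LIM_zero_iff)
 qed
 let ?W = "%n z. voice g (dist_of_fun (ps n)) (z - (0, xi)) - voice g T (z - (0, xi))"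
 let ?I = "LBINT z. voice g S z * cnj (voice g T (z - (0, xi)))"
 have W: "L2 (?W n)" "l2norm (?W n) = l2norm (%z. voice g (dist_of_fun (ps n)) z - voice g T z)" for n
 by (rule tr[OF L2_diff[OF lim(2) VT]])+
 have l2: "?Z ----> ?I"
 proof -
 have "(%n. ?Z n - ?I) ----> 0"
 proof (rule Lim_null_comparison)
 show "\<forall>\<^sub>F n in sequentially. norm (?Z n - ?I) <= l2norm (voice g S) * l2norm (%z. voice g (dist_of_fun (ps n)) z - voice g T z)"
 proof (intro always_eventually allI)
 fix n
 have "?Z n - ?I = (LBINT z. voice g S z * cnj (?W n z))"
 unfolding complex_cnj_diff right_diff_distrib
 by (rule Bochner_Integration.integral_diff[symmetric]) (intro Cauchy_Schwarz_lborel(1) VS L2_cnj tr(1) lim(2) VT)+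
 thus "norm (?Z n - ?I) <= l2norm (voice g S) * l2norm (%z. voice g (dist_of_fun (ps n)) z - voice g T z)"
 using Cauchy_Schwarz_lborel(3)[OF VS L2_cnj(1)[OF W(1)], of n] by (simp only: L2_cnj(2)[OF W(1)] W(2))
 qed
 show "(%n. l2norm (voice g S) * l2norm (%z. voice g (dist_of_fun (ps n)) z - voice g T z)) ----> 0" by (rule tendsto_mult_right_zero[OF lim(1)])
 qed
 thus ?thesis by (simp add: LIM_zero_iff)
 qed
 have eq: "?r * ft (corr S T) (- xi) = ?I"
 proof -
 have "(LBINT x. (?f x * ?c x) * cnj (?h x)) = ft (corr S T) (- xi)" by (simp add: ft_def mult_ac)
 thus ?thesis using tendsto_mult_left[OF l1, of ?r] l2 unfolding AZ by (simp add: LIMSEQ_unique)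
 qed
 have r: "recon_const g >= 0" unfolding recon_const_def by (intro mult_nonneg_nonneg integral_ge_0_AE) auto
 have "recon_const g * norm (ft (corr S T) (- xi)) = norm ?I" using r arg_cong[OF eq, of norm] by (simp add: norm_mult)
 moreover have "ennreal (norm ?I) <= (LNINT z. en (voice g S z * cnj (voice g T (z - (0, xi)))))"
 by (rule integral_norm_bound_ennreal[OF Cauchy_Schwarz_lborel(1)[OF VS L2_cnj(1)[OF tr(1)[OF VT]]]])
 ultimately show ?thesis by (simp add: norm_mult)
qed

text \<open>The left side is the geometric mean of the three terms with weights
  \<open>1 / (2 * q)\<close>, \<open>1 / (2 * q)\<close> and \<open>1 - 1 / q\<close>: these give
  \<open>ka\<close> the exponent 1, and \<open>s\<close> is fixed by giving \<open>a\<close> and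
  \<open>b\<close> the exponent 1. A weighted geometric mean of nonnegative numbers is at most their
  sum.\<close>

lemma weighted_product_le:
 fixes ka a b q :: real
 assumes nn: "0 <= ka" "0 <= a" "0 <= b" and q: "1 < q"
 defines "s \<equiv> 2 * q / (2 * q - 1)"
 shows "ka * (a * b) <= ka powr q * a powr s + ka powr q * b powr s + a powr s * b powr s"
proof (cases "ka = 0 \<or> a = 0 \<or> b = 0")
 case True
 thus ?thesis by auto
next
 case False
 hence pos: "ka > 0" "a > 0" "b > 0" using nn by auto
 let ?X = "ka powr q * a powr s" and ?Y = "ka powr q * b powr s" and ?W = "a powr s * b powr s"
 let ?M = "?X + ?Y + ?W"
 have e: "s * (1 / (2 * q)) + s * (1 - 1 / q) = 1"
 proof -
 have "1 / (2 * q) + (1 - 1 / q) = (2 * q - 1) / (2 * q)" using q by (simp add: field_simps)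
 hence "s * (1 / (2 * q) + (1 - 1 / q)) = 1" unfolding s_def using q by simp
 thus ?thesis by (simp only: distrib_left)
 qed
 have x: "?X powr (1 / (2 * q)) = ka powr (1/2) * a powr (s * (1 / (2 * q)))"
 "?Y powr (1 / (2 * q)) = ka powr (1/2) * b powr (s * (1 / (2 * q)))"
 "?W powr (1 - 1 / q) = a powr (s * (1 - 1 / q)) * b powr (s * (1 - 1 / q))"
 using pos q by (simp_all add: powr_mult powr_powr)
 have "?X powr (1 / (2 * q)) * ?Y powr (1 / (2 * q)) * ?W powr (1 - 1 / q)
 = (ka powr (1/2) * ka powr (1/2)) * (a powr (s * (1 / (2 * q))) * a powr (s * (1 - 1 / q))) * (b powr (s * (1 / (2 * q))) * b powr (s * (1 - 1 / q)))"
 unfolding x by (simp only: mult_ac)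
 also have "... = ka * (a * b)" unfolding powr_add[symmetric] e using pos by simp
 finally have "ka * (a * b) = ?X powr (1 / (2 * q)) * ?Y powr (1 / (2 * q)) * ?W powr (1 - 1 / q)" ..
 also have "... <= ?M powr (1 / (2 * q)) * ?M powr (1 / (2 * q)) * ?M powr (1 - 1 / q)"
 using q by (intro mult_mono powr_mono2 mult_nonneg_nonneg add_nonneg_nonneg powr_ge_zero) (auto simp: add_nonneg_nonneg)
 also have "... = ?M powr (1 / (2 * q) + 1 / (2 * q) + (1 - 1 / q))" by (simp only: powr_add)
 also have "... = ?M"
 proof -
 have "1 / (2 * q) + 1 / (2 * q) + (1 - 1 / q) = 1" using q by (simp add: field_simps)
 moreover have "?M > 0" using pos by (intro add_pos_pos mult_pos_pos) auto
 ultimately show ?thesis by simp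
 qed
 finally show ?thesis .
qed

text \<open>The three terms are integrated in different ways: in the first two the voice power is
  integrated over phase space and the multiplier over \<open>xi\<close>; in the third the
  \<open>xi\<close> integral of the shifted voice is a frequency slice, bounded uniformly in the
  position.\<close>

lemma voice_corr_bound:
 fixes ka k :: "real^'n => real"
 assumes g: "g : Schw" "g ~= (%_. 0)" and p: "1 <= p" "p <= s"
 and [measurable]: "ka : BM" "k : BM"
 and nn: "!!xi. 0 <= ka xi" "!!xi. 0 <= k xi" "0 <= B" "0 <= Q"
 and kQ: "(LNINT xi. ennreal (k xi)) <= ennreal Q"
 and le: "!!xi a b. 0 <= a ==> 0 <= b ==> ka xi * (a * b) <= k xi * a powr s + k xi * b powr s + B * (a powr s * b powr s)"
 shows "\<exists>D\<ge>0. ALL S:Mspace p g. ALL T:Mspace p g.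
 (LNINT xi. LNINT z. ennreal (ka xi * (norm (voice g S z) * norm (voice g T (z - (0, xi)))))) <= ennreal (D * Mnorm p g S * Mnorm p g (T :: 'n dist))"
proof -
 obtain C where C: "C > 0" and V: "!!T z. T : Mspace p g ==> norm (voice g T z) <= C * Mnorm p g (T :: 'n dist)"
 "!!T. T : Mspace p g ==> Lpow s lborel (voice g (T :: 'n dist)) <= ennreal ((C * Mnorm p g T) powr s)"
 "!!T x. T : Mspace p g ==> (LNINT y. ennreal (norm (voice g T (x, y)) powr s)) <= ennreal ((C * Mnorm p g (T :: 'n dist)) powr s)"
 using voice_interpolate[OF g p] by blast
 define c where "c = C powr s"
 have c: "c >= 0" by (simp add: c_def)
 define D where "D = Q * c + Q * c + B * (c * c)"
 have D: "D >= 0" unfolding D_def using nn c by (intro add_nonneg_nonneg mult_nonneg_nonneg)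
 have "(LNINT xi. LNINT z. ennreal (ka xi * (norm (voice g S z) * norm (voice g T (z - (0, xi)))))) <= ennreal (D * Mnorm p g S * Mnorm p g T)"
 if S: "S : Mspace p g" and T: "T : Mspace p g" for S T :: "'n dist"
 proof (cases "Mnorm p g S = 0 \<or> Mnorm p g T = 0")
 case True
 hence 0: "norm (voice g S z) * norm (voice g T z') = 0" for z z'
 using V(1)[OF S, of z] V(1)[OF T, of z'] by auto
 show ?thesis unfolding 0 by simp
 next
 case False
 \<comment> \<open>The pointwise inequality is not bilinear in the voices. Normalising both to unit
   size first makes the final bound bilinear; vanishing norms were treated before.\<close>
 define M N where "M = Mnorm p g S" and "N = Mnorm p g T"
 have MN: "M > 0" "N > 0" using False Mnorm_nonneg[of p g S] Mnorm_nonneg[of p g T] unfolding M_def N_def by linarith+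
 have [measurable]: "voice g S : BM" "voice g T : BM"
 using voice_borel g(1) Mspace_tempered S T by blast+
 define a b where "a z = ennreal ((norm (voice g S z) / M) powr s)" and "b z = ennreal ((norm (voice g T z) / N) powr s)" for z
 have [measurable]: "a : BM" "b : BM" unfolding a_def[abs_def] b_def[abs_def] by measurable
 have scale: "ennreal (L powr - s) * ennreal ((C * L) powr s) = ennreal c" if "L > 0" for L
 using that C by (simp add: c_def powr_mult powr_minus ennreal_mult[symmetric] field_simps)
 have ab: "a = (%z. ennreal (M powr - s) * ennreal (norm (voice g S z) powr s))" "b = (%z. ennreal (N powr - s) * ennreal (norm (voice g T z) powr s))"
 using MN by (auto simp: a_def b_def fun_eq_iff powr_mult inverse_powr powr_minus ennreal_mult[symmetric] divide_inverse mult.commute)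
 have A: "(LNINT z. a z) <= ennreal c"
 using mult_left_mono[OF V(2)[OF S], of "ennreal (M powr - s)"] unfolding ab(1) M_def[symmetric] scale[OF MN(1)] by (simp add: nn_integral_cmult Lpow_def)
 have Bb: "(LNINT z. b z) <= ennreal c"
 using mult_left_mono[OF V(2)[OF T], of "ennreal (N powr - s)"] unfolding ab(2) N_def[symmetric] scale[OF MN(2)] by (simp add: nn_integral_cmult Lpow_def)
 have Bx: "(LNINT y. b (x, y)) <= ennreal c" for x
 using mult_left_mono[OF V(3)[OF T], of "ennreal (N powr - s)" x] unfolding ab(2) N_def[symmetric] scale[OF MN(2)] by (simp add: nn_integral_cmult)
 have Btr: "(LNINT z. b (z - (0, xi))) <= ennreal c" for xi
 proof -
 have "(LNINT z. b (z + - (0, xi))) = (LNINT z. b z)" by (rule nn_translate) measurable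
 thus ?thesis using Bb by (simp only: diff_conv_add_uminus)
 qed
 have Bsh: "(LNINT xi. b (z - (0, xi))) <= ennreal c" for z
 proof -
 have "(LNINT xi. b (fst z, snd z - xi)) = (LNINT \<eta>. b (fst z, \<eta>))"
 by (rule lborel_nn_integral_reflect[of "%\<eta>. b (fst z, \<eta>)" "snd z"]) measurable
 moreover have "z - (0, xi) = (fst z, snd z - xi)" for xi by (simp add: prod_eq_iff)
 ultimately show ?thesis using Bx[of "fst z"] by (simp only:)
 qed
 have pw: "ennreal (ka xi * (norm (voice g S z) * norm (voice g T (z - (0, xi)))))
 <= ennreal (M * N) * (ennreal (k xi) * a z + ennreal (k xi) * b (z - (0, xi)) + ennreal B * (a z * b (z - (0, xi))))" for xi z
 proof -
 let ?a = "norm (voice g S z) / M" and ?b = "norm (voice g T (z - (0, xi))) / N"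
 have "ka xi * (norm (voice g S z) * norm (voice g T (z - (0, xi)))) = (M * N) * (ka xi * (?a * ?b))" using MN by simp
 also have "... <= (M * N) * (k xi * ?a powr s + k xi * ?b powr s + B * (?a powr s * ?b powr s))"
 using MN by (intro mult_left_mono le) auto
 finally have "ennreal (ka xi * (norm (voice g S z) * norm (voice g T (z - (0, xi))))) <= ennreal ((M * N) * (k xi * ?a powr s + k xi * ?b powr s + B * (?a powr s * ?b powr s)))"
 by (rule ennreal_leI)
 also have "... = ennreal (M * N) * (ennreal (k xi) * a z + ennreal (k xi) * b (z - (0, xi)) + ennreal B * (a z * b (z - (0, xi))))"
 using MN nn unfolding a_def b_def by (simp add: ennreal_mult ennreal_plus)
 finally show ?thesis .
 qed
 have "(LNINT xi. LNINT z. ennreal (ka xi * (norm (voice g S z) * norm (voice g T (z - (0, xi))))))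
 <= (LNINT xi. LNINT z. ennreal (M * N) * (ennreal (k xi) * a z + ennreal (k xi) * b (z - (0, xi)) + ennreal B * (a z * b (z - (0, xi)))))"
 by (intro nn_integral_mono pw)
 also have "... = (LNINT xi. ennreal (M * N) * (ennreal (k xi) * (LNINT z. a z) + ennreal (k xi) * (LNINT z. b (z - (0, xi))) + ennreal B * (LNINT z. a z * b (z - (0, xi)))))"
 by (simp add: nn_integral_cmult nn_integral_add)
 also have "... <= (LNINT xi. ennreal (M * N) * (ennreal (k xi) * ennreal c + ennreal (k xi) * ennreal c + ennreal B * (LNINT z. a z * b (z - (0, xi)))))"
 by (intro nn_integral_mono mult_left_mono add_mono A Btr order_refl) auto
 also have "... = ennreal (M * N) * ((LNINT xi. ennreal (k xi)) * ennreal c + (LNINT xi. ennreal (k xi)) * ennreal c + ennreal B * (LNINT xi. LNINT z. a z * b (z - (0, xi))))"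
 by (simp add: nn_integral_cmult nn_integral_add nn_integral_multc)
 also have "(LNINT xi. LNINT z. a z * b (z - (0, xi))) = (LNINT z. LNINT xi. a z * b (z - (0, xi)))"
 by (rule lborel_pair.Fubini') measurable
 also have "... = (LNINT z. a z * (LNINT xi. b (z - (0, xi))))" by (simp add: nn_integral_cmult)
 also have "ennreal (M * N) * ((LNINT xi. ennreal (k xi)) * ennreal c + (LNINT xi. ennreal (k xi)) * ennreal c + ennreal B * (LNINT z. a z * (LNINT xi. b (z - (0, xi)))))
 <= ennreal (M * N) * (ennreal Q * ennreal c + ennreal Q * ennreal c + ennreal B * (LNINT z. a z * ennreal c))"
 by (intro mult_left_mono add_mono mult_right_mono kQ nn_integral_mono Bsh) auto
 also have "(LNINT z. a z * ennreal c) = (LNINT z. a z) * ennreal c" by (rule nn_integral_multc) measurable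
 also have "ennreal (M * N) * (ennreal Q * ennreal c + ennreal Q * ennreal c + ennreal B * ((LNINT z. a z) * ennreal c))
 <= ennreal (M * N) * (ennreal Q * ennreal c + ennreal Q * ennreal c + ennreal B * (ennreal c * ennreal c))"
 by (intro mult_left_mono add_mono mult_right_mono A order_refl) auto
 also have "... = ennreal (M * N * D)" unfolding D_def using nn c MN by (simp add: ennreal_mult ennreal_plus mult_2[of "ennreal Q * ennreal c"])
 finally show ?thesis by (simp add: M_def N_def mult_ac)
 qed
 thus ?thesis using D by blast
qed

text \<open>The common interface for the kernels: multipliers that make the Fourier transform of a
  product of two elements integrable, with a bilinear bound.\<close>

definition corr_weight :: "real => (real^'n => complex) => (real^'n => complex) => bool" where
 "corr_weight p g ka \<longleftrightarrow> ka : BM & (\<exists>D\<ge>0. ALL S:Mspace p g. ALL T:Mspace p g.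
 (LNINT xi. en (ka xi * fourier (corr S T) xi)) <= ennreal (D * Mnorm p g S * Mnorm p g (T :: ('n::finite) dist)))"

lemma corr_weightI:
 fixes ka :: "real^'n => complex" and k :: "real^'n => real"
 assumes g: "g : Schw" "g ~= (%_. 0)" and p: "1 <= p" "p <= s" "p <= 2"
 and ka [measurable]: "ka : BM" and k [measurable]: "k : BM"
 and nn: "!!xi. 0 <= k xi" "0 <= B" "0 <= Q"
 and kQ: "(LNINT xi. ennreal (k xi)) <= ennreal Q"
 and le: "!!xi a b. 0 <= a ==> 0 <= b ==> norm (ka xi) * (a * b) <= k xi * a powr s + k xi * b powr s + B * (a powr s * b powr s)"
 shows "corr_weight p g ka"
proof -
 have m: "(%xi. norm (ka xi)) : BM" by measurable
 obtain D where D: "D >= 0" and bnd: "!!S T. S : Mspace p g ==> T : Mspace p g ==>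
 (LNINT xi. LNINT z. ennreal (norm (ka xi) * (norm (voice g S z) * norm (voice g T (z - (0, xi)))))) <= ennreal (D * Mnorm p g S * Mnorm p g (T :: 'n dist))"
 using voice_corr_bound[OF g p(1,2) m k norm_ge_zero nn kQ le] by blast
 define c where "c = (2 * pi) powr (- real CARD('n) / 2) / recon_const g"
 have c: "c > 0" using recon_const_pos[OF g] by (simp add: c_def)
 have "(LNINT xi. en (ka xi * fourier (corr S T) xi)) <= ennreal ((c * D) * Mnorm p g S * Mnorm p g T)"
 if S: "S : Mspace p g" and T: "T : Mspace p g" for S T :: "'n dist"
 proof -
 have [measurable]: "voice g S : BM" "voice g T : BM"
 using voice_borel g(1) Mspace_tempered S T by blast+
 have "en (ka xi * fourier (corr S T) xi) <= ennreal c * (LNINT z. ennreal (norm (ka xi) * (norm (voice g S z) * norm (voice g T (z - (0, xi))))))" for xi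
 proof -
 have "norm (ka xi * fourier (corr S T) xi) = c * (norm (ka xi) * (recon_const g * norm (ft (corr S T) (- xi))))"
 using recon_const_pos[OF g] by (simp add: fourier_ft norm_mult c_def)
 hence "en (ka xi * fourier (corr S T) xi) = ennreal c * (en (ka xi) * ennreal (recon_const g * norm (ft (corr S T) (- xi))))"
 using c recon_const_pos[OF g] by (simp add: ennreal_mult)
 also have "... <= ennreal c * (en (ka xi) * (LNINT z. ennreal (norm (voice g S z) * norm (voice g T (z - (0, xi))))))"
 by (intro mult_left_mono fourier_corr[OF g p(1,3) S T]) auto
 finally show ?thesis by (simp add: nn_integral_cmult[symmetric] ennreal_mult)
 qed
 hence "(LNINT xi. en (ka xi * fourier (corr S T) xi)) <= (LNINT xi. ennreal c * (LNINT z. ennreal (norm (ka xi) * (norm (voice g S z) * norm (voice g T (z - (0, xi)))))))"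
 by (rule nn_integral_mono)
 also have "... = ennreal c * (LNINT xi. LNINT z. ennreal (norm (ka xi) * (norm (voice g S z) * norm (voice g T (z - (0, xi))))))"
 by (rule nn_integral_cmult) measurable
 also have "... <= ennreal c * ennreal (D * Mnorm p g S * Mnorm p g T)" by (intro mult_left_mono bnd S T) auto
 also have "... = ennreal ((c * D) * Mnorm p g S * Mnorm p g T)" using c D by (simp add: ennreal_mult[symmetric] mult.assoc)
 finally show ?thesis .
 qed
 thus ?thesis unfolding corr_weight_def using c D ka by (intro conjI exI[of _ "c * D"] ballI) auto
qed

text \<open>For exponent 1 the third term of the splitting alone suffices, with the first two set to
  zero.\<close>

lemma corr_weight_bounded:
 fixes ka :: "real^'n => complex"
 assumes "g : Schw" "g ~= (%_. 0)" "ka : BM" "!!xi. norm (ka xi) <= B"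
 shows "corr_weight 1 g ka"
proof (rule corr_weightI[where s=1 and k="%_. 0" and Q=0])
 show "norm (ka xi) * (a * b) <= 0 * a powr 1 + 0 * b powr 1 + B * (a powr 1 * b powr 1)" if "0 <= a" "0 <= b" for xi a b
 using that assms(4)[of xi] by (simp add: mult_right_mono)
 show "0 <= B" using order_trans[OF norm_ge_zero assms(4)] .
qed (use assms in auto)

text \<open>The splitting is used with \<open>k\<close> the q-th power of the multiplier;
  \<open>p\<close> may lie below the critical exponent thanks to
  \<open>voice_interpolate\<close>.\<close>

lemma corr_weight_Lspace:
 fixes ka :: "real^'n => complex"
 assumes g: "g : Schw" "g ~= (%_. 0)" and q: "1 < q" and ka: "ka : Lspace (ennreal q)" and p: "1 <= p" "p <= 2 * q / (2 * q - 1)"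
 shows "corr_weight p g ka"
proof -
 have m [measurable]: "ka : BM" and "ennpowr (Lpow q lborel ka) (1 / q) < \<infinity>"
 using ka q Lnorm_ennreal[of q lborel ka] by (auto simp: Lspace_def)
 hence fin: "Lpow q lborel ka < \<infinity>" by (cases "Lpow q lborel ka") (auto simp: ennpowr_top)
 have s: "2 * q / (2 * q - 1) <= 2" using q by (simp add: divide_le_eq)
 show ?thesis
 proof (rule corr_weightI[OF g p order_trans[OF p(2) s] m, where k="%xi. norm (ka xi) powr q" and Q="enn2real (Lpow q lborel ka)" and B=1])
 show "norm (ka xi) * (a * b) <= norm (ka xi) powr q * a powr (2 * q / (2 * q - 1)) + norm (ka xi) powr q * b powr (2 * q / (2 * q - 1)) + 1 * (a powr (2 * q / (2 * q - 1)) * b powr (2 * q / (2 * q - 1)))"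
 if "0 <= a" "0 <= b" for xi a b
 using weighted_product_le[OF norm_ge_zero that q] by simp
 show "(LNINT xi. ennreal (norm (ka xi) powr q)) <= ennreal (enn2real (Lpow q lborel ka))"
 using fin by (simp add: Lpow_def)
 show "(%xi. norm (ka xi) powr q) : BM" by measurable
 qed auto
qed

text \<open>Multiplying by an inverse transform superposes frequency translates of the voice with
  weights \<open>m\<close>. Translations preserve the norm, and \<open>kernel_power\<close> gives
  the factor 2 together with the mass \<open>K\<close>.\<close>

lemma Mspace_module:
 fixes T :: "('n::finite) dist"
 assumes g: "g : Schw" "g ~= (%_. 0)" and p: "1 <= p" "p <= 2" and T: "T : Mspace p g" and m: "L1 m"
 and K: "0 < K" and mK: "(LNINT xi. en (m xi)) <= ennreal K"
 shows "L2 (%x. inv_fourier m x * fun_of_dist T x)"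
 and "dist_of_fun (%x. inv_fourier m x * fun_of_dist T x) : Mspace p g"
 and "Mnorm p g (dist_of_fun (%x. inv_fourier m x * fun_of_dist T x)) <= 2 * K * Mnorm p g T"
proof -
 let ?f = "fun_of_dist T" and ?u = "%x. inv_fourier m x * fun_of_dist T x"
 define c where "c = (2 * pi) powr (- real CARD('n) / 2)"
 have c: "0 < c" "c <= 1"
 unfolding c_def using pi_gt3 powr_mono[of "- real CARD('n) / 2" 0 "2 * pi"] by simp_all
 note f = Mspace_fun_of_dist[OF g p T]
 have [measurable]: "?f : BM" "m : BM" using L2_borel[OF f(1)] m by auto
 have ib: "norm (inv_fourier m x) <= K" for x
 proof -
 have "ennreal (LBINT s. norm (m s)) <= ennreal K" using mK m by (simp add: nn_integral_eq_integral)
 hence "(LBINT s. norm (m s)) <= K" using K by (simp add: ennreal_le_iff)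
 hence "c * (LBINT s. norm (m s)) <= 1 * K" using c by (intro mult_mono) auto
 thus ?thesis using fourier_properties(4)[OF m, of x] by (simp add: c_def)
 qed
 have "Lpow 2 lborel ?u <= Lpow 2 lborel (%x. cx K * ?f x)"
 unfolding Lpow_def using ib K by (intro nn_integral_mono ennreal_leI powr_mono2) (auto simp: norm_mult intro!: mult_right_mono)
 also have "... < \<infinity>" using L2_cmult[OF f(1)] by (simp add: L2_def)
 finally show u: "L2 ?u" using fourier_properties(2)[OF m] by (simp add: L2_def)
 let ?V = "voice g T"
 have [measurable]: "?V : BM" using voice_borel[OF Mspace_tempered[OF T] g(1)] .
 have V: "voice g (dist_of_fun ?u) z = cx c * (LBINT xi. m xi * ?V (z - (0, xi)))" for z
 proof -
 have fE: "L1 (%t. ?f t * atom g z t)"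
 by (rule Cauchy_Schwarz_lborel(1)[OF f(1) schw_L2[OF schw_atom[OF g(1)]]])
 have "ft (%t. ?f t * atom g z t) xi = voice g (dist_of_fun ?f) (z - (0, xi))" for xi
 proof -
 have "(?f t * atom g z t) * cis (xi \<bullet> t) = ?f t * atom g (z - (0, xi)) t" for t
 proof -
 have "atom g (z - (0, xi)) t = (cis (- (snd z \<bullet> t)) * cis (xi \<bullet> t)) * cnj (g (t - fst z))"
 by (simp add: atom_def inner_diff_left cis_mult)
 also have "... = atom g z t * cis (xi \<bullet> t)" unfolding atom_def by (simp only: mult_ac)
 finally show ?thesis by (simp only: mult.assoc)
 qed
 thus ?thesis by (simp only: ft_def voice_dist_of_fun[OF g(1)])
 qed
 hence "(LBINT t. ft m t * (?f t * atom g z t)) = (LBINT xi. m xi * ?V (z - (0, xi)))"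
 using ft_multiplication(1)[OF m fE] by (simp only: f(2))
 thus ?thesis unfolding voice_dist_of_fun[OF g(1)]
 by (simp only: inv_fourier_ft c_def[symmetric] mult.assoc integral_mult_right_zero)
 qed
 have le: "Lpow p lborel (voice g (dist_of_fun ?u)) <= ennreal ((2 * K * Mnorm p g T) powr p)"
 proof -
 have 1: "ennreal (norm (voice g (dist_of_fun ?u) z) powr p) <= ennreal (2 powr p * K powr (p - 1)) * (LNINT xi. ennreal (norm (?V (z - (0, xi))) powr p * norm (m xi)))" for z
 proof (rule kernel_power[OF p(1) K norm_ge_zero])
 have "norm (voice g (dist_of_fun ?u) z) <= 1 * norm (LBINT xi. m xi * ?V (z - (0, xi)))"
 unfolding V norm_mult using c by (intro mult_right_mono) auto
 hence "en (voice g (dist_of_fun ?u) z) <= en (LBINT xi. m xi * ?V (z - (0, xi)))" by (simp add: ennreal_leI)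
 also have "... <= (LNINT xi. en (m xi * ?V (z - (0, xi))))"
 proof (cases "L1 (%xi. m xi * ?V (z - (0, xi)))")
 case True thus ?thesis by (rule integral_norm_bound_ennreal)
 next
 case False thus ?thesis by (simp add: not_integrable_integral_eq)
 qed
 finally show "en (voice g (dist_of_fun ?u) z) <= (LNINT xi. ennreal (norm (?V (z - (0, xi))) * norm (m xi)))"
 by (simp add: norm_mult mult.commute)
 show "(LNINT xi. en (m xi)) <= ennreal K" by (rule mK)
 show "(%xi. norm (?V (z - (0, xi)))) : LM" "(%xi. norm (m xi)) : LM" by measurable
 qed auto
 have tr: "(LNINT z. ennreal (norm (?V (z - (0, xi))) powr p)) = Lpow p lborel ?V" for xi
 using nn_translate[of "%z. ennreal (norm (?V z) powr p)" "- (0, xi)"]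
 by (simp only: Lpow_def diff_conv_add_uminus) measurable
 have "Lpow p lborel (voice g (dist_of_fun ?u)) <= (LNINT z. ennreal (2 powr p * K powr (p - 1)) * (LNINT xi. ennreal (norm (?V (z - (0, xi))) powr p * norm (m xi))))"
 unfolding Lpow_def by (intro nn_integral_mono 1)
 also have "... = ennreal (2 powr p * K powr (p - 1)) * (LNINT z. LNINT xi. ennreal (norm (?V (z - (0, xi))) powr p * norm (m xi)))"
 by (rule nn_integral_cmult) measurable
 also have "(LNINT z. LNINT xi. ennreal (norm (?V (z - (0, xi))) powr p * norm (m xi))) = (LNINT xi. LNINT z. ennreal (norm (?V (z - (0, xi))) powr p * norm (m xi)))"
 by (rule lborel_pair.Fubini'[symmetric]) measurable
 also have "... = (LNINT xi. Lpow p lborel ?V * en (m xi))"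
 by (simp add: ennreal_mult nn_integral_multc tr)
 also have "... = Lpow p lborel ?V * (LNINT xi. en (m xi))" by (rule nn_integral_cmult) measurable
 also have "ennreal (2 powr p * K powr (p - 1)) * (Lpow p lborel ?V * (LNINT xi. en (m xi))) <= ennreal (2 powr p * K powr (p - 1)) * (ennreal (Mnorm p g T powr p) * ennreal K)"
 unfolding Lpow_Mnorm[OF T p(1)] by (intro mult_left_mono mK) auto
 also have "... = ennreal ((2 powr p * K powr (p - 1)) * (Mnorm p g T powr p * K))" using K by (simp add: ennreal_mult)
 also have "(2 powr p * K powr (p - 1)) * (Mnorm p g T powr p * K) = (2 * K * Mnorm p g T) powr p"
 proof -
 have "K powr (p - 1) * K = K powr p" using K powr_add[of K "p - 1" 1] by simp
 thus ?thesis using K by (simp add: powr_mult mult_ac)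
 qed
 finally show ?thesis .
 qed
 show "dist_of_fun ?u : Mspace p g" unfolding Mspace_def using le_less_trans[OF le ennreal_less_top] dist_of_fun_tempered[OF u] by simp
 show "Mnorm p g (dist_of_fun ?u) <= 2 * K * Mnorm p g T" using K by (intro Mnorm_leI[OF le _ p(1)]) simp
qed

section \<open>An isometric embedding\<close>

text \<open>The extremal function of Hoelder's inequality: multiplied by \<open>W\<close> it gives
  the p-th power of the modulus. For \<open>p = 1\<close> it is the conjugate of the sign, so no
  dual exponent appears.\<close>

definition dual_fun :: "real => ('a => complex) => 'a => complex" where
 "dual_fun p W z = cnj (sgn (W z)) * cx (norm (W z) powr (p - 1))"

lemma dual_fun_borel [measurable (raw)]:
 "W : borel_measurable M ==> (%z. dual_fun p W z) : borel_measurable M"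
proof -
 assume [measurable]: "W : borel_measurable M"
 have [measurable]: "cnj : BM" by (intro borel_cont continuous_intros)
 have "cnj (sgn (W z)) = cnj (W z) / cx (norm (W z))" for z by (simp add: sgn_div_norm scaleR_conv_of_real divide_inverse mult.commute)
 hence "(%z. dual_fun p W z) = (%z. cnj (W z) / cx (norm (W z)) * cx (norm (W z) powr (p - 1)))"
 by (simp add: dual_fun_def)
 also have "... : borel_measurable M" by measurable
 finally show ?thesis .
qed

text \<open>Young's inequality for the normalised numbers \<open>a / A\<close> and
  \<open>b / B\<close>; the weights \<open>1 / p\<close> and \<open>1 - 1 / p\<close> include the
  endpoint \<open>p = 1\<close>.\<close>

lemma Hoelder_pointwise:
 fixes a b A B p :: real
 assumes "0 <= a" "0 < b" "0 < A" "0 < B" "1 <= p"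
 shows "a * b powr (p - 1) <= A * B powr (p - 1) * (1 / p * (a powr p / A powr p) + (1 - 1 / p) * (b powr p / B powr p))"
proof (cases "a = 0")
 case True
 thus ?thesis using assms by simp
next
 case False
 define x y where "x = (a / A) powr p" and "y = (b / B) powr p"
 have xy: "x > 0" "y > 0" using False assms by (auto simp: x_def y_def)
 have "a / A * (b / B) powr (p - 1) = x powr (1 / p) * y powr (1 - 1 / p)"
 proof -
 have "p * (1 - 1 / p) = p - 1" using assms by (simp add: field_simps)
 thus ?thesis using assms False by (simp add: x_def y_def powr_powr)
 qed
 also have "... <= 1 / p * x + (1 - 1 / p) * y" using assms xy by (intro Youngs_inequality_0) auto
 finally have "A * B powr (p - 1) * (a / A * (b / B) powr (p - 1)) <= A * B powr (p - 1) * (1 / p * x + (1 - 1 / p) * y)"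
 using assms by (intro mult_left_mono) auto
 moreover have "A * B powr (p - 1) * (a / A * (b / B) powr (p - 1)) = a * b powr (p - 1)" using assms by (simp add: powr_divide)
 ultimately show ?thesis using assms by (simp add: x_def y_def powr_divide)
qed

lemma Hoelder_dual_fun:
 fixes V W :: "'a => complex"
 assumes [measurable]: "V : borel_measurable M" "W : borel_measurable M" and p: "1 <= p" and AB: "0 < A" "0 < B"
 and V: "Lpow p M V <= ennreal (A powr p)" and W: "Lpow p M W <= ennreal (B powr p)"
 shows "integrable M (%z. V z * dual_fun p W z)" "norm (\<integral>z. V z * dual_fun p W z \<partial>M) <= A * B powr (p - 1)"
proof -
 let ?c = "A * B powr (p - 1)"
 have pw: "en (V z * dual_fun p W z) <= ennreal ?c * (ennreal (1 / p / A powr p) * ennreal (norm (V z) powr p) + ennreal ((1 - 1 / p) / B powr p) * ennreal (norm (W z) powr p))" for z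
 proof (cases "W z = 0")
 case False
 hence "norm (V z * dual_fun p W z) = norm (V z) * norm (W z) powr (p - 1)"
 by (simp add: dual_fun_def norm_mult norm_sgn)
 also have "... <= ?c * (1 / p / A powr p * norm (V z) powr p + (1 - 1 / p) / B powr p * norm (W z) powr p)"
 using Hoelder_pointwise[of "norm (V z)" "norm (W z)" A B p] False AB p by (simp add: mult.commute)
 finally have "en (V z * dual_fun p W z) <= ennreal (?c * (1 / p / A powr p * norm (V z) powr p + (1 - 1 / p) / B powr p * norm (W z) powr p))"
 by (rule ennreal_leI)
 also have "... = ennreal ?c * (ennreal (1 / p / A powr p) * ennreal (norm (V z) powr p) + ennreal ((1 - 1 / p) / B powr p) * ennreal (norm (W z) powr p))"
 using AB p by (simp add: ennreal_mult[symmetric] ennreal_plus[symmetric] del: ennreal_plus)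
 finally show ?thesis .
 qed (simp add: dual_fun_def)
 have "(\<integral>\<^sup>+z. en (V z * dual_fun p W z) \<partial>M) <= ennreal ?c * (ennreal (1 / p / A powr p) * Lpow p M V + ennreal ((1 - 1 / p) / B powr p) * Lpow p M W)"
 by (rule order_trans[OF nn_integral_mono[OF pw]]) (simp add: nn_integral_cmult nn_integral_add Lpow_def)
 also have "... <= ennreal ?c * (ennreal (1 / p / A powr p) * ennreal (A powr p) + ennreal ((1 - 1 / p) / B powr p) * ennreal (B powr p))"
 by (intro mult_left_mono add_mono V W) auto
 also have "... = ennreal ?c"
 using AB p by (simp add: ennreal_mult[symmetric] ennreal_plus[symmetric] del: ennreal_plus)
 finally have le: "(\<integral>\<^sup>+z. en (V z * dual_fun p W z) \<partial>M) <= ennreal ?c" .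
 have m: "(%z. V z * dual_fun p W z) : borel_measurable M" by measurable
 show i: "integrable M (%z. V z * dual_fun p W z)"
 using le_less_trans[OF le ennreal_less_top] m by (intro integrableI_bounded) auto
 have "en (\<integral>z. V z * dual_fun p W z \<partial>M) <= ennreal ?c" by (rule order_trans[OF integral_norm_bound_ennreal[OF i] le])
 thus "norm (\<integral>z. V z * dual_fun p W z \<partial>M) <= ?c" using AB by (simp add: ennreal_le_iff)
qed

text \<open>By duality the modulation space is isometric to a space of bounded functions, which makes the
 library's integration theory for Banach spaces available.\<close>

definition emb :: "real => (real^'n => complex) => ('n::finite) dist => 'n dist discrete \<Rightarrow>\<^sub>C complex" where
 "emb p g T = Bcontfun (%W. if of_discrete W : Mspace p g & Mnorm p g (of_discrete W) ~= 0
 then (LBINT z. voice g T z * dual_fun p (voice g (of_discrete W)) z) / cx (Mnorm p g (of_discrete W) powr (p - 1)) else 0)"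

context
 fixes g :: "real^'n::finite => complex" and p :: real
 assumes g: "g : Schw" "g ~= (%_. 0)" and p: "1 <= p" "p <= 2"
begin

lemma voice_dual_pairing:
 fixes T W :: "'n dist"
 assumes T: "T : Mspace p g" and W: "W : Mspace p g" "Mnorm p g W ~= 0"
 shows "L1 (%z. voice g T z * dual_fun p (voice g W) z)"
 "norm (LBINT z. voice g T z * dual_fun p (voice g W) z) <= Mnorm p g T * Mnorm p g W powr (p - 1)"
proof -
 have [measurable]: "voice g T : BM" "voice g W : BM"
 using voice_borel g(1) Mspace_tempered T W by blast+
 have B: "0 < Mnorm p g W" using W(2) Mnorm_nonneg[of p g W] by linarith
 have L: "Lpow p lborel (voice g T) = ennreal (Mnorm p g T powr p)" "Lpow p lborel (voice g W) = ennreal (Mnorm p g W powr p)"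
 by (rule Lpow_Mnorm; fact)+
 \<comment> \<open>The Hoelder estimate asks for positive bounds, so a slack above the norm of
   \<open>T\<close> covers a vanishing norm; it is removed at the end.\<close>
 have H: "L1 (%z. voice g T z * dual_fun p (voice g W) z) & norm (LBINT z. voice g T z * dual_fun p (voice g W) z) <= A * Mnorm p g W powr (p - 1)"
 if "0 < A" "Mnorm p g T <= A" for A
 proof (intro conjI)
 have le: "Lpow p lborel (voice g T) <= ennreal (A powr p)" unfolding L using that p by (intro ennreal_leI powr_mono2) auto
 show "L1 (%z. voice g T z * dual_fun p (voice g W) z)" "norm (LBINT z. voice g T z * dual_fun p (voice g W) z) <= A * Mnorm p g W powr (p - 1)"
 by (rule Hoelder_dual_fun[OF _ _ p(1) that(1) B le]; simp add: L)+
 qed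
 show "L1 (%z. voice g T z * dual_fun p (voice g W) z)"
 using H[of "Mnorm p g T + 1"] Mnorm_nonneg[of p g T] by simp
 show "norm (LBINT z. voice g T z * dual_fun p (voice g W) z) <= Mnorm p g T * Mnorm p g W powr (p - 1)"
 proof (rule field_le_epsilon)
 fix e :: real assume e: "e > 0"
 have "norm (LBINT z. voice g T z * dual_fun p (voice g W) z) <= (Mnorm p g T + e / Mnorm p g W powr (p - 1)) * Mnorm p g W powr (p - 1)"
 using H[of "Mnorm p g T + e / Mnorm p g W powr (p - 1)"] e B Mnorm_nonneg[of p g T] by (simp add: add_nonneg_pos)
 thus "norm (LBINT z. voice g T z * dual_fun p (voice g W) z) <= Mnorm p g T * Mnorm p g W powr (p - 1) + e"
 using B by (simp add: distrib_right)
 qed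
qed

text \<open>The index type carries the discrete topology, so continuity is automatic and Hoelder's
  inequality supplies the bound; dividing by the power of \<open>Mnorm\<close> normalises each
  functional.\<close>

lemma emb_apply:
 fixes T :: "'n dist"
 assumes T: "T : Mspace p g"
 shows "apply_bcontfun (emb p g T) W = (if of_discrete W : Mspace p g & Mnorm p g (of_discrete W) ~= 0
 then (LBINT z. voice g T z * dual_fun p (voice g (of_discrete W)) z) / cx (Mnorm p g (of_discrete W) powr (p - 1)) else 0)"
 (is "_ = ?F W")
 and "norm (apply_bcontfun (emb p g T) W) <= Mnorm p g T"
proof -
 have bnd: "norm (?F W) <= Mnorm p g T" for W
 proof (cases "of_discrete W : Mspace p g & Mnorm p g (of_discrete W) ~= 0")
 case True
 hence "Mnorm p g (of_discrete W) powr (p - 1) > 0" by simp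
 thus ?thesis using True voice_dual_pairing(2)[OF T, of "of_discrete W"] by (simp add: norm_divide divide_le_eq)
 qed simp
 have "?F : bcontfun"
 proof (rule bcontfun_normI[OF _ bnd])
 show "continuous_on UNIV ?F" unfolding continuous_on_open_vimage[OF open_UNIV] using open_discrete by blast
 qed
 thus "apply_bcontfun (emb p g T) W = ?F W" unfolding emb_def by (simp add: Bcontfun_inverse)
 with bnd show "norm (apply_bcontfun (emb p g T) W) <= Mnorm p g T" by simp
qed

text \<open>The supremum is attained at the index \<open>T\<close> itself, where Hoelder's
  inequality is an equality.\<close>

lemma norm_emb:
 fixes T :: "'n dist"
 assumes T: "T : Mspace p g"
 shows "norm (emb p g T) = Mnorm p g T"
proof (rule antisym)
 show "norm (emb p g T) <= Mnorm p g T" by (rule norm_bound) (rule emb_apply(2)[OF T])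
 show "Mnorm p g T <= norm (emb p g T)"
 proof (cases "Mnorm p g T = 0")
 case False
 hence pos: "Mnorm p g T > 0" using Mnorm_nonneg[of p g T] by linarith
 have [measurable]: "voice g T : BM" using voice_borel[OF Mspace_tempered[OF T] g(1)] .
 have "voice g T z * dual_fun p (voice g T) z = cx (norm (voice g T z) powr p)" for z
 proof (cases "voice g T z = 0")
 case False
 have "voice g T z * cnj (sgn (voice g T z)) = cx (norm (voice g T z))"
 proof -
 have "voice g T z * cnj (sgn (voice g T z)) = cx ((norm (voice g T z))^2) / cx (norm (voice g T z))"
 by (simp only: complex_norm_square) (simp add: sgn_div_norm scaleR_conv_of_real divide_inverse mult_ac)
 thus ?thesis using False by (simp add: power2_eq_square)
 qed
 moreover have "norm (voice g T z) * norm (voice g T z) powr (p - 1) = norm (voice g T z) powr p"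
 using False powr_add[of "norm (voice g T z)" 1 "p - 1"] by simp
 ultimately show ?thesis by (simp only: dual_fun_def mult.assoc[symmetric] of_real_mult[symmetric])
 qed (simp add: dual_fun_def)
 hence "(LBINT z. voice g T z * dual_fun p (voice g T) z) = cx (LBINT z. norm (voice g T z) powr p)"
 by (simp only: integral_complex_of_real)
 also have "(LBINT z. norm (voice g T z) powr p) = Mnorm p g T powr p"
 using Lpow_Mnorm[OF T p(1)] by (subst integral_eq_nn_integral) (auto simp: Lpow_def)
 also have "cx (Mnorm p g T powr p) / cx (Mnorm p g T powr (p - 1)) = cx (Mnorm p g T)"
 using pos by (simp add: powr_diff flip: of_real_divide)
 finally have "apply_bcontfun (emb p g T) (discrete T) = cx (Mnorm p g T)"
 if "True" using T False pos by (simp add: emb_apply(1)[OF T] discrete_inverse powr_diff flip: of_real_divide)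
 thus ?thesis using norm_bounded[of "emb p g T" "discrete T"] pos by simp
 qed simp
qed

lemma emb_lincomb:
 fixes S T :: "'n dist"
 assumes S: "S : Mspace p g" and T: "T : Mspace p g"
 shows "emb p g (%ph. cx a * S ph + cx b * T ph) = a *r emb p g S + b *r emb p g T"
proof (rule bcontfun_eqI)
 fix W
 show "apply_bcontfun (emb p g (%ph. cx a * S ph + cx b * T ph)) W = apply_bcontfun (a *r emb p g S + b *r emb p g T) W"
 proof (cases "of_discrete W : Mspace p g & Mnorm p g (of_discrete W) ~= 0")
 case True
 let ?W = "of_discrete W"
 have i: "L1 (%z. cx c * (voice g R z * dual_fun p (voice g ?W) z))" if "R : Mspace p g" for c and R :: "'n dist"
 by (rule integrable_mult_right[OF voice_dual_pairing(1)[OF that]]) (use True in auto)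
 have "(LBINT z. voice g (%ph. cx a * S ph + cx b * T ph) z * dual_fun p (voice g ?W) z)
 = (LBINT z. cx a * (voice g S z * dual_fun p (voice g ?W) z) + cx b * (voice g T z * dual_fun p (voice g ?W) z))"
 by (simp only: voice_lincomb distrib_right mult.assoc)
 also have "... = cx a * (LBINT z. voice g S z * dual_fun p (voice g ?W) z) + cx b * (LBINT z. voice g T z * dual_fun p (voice g ?W) z)"
 by (simp only: Bochner_Integration.integral_add[OF i[OF S] i[OF T]] integral_mult_right_zero)
 finally show ?thesis using True
 by (simp add: emb_apply(1) S T Mspace_lincomb g p plus_bcontfun.rep_eq scaleR_bcontfun.rep_eq scaleR_conv_of_real add_divide_distrib)
 qed (simp add: emb_apply(1) S T Mspace_lincomb g p plus_bcontfun.rep_eq scaleR_bcontfun.rep_eq)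
qed

lemma emb_diff: "S : Mspace p g ==> T : Mspace p g ==> emb p g (%ph. S ph - T ph) = emb p g S - emb p g (T :: 'n dist)"
 using emb_lincomb[of S T 1 "-1"] by simp

lemma emb_add: "S : Mspace p g ==> T : Mspace p g ==> emb p g (%ph. S ph + T ph) = emb p g S + emb p g (T :: 'n dist)"
 using emb_lincomb[of S T 1 1] by simp

lemma emb_zero: "emb p g (%_. 0 :: complex) = (0 :: 'n dist discrete \<Rightarrow>\<^sub>C complex)"
 using norm_emb[OF Mspace_zero[OF p(1)]] Mnorm_zero[OF p(1), of g] by simp

lemma emb_sum:
 assumes "finite I" "!!i. i : I ==> T i : Mspace p g"
 shows "emb p g (%ph. \<Sum>i\<in>I. cx (c i) * T i ph) = (\<Sum>i\<in>I. c i *r emb p g (T i :: 'n dist))"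
 using assms
proof (induction I rule: finite_induct)
 case (insert i I)
 have "(%ph. \<Sum>i\<in>I. cx (c i) * T i ph) : Mspace p g" by (rule Mspace_sum) (use insert g p in auto)
 thus ?case using insert emb_lincomb[of "T i" "%ph. \<Sum>i\<in>I. cx (c i) * T i ph" "c i" 1] by simp
qed (simp add: emb_zero)

lemma emb_inject:
 fixes S T :: "'n dist"
 assumes S: "S : Mspace p g" and T: "T : Mspace p g" and eq: "emb p g S = emb p g T"
 shows "S = T"
proof -
 have "Mnorm p g (%ph. S ph - T ph) = 0" using norm_emb[OF Mspace_diff[OF S T g(1) p(1)]] emb_diff[OF S T] eq by simp
 moreover obtain C where "ALL T:Mspace p g. ALL z. norm (voice g T z) <= C * Mnorm p g (T :: 'n dist)"
 using voice_sup_bound[OF g g(1) p(1)] by blast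
 ultimately have "voice g (%ph. S ph - T ph) z = 0" for z using Mspace_diff[OF S T g(1) p(1)] by fastforce
 thus ?thesis by (intro tempered_eqI[OF Mspace_tempered[OF S] Mspace_tempered[OF T] g]) (simp add: voice_def)
qed

lemma Mnorm_diff_emb: "S : Mspace p g ==> T : Mspace p g ==> Mnorm p g (%ph. S ph - T ph) = norm (emb p g S - emb p g (T :: 'n dist))"
 using norm_emb[OF Mspace_diff[OF _ _ g(1) p(1)]] emb_diff by metis

lemma closed_emb: "closed (emb p g ` (Mspace p g :: 'n dist set))"
proof (rule complete_imp_closed, rule completeI)
 fix f assume f: "ALL n. f n : emb p g ` (Mspace p g :: 'n dist set)" and c: "Cauchy f"
 from f have "ALL n. EX T. T : Mspace p g & f n = emb p g (T :: 'n dist)" by blast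
 then obtain T :: "nat => 'n dist" where T: "!!n. T n : Mspace p g" "!!n. f n = emb p g (T n)" by metis
 have "EX N. \<forall>m\<ge>N. \<forall>n\<ge>N. Mnorm p g (%ph. T m ph - T n ph) < e" if "e > 0" for e
 using c that by (simp add: Cauchy_def dist_norm T Mnorm_diff_emb)
 from Mspace_complete[OF g p T(1) this] obtain S where S: "S : Mspace p g" "(%n. Mnorm p g (%ph. T n ph - S ph)) ----> 0" by blast
 have "(%n. f n - emb p g S) ----> 0" using S(2) by (subst tendsto_norm_zero_iff[symmetric]) (simp add: T Mnorm_diff_emb S(1))
 hence "f ----> emb p g S" by (simp add: LIM_zero_iff)
 thus "EX l:emb p g ` (Mspace p g :: 'n dist set). f ----> l" using S(1) by blast
qed

end

section \<open>Semilinear evolution equations\<close>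

text \<open>\<open>has_mod_integral\<close> wants one mesh size for all tags, whereas the Henstock
  integral allows a variable gauge; uniform continuity of the integrand gives the former.\<close>

lemma uniform_Riemann_sums:
 fixes G :: "real => 'b::banach"
 assumes G: "continuous_on {a..b} G" and e: "e > 0"
 shows "\<exists>\<delta>>0. ALL D. D tagged_division_of {a..b} & (%ta. ball ta \<delta>) fine D -->
 norm ((\<Sum>(ta, I)\<in>D. measure lborel I *r G ta) - integral {a..b} G) < e"
proof -
 define e' where "e' = e / (2 * (\<bar>b - a\<bar> + 1))"
 have e': "e' > 0" unfolding e'_def using e by (intro divide_pos_pos mult_pos_pos add_nonneg_pos) auto
 have "uniformly_continuous_on {a..b} G" by (rule compact_uniformly_continuous[OF G compact_Icc])
 then obtain \<delta> where \<delta>: "\<delta> > 0" "!!x y. x : {a..b} ==> y : {a..b} ==> dist y x < \<delta> ==> dist (G y) (G x) < e'"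
 unfolding uniformly_continuous_on_def using e' by metis
 have "norm ((\<Sum>(ta, I)\<in>D. measure lborel I *r G ta) - integral {a..b} G) < e"
 if D: "D tagged_division_of {a..b}" and fine: "(%ta. ball ta \<delta>) fine D" for D
 proof -
 have int: "integral {a..b} G = (\<Sum>(ta, I)\<in>D. integral I G)"
 using integral_combine_tagged_division_topdown[of G a b D] integrable_continuous_real[OF G] D by simp
 have "norm (measure lborel I *r G ta - integral I G) <= e' * measure lborel I" if taI: "(ta, I) : D" for ta I
 proof -
 obtain c d where I: "I = {c..d}" using tagged_division_ofD(4)[OF D taI] by auto
 have sub: "I \<subseteq> {a..b}" "ta : I" "I \<subseteq> ball ta \<delta>" using tagged_division_ofD(2,3)[OF D taI] fine taI by (auto simp: fine_def)
 have cd: "c <= d" using sub(2) I by simp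
 have GI: "continuous_on {c..d} G" using continuous_on_subset[OF G] sub(1) I by simp
 have i: "(%x. G ta - G x) integrable_on {c..d}" by (intro integrable_continuous_real continuous_intros GI)
 have "integral {c..d} (%x. G ta - G x) = measure lborel I *r G ta - integral I G"
 using cd integral_diff[OF integrable_const_ivl integrable_continuous_real[OF GI], of "G ta"] by (simp add: I)
 moreover have "norm (integral {c..d} (%x. G ta - G x)) <= e' * (d - c)"
 proof (rule integral_bound[OF cd])
 show "continuous_on {c..d} (%x. G ta - G x)" by (intro continuous_intros GI)
 show "norm (G ta - G x) <= e'" if "x : {c..d}" for x
 proof -
 have x: "x : I" using that I by simp
 hence "dist ta x < \<delta>" using sub(3) by auto
 hence "dist (G ta) (G x) < e'" using \<delta>(2)[of x ta] sub(1,2) x by blast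
 thus ?thesis by (simp add: dist_norm)
 qed
 qed
 ultimately show ?thesis using cd by (simp add: I)
 qed
 hence "norm ((\<Sum>(ta, I)\<in>D. measure lborel I *r G ta) - (\<Sum>(ta, I)\<in>D. integral I G)) <= (\<Sum>(ta, I)\<in>D. e' * measure lborel I)"
 unfolding sum_subtractf[symmetric] by (intro sum_norm_le) (auto simp: split_def)
 also have "... = e' * (\<Sum>(ta, I)\<in>D. measure lborel I)" by (simp add: sum_distrib_left split_def)
 also have "(\<Sum>(ta, I)\<in>D. measure lborel I) = measure lborel {a..b}" using additive_content_tagged_division[of D a b] D by simp
 also have "e' * measure lborel {a..b} <= e' * \<bar>b - a\<bar>" using e' by (intro mult_left_mono) (auto simp: content_real_if)
 also have "... < e" using e by (simp add: e'_def field_simps add_pos_nonneg)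
 finally show ?thesis unfolding int .
 qed
 thus ?thesis using \<delta>(1) by blast
qed

lemma integral_mem_closed_subspace:
 fixes f :: "real => 'b::banach"
 assumes X: "closed X" "subspace X" and f: "f integrable_on {a..b}" and fX: "!!x. x : {a..b} ==> f x : X"
 shows "integral {a..b} f : X"
proof -
 have "EX y:X. dist y (integral {a..b} f) < e" if "e > 0" for e
 proof -
 obtain \<gamma> where \<gamma>: "gauge \<gamma>" "!!D. D tagged_division_of (cbox a b) ==> \<gamma> fine D ==> norm ((\<Sum>(x,k)\<in>D. measure lborel k *r f x) - integral {a..b} f) < e"
 using has_integralD[of f "integral {a..b} f" a b e] integrable_integral[OF f] \<open>e > 0\<close> by auto
 obtain D where D: "D tagged_division_of (cbox a b)" "\<gamma> fine D" using fine_division_exists[OF \<gamma>(1)] by blast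
 have "(\<Sum>(x,k)\<in>D. measure lborel k *r f x) : X"
 proof (rule subspace_sum[OF X(2)], safe)
 fix x k assume "(x, k) : D"
 hence "x : {a..b}" using tagged_division_ofD(2,3)[OF D(1), of x k] by auto
 thus "measure lborel k *r f x : X" by (intro subspace_scale[OF X(2)] fX)
 qed
 thus ?thesis using \<gamma>(2)[OF D] by (auto simp: dist_norm)
 qed
 thus ?thesis using X(1) by (metis closed_approachable)
qed

text \<open>\<open>X\<close> will be the image of the modulation space among bounded functions: a
  closed subspace and not a type, hence the membership conditions. \<open>F\<close> will contain the
  factor \<open>- \<i>\<close>, so that only real-linear structure is involved.\<close>

locale semilinear =
 fixes X :: "'b::banach set" and U :: "real => 'b => 'b" and F :: "'b => 'b" and C :: real
 assumes X: "closed X" "subspace X"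
 and C: "C > 0"
 and U_mem: "x : X ==> U t x : X"
 and U_diff: "x : X ==> y : X ==> U t (x - y) = U t x - U t y"
 and U_bound: "x : X ==> norm (U t x) <= C * norm x"
 and U_continuous: "x : X ==> continuous_on UNIV (%t. U t x)"
 and F_mem: "x : X ==> F x : X"
 and F_Lipschitz: "EX L. ALL x:X. ALL y:X. norm x <= R & norm y <= R --> norm (F x - F y) <= L * norm (x - y)"
begin

lemma F_Lipschitz_pos:
 obtains L where "L > 0" "!!x y. x : X ==> y : X ==> norm x <= R ==> norm y <= R ==> norm (F x - F y) <= L * norm (x - y)"
proof -
 obtain L where L: "!!x y. x : X ==> y : X ==> norm x <= R ==> norm y <= R ==> norm (F x - F y) <= L * norm (x - y)"
 using F_Lipschitz[of R] by blast
 have "norm (F x - F y) <= (\<bar>L\<bar> + 1) * norm (x - y)" if "x : X" "y : X" "norm x <= R" "norm y <= R" for x y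
 by (rule order_trans[OF L[OF that]]) (intro mult_right_mono, auto)
 thus ?thesis using that[of "\<bar>L\<bar> + 1"] by simp
qed

text \<open>Continuity in time for a fixed vector and the bound \<open>C\<close>, uniform in time,
  control the two parts of the difference.\<close>

lemma U_jointly_continuous:
 fixes A :: "'a::topological_space set"
 assumes t: "continuous_on A t" and v: "continuous_on A v" "!!a. a : A ==> v a : X"
 shows "continuous_on A (%a. U (t a) (v a))"
 unfolding continuous_on_def
proof
 fix a assume a: "a : A"
 have "((%b. U (t b) (v b) - U (t b) (v a)) ~~> 0) (at a within A)"
 proof (rule Lim_null_comparison)
 show "\<forall>\<^sub>F b in at a within A. norm (U (t b) (v b) - U (t b) (v a)) <= C * norm (v b - v a)"
 using U_bound[OF subspace_diff[OF X(2) v(2) v(2)[OF a]]] U_diff[OF v(2) v(2)[OF a]]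
 by (auto simp: eventually_at_filter)
 show "((%b. C * norm (v b - v a)) ~~> 0) (at a within A)"
 using v(1) a by (intro tendsto_mult_right_zero tendsto_norm_zero LIM_zero) (auto simp: continuous_on_def)
 qed
 moreover have "((%b. U (t b) (v a)) ~~> U (t a) (v a)) (at a within A)"
 using continuous_on_compose2[OF U_continuous[OF v(2)[OF a]] t] a by (auto simp: continuous_on_def)
 ultimately show "((%b. U (t b) (v b)) ~~> U (t a) (v a)) (at a within A)"
 using tendsto_add[of "%b. U (t b) (v b) - U (t b) (v a)" 0 _ "%b. U (t b) (v a)"] by simp
qed

lemma F_continuous: "continuous_on X F"
 unfolding continuous_on_iff
proof (intro ballI allI impI)
 fix x and e :: real assume x: "x : X" and e: "e > 0"
 obtain L where L: "L > 0" "!!x' y. x' : X ==> y : X ==> norm x' <= norm x + 1 ==> norm y <= norm x + 1 ==> norm (F x' - F y) <= L * norm (x' - y)"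
 using F_Lipschitz_pos[of "norm x + 1"] by blast
 have "dist (F y) (F x) < e" if y: "y : X" "dist y x < min 1 (e / L)" for y
 proof -
 have n: "norm (y - x) < 1" "norm (y - x) < e / L" using y by (auto simp: dist_norm)
 have "norm y <= norm x + 1" using n norm_triangle_ineq2[of y x] by linarith
 hence "norm (F y - F x) <= L * norm (y - x)" using L(2)[OF y(1) x] by simp
 also have "... < e" using n(2) L(1) by (simp add: field_simps)
 finally show ?thesis by (simp add: dist_norm)
 qed
 thus "\<exists>d>0. ALL y:X. dist y x < d --> dist (F y) (F x) < e" using e L(1) by (intro exI[of _ "min 1 (e / L)"]) auto
qed

definition duh_term :: "(real => 'b) => real => 'b" where
 "duh_term u t = integral {0..t} (%ta. U (t - ta) (F (u ta)))"

lemma duhamel_integrand_continuous: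
 assumes "continuous_on {0..t} u" "!!ta. ta : {0..t} ==> u ta : X"
 shows "continuous_on {0..t} (%ta. U (t - ta) (F (u ta)))"
 using assms by (intro U_jointly_continuous continuous_intros continuous_on_compose2[OF F_continuous] F_mem) auto

lemma duh_term_mem:
 assumes "continuous_on {0..t} u" "!!ta. ta : {0..t} ==> u ta : X"
 shows "duh_term u t : X"
 unfolding duh_term_def using assms
 by (intro integral_mem_closed_subspace X integrable_continuous_real duhamel_integrand_continuous U_mem F_mem) auto

text \<open>Rescaling to the fixed interval \<open>{0..1}\<close> moves the variable endpoint into
  the integrand, where continuity in a parameter applies.\<close>

lemma duh_term_continuous:
 assumes u: "continuous_on {0..T} u" "!!ta. ta : {0..T} ==> u ta : X"
 shows "continuous_on {0..T} (duh_term u)"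
proof -
 have "continuous_on ({0..T} \<times> cbox 0 1) (%(t, \<sigma>). U (t - t * \<sigma>) (F (u (t * \<sigma>))))"
 proof -
 have m: "t * \<sigma> : {0..T}" if "t : {0..T}" "\<sigma> : cbox 0 1" for t \<sigma> :: real
 using that mult_left_le[of \<sigma> t] by auto
 have "continuous_on ({0..T} \<times> cbox 0 1) (%z. U (fst z - fst z * snd z) (F (u (fst z * snd z))))"
 by (intro U_jointly_continuous continuous_intros continuous_on_compose2[OF F_continuous] continuous_on_compose2[OF u(1)] F_mem)
 (use m u(2) in auto)
 thus ?thesis by (simp add: split_def)
 qed
 from integral_continuous_on_param[OF this]
 have c: "continuous_on {0..T} (%t. t *r integral {0..1} (%\<sigma>. U (t - t * \<sigma>) (F (u (t * \<sigma>)))))"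
 by (intro continuous_intros) simp
 have "duh_term u t = t *r integral {0..1} (%\<sigma>. U (t - t * \<sigma>) (F (u (t * \<sigma>))))" if t: "t : {0..T}" for t
 proof (cases "t = 0")
 case False
 hence t0: "t > 0" using t by simp
 have "((%ta. U (t - ta) (F (u ta))) has_integral duh_term u t) {0..t}"
 unfolding duh_term_def using t u
 by (intro integrable_integral integrable_continuous_real duhamel_integrand_continuous) (auto intro: continuous_on_subset)
 from has_integral_stretch_real[OF this False]
 have "((%\<sigma>. U (t - t * \<sigma>) (F (u (t * \<sigma>)))) has_integral (1 / t) *r duh_term u t) ((%x. x / t) ` {0..t})" using t0 by simp
 moreover have "(%x. x / t) ` {0..t} = {0..1}" using t0 by (simp add: image_divide_atLeastAtMost)
 ultimately have "integral {0..1} (%\<sigma>. U (t - t * \<sigma>) (F (u (t * \<sigma>)))) = (1 / t) *r duh_term u t" by (simp add: integral_unique)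
 thus ?thesis using t0 by simp
 qed (simp add: duh_term_def)
 thus ?thesis using c by (subst continuous_on_cong[OF refl]) auto
qed

lemma duh_term_diff_bound:
 assumes u: "continuous_on {0..t} u" "!!ta. ta : {0..t} ==> u ta : X"
 and v: "continuous_on {0..t} v" "!!ta. ta : {0..t} ==> v ta : X"
 and le: "!!ta. ta : {0..t} ==> norm (F (u ta) - F (v ta)) <= b ta" and b: "continuous_on {0..t} b"
 shows "norm (duh_term u t - duh_term v t) <= C * integral {0..t} b"
proof -
 note cu = duhamel_integrand_continuous[OF u] and cv = duhamel_integrand_continuous[OF v]
 have "duh_term u t - duh_term v t = integral {0..t} (%ta. U (t - ta) (F (u ta)) - U (t - ta) (F (v ta)))"
 unfolding duh_term_def by (rule integral_diff[symmetric, OF integrable_continuous_real[OF cu] integrable_continuous_real[OF cv]])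
 also have "norm ... <= integral {0..t} (%ta. C * b ta)"
 proof (rule integral_norm_bound_integral)
 show "(%ta. U (t - ta) (F (u ta)) - U (t - ta) (F (v ta))) integrable_on {0..t}"
 by (rule integrable_continuous_real[OF continuous_on_diff[OF cu cv]])
 show "(%ta. C * b ta) integrable_on {0..t}"
 by (rule integrable_continuous_real[OF continuous_on_mult_left[OF b]])
 fix ta assume ta: "ta : {0..t}"
 have "norm (U (t - ta) (F (u ta)) - U (t - ta) (F (v ta))) <= C * norm (F (u ta) - F (v ta))"
 using U_bound[OF subspace_diff[OF X(2) F_mem[OF u(2)[OF ta]] F_mem[OF v(2)[OF ta]]]] U_diff[OF F_mem[OF u(2)[OF ta]] F_mem[OF v(2)[OF ta]]] by simp
 also have "... <= C * b ta" using le[OF ta] C by simp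
 finally show "norm (U (t - ta) (F (u ta)) - U (t - ta) (F (v ta))) <= C * b ta" .
 qed
 finally show ?thesis by simp
qed

text \<open>Banach's fixed point theorem on curves in a ball of \<open>X\<close>. The time is
  quantified before the data, since only the radius \<open>M\<close> enters its choice.\<close>

lemma local_existence:
 assumes M: "M >= 0"
 shows "\<exists>T>0. ALL u0:X. norm u0 <= M --> (EX u. continuous_on {0..T} u & (ALL t:{0..T}. u t : X & u t = U t u0 + duh_term u t))"
proof -
 \<comment> \<open>The free evolution stays within \<open>C * M\<close>, which leaves room 1 for the
   integral term.\<close>
 define R where "R = C * M + 1"
 have R: "R > 0" using M C by (simp add: R_def add_nonneg_pos)
 obtain L where L: "L > 0" "!!x y. x : X ==> y : X ==> norm x <= R ==> norm y <= R ==> norm (F x - F y) <= L * norm (x - y)"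
 using F_Lipschitz_pos[of R] by blast
 define K where "K = norm (F 0) + L * R"
 have K: "K > 0" using L R by (simp add: K_def add_nonneg_pos)
 have 0: "0 : X" by (rule subspace_0[OF X(2)])
 have FK: "norm (F x) <= K" if "x : X" "norm x <= R" for x
 proof -
 have "norm (F x - F 0) <= L * norm x" using L(2)[OF that(1) 0 that(2)] R by simp
 also have "... <= L * R" using that L by (intro mult_left_mono) auto
 finally show ?thesis using norm_triangle_ineq2[of "F x" "F 0"] by (simp add: K_def)
 qed
 \<comment> \<open>The first entry keeps the ball invariant, the second makes the map contract by
   one half.\<close>
 define T where "T = min (1 / (C * K)) (1 / (2 * C * L))"
 have T: "T > 0" using C K L by (simp add: T_def)
 have TK: "C * (K * T) <= 1" and TL: "C * (L * T) <= 1 / 2"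
 proof -
 have "T <= 1 / (C * K)" "T <= 1 / (2 * C * L)" by (auto simp: T_def)
 thus "C * (K * T) <= 1" "C * (L * T) <= 1 / 2" using C K L by (simp_all add: field_simps)
 qed
 have "EX u. continuous_on {0..T} u & (ALL t:{0..T}. u t : X & u t = U t u0 + duh_term u t)" if u0: "u0 : X" "norm u0 <= M" for u0
 proof -
 \<comment> \<open>Curves live on the whole line, so that the complete type of bounded continuous
   functions can be used; the clamp \<open>cl\<close> makes the map look only at times in
   \<open>{0..T}\<close>.\<close>
 define S where "S = PiC UNIV (%_::real. X \<inter> cball 0 R)"
 define cl where "cl t = max 0 (min t T)" for t :: real
 have cl: "cl t : {0..T}" for t using T by (auto simp: cl_def)
 have clc: "continuous_on UNIV cl" unfolding cl_def by (intro continuous_intros)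
 define \<Phi> where "\<Phi> w t = U (cl t) u0 + duh_term w (cl t)" for w :: "real => 'b" and t
 have S: "apply_bcontfun w t : X" "norm (apply_bcontfun w t) <= R" if "w : S" for w t
 using that by (auto simp: S_def mem_PiC_iff Pi_iff)
 have cw: "continuous_on A (apply_bcontfun w)" for w :: "real \<Rightarrow>\<^sub>C 'b" and A by simp
 have Un: "norm (U t u0) <= C * M" for t using U_bound[OF u0(1), of t] u0(2) C by (meson less_imp_le mult_left_mono order_trans)
 have \<Phi>S: "\<Phi> w t : X \<inter> cball 0 R" if w: "w : S" for w t
 proof -
 have "norm (duh_term (apply_bcontfun w) (cl t)) <= (C * K) * (cl t - 0)"
 unfolding duh_term_def
 proof (rule integral_bound)
 show "continuous_on {0..cl t} (%ta. U (cl t - ta) (F (apply_bcontfun w ta)))" by (intro duhamel_integrand_continuous cw S w)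
 show "norm (U (cl t - ta) (F (apply_bcontfun w ta))) <= C * K" for ta
 using U_bound[OF F_mem[OF S(1)[OF w]]] FK[OF S[OF w]] C by (meson less_imp_le mult_left_mono order_trans)
 qed (use cl in auto)
 also have "... <= (C * K) * T" using cl[of t] C K by (intro mult_left_mono) auto
 finally have "norm (\<Phi> w t) <= R"
 using norm_triangle_ineq[of "U (cl t) u0" "duh_term (apply_bcontfun w) (cl t)"] Un[of "cl t"] TK by (simp add: \<Phi>_def R_def mult.assoc)
 moreover have "\<Phi> w t : X" unfolding \<Phi>_def by (intro subspace_add[OF X(2)] U_mem u0 duh_term_mem cw S w)
 ultimately show ?thesis by simp
 qed
 have \<Phi>c: "\<Phi> w : bcontfun" if w: "w : S" for w
 proof (rule bcontfun_normI)
 have "continuous_on {0..T} (%t. U t u0 + duh_term (apply_bcontfun w) t)"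
 by (intro continuous_on_add duh_term_continuous continuous_on_subset[OF U_continuous[OF u0(1)]] cw S w) auto
 thus "continuous_on UNIV (\<Phi> w)"
 unfolding \<Phi>_def by (rule continuous_on_compose2[OF _ clc]) (use cl in auto)
 show "norm (\<Phi> w t) <= R" for t using \<Phi>S[OF w, of t] by simp
 qed
 have "closed S" unfolding S_def by (intro closed_PiC closed_Int X closed_cball)
 hence "\<exists>!w. w : S & Bcontfun (\<Phi> w) = w"
 proof (rule Banach_fix[OF iffD2[OF complete_eq_closed]])
 have "const_bcontfun 0 : S" using 0 R by (simp add: S_def mem_PiC_iff const_bcontfun.rep_eq)
 thus "S ~= {}" by blast
 show "(%w. Bcontfun (\<Phi> (apply_bcontfun w))) ` S \<subseteq> S"
 using \<Phi>S \<Phi>c by (auto simp: S_def mem_PiC_iff Bcontfun_inverse)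
 show "dist (Bcontfun (\<Phi> x)) (Bcontfun (\<Phi> y)) <= 1 / 2 * dist x y" if x: "x : S" and y: "y : S" for x y
 proof (rule dist_bound)
 fix t
 have "norm (duh_term x (cl t) - duh_term y (cl t)) <= C * integral {0..cl t} (%_. L * dist x y)"
 proof (rule duh_term_diff_bound)
 show "norm (F (apply_bcontfun x ta) - F (apply_bcontfun y ta)) <= L * dist x y" for ta
 by (rule order_trans[OF L(2)[OF S(1)[OF x] S(1)[OF y] S(2)[OF x] S(2)[OF y]]])
 (use dist_bounded[of x ta y] L(1) in \<open>auto simp: dist_norm[symmetric] intro!: mult_left_mono\<close>)
 qed (auto intro: S x y)
 also have "... <= C * (L * T) * dist x y" using cl[of t] C L by (auto intro!: mult_left_mono mult_right_mono)
 also have "... <= 1 / 2 * dist x y" using TL by (intro mult_right_mono) auto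
 finally show "dist (apply_bcontfun (Bcontfun (\<Phi> x)) t) (apply_bcontfun (Bcontfun (\<Phi> y)) t) <= 1 / 2 * dist x y"
 using \<Phi>c[OF x] \<Phi>c[OF y] by (simp add: Bcontfun_inverse \<Phi>_def dist_norm)
 qed
 qed auto
 then obtain w where w: "w : S" "Bcontfun (\<Phi> w) = w" by blast
 have "apply_bcontfun w t = U t u0 + duh_term w t" if "t : {0..T}" for t
 using arg_cong[OF w(2), of "%w. apply_bcontfun w t"] that \<Phi>c[OF w(1)] by (simp add: Bcontfun_inverse \<Phi>_def cl_def)
 thus ?thesis using S[OF w(1)] cw by blast
 qed
 thus ?thesis using T by blast
qed

text \<open>Gronwall in the form of a weighted maximum: at the point \<open>s\<close> where
  \<open>exp (- a * s)\<close> times the distance is largest, integrating the weight costs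
  \<open>1 / a\<close>. With \<open>a = 2 * (C * L)\<close> the distance at \<open>s\<close> is at
  most half of itself. No smallness of the interval is involved, so uniqueness holds up to any
  \<open>T\<close>.\<close>

lemma uniqueness:
 assumes u: "continuous_on {0..<T} u" "!!t. t : {0..<T} ==> u t : X" "!!t. t : {0..<T} ==> u t = U t u0 + duh_term u t"
 and v: "continuous_on {0..<T} v" "!!t. t : {0..<T} ==> v t : X" "!!t. t : {0..<T} ==> v t = U t u0 + duh_term v t"
 and t: "t : {0..<T}"
 shows "u t = v t"
proof -
 have sub: "{0..s} \<subseteq> {0..<T}" if "s : {0..t}" for s using that t by auto
 have cu: "continuous_on {0..s} u" and cv: "continuous_on {0..s} v" if "s : {0..t}" for s
 using continuous_on_subset[OF u(1) sub[OF that]] continuous_on_subset[OF v(1) sub[OF that]] .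
 have tt: "t : {0..t}" using t by simp
 have "bounded (u ` {0..t} \<union> v ` {0..t})"
 using compact_continuous_image[OF cu[OF tt] compact_Icc] compact_continuous_image[OF cv[OF tt] compact_Icc] by (simp add: compact_imp_bounded)
 then obtain R where R: "!!s. s : {0..t} ==> norm (u s) <= R & norm (v s) <= R" unfolding bounded_iff by blast
 obtain L where L: "L > 0" "!!x y. x : X ==> y : X ==> norm x <= R ==> norm y <= R ==> norm (F x - F y) <= L * norm (x - y)"
 using F_Lipschitz_pos[of R] by blast
 define a where "a = 2 * (C * L)"
 have a: "a > 0" using C L by (simp add: a_def)
 let ?d = "%s. exp (- a * s) * norm (u s - v s)"
 have dc: "continuous_on {0..t} ?d" by (intro continuous_intros cu[OF tt] cv[OF tt])
 obtain s where s: "s : {0..t}" "!!r. r : {0..t} ==> ?d r <= ?d s"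
 using continuous_attains_sup[OF compact_Icc _ dc] tt by blast
 have inT: "r : {0..<T}" if "r : {0..s}" for r using that s(1) t by auto
 have s0: "0 <= s" using s(1) by simp
 have pw: "norm (F (u r) - F (v r)) <= L * (?d s * exp (a * r))" if r: "r : {0..s}" for r
 proof -
 have rt: "r : {0..t}" using r s(1) by auto
 have "norm (u r - v r) = ?d r * exp (a * r)" by (simp add: exp_minus mult_ac)
 also have "... <= ?d s * exp (a * r)" by (intro mult_right_mono s(2) rt) auto
 finally have "L * norm (u r - v r) <= L * (?d s * exp (a * r))" using L(1) by simp
 thus ?thesis using L(2)[OF u(2)[OF inT[OF r]] v(2)[OF inT[OF r]]] R[OF rt] by fastforce
 qed
 have ie: "((%r. exp (a * r)) has_integral (exp (a * s) / a - exp (a * 0) / a)) {0..s}"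
 using a s0 by (intro fundamental_theorem_of_calculus) (auto intro!: derivative_eq_intros simp: has_real_derivative_iff_has_vector_derivative[symmetric])
 have "norm (u s - v s) = norm (duh_term u s - duh_term v s)"
 using u(3)[of s] v(3)[of s] inT[of s] s0 by simp
 also have "... <= C * integral {0..s} (%r. L * (?d s * exp (a * r)))"
 by (rule duh_term_diff_bound[OF cu[OF s(1)] u(2)[OF inT] cv[OF s(1)] v(2)[OF inT] pw]) (auto intro!: continuous_intros)
 also have "integral {0..s} (%r. L * (?d s * exp (a * r))) = L * (?d s * (exp (a * s) / a - 1 / a))"
 using integral_unique[OF ie] by simp
 also have "C * (L * (?d s * (exp (a * s) / a - 1 / a))) <= C * (L * (?d s * (exp (a * s) / a)))"
 using C L a by (intro mult_left_mono) auto
 also have "... = norm (u s - v s) / 2" using C L by (simp add: a_def exp_minus field_simps)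
 finally have "?d s <= 0" by simp
 hence "?d t <= 0" using s(2)[OF tt] by linarith
 thus ?thesis by (simp add: mult_le_0_iff not_le[symmetric])
qed

end

section \<open>The nonlinearity\<close>

lemma ft_diff_AE:
 assumes "L1 f" "L1 h" "u : BM" "AE x in lborel. u x = f x - h x"
 shows "ft u y = ft f y - ft h y"
proof -
 have m: "f : BM" "h : BM" using assms(1,2) by auto
 have "ft u y = (LBINT s. f s * cis (y \<bullet> s) - h s * cis (y \<bullet> s))"
 unfolding ft_def by (rule integral_cong_AE) (use m assms(3,4) in \<open>auto simp: left_diff_distrib\<close>)
 thus ?thesis by (simp add: ft_def integrable_mult_cis assms)
qed

lemma dist_of_fun_diff:
 assumes "reg_fun f" "reg_fun h"
 shows "dist_of_fun (%x. f x - h x) ph = dist_of_fun f ph - dist_of_fun h ph"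
 using assms by (cases "ph : Schw") (auto simp: dist_of_fun_def reg_fun_def left_diff_distrib)

text \<open>The polarised cubic Hartree term, up to the power of \<open>2 * pi\<close> in the
  convolution: linear in \<open>S\<close> and \<open>R\<close>, conjugate linear in
  \<open>T\<close>.\<close>

definition tri :: "(real^'n => complex) => ('n::finite) dist => 'n dist => 'n dist => 'n dist" where
 "tri ka S T R = dist_of_fun (%x. inv_fourier (%xi. ka xi * fourier (corr S T) xi) x * fun_of_dist R x)"

context
 fixes g :: "real^'n::finite => complex" and p :: real and ka :: "real^'n => complex"
 assumes g: "g : Schw" "g ~= (%_. 0)" and p: "1 <= p" "p <= 2" and ka: "corr_weight p g ka"
begin

lemma corr_weight_integrable:
 assumes "S : Mspace p g" "T : Mspace p g"
 shows "L1 (%xi. ka xi * fourier (corr S T) xi)"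
proof -
 have m: "(%xi. ka xi * fourier (corr S T) xi) : LM"
 proof -
 have [measurable]: "ka : BM" "fourier (corr S T) : BM"
 using ka fourier_properties(1)[OF corr_integrable[OF g p assms]] by (auto simp: corr_weight_def)
 show ?thesis by measurable
 qed
 obtain c where "(LNINT xi. en (ka xi * fourier (corr S T) xi)) <= ennreal c"
 using ka assms unfolding corr_weight_def by blast
 thus ?thesis using m le_less_trans[OF _ ennreal_less_top] by (intro integrableI_bounded) auto
qed

lemma tri_bound: "\<exists>L\<ge>0. ALL S:Mspace p g. ALL T:Mspace p g. ALL R:Mspace p g.
 tri ka S T R : Mspace p g & Mnorm p g (tri ka S T R) <= L * (Mnorm p g S * Mnorm p g T * Mnorm p g R)"
proof -
 obtain D where D: "D >= 0" and le: "!!S T. S : Mspace p g ==> T : Mspace p g ==>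
 (LNINT xi. en (ka xi * fourier (corr S T) xi)) <= ennreal (D * Mnorm p g S * Mnorm p g T)"
 using ka unfolding corr_weight_def by blast
 have "tri ka S T R : Mspace p g & Mnorm p g (tri ka S T R) <= (2 * D) * (Mnorm p g S * Mnorm p g T * Mnorm p g R)"
 if S: "S : Mspace p g" and T: "T : Mspace p g" and R: "R : Mspace p g" for S T R
 proof
 note i = corr_weight_integrable[OF S T]
 \<comment> \<open>The slack keeps the bound positive, as \<open>Mspace_module\<close> demands, even
   if a norm vanishes.\<close>
 have K: "(LNINT xi. en (ka xi * fourier (corr S T) xi)) <= ennreal (D * Mnorm p g S * Mnorm p g T + e)"
 "D * Mnorm p g S * Mnorm p g T + e > 0" if "e > 0" for e
 using le[OF S T] that D by (auto intro!: order_trans[OF le[OF S T]] ennreal_leI add_nonneg_pos)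
 show "tri ka S T R : Mspace p g" unfolding tri_def by (rule Mspace_module(2)[OF g p R i K(2,1)[of 1]]) simp_all
 show "Mnorm p g (tri ka S T R) <= (2 * D) * (Mnorm p g S * Mnorm p g T * Mnorm p g R)"
 proof (rule field_le_epsilon)
 fix e :: real assume e: "e > 0"
 define m where "m = Mnorm p g R + 1"
 define e' where "e' = e / (2 * m)"
 have M: "m > 0" by (simp add: m_def add_nonneg_pos)
 have e': "e' > 0" using e M by (simp add: e'_def)
 have "Mnorm p g (tri ka S T R) <= 2 * (D * Mnorm p g S * Mnorm p g T + e') * Mnorm p g R"
 unfolding tri_def by (rule Mspace_module(3)[OF g p R i K(2,1)[OF e']])
 moreover have "2 * e' * Mnorm p g R <= e"
 proof -
 have "2 * e' * Mnorm p g R <= 2 * e' * m" unfolding m_def using e' by (intro mult_left_mono) auto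
 also have "... = e" using M by (simp add: e'_def)
 finally show ?thesis .
 qed
 ultimately show "Mnorm p g (tri ka S T R) <= (2 * D) * (Mnorm p g S * Mnorm p g T * Mnorm p g R) + e" by (simp add: algebra_simps)
 qed
 qed
 thus ?thesis using D by (intro exI[of _ "2 * D"]) auto
qed

lemma fun_of_dist_diff:
 assumes "S : Mspace p g" "T : Mspace p g"
 shows "AE x in lborel. fun_of_dist (%ph. S ph - T ph) x = fun_of_dist S x - fun_of_dist T x"
proof -
 note S = Mspace_fun_of_dist[OF g p assms(1)] and T = Mspace_fun_of_dist[OF g p assms(2)]
 have "dist_of_fun (%x. fun_of_dist S x - fun_of_dist T x) ph = S ph - T ph" for ph
 by (simp only: dist_of_fun_diff[OF reg_fun_L2[OF S(1)] reg_fun_L2[OF T(1)]] S(2) T(2))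
 hence "dist_of_fun (%x. fun_of_dist S x - fun_of_dist T x) = (%ph. S ph - T ph)" by (rule ext)
 thus ?thesis using reg_fun_fun_of_dist(3)[OF reg_fun_L2[OF L2_diff[OF S(1) T(1)]]] by (simp only:)
qed

lemma inv_fourier_bound_L2:
 assumes "S : Mspace p g" "T : Mspace p g" "R : Mspace p g"
 shows "L2 (%x. inv_fourier (%xi. ka xi * fourier (corr S T) xi) x * fun_of_dist R x)"
proof -
 note i = corr_weight_integrable[OF assms(1,2)]
 have "(LNINT xi. en (ka xi * fourier (corr S T) xi)) <= ennreal ((LBINT xi. norm (ka xi * fourier (corr S T) xi)) + 1)"
 using i by (subst nn_integral_eq_integral) (auto intro!: ennreal_leI)
 moreover have "0 < (LBINT xi. norm (ka xi * fourier (corr S T) xi)) + 1"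
 by (intro add_nonneg_pos integral_ge_0_AE) auto
 ultimately show ?thesis using Mspace_module(1)[OF g p assms(3) i] by blast
qed

lemma tri_diff:
 assumes S: "S : Mspace p g" "S' : Mspace p g" and T: "T : Mspace p g" "T' : Mspace p g" and R: "R : Mspace p g" "R' : Mspace p g"
 shows "tri ka (%ph. S ph - S' ph) T R = (%ph. tri ka S T R ph - tri ka S' T R ph)"
 and "tri ka S (%ph. T ph - T' ph) R = (%ph. tri ka S T R ph - tri ka S T' R ph)"
 and "tri ka S T (%ph. R ph - R' ph) = (%ph. tri ka S T R ph - tri ka S T R' ph)"
proof -
 note ci = corr_integrable[OF g p] and wi = corr_weight_integrable and sq = inv_fourier_bound_L2
 note md = Mspace_diff[OF _ _ g(1) p(1)]
 have fm: "fun_of_dist V : BM" if "V : Mspace p g" for V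
 using Mspace_fun_of_dist(1)[OF g p that] by (rule L2_borel)
 have [measurable]: "ka : BM" using ka by (simp add: corr_weight_def)
 \<comment> \<open>One claim for the first two slots, since both enter only through the product
   \<open>corr\<close>.\<close>
 have *: "tri ka A B R = (%ph. tri ka A1 B1 R ph - tri ka A2 B2 R ph)"
 if "A : Mspace p g" "B : Mspace p g" "A1 : Mspace p g" "B1 : Mspace p g" "A2 : Mspace p g" "B2 : Mspace p g"
 and ae: "AE x in lborel. corr A B x = corr A1 B1 x - corr A2 B2 x" for A B A1 B1 A2 B2
 proof
 fix ph
 have mAB: "corr A B : BM" using ci[OF that(1,2)] by auto
 have "fourier (corr A B) xi = fourier (corr A1 B1) xi - fourier (corr A2 B2) xi" for xi
 unfolding fourier_ft ft_diff_AE[OF ci[OF that(3,4)] ci[OF that(5,6)] mAB ae] by (rule right_diff_distrib)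
 hence "inv_fourier (%xi. ka xi * fourier (corr A B) xi) x
 = inv_fourier (%xi. ka xi * fourier (corr A1 B1) xi) x - inv_fourier (%xi. ka xi * fourier (corr A2 B2) xi) x" for x
 unfolding inv_fourier_ft using wi[OF that(1,2)]
 by (subst ft_diff_AE[OF wi[OF that(3,4)] wi[OF that(5,6)]]) (auto simp: right_diff_distrib)
 thus "tri ka A B R ph = tri ka A1 B1 R ph - tri ka A2 B2 R ph"
 unfolding tri_def by (simp only: left_diff_distrib dist_of_fun_diff[OF reg_fun_L2[OF sq[OF that(3,4) R(1)]] reg_fun_L2[OF sq[OF that(5,6) R(1)]]])
 qed
 show "tri ka (%ph. S ph - S' ph) T R = (%ph. tri ka S T R ph - tri ka S' T R ph)"
 by (rule *[OF md[OF S] T(1) S(1) T(1) S(2) T(1)]) (use fun_of_dist_diff[OF S] in \<open>auto simp: left_diff_distrib\<close>)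
 show "tri ka S (%ph. T ph - T' ph) R = (%ph. tri ka S T R ph - tri ka S T' R ph)"
 by (rule *[OF S(1) md[OF T] S(1) T(1) S(1) T(2)]) (use fun_of_dist_diff[OF T] in \<open>auto simp: right_diff_distrib\<close>)
 show "tri ka S T (%ph. R ph - R' ph) = (%ph. tri ka S T R ph - tri ka S T R' ph)"
 proof
 fix ph
 let ?w = "inv_fourier (%xi. ka xi * fourier (corr S T) xi)"
 have "tri ka S T (%ph. R ph - R' ph) = dist_of_fun (%x. ?w x * fun_of_dist R x - ?w x * fun_of_dist R' x)"
 unfolding tri_def
 by (intro dist_of_fun_cong reg_fun_L2 sq S T md[OF R] L2_diff R)
 (use fun_of_dist_diff[OF R] in \<open>auto simp: right_diff_distrib\<close>)
 thus "tri ka S T (%ph. R ph - R' ph) ph = tri ka S T R ph - tri ka S T R' ph"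
 unfolding tri_def by (simp only: dist_of_fun_diff[OF reg_fun_L2[OF sq[OF S(1) T(1) R(1)]] reg_fun_L2[OF sq[OF S(1) T(1) R(2)]]])
 qed
qed

end

definition loc_Lipschitz :: "real => (real^'n => complex) => (('n::finite) dist => 'n dist) => bool" where
 "loc_Lipschitz p g N \<longleftrightarrow> (ALL T:Mspace p g. N T : Mspace p g) \<and>
 (ALL R. \<exists>L\<ge>0. ALL S:Mspace p g. ALL T:Mspace p g. Mnorm p g S <= R & Mnorm p g T <= R -->
 Mnorm p g (%ph. N S ph - N T ph) <= L * Mnorm p g (%ph. S ph - T ph))"

context
 fixes g :: "real^'n::finite => complex" and p :: real
 assumes g: "g : Schw" "g ~= (%_. 0)" and p: "1 <= p" "p <= 2"
begin

lemma loc_Lipschitz_id: "loc_Lipschitz p g (%T. T)"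
 unfolding loc_Lipschitz_def by (auto intro!: exI[of _ 1])

lemma Mnorm_triangle3:
 assumes "A : Mspace p g" "B : Mspace p g" "D : Mspace p g"
 shows "Mnorm p g (%ph. A ph + B ph + D ph :: complex) <= Mnorm p g A + Mnorm p g B + Mnorm p g D"
proof -
 note add = Mspace_lincomb[OF _ _ g(1) p(1), of _ _ 1 1, simplified]
 show ?thesis
 using norm_emb[OF g p add[OF add[OF assms(1,2)] assms(3)]] norm_triangle_ineq[of "emb p g A + emb p g B" "emb p g D"] norm_triangle_ineq[of "emb p g A" "emb p g B"]
 by (simp add: emb_add[OF g p] add assms norm_emb[OF g p])
qed

text \<open>The difference telescopes into three terms with one difference in one slot each. A
  general map \<open>N\<close> in the first slot lets the lemma be iterated, from the identity
  through the odd powers to the full nonlinearity.\<close>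

lemma loc_Lipschitz_tri:
 assumes ka: "corr_weight p g ka" and N: "loc_Lipschitz p g N"
 shows "loc_Lipschitz p g (%T. tri ka (N T) T T)"
 unfolding loc_Lipschitz_def
proof (intro conjI ballI allI)
 obtain D where D: "D >= 0" and tri: "!!S T R. S : Mspace p g ==> T : Mspace p g ==> R : Mspace p g ==>
 tri ka S T R : Mspace p g & Mnorm p g (tri ka S T R) <= D * (Mnorm p g S * Mnorm p g T * Mnorm p g R)"
 using tri_bound[OF g p ka] by blast
 have NM: "N T : Mspace p g" if "T : Mspace p g" for T using N that by (simp add: loc_Lipschitz_def)
 show "tri ka (N T) T T : Mspace p g" if "T : Mspace p g" for T using tri[OF NM] that by blast
 fix R0 :: real
 define R where "R = max R0 0"
 obtain L where L: "L >= 0" "!!S T. S : Mspace p g ==> T : Mspace p g ==> Mnorm p g S <= R ==> Mnorm p g T <= R ==>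
 Mnorm p g (%ph. N S ph - N T ph) <= L * Mnorm p g (%ph. S ph - T ph)"
 using N unfolding loc_Lipschitz_def by meson
 define z :: "'n dist" where "z = (%_. 0)"
 have z: "z : Mspace p g" "Mnorm p g z = 0" unfolding z_def by (rule Mspace_zero[OF p(1)], rule Mnorm_zero[OF p(1)])
 define B where "B = L * R + Mnorm p g (N z)"
 have R: "R >= 0" by (simp add: R_def)
 have B: "B >= 0" unfolding B_def using L(1) R by simp
 have NB: "Mnorm p g (N T) <= B" if T: "T : Mspace p g" "Mnorm p g T <= R" for T
 proof -
 have "Mnorm p g (%ph. N T ph - N z ph) <= L * Mnorm p g (%ph. T ph - z ph)" using L(2)[OF T(1) z(1) T(2)] R z(2) by simp
 also have "... <= L * R" using L(1) T(2) by (intro mult_left_mono) (auto simp: z_def)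
 finally have "norm (emb p g (N T) - emb p g (N z)) <= L * R" by (simp add: Mnorm_diff_emb[OF g p] NM T z)
 thus ?thesis using norm_triangle_ineq2[of "emb p g (N T)" "emb p g (N z)"] by (simp add: norm_emb[OF g p] NM T z B_def)
 qed
 have "Mnorm p g (%ph. tri ka (N S) S S ph - tri ka (N T) T T ph) <= (D * (L * R * R + B * R + B * R)) * Mnorm p g (%ph. S ph - T ph)"
 if S: "S : Mspace p g" "Mnorm p g S <= R" and T: "T : Mspace p g" "Mnorm p g T <= R" for S T
 proof -
 let ?d = "Mnorm p g (%ph. S ph - T ph)"
 note md = Mspace_diff[OF _ _ g(1) p(1)]
 let ?A = "tri ka (%ph. N S ph - N T ph) S S" and ?B = "tri ka (N T) (%ph. S ph - T ph) S" and ?C = "tri ka (N T) T (%ph. S ph - T ph)"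
 have eq: "(%ph. tri ka (N S) S S ph - tri ka (N T) T T ph) = (%ph. ?A ph + ?B ph + ?C ph)"
 by (simp add: tri_diff(1)[OF g p ka NM[OF S(1)] NM[OF T(1)] S(1) S(1) S(1) S(1)]
 tri_diff(2)[OF g p ka NM[OF T(1)] NM[OF T(1)] S(1) T(1) S(1) S(1)] tri_diff(3)[OF g p ka NM[OF T(1)] NM[OF T(1)] T(1) T(1) S(1) T(1)])
 have 1: "Mnorm p g ?A <= D * (L * ?d * R * R)"
 by (rule order_trans[OF conjunct2[OF tri[OF md[OF NM NM] S(1) S(1), OF S(1) T(1)]]])
 (intro mult_left_mono D mult_mono L(2) S T Mnorm_nonneg mult_nonneg_nonneg L(1) R)
 have 2: "Mnorm p g ?B <= D * (B * ?d * R)"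
 by (rule order_trans[OF conjunct2[OF tri[OF NM[OF T(1)] md[OF S(1) T(1)] S(1)]]])
 (intro mult_left_mono D mult_mono NB S T Mnorm_nonneg mult_nonneg_nonneg B R order_refl)
 have 3: "Mnorm p g ?C <= D * (B * R * ?d)"
 by (rule order_trans[OF conjunct2[OF tri[OF NM[OF T(1)] T(1) md[OF S(1) T(1)]]]])
 (intro mult_left_mono D mult_mono NB S T Mnorm_nonneg mult_nonneg_nonneg B R order_refl)
 have "Mnorm p g (%ph. ?A ph + ?B ph + ?C ph) <= Mnorm p g ?A + Mnorm p g ?B + Mnorm p g ?C"
 by (intro Mnorm_triangle3 conjunct1[OF tri] md NM S T)
 also have "... <= D * (L * ?d * R * R) + D * (B * ?d * R) + D * (B * R * ?d)" using 1 2 3 by linarith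
 finally show ?thesis unfolding eq by (simp add: algebra_simps)
 qed
 moreover have "0 <= D * (L * R * R + B * R + B * R)" using D L(1) R B by simp
 ultimately show "\<exists>L\<ge>0. ALL S:Mspace p g. ALL T:Mspace p g. Mnorm p g S <= R0 & Mnorm p g T <= R0 -->
 Mnorm p g (%ph. tri ka (N S) S S ph - tri ka (N T) T T ph) <= L * Mnorm p g (%ph. S ph - T ph)"
 by (intro exI[of _ "D * (L * R * R + B * R + B * R)"]) (auto simp: R_def)
qed

lemma loc_Lipschitz_cmult:
 assumes N: "loc_Lipschitz p g N"
 shows "loc_Lipschitz p g (%T ph. c * N T ph)"
 unfolding loc_Lipschitz_def
proof (intro conjI ballI allI)
 have NM: "N T : Mspace p g" if "T : Mspace p g" for T using N that by (simp add: loc_Lipschitz_def)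
 show "(%ph. c * N T ph) : Mspace p g" if "T : Mspace p g" for T by (rule Mspace_cmult[OF NM[OF that] g(1) p(1)])
 fix R
 obtain L where L: "L >= 0" "!!S T. S : Mspace p g ==> T : Mspace p g ==> Mnorm p g S <= R ==> Mnorm p g T <= R ==>
 Mnorm p g (%ph. N S ph - N T ph) <= L * Mnorm p g (%ph. S ph - T ph)"
 using N unfolding loc_Lipschitz_def by meson
 have "Mnorm p g (%ph. c * N S ph - c * N T ph) <= (norm c * L) * Mnorm p g (%ph. S ph - T ph)"
 if "S : Mspace p g" "T : Mspace p g" "Mnorm p g S <= R" "Mnorm p g T <= R" for S T
 using Mnorm_cmult[OF Mspace_diff[OF NM[OF that(1)] NM[OF that(2)] g(1) p(1)] g(1) p(1), of c] mult_left_mono[OF L(2)[OF that], of "norm c"]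
 by (simp add: right_diff_distrib mult.assoc)
 thus "\<exists>L\<ge>0. ALL S:Mspace p g. ALL T:Mspace p g. Mnorm p g S <= R & Mnorm p g T <= R -->
 Mnorm p g (%ph. c * N S ph - c * N T ph) <= L * Mnorm p g (%ph. S ph - T ph)"
 using L(1) by (intro exI[of _ "norm c * L"]) auto
qed

end

text \<open>Pointwise the modulus is at most 1 plus its q-th power; the 1 is integrated against the
  Schwartz function, the power against its supremum.\<close>

lemma reg_fun_Lspace:
 fixes ka :: "real^'n => complex"
 assumes q: "1 <= q" and ka: "ka : Lspace (ennreal q)"
 shows "reg_fun ka"
proof -
 have m [measurable]: "ka : BM" and "ennpowr (Lpow q lborel ka) (1 / q) < \<infinity>"
 using ka q Lnorm_ennreal[of q lborel ka] by (auto simp: Lspace_def)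
 hence fin: "Lpow q lborel ka < \<infinity>" by (cases "Lpow q lborel ka") (auto simp: ennpowr_top)
 have i: "L1 (%x. norm (ka x) powr q)"
 using fin by (intro integrableI_bounded) (auto simp: Lpow_def)
 have "L1 (%x. ka x * ph x)" if ph: "ph : Schw" for ph
 proof -
 have [measurable]: "ph : BM" by (rule schw_borel[OF ph])
 obtain B where B: "B > 0" "!!x. norm (ph x) <= B" using schw_bounded[OF ph] by metis
 have "L1 (%x. norm (ph x) + B * norm (ka x) powr q)"
 by (intro Bochner_Integration.integrable_add integrable_mult_right integrable_norm schw_integrable ph i)
 thus ?thesis
 proof (rule integrable_bound)
 show "AE x in lborel. norm (ka x * ph x) <= norm (norm (ph x) + B * norm (ka x) powr q)"
 proof (rule AE_I2)
 fix x
 have "norm (ka x) <= 1 + norm (ka x) powr q"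
 proof (cases "norm (ka x) <= 1")
 case False
 thus ?thesis using powr_mono[OF q, of "norm (ka x)"] by simp
 qed (simp add: add_increasing2)
 hence "norm (ka x * ph x) <= (1 + norm (ka x) powr q) * norm (ph x)" by (simp add: norm_mult mult_right_mono)
 also have "... = norm (ph x) + norm (ph x) * norm (ka x) powr q" by (simp add: algebra_simps)
 also have "... <= norm (ph x) + B * norm (ka x) powr q" by (intro add_left_mono mult_right_mono B) auto
 finally show "norm (ka x * ph x) <= norm (norm (ph x) + B * norm (ka x) powr q)" by simp
 qed
 qed measurable
 qed
 thus ?thesis using m by (simp add: reg_fun_def)
qed

lemma loc_Lipschitz_cong: "loc_Lipschitz p g N ==> (!!T. T : Mspace p g ==> N' T = N T) ==> loc_Lipschitz p g N'"
 unfolding loc_Lipschitz_def by simp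

lemma ft_cong_AE:
 assumes "f : BM" "h : BM" "AE x in lborel. f x = h x"
 shows "ft f = ft h"
 unfolding ft_def[abs_def] by (intro ext integral_cong_AE) (use assms in auto)

context
 fixes g :: "real^'n::finite => complex" and p :: real and ka :: "real^'n => complex" and K :: "'n dist"
 assumes g: "g : Schw" "g ~= (%_. 0)" and p: "1 <= p" "p <= 2" and ka: "corr_weight p g ka" "reg_fun ka"
 and K: "dist_fourier K = dist_of_fun ka"
begin

text \<open>\<open>hartree\<close> chooses a representative at every stage; \<open>r1\<close>,
  \<open>r2\<close> and \<open>r3\<close> replace the choices by explicit functions almost
  everywhere. The auxiliary \<open>w\<close> encodes the density: \<open>v\<close> itself for the
  cubic case, and \<open>odd_power (k - 1) v\<close> in general.\<close>

lemma hartree_tri: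
 assumes v: "v : Mspace p g" and w: "w : Mspace p g"
 and ae: "AE x in lborel. fun_of_dist w x * cnj (fun_of_dist v x) = cx (norm (fun_of_dist v x) ^ (2 * k))"
 shows "hartree K k v = (%ph. cx ((2 * pi) powr (real CARD('n) / 2)) * tri ka w v v ph)"
proof -
 define c where "c = cx ((2 * pi) powr (real CARD('n) / 2))"
 let ?f = "fun_of_dist v" and ?H = "corr w v" and ?h = "%x. cx (norm (fun_of_dist v x) ^ (2 * k))"
 note f = Mspace_fun_of_dist[OF g p v]
 have [measurable]: "?f : BM" by (rule L2_borel[OF f(1)])
 have H: "L1 ?H" by (rule corr_integrable[OF g p w v])
 have [measurable]: "?H : BM" using H by auto
 have hm: "?h : BM" by measurable
 have h: "L1 ?h" using H integrable_cong_AE[OF _ _ ae] hm by simp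
 have Fh: "fourier ?h = fourier ?H" unfolding fourier_ft[abs_def] using ft_cong_AE[OF hm _ AE_symmetric[OF ae]] by simp
 define m where "m xi = ka xi * fourier ?H xi" for xi
 have m: "L1 m" unfolding m_def[abs_def] by (rule corr_weight_integrable[OF g p ka(1) w v])
 have 1: "dist_fourier (dist_abs_power v (2 * k)) = dist_of_fun (fourier ?H)"
 by (simp only: dist_abs_power_def dist_fourier_integrable(1)[OF h] Fh)
 note r1 = reg_fun_fun_of_dist[OF ka(2)] and r2 = reg_fun_fun_of_dist[OF reg_fun_fourier(1)[OF H]]
 let ?m = "%x. fun_of_dist (dist_of_fun ka) x * fun_of_dist (dist_of_fun (fourier ?H)) x"
 have aem: "AE x in lborel. ?m x = m x" using r1(3) r2(3) by eventually_elim (simp add: m_def)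
 have mm: "?m : LM" using r1(1) r2(1) unfolding reg_fun_def by (intro borel_measurable_times) auto
 have mi: "L1 ?m"
 proof (rule iffD2[OF integrable_cong_AE])
 show "?m : LM" by (rule mm)
 show "m : LM" by (rule borel_measurable_integrable[OF m])
 show "AE x in lborel. ?m x = m x" by (rule aem)
 show "L1 m" by (rule m)
 qed
 have 2: "dist_mult (dist_fourier K) (dist_fourier (dist_abs_power v (2 * k))) = dist_of_fun m"
 unfolding dist_mult_def K 1 by (rule dist_of_fun_cong[OF reg_fun_integrable[OF mi] reg_fun_integrable[OF m] aem])
 let ?w = "%x. c * inv_fourier m x"
 have 3: "dist_convolution K (dist_abs_power v (2 * k)) = dist_of_fun ?w"
 unfolding dist_convolution_def 2 dist_fourier_integrable(2)[OF m] c_def[symmetric]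
 by (auto simp: fun_eq_iff dist_of_fun_def mult.assoc)
 have wm: "?w : BM" using fourier_properties(2)[OF m] by simp
 have wb: "norm (?w x) <= norm c * ((2 * pi) powr (- real CARD('n) / 2) * (LBINT s. norm (m s)))" for x
 unfolding norm_mult by (intro mult_left_mono fourier_properties(4)[OF m]) auto
 have rw: "reg_fun ?w" by (rule reg_fun_bounded[OF wm wb])
 note r3 = reg_fun_fun_of_dist[OF rw]
 have sq: "L2 (%x. inv_fourier m x * ?f x)"
 using inv_fourier_bound_L2[OF g p ka(1) w v v] unfolding m_def[abs_def] .
 have aew: "AE x in lborel. fun_of_dist (dist_of_fun ?w) x * ?f x = c * (inv_fourier m x * ?f x)"
 using r3(3) by eventually_elim simp
 have "Lpow 2 lborel (%x. fun_of_dist (dist_of_fun ?w) x * ?f x) = Lpow 2 lborel (%x. c * (inv_fourier m x * ?f x))" by (rule Lpow_cong_AE[OF aew])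
 moreover have "Lpow 2 lborel (%x. fun_of_dist (dist_of_fun ?w) x * ?f x) = Lpow 2 lborel (%x. c * (inv_fourier m x * ?f x)) ==> L2 (%x. fun_of_dist (dist_of_fun ?w) x * ?f x)"
 proof -
 have [measurable]: "fun_of_dist (dist_of_fun ?w) : BM" using r3(1) by (simp add: reg_fun_def)
 have "(%x. fun_of_dist (dist_of_fun ?w) x * ?f x) : BM" by measurable
 thus "Lpow 2 lborel (%x. fun_of_dist (dist_of_fun ?w) x * ?f x) = Lpow 2 lborel (%x. c * (inv_fourier m x * ?f x)) ==> L2 (%x. fun_of_dist (dist_of_fun ?w) x * ?f x)"
 using L2_cmult[OF sq, of c] by (simp add: L2_def)
 qed
 ultimately have sw: "L2 (%x. fun_of_dist (dist_of_fun ?w) x * ?f x)" by (simp only:)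
 have "hartree K k v = dist_of_fun (%x. c * (inv_fourier m x * ?f x))"
 unfolding hartree_def 3 dist_mult_def by (rule dist_of_fun_cong[OF reg_fun_L2[OF sw] reg_fun_L2[OF L2_cmult[OF sq]] aew])
 also have "... = (%ph. c * dist_of_fun (%x. inv_fourier m x * ?f x) ph)"
 unfolding dist_of_fun_def by (simp add: fun_eq_iff mult.assoc)
 finally show ?thesis unfolding tri_def c_def m_def[abs_def] .
qed

lemma loc_Lipschitz_hartree_1: "loc_Lipschitz p g (hartree K 1)"
proof (rule loc_Lipschitz_cong[OF loc_Lipschitz_cmult[OF g p loc_Lipschitz_tri[OF g p ka(1) loc_Lipschitz_id[OF g p]]]])
 show "hartree K 1 T = (%ph. cx ((2 * pi) powr (real CARD('n) / 2)) * tri ka T T T ph)" if "T : Mspace p g" for T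
 by (rule hartree_tri[OF that that]) (simp add: complex_norm_square[symmetric])
qed

end

section \<open>Higher powers and bounded multipliers\<close>

context
 fixes g :: "real^'n::finite => complex"
 assumes g: "g : Schw" "g ~= (%_. 0)"
begin

text \<open>With multiplier 1 the trilinear form is the pointwise product, so the recursion yields
  the distribution of \<open>|T|^(2j) T\<close> and stays within the modulation space of exponent
  1.\<close>

fun odd_power :: "nat => 'n dist => 'n dist" where
 "odd_power 0 T = T"
| "odd_power (Suc j) T = tri (%_. 1) (odd_power j T) T T"

lemma corr_weight_one: "corr_weight 1 g (%_. 1)"
 by (rule corr_weight_bounded[OF g, of _ 1]) auto

lemma loc_Lipschitz_odd_power: "loc_Lipschitz 1 g (odd_power j)"
proof (induction j)
 case 0
 thus ?case using loc_Lipschitz_id[OF g, of 1] by simp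
next
 case (Suc j)
 thus ?case using loc_Lipschitz_tri[OF g _ _ corr_weight_one Suc.IH] by simp
qed

text \<open>Both the product of two elements and its Fourier transform are integrable here, so
  Fourier inversion identifies the inverse transform in \<open>tri\<close> with the product.\<close>

lemma fun_of_odd_power:
 assumes T: "T : Mspace 1 g"
 shows "AE x in lborel. fun_of_dist (odd_power j T) x = cx (norm (fun_of_dist T x) ^ (2 * j)) * fun_of_dist T x"
proof (induction j)
 case (Suc j)
 let ?S = "odd_power j T" and ?F = "fun_of_dist T"
 have p: "(1::real) <= 1" "(1::real) <= 2" by auto
 have S: "?S : Mspace 1 g" using loc_Lipschitz_odd_power T by (simp add: loc_Lipschitz_def)
 have H: "L1 (corr ?S T)" by (rule corr_integrable[OF g p S T])
 have m: "L1 (fourier (corr ?S T))" using corr_weight_integrable[OF g p corr_weight_one S T] by simp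
 have sq: "L2 (%x. inv_fourier (fourier (corr ?S T)) x * ?F x)"
 using inv_fourier_bound_L2[OF g p corr_weight_one S T T] by simp
 have "AE x in lborel. fun_of_dist (odd_power (Suc j) T) x = inv_fourier (fourier (corr ?S T)) x * ?F x"
 using reg_fun_fun_of_dist(3)[OF reg_fun_L2[OF sq]] by (simp add: tri_def)
 thus ?case using Suc.IH fourier_inversion[OF H m]
 proof eventually_elim
 case (elim x)
 have "fun_of_dist (odd_power (Suc j) T) x = cx (norm (?F x) ^ (2 * j)) * (?F x * cnj (?F x)) * ?F x"
 unfolding elim(1,3) unfolding elim(2) by (simp only: mult_ac)
 also have "?F x * cnj (?F x) = cx ((norm (?F x))^2)" by (simp only: complex_norm_square)
 finally show ?case by (simp only: of_real_mult[symmetric] power_add[symmetric] mult_Suc_right add.commute[of 2])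
 qed
qed simp

lemma loc_Lipschitz_hartree:
 assumes k: "1 <= k" and ka: "corr_weight 1 g ka" "reg_fun ka" and K: "dist_fourier K = dist_of_fun ka"
 shows "loc_Lipschitz 1 g (hartree K k)"
proof -
 have p: "(1::real) <= 1" "(1::real) <= 2" by auto
 show ?thesis
 proof (rule loc_Lipschitz_cong[OF loc_Lipschitz_cmult[OF g p loc_Lipschitz_tri[OF g p ka(1) loc_Lipschitz_odd_power[of "k - 1"]]]])
 fix T :: "'n dist" assume T: "T : Mspace 1 g"
 have S: "odd_power (k - 1) T : Mspace 1 g" using loc_Lipschitz_odd_power T by (simp add: loc_Lipschitz_def)
 show "hartree K k T = (%ph. cx ((2 * pi) powr (real CARD('n) / 2)) * tri ka (odd_power (k - 1) T) T T ph)"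
 proof (rule hartree_tri[OF g p ka K T S])
 show "AE x in lborel. fun_of_dist (odd_power (k - 1) T) x * cnj (fun_of_dist T x) = cx (norm (fun_of_dist T x) ^ (2 * k))"
 using fun_of_odd_power[OF T, of "k - 1"]
 proof eventually_elim
 case (elim x)
 have "fun_of_dist (odd_power (k - 1) T) x * cnj (fun_of_dist T x) = cx (norm (fun_of_dist T x) ^ (2 * (k - 1))) * cx ((norm (fun_of_dist T x))^2)"
 unfolding elim complex_norm_square by (simp only: mult.assoc)
 also have "2 * (k - 1) + 2 = 2 * k" using k by simp
 hence "cx (norm (fun_of_dist T x) ^ (2 * (k - 1))) * cx ((norm (fun_of_dist T x))^2) = cx (norm (fun_of_dist T x) ^ (2 * k))"
 by (simp only: of_real_mult[symmetric] power_add[symmetric])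
 finally show ?case .
 qed
 qed
 qed
qed

text \<open>Reconstruction expresses the Fourier transform of \<open>K\<close> at \<open>xi\<close>
  as an integral of the voice against the window's transform centred at \<open>xi\<close>. The
  essential supremum over frequencies of the L1 norm in position, times the L1 norm of
  \<open>ft g\<close>, bounds it.\<close>

lemma dist_fourier_M1inf:
 assumes K: "K : mod_space g 1 \<infinity>"
 obtains ka B where "ka : BM" "!!xi. norm (ka xi) <= B" "dist_fourier K = dist_of_fun ka"
proof -
 define c where "c = (2 * pi) powr (- real CARD('n) / 2)"
 have c: "c > 0" by (simp add: c_def)
 let ?V = "voice g K" and ?r = "recon_const g"
 have Kt: "K : tempered" and fin: "mod_norm g 1 \<infinity> K < \<infinity>" using K by (auto simp: mod_space_def)
 have [measurable]: "?V : BM" by (rule voice_borel[OF Kt g(1)])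
 have r: "?r > 0" by (rule recon_const_pos[OF g])
 define E where "E = enn2real (mod_norm g 1 \<infinity> K) / c"
 have E: "E >= 0" using c by (simp add: E_def)
 have V: "AE y in lborel. (LNINT x. en (?V (x, y))) <= ennreal E"
 proof -
 have L: "Lnorm 1 lborel (%x. en (stft g K x y)) = ennreal c * (LNINT x. en (?V (x, y)))" for y
 proof -
 have "Lnorm (ennreal 1) lborel (%x. en (stft g K x y)) = ennpowr (Lpow 1 lborel (%x. stft g K x y)) (1 / 1)" by (rule Lnorm_ennreal) simp
 moreover have "ennpowr z 1 = z" for z by (cases z) (auto simp: ennpowr_ennreal ennpowr_top)
 moreover have "Lpow 1 lborel (%x. stft g K x y) = ennreal c * (LNINT x. en (?V (x, y)))"
 unfolding Lpow_def stft_voice c_def[symmetric] using c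
 by (subst nn_integral_cmult[symmetric]) (auto simp: norm_mult ennreal_mult)
 ultimately show ?thesis by simp
 qed
 have "(%y. ennreal c * (LNINT x. en (?V (x, y)))) : LM" by measurable
 hence "AE y in lborel. ennreal c * (LNINT x. en (?V (x, y))) <= mod_norm g 1 \<infinity> K"
 unfolding mod_norm_def L using esssup_AE[of "%y. ennreal c * (LNINT x. en (?V (x, y)))" lborel] by (simp add: Lnorm_def)
 thus ?thesis
 proof eventually_elim
 case (elim y)
 hence "ennreal (1 / c) * (ennreal c * (LNINT x. en (?V (x, y)))) <= ennreal (1 / c) * mod_norm g 1 \<infinity> K"
 by (intro mult_left_mono) auto
 moreover have "ennreal (1 / c) * (ennreal c * z) = z" for z using c by (simp add: mult.assoc[symmetric] ennreal_mult[symmetric])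
 moreover have "ennreal (1 / c) * mod_norm g 1 \<infinity> K = ennreal E"
 using fin c by (cases "mod_norm g 1 \<infinity> K") (auto simp: E_def ennreal_mult[symmetric])
 ultimately show ?case by simp
 qed
 qed
 have gh: "ft g : Schw" by (rule schw_ft[OF g(1)])
 note [measurable] = schw_borel[OF gh]
 define G where "G = (LBINT y. norm (ft g y))"
 have G: "(LNINT y. en (ft g (y - xi))) = ennreal G" for xi
 using nn_integral_eq_integral[OF integrable_norm[OF schw_integrable[OF gh]]] nn_translate[of "%y. en (ft g y)" "- xi"]
 by (simp add: G_def)
 have G0: "G >= 0" unfolding G_def by (intro integral_ge_0_AE) auto
 \<comment> \<open>The factor next to the voice is, up to the constant \<open>c\<close>, the weight
   with which \<open>ph xi\<close> enters \<open>dual_coef g (fourier ph) z\<close>; this is the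
   computation \<open>dc\<close>.\<close>
 define W where "W xi z = ?V z * (cis ((snd z - xi) \<bullet> fst z) * ft g (snd z - xi))" for xi z
 have Wq: "(%q. W (fst q) (snd q)) : BM"
 proof -
 have "(%q. ?V (snd q)) : BM" by (rule borel_comp[OF voice_borel[OF Kt g(1)] continuous_on_snd[OF continuous_on_id]])
 moreover have "continuous_on UNIV (%q. cis ((snd (snd q) - fst q) \<bullet> fst (snd q)) * ft g (snd (snd q) - fst q))"
 by (intro continuous_on_mult continuous_cis continuous_on_inner continuous_on_diff continuous_on_fst continuous_on_snd continuous_on_id
 continuous_on_compose2[OF schw_continuous[OF gh, of UNIV]]) auto
 ultimately show ?thesis
 unfolding W_def by (rule borel_measurable_times[OF _ borel_cont])
 qed
 have Wm: "(%(xi, z). W xi z) : borel_measurable (lborel \<Otimes>\<^sub>M lborel)"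
 using Wq by (simp add: lborel_prod split_def)
 have Wm1: "W xi : BM" for xi
 using borel_comp[OF Wq, of "%z. (xi, z)"] by (simp add: continuous_on_Pair)
 have Wb: "(LNINT z. en (W xi z)) <= ennreal (E * G)" for xi
 proof -
 note [measurable] = Wm1[of xi]
 have "(LNINT z. en (W xi z)) = (LNINT y. LNINT x. en (W xi (x, y)))"
 by (intro nn_integral_lborel_pair(2)) measurable
 also have "... = (LNINT y. LNINT x. ennreal (norm (?V (x, y)) * norm (ft g (y - xi))))"
 by (simp add: W_def norm_mult)
 also have "... = (LNINT y. (LNINT x. en (?V (x, y))) * en (ft g (y - xi)))"
 by (simp add: ennreal_mult nn_integral_multc)
 also have "... <= (LNINT y. ennreal E * en (ft g (y - xi)))"
 by (rule nn_integral_mono_AE) (use V in \<open>eventually_elim, auto intro: mult_right_mono\<close>)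
 also have "... = ennreal (E * G)" using E G0 by (simp add: nn_integral_cmult G ennreal_mult)
 finally show ?thesis .
 qed
 have Wi: "L1 (W xi)" for xi
 using le_less_trans[OF Wb ennreal_less_top] Wm1 by (intro integrableI_bounded) auto
 define ka where "ka xi = cx (c / ?r) * (LBINT z. W xi z)" for xi
 have kam: "ka : BM"
 proof -
 have "(%xi. LBINT z. W xi z) : LM" by (rule lborel.borel_measurable_lebesgue_integral) (rule Wm)
 thus ?thesis unfolding ka_def[abs_def] by simp
 qed
 have kab: "norm (ka xi) <= c / ?r * (E * G)" for xi
 proof -
 have "en (LBINT z. W xi z) <= ennreal (E * G)" by (rule order_trans[OF integral_norm_bound_ennreal[OF Wi] Wb])
 hence "norm (LBINT z. W xi z) <= E * G" using E G0 by (simp add: ennreal_le_iff)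
 thus ?thesis unfolding ka_def norm_mult norm_of_real using c r by (intro mult_mono) auto
 qed
 have "dist_fourier K ph = dist_of_fun ka ph" for ph
 proof (cases "ph : Schw")
 case True
 note ph = True
 have [measurable]: "ph : BM" by (rule schw_borel[OF ph])
 note phi = schw_integrable[OF ph]
 let ?h = "%(xi, z). ph xi * W xi z"
 have hm: "?h : borel_measurable (lborel \<Otimes>\<^sub>M lborel)" using Wm by measurable
 have ih: "integrable (lborel \<Otimes>\<^sub>M lborel) ?h"
 proof (rule integrableI_bounded[OF hm])
 have "(\<integral>\<^sup>+q. en (?h q) \<partial>(lborel \<Otimes>\<^sub>M lborel)) = (LNINT xi. LNINT z. en (?h (xi, z)))"
 by (rule lborel.nn_integral_fst[symmetric]) (use hm in measurable)
 also have "... = (LNINT xi. en (ph xi) * (LNINT z. en (W xi z)))"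
 using Wm1 by (simp add: norm_mult ennreal_mult nn_integral_cmult)
 also have "... <= (LNINT xi. en (ph xi) * ennreal (E * G))" by (intro nn_integral_mono mult_left_mono Wb) auto
 also have "... < \<infinity>" using phi by (simp add: nn_integral_multc ennreal_mult_less_top integrable_iff_bounded)
 finally show "(\<integral>\<^sup>+q. en (?h q) \<partial>(lborel \<Otimes>\<^sub>M lborel)) < \<infinity>" .
 qed
 have dc: "dual_coef g (fourier ph) z = cx c * (LBINT xi. ph xi * (cis ((snd z - xi) \<bullet> fst z) * ft g (snd z - xi)))" for z
 proof -
 have gz: "L1 (%s. g (s - fst z) * cis (snd z \<bullet> s))"
 by (rule integrable_mult_cis[OF schw_integrable[OF schw_translate[OF g(1)]]])
 let ?G = "%s. g (- s - fst z) * cis (snd z \<bullet> (- s))"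
 have Gi: "L1 ?G" using lborel_integrable_scale[OF gz, of "-1"] by simp
 have [measurable]: "g : BM" by (rule schw_borel[OF g(1)])
 have ftG: "ft ?G xi = cis ((snd z - xi) \<bullet> fst z) * ft g (snd z - xi)" for xi
 proof -
 have "ft ?G xi = ft (%s. g (s - fst z) * cis (snd z \<bullet> s)) (- xi)"
 by (rule ft_reflect) measurable
 also have "... = (LBINT s. g (s - fst z) * cis ((snd z - xi) \<bullet> s))"
 by (simp add: ft_def mult.assoc cis_mult inner_diff_left)
 also have "... = (LBINT s. g (s + fst z - fst z) * cis ((snd z - xi) \<bullet> (s + fst z)))"
 using lborel_integral_translate[of "%s. g (s - fst z) * cis ((snd z - xi) \<bullet> s)" "fst z"] by simp
 also have "... = (LBINT s. cis ((snd z - xi) \<bullet> fst z) * (g s * cis ((snd z - xi) \<bullet> s)))"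
 by (simp only: add_diff_cancel_right' inner_add_right cis_mult[symmetric] mult_ac)
 finally show ?thesis by (simp add: ft_def)
 qed
 have "dual_coef g (fourier ph) z = (LBINT s. cx c * (ft ph (- s) * (g (s - fst z) * cis (snd z \<bullet> s))))"
 unfolding dual_coef_def ft_def[of "%s. fourier ph s * g (s - fst z)"]
 unfolding fourier_ft c_def by (simp only: mult.assoc)
 also have "... = cx c * (LBINT s. ft ph s * ?G s)"
 proof -
 have "(LBINT s. ft ph (- s) * (g (s - fst z) * cis (snd z \<bullet> s))) = (LBINT s. ft ph s * ?G s)"
 using lborel_affine_scale[of "%s. ft ph s * ?G s" "-1" 0] schw_borel[OF schw_ft[OF ph]] by simp
 thus ?thesis by (simp only: integral_mult_right_zero)
 qed
 finally show ?thesis unfolding ft_multiplication(1)[OF phi Gi] ftG .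
 qed
 have "cx ?r * K (fourier ph) = (LBINT z. dual_coef g (fourier ph) z * ?V z)"
 by (rule voice_reconstruct(2)[OF Kt g(1) schw_fourier(1)[OF ph]])
 also have "... = (LBINT z. cx c * (LBINT xi. ?h (xi, z)))"
 proof (intro int_cong refl)
 fix z
 have "(LBINT xi. ?h (xi, z)) = (LBINT xi. (ph xi * (cis ((snd z - xi) \<bullet> fst z) * ft g (snd z - xi))) * ?V z)"
 unfolding W_def prod.case by (simp only: mult_ac)
 also have "... = (LBINT xi. ph xi * (cis ((snd z - xi) \<bullet> fst z) * ft g (snd z - xi))) * ?V z"
 by (rule integral_mult_left_zero)
 finally show "dual_coef g (fourier ph) z * ?V z = cx c * (LBINT xi. ?h (xi, z))"
 unfolding dc by (simp only: mult.assoc)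
 qed
 also have "... = cx c * (LBINT z. (LBINT xi. ?h (xi, z)))" by simp
 also have "(LBINT z. (LBINT xi. ?h (xi, z))) = (LBINT xi. (LBINT z. ?h (xi, z)))"
 using lborel_pair.Fubini_integral[of "%xi z. ?h (xi, z)"] ih by (simp add: split_def)
 also have "... = (LBINT xi. ph xi * (LBINT z. W xi z))" by simp
 finally have "K (fourier ph) = cx (c / ?r) * (LBINT xi. ph xi * (LBINT z. W xi z))"
 using r by (simp add: field_simps)
 also have "... = (LBINT xi. ka xi * ph xi)"
 unfolding ka_def by (subst integral_mult_right_zero[symmetric]) (simp only: mult_ac)
 finally show ?thesis using ph by (simp add: dist_fourier_def dist_of_fun_apply)
 qed (simp add: dist_fourier_def dist_of_fun_def)
 hence "dist_fourier K = dist_of_fun ka" by (rule ext)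
 thus ?thesis by (rule that[OF kam kab])
qed

end

section \<open>Local well-posedness\<close>

instance bcontfun :: (metric_space, banach) banach
 by intro_classes

context
 fixes g :: "real^'n::finite => complex" and p :: real
 assumes g: "g : Schw" "g ~= (%_. 0)" and p: "1 <= p" "p <= 2"
begin

lemma emb_cmult_real: "T : Mspace p g ==> emb p g (%ph. cx a * T ph) = a *r emb p g (T :: 'n dist)"
 using emb_lincomb[OF g p, of T T a 0] by simp

text \<open>For continuous curves the Riemann integral of the definitions is the library's integral in the
 space of bounded functions; the unimodular factor \<open>c\<close> absorbs the \<open>-i\<close> of Duhamel's formula.\<close>

lemma has_mod_integral_emb:
 fixes G :: "real => 'n dist"
 assumes G: "!!ta. ta : {a..b} ==> G ta : Mspace p g" and J: "J : Mspace p g" and c: "norm c = 1"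
 and cont: "continuous_on {a..b} (%ta. emb p g (%ph. c * G ta ph))"
 shows "has_mod_integral g (ennreal p) G a b J \<longleftrightarrow> integral {a..b} (%ta. emb p g (%ph. c * G ta ph)) = emb p g (%ph. c * J ph)"
proof -
 let ?n = "%D. mod_norm g (ennreal p) (ennreal p) (%ph. (\<Sum>(ta, I)\<in>D. cx (measure lborel I) * G ta ph) - J ph)"
 let ?G = "%ta. emb p g (%ph. c * G ta ph)" and ?J = "emb p g (%ph. c * J ph)"
 define k where "k = (2 * pi) powr (- real CARD('n) / 2)"
 have k: "k > 0" by (simp add: k_def)
 note cm = Mspace_cmult[OF _ g(1) p(1)]
 have norm_eq: "mod_norm g (ennreal p) (ennreal p) (%ph. (\<Sum>(ta, I)\<in>D. cx (measure lborel I) * G ta ph) - J ph)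
 = ennreal (k * norm ((\<Sum>(ta, I)\<in>D. measure lborel I *r ?G ta) - ?J))" if D: "D tagged_division_of {a..b}" for D
 proof -
 have fin: "finite D" and DG: "!!q. q : D ==> G (fst q) : Mspace p g"
 using tagged_division_ofD(1,2,3)[OF D] G by (blast, metis prod.collapse subsetD)
 let ?S = "%ph. \<Sum>q\<in>D. cx (measure lborel (snd q)) * G (fst q) ph"
 have S: "?S : Mspace p g" by (rule Mspace_sum[OF DG g(1) p(1)])
 have SJ: "(%ph. ?S ph - J ph) : Mspace p g" by (rule Mspace_diff[OF S J g(1) p(1)])
 have "(%ph. c * ?S ph) = (%ph. \<Sum>q\<in>D. cx (measure lborel (snd q)) * (c * G (fst q) ph))"
 by (simp add: sum_distrib_left mult.left_commute)
 hence e: "emb p g (%ph. c * ?S ph) = (\<Sum>q\<in>D. measure lborel (snd q) *r ?G (fst q))"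
 using emb_sum[OF g p fin, of "%q ph. c * G (fst q) ph" "%q. measure lborel (snd q)"] cm[OF DG] by simp
 have "Mnorm p g (%ph. ?S ph - J ph) = Mnorm p g (%ph. c * (?S ph - J ph))" using Mnorm_cmult[OF SJ g(1) p(1), of c] c by simp
 also have "... = Mnorm p g (%ph. c * ?S ph - c * J ph)" by (simp only: right_diff_distrib)
 also have "... = norm ((\<Sum>q\<in>D. measure lborel (snd q) *r ?G (fst q)) - ?J)"
 using Mnorm_diff_emb[OF g p cm[OF S, of c] cm[OF J, of c]] by (simp only: e)
 finally show ?thesis using mod_space_Mspace(2)[OF g(1) p(1) SJ] by (simp add: split_def k_def)
 qed
 have sp: "mod_space g (ennreal p) (ennreal p) = Mspace p g" by (rule mod_space_Mspace(1)[OF g(1) p(1)])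
 show ?thesis
 proof
 assume H: "has_mod_integral g (ennreal p) G a b J"
 have "(?G has_integral ?J) (cbox a b)"
 unfolding has_integral
 proof (intro allI impI)
 fix e :: real assume e: "e > 0"
 have H': "\<forall>\<epsilon>>0. \<exists>\<delta>>0. ALL D. D tagged_division_of {a..b} & (%ta. ball ta \<delta>) fine D --> ?n D < ennreal \<epsilon>"
 using H unfolding has_mod_integral_def by (elim conjE)
 obtain \<delta> where \<delta>: "\<delta> > 0" "ALL D. D tagged_division_of {a..b} & (%ta. ball ta \<delta>) fine D --> ?n D < ennreal (k * e)"
 using H'[rule_format, OF mult_pos_pos[OF k e]] by (elim exE conjE)
 have "norm ((\<Sum>(ta, I)\<in>D. measure lborel I *r ?G ta) - ?J) < e" if "D tagged_division_of cbox a b" "(%ta. ball ta \<delta>) fine D" for D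
 proof -
 have D: "D tagged_division_of {a..b}" using that(1) by (simp only: box_real)
 have "ennreal (k * norm ((\<Sum>(ta, I)\<in>D. measure lborel I *r ?G ta) - ?J)) < ennreal (k * e)"
 using \<delta>(2)[rule_format, OF conjI[OF D that(2)]] unfolding norm_eq[OF D] .
 thus ?thesis using k by (simp add: ennreal_less_iff)
 qed
 thus "\<exists>\<gamma>. gauge \<gamma> & (ALL D. D tagged_division_of cbox a b & \<gamma> fine D --> norm ((\<Sum>(ta, I)\<in>D. measure lborel I *r ?G ta) - ?J) < e)"
 using gauge_ball[OF \<delta>(1)] by (intro exI[of _ "%ta. ball ta \<delta>"] conjI allI impI) (assumption, elim conjE)
 qed
 thus "integral {a..b} ?G = ?J" by (simp add: integral_unique)
 next
 assume I: "integral {a..b} ?G = ?J"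
 show "has_mod_integral g (ennreal p) G a b J"
 unfolding has_mod_integral_def sp
 proof (intro conjI ballI allI impI G J)
 fix e :: real assume e: "e > 0"
 hence "e / k > 0" using k by simp
 from uniform_Riemann_sums[OF cont this]
 obtain \<delta> where \<delta>: "\<delta> > 0" "ALL D. D tagged_division_of {a..b} & (%ta. ball ta \<delta>) fine D -->
 norm ((\<Sum>(ta, I)\<in>D. measure lborel I *r ?G ta) - ?J) < e / k" unfolding I by (elim exE conjE)
 have "?n D < ennreal e" if "D tagged_division_of {a..b}" "(%ta. ball ta \<delta>) fine D" for D
 proof -
 have "k * norm ((\<Sum>(ta, I)\<in>D. measure lborel I *r ?G ta) - ?J) < e"
 using \<delta>(2)[rule_format, OF conjI[OF that]] k by (simp only: pos_less_divide_eq mult.commute)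
 thus ?thesis unfolding norm_eq[OF that(1)] by (rule ennreal_lessI[OF e])
 qed
 thus "\<exists>\<delta>>0. ALL D. D tagged_division_of {a..b} & (%ta. ball ta \<delta>) fine D --> ?n D < ennreal e"
 using \<delta>(1) by (intro exI[of _ \<delta>] conjI allI impI) (assumption, elim conjE)
 qed
 qed
qed

lemma mod_curves_emb:
 fixes u :: "real => 'n dist"
 shows "u : mod_curves g (ennreal p) T \<longleftrightarrow> u : {0..<T} \<rightarrow>\<^sub>E Mspace p g & continuous_on {0..<T} (%t. emb p g (u t))"
proof -
 define k where "k = (2 * pi) powr (- real CARD('n) / 2)"
 have k: "k > 0" by (simp add: k_def)
 have "(((%s. mod_norm g (ennreal p) (ennreal p) (%ph. u s ph - u t ph)) ~~> 0) (at t within {0..<T}))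
 \<longleftrightarrow> ((%s. emb p g (u s)) ~~> emb p g (u t)) (at t within {0..<T})"
 if u: "u : {0..<T} \<rightarrow> Mspace p g" and t: "t : {0..<T}" for t
 proof -
 have "mod_norm g (ennreal p) (ennreal p) (%ph. u s ph - u t ph) = ennreal (k * norm (emb p g (u s) - emb p g (u t)))" if "s : {0..<T}" for s
 proof -
 have m: "u s : Mspace p g" "u t : Mspace p g" using u t that by auto
 show ?thesis using mod_space_Mspace(2)[OF g(1) p(1) Mspace_diff[OF m g(1) p(1)]] by (simp only: k_def Mnorm_diff_emb[OF g p m])
 qed
 hence "\<forall>\<^sub>F s in at t within {0..<T}. mod_norm g (ennreal p) (ennreal p) (%ph. u s ph - u t ph) = ennreal (k * norm (emb p g (u s) - emb p g (u t)))"
 unfolding eventually_at_filter by (intro always_eventually allI impI)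
 hence "(((%s. mod_norm g (ennreal p) (ennreal p) (%ph. u s ph - u t ph)) ~~> 0) (at t within {0..<T}))
 \<longleftrightarrow> (((%s. ennreal (k * norm (emb p g (u s) - emb p g (u t)))) ~~> ennreal 0) (at t within {0..<T}))"
 unfolding ennreal_0 by (rule tendsto_cong)
 also have "... \<longleftrightarrow> ((%s. k * norm (emb p g (u s) - emb p g (u t))) ~~> 0) (at t within {0..<T})"
 using k by (intro tendsto_ennreal_iff always_eventually allI mult_nonneg_nonneg) auto
 also have "... \<longleftrightarrow> ((%s. norm (emb p g (u s) - emb p g (u t))) ~~> 0) (at t within {0..<T})"
 using k tendsto_mult_left_iff[of k "%s. norm (emb p g (u s) - emb p g (u t))" 0] by simp
 also have "... \<longleftrightarrow> ((%s. emb p g (u s)) ~~> emb p g (u t)) (at t within {0..<T})"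
 by (simp only: tendsto_norm_zero_iff LIM_zero_iff)
 finally show ?thesis .
 qed
 thus ?thesis
 unfolding mod_curves_def continuous_on_def mod_space_Mspace(1)[OF g(1) p(1)] mem_Collect_eq
 by (intro conj_cong refl ball_cong) (simp_all add: PiE_iff Pi_iff)
qed

text \<open>All facts about the equation are in \<open>N\<close>. The problem is carried by
  \<open>emb\<close> to the closed subspace \<open>X\<close>, solved there by
  \<open>semilinear\<close>, and carried back by the inverse \<open>dec\<close>.\<close>

theorem local_wellposedness:
 fixes K :: "'n dist"
 assumes N: "loc_Lipschitz p g (hartree K k)"
 shows "\<exists>Tstar::ennreal => real. ALL u0:mod_space g (ennreal p) (ennreal p).
 Tstar (mod_norm g (ennreal p) (ennreal p) u0) > 0 \<and>
 (\<exists>!u. u : mod_curves g (ennreal p) (Tstar (mod_norm g (ennreal p) (ennreal p) u0)) \<and>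
 duhamel g (ennreal p) K k u0 (Tstar (mod_norm g (ennreal p) (ennreal p) u0)) u)"
proof -
 let ?M = "Mspace p g :: 'n dist set" and ?e = "emb p g :: 'n dist => _" and ?H = "hartree K k"
 define X where "X = ?e ` ?M"
 define dec where "dec = inv_into ?M ?e"
 have dec: "dec (?e T) = T" if "T : ?M" for T
 unfolding dec_def by (rule inv_into_f_f[OF _ that]) (auto intro: inj_onI emb_inject[OF g p])
 have eX: "?e T : X" if "T : ?M" for T using that by (simp add: X_def)
 have decX: "dec x : ?M" "?e (dec x) = x" if "x : X" for x
 using that unfolding X_def dec_def by (rule inv_into_into, rule f_inv_into_f)
 define U where "U t x = ?e (hermite_propagator t (dec x))" for t x
 \<comment> \<open>The factor \<open>- \<i>\<close> is applied before embedding, because the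
   embedding is established as real-linear.\<close>
 define F where "F x = ?e (%ph. - \<i> * ?H (dec x) ph)" for x
 obtain C where C: "C > 0" and pr: "!!T t. T : ?M ==> hermite_propagator t T : ?M"
 "!!T t. T : ?M ==> Mnorm p g (hermite_propagator t T) <= C * Mnorm p g T"
 proof -
 obtain C where C: "C > 0" "ALL T:?M. ALL t. hermite_propagator t T : ?M & Mnorm p g (hermite_propagator t T) <= C * Mnorm p g T"
 using propagator_Mspace[OF g p] by (elim exE conjE)
 show ?thesis by (rule that[OF C(1)]) (simp_all add: C(2))
 qed
 note l2 = Mspace_l2_bounded[OF g p]
 have HM: "?H T : ?M" if "T : ?M" for T using N that by (simp add: loc_Lipschitz_def)
 have N': "loc_Lipschitz p g (%T ph. - \<i> * ?H T ph)" by (rule loc_Lipschitz_cmult[OF g p N])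
 have iM: "(%ph. c * T ph) : ?M" if "T : ?M" for T c by (rule Mspace_cmult[OF that g(1) p(1)])
 have Ue: "U t (?e T) = ?e (hermite_propagator t T)" if "T : ?M" for t T by (simp add: U_def dec that)
 interpret semilinear X U F C
 proof
 show "closed X" unfolding X_def by (rule closed_emb[OF g p])
 show "subspace X"
 proof (rule subspaceI)
 show "0 : X" using eX[OF Mspace_zero[OF p(1)]] by (simp add: emb_zero[OF g p])
 show "x + y : X" if "x : X" "y : X" for x y
 proof -
 note m = decX(1)[OF that(1)] decX(1)[OF that(2)]
 have "?e (%ph. dec x ph + dec y ph) = x + y" by (simp only: emb_add[OF g p m] decX(2) that)
 thus ?thesis using eX[of "%ph. dec x ph + dec y ph"] Mspace_lincomb[OF m g(1) p(1), of 1 1] by simp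
 qed
 show "a *r x : X" if "x : X" for a x
 using eX[OF iM[OF decX(1)[OF that], of "cx a"]] by (simp only: emb_cmult_real[OF decX(1)[OF that]] decX(2)[OF that])
 qed
 show "C > 0" by (rule C)
 show "U t x : X" if "x : X" for x t unfolding U_def by (intro eX pr decX that)
 show "U t (x - y) = U t x - U t y" if "x : X" "y : X" for x y t
 proof -
 note m = decX(1)[OF that(1)] decX(1)[OF that(2)]
 have "?e (%ph. dec x ph - dec y ph) = x - y" by (simp only: emb_diff[OF g p m] decX(2) that)
 hence "U t (x - y) = ?e (hermite_propagator t (%ph. dec x ph - dec y ph))"
 using Ue[OF Mspace_diff[OF m g(1) p(1)], of t] by simp
 also have "hermite_propagator t (%ph. dec x ph - dec y ph) = (%ph. hermite_propagator t (dec x) ph - hermite_propagator t (dec y) ph)"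
 using propagator_lincomb[OF l2[OF m(1)] l2[OF m(2)], of t 1 "-1"] by simp
 also have "?e ... = U t x - U t y" by (simp only: emb_diff[OF g p pr(1)[OF m(1)] pr(1)[OF m(2)]] U_def)
 finally show ?thesis .
 qed
 show "norm (U t x) <= C * norm x" if "x : X" for x t
 proof -
 have "norm x = Mnorm p g (dec x)" using norm_emb[OF g p decX(1)[OF that]] decX(2)[OF that] by simp
 thus ?thesis unfolding U_def using pr[OF decX(1)[OF that], of t] by (simp add: norm_emb[OF g p])
 qed
 show "continuous_on UNIV (%t. U t x)" if "x : X" for x
 unfolding continuous_on_def
 proof
 fix t
 have "((%s. norm (U s x - U t x)) ~~> 0) (at t)"
 using propagator_continuous[OF g p decX(1)[OF that], of t]
 unfolding U_def Mnorm_diff_emb[OF g p pr(1)[OF decX(1)[OF that]] pr(1)[OF decX(1)[OF that]]] .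
 thus "((%t. U t x) ~~> U t x) (at t within UNIV)" by (simp only: tendsto_norm_zero_iff LIM_zero_iff)
 qed
 show "F x : X" if "x : X" for x unfolding F_def by (intro eX iM HM decX that)
 show "EX L. ALL x:X. ALL y:X. norm x <= R & norm y <= R --> norm (F x - F y) <= L * norm (x - y)" for R
 proof -
 obtain L where L: "!!S T. S : ?M ==> T : ?M ==> Mnorm p g S <= R ==> Mnorm p g T <= R ==>
 Mnorm p g (%ph. - \<i> * ?H S ph - - \<i> * ?H T ph) <= L * Mnorm p g (%ph. S ph - T ph)"
 using N' unfolding loc_Lipschitz_def by meson
 have "norm (F x - F y) <= L * norm (x - y)" if x: "x : X" "norm x <= R" and y: "y : X" "norm y <= R" for x y
 proof -
 note m = decX(1)[OF x(1)] decX(1)[OF y(1)]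
 have "Mnorm p g (dec x) <= R" "Mnorm p g (dec y) <= R"
 using x y norm_emb[OF g p m(1)] norm_emb[OF g p m(2)] by (simp_all add: decX(2))
 from L[OF m this] show ?thesis
 unfolding Mnorm_diff_emb[OF g p m] Mnorm_diff_emb[OF g p iM[OF HM[OF m(1)]] iM[OF HM[OF m(2)]]] decX(2)[OF x(1)] decX(2)[OF y(1)] F_def .
 qed
 thus ?thesis by blast
 qed
 qed
 \<comment> \<open>The image of Duhamel's formula is the fixed point equation. Conversely
   \<open>J\<close> is recovered as \<open>\<i>\<close> times the decoded integral, since that
   integral already contains \<open>- \<i>\<close>.\<close>
 have key: "(EX J. has_mod_integral g (ennreal p) (%ta. hermite_propagator (t - ta) (?H (u ta))) 0 t J \<and>
 u t = (%ph. hermite_propagator t u0 ph - \<i> * J ph)) \<longleftrightarrow> ?e (u t) = U t (?e u0) + duh_term (%ta. ?e (u ta)) t"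
 if u: "!!ta. ta : {0..t} ==> u ta : ?M" and cu: "continuous_on {0..t} (%ta. ?e (u ta))" and t: "0 <= t" and u0: "u0 : ?M" for u t u0
 proof -
 let ?G = "%ta. hermite_propagator (t - ta) (?H (u ta))" and ?w = "%ta. ?e (u ta)"
 have GM: "?G ta : ?M" if "ta : {0..t}" for ta by (intro pr HM u that)
 have Ge: "?e (%ph. - \<i> * ?G ta ph) = U (t - ta) (F (?w ta))" if "ta : {0..t}" for ta
 proof -
 note m = HM[OF u[OF that]]
 have "hermite_propagator (t - ta) (%ph. - \<i> * ?H (u ta) ph) = (%ph. - \<i> * ?G ta ph)"
 using propagator_lincomb[OF l2[OF m] l2[OF m], of "t - ta" "- \<i>" 0] by simp
 thus ?thesis by (simp only: F_def dec[OF u[OF that]] Ue[OF iM[OF m]])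
 qed
 have cG: "continuous_on {0..t} (%ta. ?e (%ph. - \<i> * ?G ta ph))"
 by (rule continuous_on_eq[OF duhamel_integrand_continuous[OF cu eX[OF u]]]) (assumption, rule Ge[symmetric])
 have D: "integral {0..t} (%ta. ?e (%ph. - \<i> * ?G ta ph)) = duh_term ?w t"
 unfolding duh_term_def by (rule integral_cong) (rule Ge)
 have iff: "has_mod_integral g (ennreal p) ?G 0 t J \<longleftrightarrow> duh_term ?w t = ?e (%ph. - \<i> * J ph)" if "J : ?M" for J
 using has_mod_integral_emb[OF GM that _ cG] unfolding D by simp
 have ut: "u t : ?M" using u t by simp
 have add: "?e (u t) = U t (?e u0) + ?e (%ph. - \<i> * J ph) \<longleftrightarrow> u t = (%ph. hermite_propagator t u0 ph - \<i> * J ph)" if J: "J : ?M" for J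
 proof -
 have eq: "U t (?e u0) + ?e (%ph. - \<i> * J ph) = ?e (%ph. hermite_propagator t u0 ph - \<i> * J ph)"
 using emb_add[OF g p pr(1)[OF u0, of t] iM[OF J, of "- \<i>"]] by (simp add: Ue u0)
 have m: "(%ph. hermite_propagator t u0 ph - \<i> * J ph) : ?M"
 by (rule Mspace_diff[OF pr(1)[OF u0] iM[OF J] g(1) p(1)])
 show ?thesis unfolding eq using emb_inject[OF g p ut m] by auto
 qed
 show ?thesis
 proof
 assume "EX J. has_mod_integral g (ennreal p) ?G 0 t J & u t = (%ph. hermite_propagator t u0 ph - \<i> * J ph)"
 then obtain J where J: "has_mod_integral g (ennreal p) ?G 0 t J" "u t = (%ph. hermite_propagator t u0 ph - \<i> * J ph)" by blast
 have JM: "J : ?M" using J(1) by (simp add: has_mod_integral_def mod_space_Mspace(1)[OF g(1) p(1)])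
 show "?e (u t) = U t (?e u0) + duh_term ?w t"
 unfolding iffD1[OF iff[OF JM] J(1)] by (rule iffD2[OF add[OF JM] J(2)])
 next
 assume E: "?e (u t) = U t (?e u0) + duh_term ?w t"
 define D where "D = dec (duh_term ?w t)"
 have DX: "duh_term ?w t : X" by (rule duh_term_mem[OF cu eX[OF u]])
 have DM: "D : ?M" "?e D = duh_term ?w t" unfolding D_def by (rule decX[OF DX])+
 let ?J = "%ph. \<i> * D ph"
 have JM: "?J : ?M" by (rule iM[OF DM(1)])
 have JD: "(%ph. - \<i> * ?J ph) = D" by (simp add: fun_eq_iff)
 show "EX J. has_mod_integral g (ennreal p) ?G 0 t J & u t = (%ph. hermite_propagator t u0 ph - \<i> * J ph)"
 proof (intro exI[of _ ?J] conjI)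
 show "has_mod_integral g (ennreal p) ?G 0 t ?J" by (rule iffD2[OF iff[OF JM]]) (simp only: JD DM(2))
 show "u t = (%ph. hermite_propagator t u0 ph - \<i> * ?J ph)" by (rule iffD1[OF add[OF JM]]) (simp only: JD DM(2) E)
 qed
 qed
 qed
 define k0 where "k0 = (2 * pi) powr (- real CARD('n) / 2)"
 have k0: "k0 > 0" by (simp add: k0_def)
 have "ALL M. EX T. M >= 0 --> T > 0 & (ALL u0:X. norm u0 <= M --> (EX u. continuous_on {0..T} u & (ALL t:{0..T}. u t : X & u t = U t u0 + duh_term u t)))"
 using local_existence by blast
 \<comment> \<open>The local time depends on a bound for the data only, so one time can be chosen
   for each bound; this is what makes the lifespan a function of the norm.\<close>
 from choice[OF this] obtain \<theta> where \<theta>: "!!M. M >= 0 ==> \<theta> M > 0"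
 "!!M u0. M >= 0 ==> u0 : X ==> norm u0 <= M ==> EX u. continuous_on {0..\<theta> M} u & (ALL t:{0..\<theta> M}. u t : X & u t = U t u0 + duh_term u t)"
 by blast
 \<comment> \<open>Dividing by \<open>k0\<close> converts \<open>mod_norm\<close> into
   \<open>Mnorm\<close>, which is the norm of the embedded datum.\<close>
 define Tstar where "Tstar m = \<theta> (enn2real m / k0)" for m
 show ?thesis
 proof (intro exI[of _ Tstar] ballI)
 fix u0 assume "u0 : mod_space g (ennreal p) (ennreal p)"
 hence u0: "u0 : ?M" by (simp add: mod_space_Mspace(1)[OF g(1) p(1)])
 define T where "T = Tstar (mod_norm g (ennreal p) (ennreal p) u0)"
 have T: "T = \<theta> (Mnorm p g u0)" unfolding T_def Tstar_def mod_space_Mspace(2)[OF g(1) p(1) u0] k0_def[symmetric] using k0 by simp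
 have T0: "T > 0" unfolding T by (rule \<theta>(1)) simp
 have char: "u : mod_curves g (ennreal p) T & duhamel g (ennreal p) K k u0 T u \<longleftrightarrow>
 u : {0..<T} \<rightarrow>\<^sub>E ?M & continuous_on {0..<T} (%t. ?e (u t)) & (ALL t:{0..<T}. ?e (u t) = U t (?e u0) + duh_term (%ta. ?e (u ta)) t)" for u
 proof -
 have "duhamel g (ennreal p) K k u0 T u \<longleftrightarrow> (ALL t:{0..<T}. ?e (u t) = U t (?e u0) + duh_term (%ta. ?e (u ta)) t)"
 if u: "u : {0..<T} \<rightarrow>\<^sub>E ?M" and cu: "continuous_on {0..<T} (%t. ?e (u t))"
 unfolding duhamel_def
 proof (intro ball_cong refl key u0)
 fix t assume t: "t : {0..<T}"
 show "u ta : ?M" if "ta : {0..t}" for ta using u t that by (auto dest: PiE_mem)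
 show "continuous_on {0..t} (%ta. ?e (u ta))" by (rule continuous_on_subset[OF cu]) (use t in auto)
 show "0 <= t" using t by simp
 qed
 thus ?thesis unfolding mod_curves_emb by blast
 qed
 have "EX w. continuous_on {0..T} w & (ALL t:{0..T}. w t : X & w t = U t (?e u0) + duh_term w t)"
 unfolding T by (rule \<theta>(2)[OF Mnorm_nonneg eX[OF u0]]) (simp only: norm_emb[OF g p u0] order_refl)
 then obtain w where w: "continuous_on {0..T} w" "!!t. t : {0..T} ==> w t : X" "!!t. t : {0..T} ==> w t = U t (?e u0) + duh_term w t"
 by blast
 \<comment> \<open>\<open>mod_curves\<close> consists of extensional curves, so the solution on the
   closed interval is cut down to the half-open one.\<close>
 define u where "u = restrict (%t. dec (w t)) {0..<T}"
 have cl: "t : {0..T}" if "t : {0..<T}" for t using that by simp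
 have eu: "?e (u t) = w t" if "t : {0..<T}" for t
 unfolding u_def restrict_apply'[OF that] by (rule decX(2)[OF w(2)[OF cl[OF that]]])
 have "u : {0..<T} \<rightarrow>\<^sub>E ?M" unfolding u_def by (intro restrict_PiE_iff[THEN iffD2] ballI decX(1) w(2) cl)
 moreover have "continuous_on {0..<T} (%t. ?e (u t))"
 by (rule continuous_on_eq[OF continuous_on_subset[OF w(1)]]) (auto simp: eu)
 moreover have "?e (u t) = U t (?e u0) + duh_term (%ta. ?e (u ta)) t" if t: "t : {0..<T}" for t
 proof -
 have "duh_term (%ta. ?e (u ta)) t = duh_term w t"
 unfolding duh_term_def by (rule integral_cong) (use t eu in auto)
 thus ?thesis unfolding eu[OF t] by (simp only: w(3)[OF cl[OF t], symmetric])
 qed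
 ultimately have sol: "u : mod_curves g (ennreal p) T & duhamel g (ennreal p) K k u0 T u" unfolding char by blast
 have uniq: "v = u'" if "v : mod_curves g (ennreal p) T & duhamel g (ennreal p) K k u0 T v" "u' : mod_curves g (ennreal p) T & duhamel g (ennreal p) K k u0 T u'" for v u'
 proof -
 have v: "v : {0..<T} \<rightarrow>\<^sub>E ?M" "continuous_on {0..<T} (%t. ?e (v t))" "!!t. t : {0..<T} ==> ?e (v t) = U t (?e u0) + duh_term (%ta. ?e (v ta)) t"
 and u': "u' : {0..<T} \<rightarrow>\<^sub>E ?M" "continuous_on {0..<T} (%t. ?e (u' t))" "!!t. t : {0..<T} ==> ?e (u' t) = U t (?e u0) + duh_term (%ta. ?e (u' ta)) t"
 using that unfolding char by blast+
 have "v t = u' t" if t: "t : {0..<T}" for t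
 proof (rule emb_inject[OF g p PiE_mem[OF v(1) t] PiE_mem[OF u'(1) t]])
 show "?e (v t) = ?e (u' t)"
 by (rule uniqueness[OF v(2) eX[OF PiE_mem[OF v(1)]] v(3) u'(2) eX[OF PiE_mem[OF u'(1)]] u'(3) t])
 qed
 thus ?thesis by (rule PiE_ext[OF v(1) u'(1)])
 qed
 have "\<exists>!u. u : mod_curves g (ennreal p) T & duhamel g (ennreal p) K k u0 T u"
 by (rule ex1I[where a=u]) (rule sol, rule uniq[OF _ sol])
 with T0 show "Tstar (mod_norm g (ennreal p) (ennreal p) u0) > 0 \<and>
 (\<exists>!u. u : mod_curves g (ennreal p) (Tstar (mod_norm g (ennreal p) (ennreal p) u0)) \<and>
 duhamel g (ennreal p) K k u0 (Tstar (mod_norm g (ennreal p) (ennreal p) u0)) u)"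
 unfolding T_def by (rule conjI)
 qed
qed

end

theorem theorem1p4:
 fixes g :: "real^'n \<Rightarrow> complex"
 assumes "g \<in> schwartz_space" and "g \<noteq> (\<lambda>_. 0)"
 shows
  "(\<forall>(k::nat) (q::real) (K::'n dist). 1 \<le> k \<and> 1 < q \<and> K \<in> fourier_Lspace (ennreal q) \<longrightarrow>
    (\<exists>Tstar::ennreal \<Rightarrow> real. \<forall>u0\<in>mod_space g 1 1.
      Tstar (mod_norm g 1 1 u0) > 0 \<and>
      (\<exists>!u. u \<in> mod_curves g 1 (Tstar (mod_norm g 1 1 u0)) \<and>
         duhamel g 1 K k u0 (Tstar (mod_norm g 1 1 u0)) u)))
   \<and>
   (\<forall>(q::real) (r::real) (p::ennreal) (K::'n dist).
    1 < q \<and> q < 2 \<and> q < r \<and> p = ennreal (2 * r / (2 * r - 1)) \<and>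
    K \<in> fourier_Lspace (ennreal q) \<longrightarrow>
    (\<exists>Tstar::ennreal \<Rightarrow> real. \<forall>u0\<in>mod_space g p p.
      Tstar (mod_norm g p p u0) > 0 \<and>
      (\<exists>!u. u \<in> mod_curves g p (Tstar (mod_norm g p p u0)) \<and>
         duhamel g p K 1 u0 (Tstar (mod_norm g p p u0)) u)))
   \<and>
   (\<forall>(k::nat) (K::'n dist). 1 \<le> k \<and> K \<in> mod_space g 1 \<infinity> \<longrightarrow>
    (\<exists>Tstar::ennreal \<Rightarrow> real. \<forall>u0\<in>mod_space g 1 1.
      Tstar (mod_norm g 1 1 u0) > 0 \<and>
      (\<exists>!u. u \<in> mod_curves g 1 (Tstar (mod_norm g 1 1 u0)) \<and>
         duhamel g 1 K k u0 (Tstar (mod_norm g 1 1 u0)) u)))"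
proof (intro conjI allI impI)
 note g = assms
 have p1: "(1::real) <= 1" "(1::real) <= 2" by auto
 note wp1 = local_wellposedness[OF g p1, unfolded ennreal_1]
 {
 fix k :: nat and q :: real and K :: "'n dist"
 assume "1 <= k & 1 < q & K : fourier_Lspace (ennreal q)"
 then obtain ka where k: "1 <= k" and q: "1 < q" and ka: "ka : Lspace (ennreal q)" "dist_fourier K = dist_of_fun ka"
 by (auto simp: fourier_Lspace_def)
 have "1 <= 2 * q / (2 * q - 1)" using q by (simp add: le_divide_eq)
 thus "\<exists>Tstar::ennreal => real. ALL u0:mod_space g 1 1.
 Tstar (mod_norm g 1 1 u0) > 0 \<and>
 (\<exists>!u. u : mod_curves g 1 (Tstar (mod_norm g 1 1 u0)) \<and>
 duhamel g 1 K k u0 (Tstar (mod_norm g 1 1 u0)) u)"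
 using q by (intro wp1 loc_Lipschitz_hartree[OF g k _ _ ka(2)] corr_weight_Lspace[OF g q ka(1)] reg_fun_Lspace[OF _ ka(1)]) auto
 next
 fix q r :: real and p :: ennreal and K :: "'n dist"
 assume a: "1 < q & q < 2 & q < r & p = ennreal (2 * r / (2 * r - 1)) & K : fourier_Lspace (ennreal q)"
 define s where "s = 2 * r / (2 * r - 1)"
 obtain ka where ka: "ka : Lspace (ennreal q)" "dist_fourier K = dist_of_fun ka" using a by (auto simp: fourier_Lspace_def)
 have q: "1 < q" and r: "q < r" and p: "p = ennreal s" using a by (auto simp: s_def)
 have s: "1 <= s" "s <= 2" using q r by (simp_all add: s_def divide_le_eq le_divide_eq)
 \<comment> \<open>\<open>2 * r / (2 * r - 1)\<close> decreases in \<open>r\<close>, so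
   \<open>q < r\<close> puts \<open>s\<close> below the critical exponent for
   \<open>q\<close>.\<close>
 have sq: "s <= 2 * q / (2 * q - 1)" using q r by (simp add: s_def frac_le_eq divide_le_0_iff field_simps)
 show "\<exists>Tstar::ennreal => real. ALL u0:mod_space g p p.
 Tstar (mod_norm g p p u0) > 0 \<and>
 (\<exists>!u. u : mod_curves g p (Tstar (mod_norm g p p u0)) \<and>
 duhamel g p K 1 u0 (Tstar (mod_norm g p p u0)) u)"
 unfolding p using q by (intro local_wellposedness[OF g s] loc_Lipschitz_hartree_1[OF g s _ _ ka(2)] corr_weight_Lspace[OF g q ka(1) s(1) sq] reg_fun_Lspace[OF _ ka(1)]) auto
 next
 fix k :: nat and K :: "'n dist"
 assume a: "1 <= k & K : mod_space g 1 \<infinity>"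
 then obtain ka B where ka: "ka : BM" "!!xi. norm (ka xi) <= B" "dist_fourier K = dist_of_fun ka"
 using dist_fourier_M1inf[OF g] by blast
 show "\<exists>Tstar::ennreal => real. ALL u0:mod_space g 1 1.
 Tstar (mod_norm g 1 1 u0) > 0 \<and>
 (\<exists>!u. u : mod_curves g 1 (Tstar (mod_norm g 1 1 u0)) \<and>
 duhamel g 1 K k u0 (Tstar (mod_norm g 1 1 u0)) u)"
 by (intro wp1 loc_Lipschitz_hartree[OF g conjunct1[OF a] _ _ ka(3)] corr_weight_bounded[OF g ka(1,2)] reg_fun_bounded[OF ka(1,2)])
 }
qed

end
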